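(* Let $L$ and $K$ be two even lattices of the same signature $(b_+,b_-)$, and fix a group isomorphism $\iota:L\to K$, with real extension $\iota_{\mathbb{R}}$. Assume that $\iota_{\mathbb{R}}$ takes the spaces $v_\pm$ associated with an element $v\in\operatorname{Gr}(L_{\mathbb{R}})$ onto the respective spaces $w_\pm$ associated with an element $w\in\operatorname{Gr}(K_{\mathbb{R}})$. Let $L+_\iota K$ be $L$ as a group with the quadratic form $\lambda\mapsto\frac{\lambda^2}{2}+\frac{(\iota\lambda)^2}{2}$, and let $v+_\iota w\in\operatorname{Gr}\big((L+_\iota K)_{\mathbb{R}}\big)$ be the decomposition $(L+_\iota K)_{\mathbb{R}}=L_{\mathbb{R}}=v_+\oplus v_-$. Then the image of the map taking $\lambda\in L$ to $(\lambda,\iota\lambda)\in L\oplus K$ presents $L+_\iota K$ as a primitive sub-lattice of $L\oplus K$, and (under this identification) $(v+_\iota w)_\pm$ is the intersection of the spaces $v_\pm\oplus w_\pm$ associated with $v\oplus w\in\operatorname{Gr}(L_{\mathbb{R}}\oplus K_{\mathbb{R}})$ with $(L+_\iota K)_{\mathbb{R}}$. Moreover, let $\Gamma$ be a finite index subgroup of $\operatorname{Mp}_2(\mathbb{Z})$, let $F$ be a modular form of weight $\big(k-\frac{b_+}{2},l-\frac{b_-}{2}\big)$ and representation $\rho_L^*$ with respect to $\Gamma$, let $H$ be a modular form of weight $\big(\kappa-\frac{b_+}{2},\mu-\frac{b_-}{2}\big)$ and representation $\rho_K^*$ with respect to $\Gamma$, and let $\Phi_{L,v}^F$ and $\Phi_{K,w}^H$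 be the corresponding Jacobi forms. Then the modular form associated with the product Jacobi form $\Phi_{L,v}^F\Phi_{K,w}^H$, given by $(\tau,\zeta)\mapsto\Phi_{L,v}^F(\tau,\zeta)\,\Phi_{K,w}^H(\tau,\iota_{\mathbb{C}}\zeta)$, of weight $(k+\kappa,l+\mu)$ and index $(L+_\iota K,v+_\iota w)$, is the theta contraction $\Theta_{(L\oplus K,L+_\iota K)}\big(F\otimes H;(v+_\iota w)^\perp\big)$; that is, $$\Phi_{L,v}^F(\tau,\zeta)\,\Phi_{K,w}^H(\tau,\iota_{\mathbb{C}}\zeta)=\Phi_{L+_\iota K,\,v+_\iota w}^{\Theta_{(L\oplus K,L+_\iota K)}(F\otimes H;(v+_\iota w)^\perp)}(\tau,\zeta)\qquad(\tau\in\mathcal{H},\ \zeta\in L_{\mathbb{C}}).$$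
   Context: Lattices. An even lattice is a free $\mathbb{Z}$-module $L$ of finite rank with a non-degenerate symmetric bilinear form $(\cdot,\cdot):L\times L\to\mathbb{Z}$ such that $\lambda^2:=(\lambda,\lambda)$ is even for every $\lambda\in L$; its quadratic form is $\lambda\mapsto\frac{\lambda^2}{2}$. Put $L_{\mathbb{R}}=L\otimes\mathbb{R}$, $L_{\mathbb{C}}=L\otimes\mathbb{C}$; the pairing and $\lambda\mapsto\lambda^2$ are extended bilinearly (no complex conjugation). The signature of $L$ is that of $L_{\mathbb{R}}$. The dual lattice is $L^*=\{\lambda\in L_{\mathbb{R}}:(\lambda,L)\subseteq\mathbb{Z}\}\supseteq L$, and $D_L=L^*/L$ is a finite group. $\mathbb{C}[D_L]$ has basis $\{\mathfrak{e}_\gamma\}_{\gamma\in D_L}$. Write $\mathbf{e}(w)=e^{2\pi iw}$ and $\mathcal{H}=\{\tau=x+iy\in\mathbb{C}:y>0\}$. For a real quadratic space $V$ (such as $L_{\mathbb{R}}$), $\operatorname{Gr}(V)$ is the set of orthogonal decompositions $v$: $V=v_+\oplus v_-$ with $v_+$ positive definite and $v_-$ negative definite; $\lambda_{v_\pm}$ is the orthogonal projection of $\lambda$ onto $v_\pm$, extended complex linearly to $\zeta\mapsto\zeta_{v_\pm}$. The Jacobi--Siegel theta function: for $\tau\in\mathcal{H}$, $\zeta\in L_{\mathbb{C}}$, $$\Theta_L(\tau,\zeta;v)=\sum_{\gamma\in D_L}\Big[\sum_{\lambda\in L+\gamma}\mathbf{e}\Big(\tau\tfrac{\lambda_{v_+}^2}{2}+\overline{\tau}\tfrac{\lambda_{v_-}^2}{2}+(\lambda,\zeta)\Big)\Big]\mathfrak{e}_\gamma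 .$$ Metaplectic group. For $A=\begin{pmatrix}a&b\\c&d\end{pmatrix}\in\operatorname{SL}_2(\mathbb{R})$ put $A\tau=\frac{a\tau+b}{c\tau+d}$, $j(A,\tau)=c\tau+d$, $j_A'=c$. $\operatorname{Mp}_2(\mathbb{R})$ is the group of pairs $(A,\phi)$ with $A\in\operatorname{SL}_2(\mathbb{R})$, $\phi:\mathcal{H}\to\mathbb{C}$ holomorphic, $\phi^2(\tau)=j(A,\tau)$, with product $(A,\phi)(B,\psi)=(AB,(\phi\circ B)\psi)$; $\operatorname{Mp}_2(\mathbb{Z})$ is the inverse image of $\operatorname{SL}_2(\mathbb{Z})$. It is generated by $T=\big(\begin{pmatrix}1&1\\0&1\end{pmatrix},1\big)$ and $S=\big(\begin{pmatrix}0&-1\\1&0\end{pmatrix},\sqrt{\tau}\big)$ with $\sqrt\tau\in\mathcal{H}$. The Weil representation $\rho_L$ of $\operatorname{Mp}_2(\mathbb{Z})$ on $\mathbb{C}[D_L]$, for $L$ of signature $(b_+,b_-)$, is given by $$\rho_L(T)\mathfrak{e}_\gamma=\mathbf{e}(\tfrac{\gamma^2}{2})\mathfrak{e}_\gamma,\qquad \rho_L(S)\mathfrak{e}_\gamma=\frac{\mathbf{e}\big(\frac{b_--b_+}{8}\big)}{\sqrt{|D_L|}}\sum_{\delta\in D_L}\mathbf{e}(-(\gamma,\delta))\mathfrak{e}_\delta .$$ $L(-1)$ is $L$ with the forms negated; $\mathbb{C}[D_{L(-1)}]$ has basis $\{\mathfrak{e}_\gamma^*\}_{\gamma\in D_L}$,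 regarded as dual to $\{\mathfrak{e}_\gamma\}$ via the bilinear pairing $\langle\cdot,\cdot\rangle_L:\mathbb{C}[D_L]\times\mathbb{C}[D_{L(-1)}]\to\mathbb{C}$, $\langle\mathfrak{e}_\gamma,\mathfrak{e}_\delta^*\rangle_L=\delta_{\gamma,\delta}$ (extended to further tensor factors in the obvious way). $\rho_L^*=\rho_{L(-1)}$ is the dual representation: $\langle\rho_L(A,\phi)U,\rho_L^*(A,\phi)V\rangle_L=\langle U,V\rangle_L$. Growth. A function $f$ on $\mathcal{H}$ has at most linear exponential growth at the cusps if for every $A\in\operatorname{SL}_2(\mathbb{Z})$ there is a constant $C$ with $f(A\tau)=O(e^{Cy})$ as $y\to\infty$, uniformly for $x$ in bounded sets. Modular forms. For $p,q\in\frac12\mathbb{Z}$, a modular form of weight $(p,q)$ and representation $\rho_L^*$ with respect to $\Gamma$ is a smooth $F:\mathcal{H}\to\mathbb{C}[D_{L(-1)}]$ with $F(A\tau)=\phi(\tau)^{2p}\overline{\phi(\tau)}^{2q}\rho_L^*(A,\phi)F(\tau)$ for all $\tau\in\mathcal{H}$, $(A,\phi)\in\Gamma$, and at most linear exponential growth at the cusps. Jacobi forms. For $k,l\in\frac12\mathbb{Z}$, a Jacobi form of weight $(k,l)$ and index $(L,v)$ with respect to $\Gamma$ is a smooth $\Phi:\mathcal{H}\times L_{\mathbb{C}}\to\mathbb{C}$ such that: (1) for all $\tau,\zeta$ and $\sigma,\nu\in L$, $\Phi(\tau,\zeta+\tau\sigma_{v_+}+\overline\tau\sigma_{v_-}+\nu)=\mathbf{e}\big(-\tau\frac{\sigma_{v_+}^2}{2}-\overline\tau\frac{\sigma_{v_-}^2}{2}-(\sigma,\zeta)\big)\Phi(\tau,\zeta)$;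 (2) for all $\tau,\zeta$ and $(A,\phi)\in\Gamma$, $$\Phi\Big(A\tau,\tfrac{\zeta_{v_+}}{j(A,\tau)}+\tfrac{\zeta_{v_-}}{\overline{j(A,\tau)}}\Big)=\phi(\tau)^{2k}\overline{\phi(\tau)}^{2l}\,\mathbf{e}\Big(\tfrac{j_A'\zeta_{v_+}^2}{2j(A,\tau)}+\tfrac{j_A'\zeta_{v_-}^2}{2\overline{j(A,\tau)}}\Big)\Phi(\tau,\zeta);$$ (3) $\zeta\mapsto\Phi(\tau,\zeta)$ is holomorphic for each $\tau$; (4) the functions $f_\lambda$ ($\lambda\in L^*$) in the Fourier expansion $\Phi(\tau,\zeta)=\sum_{\lambda\in L^*}f_\lambda(\tau)\mathbf{e}\big(\tau\frac{\lambda_{v_+}^2}{2}+\overline\tau\frac{\lambda_{v_-}^2}{2}+(\lambda,\zeta)\big)$ have at most linear exponential growth at the cusps. The map $F\mapsto\Phi_{L,v}^F$, $\Phi_{L,v}^F(\tau,\zeta)=\langle\Theta_L(\tau,\zeta;v),F(\tau)\rangle_L$, is an isomorphism from modular forms of weight $\big(k-\frac{b_+}{2},l-\frac{b_-}{2}\big)$ and representation $\rho_L^*$ onto Jacobi forms of weight $(k,l)$ and index $(L,v)$ (with respect to $\Gamma$); the modular form associated with a Jacobi form is its preimage. This applies to any even lattice and Grassmannian element. Direct sums. For the orthogonal direct sum $L\oplus K$, $\mathbb{C}[D_{L\oplus K}]=\mathbb{C}[D_L]\otimes\mathbb{C}[D_K]$, $\rho_{L\oplus K}=\rho_L\otimes\rho_K$,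 and $(F\otimes H)(\tau)=F(\tau)\otimes H(\tau)$. $v\oplus w\in\operatorname{Gr}(L_{\mathbb{R}}\oplus K_{\mathbb{R}})$ has $(v\oplus w)_\pm=v_\pm\oplus w_\pm$. Theta contraction. Let $N$ be an even lattice, $M\subseteq N$ a primitive non-degenerate sub-lattice, and let an element of $\operatorname{Gr}(N_{\mathbb{R}})$ be the direct sum of $u\in\operatorname{Gr}(M_{\mathbb{R}})$ and $u^\perp\in\operatorname{Gr}(M_{\mathbb{R}}^\perp)$ (i.e. its spaces are $u_\pm\oplus u^\perp_\pm$), with $M_{\mathbb{R}}^\perp$ the orthogonal complement in $N_{\mathbb{R}}$. $\pi_M:N^*\to D_M$ is the composition of the surjective projection $N^*\to M^*$ with $M^*\to D_M$; it is well defined on $N^*/M$. Put $$\Theta_{N,M}(\tau;u^\perp)=\sum_{\delta\in D_M}\ \sum_{\lambda\in N^*/M,\ \pi_M(\lambda)=\delta}\mathbf{e}\Big(\tau\tfrac{\lambda_{u^\perp_+}^2}{2}+\overline\tau\tfrac{\lambda_{u^\perp_-}^2}{2}\Big)\mathfrak{e}_{\lambda+N}\otimes\mathfrak{e}_\delta^*,$$ and for a modular form $E$ with representation $\rho_N^*$ put $\Theta_{(N,M)}(E;u^\perp)(\tau)=\langle\Theta_{N,M}(\tau;u^\perp),E(\tau)\rangle_N\in\mathbb{C}[D_{M(-1)}]$. Here this is applied with $N=L\oplus K$, $M=L+_\iota K$ embedded by $\lambda\mapsto(\lambda,\iota\lambda)$, $u=v+_\iota w$, and $u^\perp=(v+_\iota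 w)^\perp$ the element of $\operatorname{Gr}(M_{\mathbb{R}}^\perp)$ whose spaces are the orthogonal complements of $(v+_\iota w)_\pm$ in $v_\pm\oplus w_\pm$, so that $v\oplus w=(v+_\iota w)\oplus(v+_\iota w)^\perp$. *)

theory Defs
  imports "HOL-Analysis.Analysis" "HOL-Algebra.Coset"
begin

section \<open>Smooth maps\<close>

primrec Ck_on :: "nat \<Rightarrow> ('a::euclidean_space \<Rightarrow> 'b::real_normed_vector) \<Rightarrow> 'a set \<Rightarrow> bool" where
  "Ck_on 0 f U \<longleftrightarrow> continuous_on U f"
| "Ck_on (Suc n) f U \<longleftrightarrow>
     f differentiable_on U \<and> (\<forall>d. Ck_on n (\<lambda>x. frechet_derivative f (at x) d) U)"

text \<open>Smoothness on an arbitrary set, by local extension to open sets. On an open set, or on an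
  open subset of a linear subspace, this is the usual intrinsic notion.\<close>

definition smooth_on :: "('a::euclidean_space \<Rightarrow> 'b::real_normed_vector) \<Rightarrow> 'a set \<Rightarrow> bool" where
  "smooth_on f S \<longleftrightarrow>
     (\<forall>x\<in>S. \<exists>U g. open U \<and> x \<in> U \<and> (\<forall>n. Ck_on n g U) \<and> (\<forall>y\<in>U \<inter> S. g y = f y))"

section \<open>Lattices\<close>

text \<open>A lattice is a subgroup of an ambient finite-dimensional real vector space, generated by a
  finite linearly independent set; its realification is its real span, which need not be the whole
  ambient space. The inner product of the ambient type is only used for its topology. The
  bilinear form is carried by the record; only its values on the real span of the lattice matter,
  and there it is the bilinear extension of the form of the lattice.\<close>

record 'a qlat =
  pts :: "'a set"
  form :: "'a \<Rightarrow> 'a \<Rightarrow> real"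

definition even_lattice :: "'a::euclidean_space qlat \<Rightarrow> bool" where
  "even_lattice L \<longleftrightarrow>
     (\<exists>E. finite E \<and> independent E \<and>
        pts L = {x. \<exists>c::'a \<Rightarrow> int. x = (\<Sum>e\<in>E. of_int (c e) *\<^sub>R e)}) \<and>
     bilinear (form L) \<and>
     (\<forall>x\<in>pts L. \<forall>y\<in>pts L. form L x y = form L y x) \<and>
     (\<forall>x\<in>pts L. \<forall>y\<in>pts L. form L x y \<in> \<int>) \<and>
     (\<forall>x\<in>pts L. \<exists>n::int. form L x x = 2 * of_int n) \<and>
     (\<forall>x\<in>pts L. (\<forall>y\<in>pts L. form L x y = 0) \<longrightarrow> x = 0)"

definition rspan :: "'a::euclidean_space qlat \<Rightarrow> 'a set" where
  "rspan L = span (pts L)"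

definition dual :: "'a::euclidean_space qlat \<Rightarrow> 'a set" where
  "dual L = {x \<in> rspan L. \<forall>y\<in>pts L. form L x y \<in> \<int>}"

definition coset :: "'a::euclidean_space qlat \<Rightarrow> 'a \<Rightarrow> 'a set" where
  "coset L x = (\<lambda>y. x + y) ` pts L"

text \<open>The discriminant group; its elements are the cosets themselves, as sets of points.\<close>

definition disc :: "'a::euclidean_space qlat \<Rightarrow> 'a set set" where
  "disc L = coset L ` dual L"

definition rep :: "'a set \<Rightarrow> 'a" where
  "rep \<gamma> = (SOME x. x \<in> \<gamma>)"

text \<open>Indices of inertia: the signature is \<open>(b_plus L, b_minus L)\<close>.\<close>

definition b_plus :: "'a::euclidean_space qlat \<Rightarrow> nat" where
  "b_plus L = Max {dim U | U. subspace U \<and> U \<subseteq> rspan L \<and> (\<forall>x\<in>U. x \<noteq> 0 \<longrightarrow> form L x x > 0)}"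

definition b_minus :: "'a::euclidean_space qlat \<Rightarrow> nat" where
  "b_minus L = Max {dim U | U. subspace U \<and> U \<subseteq> rspan L \<and> (\<forall>x\<in>U. x \<noteq> 0 \<longrightarrow> form L x x < 0)}"

definition neg_lat :: "'a::euclidean_space qlat \<Rightarrow> 'a qlat" where
  "neg_lat L = \<lparr>pts = pts L, form = (\<lambda>x y. - form L x y)\<rparr>"

definition sum_lat ::
  "'a::euclidean_space qlat \<Rightarrow> 'b::euclidean_space qlat \<Rightarrow> ('a \<times> 'b) qlat" where
  "sum_lat L K = \<lparr>pts = pts L \<times> pts K,
     form = (\<lambda>p q. form L (fst p) (fst q) + form K (snd p) (snd q))\<rparr>"

definition primitive_sublattice :: "'a::euclidean_space qlat \<Rightarrow> 'a qlat \<Rightarrow> bool" where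
  "primitive_sublattice M N \<longleftrightarrow>
     even_lattice M \<and> pts M \<subseteq> pts N \<and>
     (\<forall>x\<in>rspan M. \<forall>y\<in>rspan M. form M x y = form N x y) \<and>
     (\<forall>x\<in>pts N. \<forall>n::int. n \<noteq> 0 \<and> of_int n *\<^sub>R x \<in> pts M \<longrightarrow> x \<in> pts M)"

definition group_iso ::
  "('a::euclidean_space \<Rightarrow> 'b::euclidean_space) \<Rightarrow> 'a qlat \<Rightarrow> 'b qlat \<Rightarrow> bool" where
  "group_iso f L K \<longleftrightarrow>
     bij_betw f (pts L) (pts K) \<and> (\<forall>x\<in>pts L. \<forall>y\<in>pts L. f (x + y) = f x + f y)"

definition lattice_iso ::
  "('a::euclidean_space \<Rightarrow> 'b::euclidean_space) \<Rightarrow> 'a qlat \<Rightarrow> 'b qlat \<Rightarrow> bool" where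
  "lattice_iso f L K \<longleftrightarrow>
     group_iso f L K \<and> (\<forall>x\<in>pts L. \<forall>y\<in>pts L. form K (f x) (f y) = form L x y)"

text \<open>\<open>L +\<^sub>\<iota> K\<close>: the group \<open>L\<close> with the sum of the two forms; \<open>g\<close> is the real
  extension of \<open>\<iota>\<close>. Its copy inside \<open>L \<oplus> K\<close> is \<open>graph_lat\<close>.\<close>

definition plus_lat ::
  "('a::euclidean_space \<Rightarrow> 'b::euclidean_space) \<Rightarrow> 'a qlat \<Rightarrow> 'b qlat \<Rightarrow> 'a qlat" where
  "plus_lat g L K = \<lparr>pts = pts L, form = (\<lambda>x y. form L x y + form K (g x) (g y))\<rparr>"

definition graph_map :: "('a \<Rightarrow> 'b) \<Rightarrow> 'a \<Rightarrow> 'a \<times> 'b" where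
  "graph_map f x = (x, f x)"

definition graph_lat ::
  "('a::euclidean_space \<Rightarrow> 'b::euclidean_space) \<Rightarrow> 'a qlat \<Rightarrow> 'b qlat \<Rightarrow> ('a \<times> 'b) qlat" where
  "graph_lat f L K = \<lparr>pts = graph_map f ` pts L, form = form (sum_lat L K)\<rparr>"

section \<open>Grassmannians and projections\<close>

text \<open>The Grassmannian of a real quadratic space \<open>(V, B)\<close>; a point is the pair
  \<open>(v\<^sub>+, v\<^sub>-)\<close>. Directness of the sum is implied by definiteness.\<close>

type_synonym 'a gr = "'a set \<times> 'a set"

definition Gr :: "('a::euclidean_space \<Rightarrow> 'a \<Rightarrow> real) \<Rightarrow> 'a set \<Rightarrow> 'a gr set" where
  "Gr B V = {(P, Q). subspace P \<and> subspace Q \<and>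
     (\<forall>x\<in>P. x \<noteq> 0 \<longrightarrow> B x x > 0) \<and> (\<forall>x\<in>Q. x \<noteq> 0 \<longrightarrow> B x x < 0) \<and>
     (\<forall>x\<in>P. \<forall>y\<in>Q. B x y = 0) \<and>
     V = {x + y | x y. x \<in> P \<and> y \<in> Q}}"

definition sum_gr :: "'a gr \<Rightarrow> 'b gr \<Rightarrow> ('a \<times> 'b) gr" where
  "sum_gr v w = (fst v \<times> fst w, snd v \<times> snd w)"

text \<open>Orthogonal projection onto a subspace on which the form is non-degenerate.\<close>

definition oproj :: "'a::euclidean_space qlat \<Rightarrow> 'a set \<Rightarrow> 'a \<Rightarrow> 'a" where
  "oproj L U x = (THE a. a \<in> U \<and> (\<forall>u\<in>U. form L (x - a) u = 0))"

definition ocompl_in :: "'a::euclidean_space qlat \<Rightarrow> 'a set \<Rightarrow> 'a set \<Rightarrow> 'a set" where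
  "ocompl_in L U W = {x \<in> W. \<forall>u\<in>U. form L x u = 0}"

section \<open>Complexification\<close>

text \<open>A vector \<open>x + iy\<close> of the complexification is the pair \<open>(x, y)\<close>.\<close>

type_synonym 'a cplx = "'a \<times> 'a"

definition cspan :: "'a::euclidean_space qlat \<Rightarrow> 'a cplx set" where
  "cspan L = rspan L \<times> rspan L"

definition cvec :: "'a::real_vector \<Rightarrow> 'a cplx" where
  "cvec x = (x, 0)"

definition cscale :: "complex \<Rightarrow> 'a::real_vector cplx \<Rightarrow> 'a cplx" where
  "cscale c \<zeta> = (Re c *\<^sub>R fst \<zeta> - Im c *\<^sub>R snd \<zeta>, Re c *\<^sub>R snd \<zeta> + Im c *\<^sub>R fst \<zeta>)"

text \<open>Complex linear extension of a real linear map.\<close>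

definition cmap :: "('a \<Rightarrow> 'b) \<Rightarrow> 'a cplx \<Rightarrow> 'b cplx" where
  "cmap f \<zeta> = (f (fst \<zeta>), f (snd \<zeta>))"

text \<open>Complex bilinear (not sesquilinear) extension of the form.\<close>

definition cform :: "'a::euclidean_space qlat \<Rightarrow> 'a cplx \<Rightarrow> 'a cplx \<Rightarrow> complex" where
  "cform L \<zeta> \<xi> = Complex
     (form L (fst \<zeta>) (fst \<xi>) - form L (snd \<zeta>) (snd \<xi>))
     (form L (fst \<zeta>) (snd \<xi>) + form L (snd \<zeta>) (fst \<xi>))"

definition cholomorphic_on :: "('a::euclidean_space cplx \<Rightarrow> complex) \<Rightarrow> 'a cplx set \<Rightarrow> bool" where
  "cholomorphic_on f W \<longleftrightarrow>
     (\<forall>\<zeta>\<in>W. \<exists>D. (f has_derivative D) (at \<zeta> within W) \<and>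
        (\<forall>c. \<forall>\<xi>\<in>W. D (cscale c \<xi>) = c * D \<xi>))"

section \<open>The metaplectic group\<close>

definition uhp :: "complex set" where
  "uhp = {\<tau>. Im \<tau> > 0}"

definition ee :: "complex \<Rightarrow> complex" where
  "ee w = exp (2 * of_real pi * \<i> * w)"

definition SL2R :: "(real^2^2) set" where
  "SL2R = {A. det A = 1}"

definition SL2Z :: "(real^2^2) set" where
  "SL2Z = {A \<in> SL2R. \<forall>i j. A $ i $ j \<in> \<int>}"

definition jfac :: "real^2^2 \<Rightarrow> complex \<Rightarrow> complex" where
  "jfac A \<tau> = of_real (A $ 2 $ 1) * \<tau> + of_real (A $ 2 $ 2)"

definition moeb :: "real^2^2 \<Rightarrow> complex \<Rightarrow> complex" where
  "moeb A \<tau> = (of_real (A $ 1 $ 1) * \<tau> + of_real (A $ 1 $ 2)) / jfac A \<tau>"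

text \<open>The second component is a function on the upper half-plane, made extensional so that
  equality of group elements is equality of pairs.\<close>

type_synonym mp = "(real^2^2) \<times> (complex \<Rightarrow> complex)"

definition Mp2R :: "mp monoid" where
  "Mp2R = \<lparr>carrier = {(A, \<phi>). A \<in> SL2R \<and> \<phi> \<in> extensional uhp \<and> \<phi> holomorphic_on uhp \<and>
       (\<forall>\<tau>\<in>uhp. (\<phi> \<tau>)\<^sup>2 = jfac A \<tau>)},
     monoid.mult = (\<lambda>(A, \<phi>) (B, \<psi>). (A ** B, (\<lambda>\<tau>\<in>uhp. \<phi> (moeb B \<tau>) * \<psi> \<tau>))),
     one = (mat 1, (\<lambda>\<tau>\<in>uhp. 1))\<rparr>"

definition Mp2Z :: "mp monoid" where
  "Mp2Z = Mp2R\<lparr>carrier := {g \<in> carrier Mp2R. fst g \<in> SL2Z}\<rparr>"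

definition T_mp :: mp where
  "T_mp = (vector [vector [1, 1], vector [0, 1]], (\<lambda>\<tau>\<in>uhp. 1))"

text \<open>On the upper half-plane \<open>csqrt\<close> is the square root with positive imaginary part.\<close>

definition S_mp :: mp where
  "S_mp = (vector [vector [0, -1], vector [1, 0]], (\<lambda>\<tau>\<in>uhp. csqrt \<tau>))"

definition finite_index_subgroup :: "mp set \<Rightarrow> bool" where
  "finite_index_subgroup \<Gamma> \<longleftrightarrow> subgroup \<Gamma> Mp2Z \<and> finite (rcosets\<^bsub>Mp2Z\<^esub> \<Gamma>)"

section \<open>The Weil representation\<close>

text \<open>An element of the group ring of the discriminant group is its coefficient function.\<close>

type_synonym 'a gring = "'a set \<Rightarrow> complex"

definition gring :: "'a::euclidean_space qlat \<Rightarrow> 'a gring set" where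
  "gring L = {U. \<forall>\<gamma>. \<gamma> \<notin> disc L \<longrightarrow> U \<gamma> = 0}"

definition ebas :: "'a set \<Rightarrow> 'a gring" where
  "ebas \<gamma> = (\<lambda>\<delta>. if \<delta> = \<gamma> then 1 else 0)"

definition is_weil_rep :: "'a::euclidean_space qlat \<Rightarrow> (mp \<Rightarrow> 'a gring \<Rightarrow> 'a gring) \<Rightarrow> bool" where
  "is_weil_rep L \<rho> \<longleftrightarrow>
     (\<forall>g\<in>carrier Mp2Z. \<forall>U\<in>gring L. \<rho> g U \<in> gring L) \<and>
     (\<forall>g\<in>carrier Mp2Z. \<forall>U\<in>gring L. \<forall>V\<in>gring L. \<forall>a b.
        \<rho> g (\<lambda>\<gamma>. a * U \<gamma> + b * V \<gamma>) = (\<lambda>\<gamma>. a * \<rho> g U \<gamma> + b * \<rho> g V \<gamma>)) \<and>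
     (\<forall>U\<in>gring L. \<rho> \<one>\<^bsub>Mp2Z\<^esub> U = U) \<and>
     (\<forall>g\<in>carrier Mp2Z. \<forall>h\<in>carrier Mp2Z. \<forall>U\<in>gring L.
        \<rho> (g \<otimes>\<^bsub>Mp2Z\<^esub> h) U = \<rho> g (\<rho> h U)) \<and>
     (\<forall>\<gamma>\<in>disc L. \<rho> T_mp (ebas \<gamma>) =
        (\<lambda>\<delta>. ee (of_real (form L (rep \<gamma>) (rep \<gamma>) / 2)) * ebas \<gamma> \<delta>)) \<and>
     (\<forall>\<gamma>\<in>disc L. \<rho> S_mp (ebas \<gamma>) =
        (\<lambda>\<eta>. ee ((of_nat (b_minus L) - of_nat (b_plus L)) / 8) / of_real (sqrt (real (card (disc L)))) *
            (\<Sum>\<delta>\<in>disc L. ee (of_real (- form L (rep \<gamma>) (rep \<delta>))) * ebas \<delta> \<eta>)))"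

text \<open>Since \<open>T_mp\<close> and \<open>S_mp\<close> generate the group, the choice is
  unique on \<open>carrier Mp2Z\<close> and \<open>gring L\<close>.\<close>

definition weil_rep :: "'a::euclidean_space qlat \<Rightarrow> mp \<Rightarrow> 'a gring \<Rightarrow> 'a gring" where
  "weil_rep L = (SOME \<rho>. is_weil_rep L \<rho>)"

text \<open>The dual representation. \<open>L\<close> and \<open>L(-1)\<close> have the same points and the same
  cosets, so both group rings consist of the same coefficient functions.\<close>

definition dual_weil_rep :: "'a::euclidean_space qlat \<Rightarrow> mp \<Rightarrow> 'a gring \<Rightarrow> 'a gring" where
  "dual_weil_rep L = weil_rep (neg_lat L)"

definition gpair :: "'a::euclidean_space qlat \<Rightarrow> 'a gring \<Rightarrow> 'a gring \<Rightarrow> complex" where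
  "gpair L U V = (\<Sum>\<gamma>\<in>disc L. U \<gamma> * V \<gamma>)"

section \<open>Modular forms and Jacobi forms\<close>

definition lin_exp_growth :: "(complex \<Rightarrow> complex) \<Rightarrow> bool" where
  "lin_exp_growth f \<longleftrightarrow>
     (\<forall>A\<in>SL2Z. \<exists>C::real. \<forall>R::real. \<exists>c y0::real. \<forall>x y::real.
        \<bar>x\<bar> \<le> R \<and> y > 0 \<and> y \<ge> y0 \<longrightarrow> cmod (f (moeb A (Complex x y))) \<le> c * exp (C * y))"

definition half_int :: "real \<Rightarrow> bool" where
  "half_int p \<longleftrightarrow> 2 * p \<in> \<int>"

text \<open>\<open>autf \<phi> p q \<tau>\<close> is \<open>\<phi>(\<tau>)\<close> to the power \<open>2p\<close> times its
  conjugate to the power \<open>2q\<close>, with integral exponents for half-integral weights.\<close>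

definition autf :: "(complex \<Rightarrow> complex) \<Rightarrow> real \<Rightarrow> real \<Rightarrow> complex \<Rightarrow> complex" where
  "autf \<phi> p q \<tau> = (\<phi> \<tau>) powi \<lfloor>2 * p\<rfloor> * (cnj (\<phi> \<tau>)) powi \<lfloor>2 * q\<rfloor>"

text \<open>Modular forms of weight \<open>(p, q)\<close> and representation \<open>dual_weil_rep L\<close>.\<close>

definition modular_form ::
  "'a::euclidean_space qlat \<Rightarrow> mp set \<Rightarrow> real \<Rightarrow> real \<Rightarrow> (complex \<Rightarrow> 'a gring) \<Rightarrow> bool" where
  "modular_form L \<Gamma> p q F \<longleftrightarrow>
     half_int p \<and> half_int q \<and>
     (\<forall>\<tau>\<in>uhp. F \<tau> \<in> gring (neg_lat L)) \<and>
     (\<forall>\<gamma>\<in>disc L. smooth_on (\<lambda>\<tau>. F \<tau> \<gamma>) uhp) \<and>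
     (\<forall>\<tau>\<in>uhp. \<forall>(A, \<phi>)\<in>\<Gamma>.
        F (moeb A \<tau>) = (\<lambda>\<gamma>. autf \<phi> p q \<tau> * dual_weil_rep L (A, \<phi>) (F \<tau>) \<gamma>)) \<and>
     (\<forall>\<gamma>\<in>disc L. lin_exp_growth (\<lambda>\<tau>. F \<tau> \<gamma>))"

text \<open>\<open>\<tau> x\<^sub>+\<^sup>2 / 2 + cnj \<tau> x\<^sub>-\<^sup>2 / 2\<close>, where \<open>x\<^sub>\<plusminus>\<close> are the
  projections of \<open>x\<close> to the two spaces of \<open>v\<close>.\<close>

definition qexpt :: "'a::euclidean_space qlat \<Rightarrow> 'a gr \<Rightarrow> complex \<Rightarrow> 'a \<Rightarrow> complex" where
  "qexpt L v \<tau> x =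
     \<tau> * of_real (form L (oproj L (fst v) x) (oproj L (fst v) x) / 2) +
     cnj \<tau> * of_real (form L (oproj L (snd v) x) (oproj L (snd v) x) / 2)"

definition siegel_theta ::
  "'a::euclidean_space qlat \<Rightarrow> 'a gr \<Rightarrow> complex \<Rightarrow> 'a cplx \<Rightarrow> 'a gring" where
  "siegel_theta L v \<tau> \<zeta> = (\<lambda>\<gamma>. if \<gamma> \<in> disc L
     then (\<Sum>\<^sub>\<infinity>x\<in>\<gamma>. ee (qexpt L v \<tau> x + cform L (cvec x) \<zeta>)) else 0)"

definition jacobi_form ::
  "'a::euclidean_space qlat \<Rightarrow> 'a gr \<Rightarrow> mp set \<Rightarrow> real \<Rightarrow> real \<Rightarrow> (complex \<Rightarrow> 'a cplx \<Rightarrow> complex) \<Rightarrow> bool"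
  where
  "jacobi_form L v \<Gamma> k l \<Phi> \<longleftrightarrow>
     half_int k \<and> half_int l \<and>
     smooth_on (\<lambda>(\<tau>, \<zeta>). \<Phi> \<tau> \<zeta>) (uhp \<times> cspan L) \<and>
     (\<forall>\<tau>\<in>uhp. \<forall>\<zeta>\<in>cspan L. \<forall>\<sigma>\<in>pts L. \<forall>\<nu>\<in>pts L.
        \<Phi> \<tau> (\<zeta> + cscale \<tau> (cvec (oproj L (fst v) \<sigma>)) +
              cscale (cnj \<tau>) (cvec (oproj L (snd v) \<sigma>)) + cvec \<nu>) =
        ee (- qexpt L v \<tau> \<sigma> - cform L (cvec \<sigma>) \<zeta>) * \<Phi> \<tau> \<zeta>) \<and>
     (\<forall>\<tau>\<in>uhp. \<forall>\<zeta>\<in>cspan L. \<forall>(A, \<phi>)\<in>\<Gamma>.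
        (let zp = cmap (oproj L (fst v)) \<zeta>; zm = cmap (oproj L (snd v)) \<zeta>;
             j = jfac A \<tau>; j' = of_real (A $ 2 $ 1)
         in \<Phi> (moeb A \<tau>) (cscale (1 / j) zp + cscale (1 / cnj j) zm) =
            autf \<phi> k l \<tau> *
            ee (j' * cform L zp zp / (2 * j) + j' * cform L zm zm / (2 * cnj j)) * \<Phi> \<tau> \<zeta>)) \<and>
     (\<forall>\<tau>\<in>uhp. cholomorphic_on (\<Phi> \<tau>) (cspan L)) \<and>
     (\<exists>f. (\<forall>x\<in>dual L. lin_exp_growth (f x)) \<and>
        (\<forall>\<tau>\<in>uhp. \<forall>\<zeta>\<in>cspan L.
           ((\<lambda>x. f x \<tau> * ee (qexpt L v \<tau> x + cform L (cvec x) \<zeta>)) has_sum \<Phi> \<tau> \<zeta>) (dual L)))"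

definition jacobi_of ::
  "'a::euclidean_space qlat \<Rightarrow> 'a gr \<Rightarrow> (complex \<Rightarrow> 'a gring) \<Rightarrow> complex \<Rightarrow> 'a cplx \<Rightarrow> complex" where
  "jacobi_of L v F \<tau> \<zeta> = gpair L (siegel_theta L v \<tau> \<zeta>) (F \<tau>)"

text \<open>\<open>G\<close> is a preimage of the Jacobi form \<open>\<Phi>\<close> of weight \<open>(k, l)\<close> under
  \<open>jacobi_of\<close>.\<close>

definition assoc_modular_form ::
  "'a::euclidean_space qlat \<Rightarrow> 'a gr \<Rightarrow> mp set \<Rightarrow> real \<Rightarrow> real \<Rightarrow>
   (complex \<Rightarrow> 'a cplx \<Rightarrow> complex) \<Rightarrow> (complex \<Rightarrow> 'a gring) \<Rightarrow> bool" where
  "assoc_modular_form L v \<Gamma> k l \<Phi> G \<longleftrightarrow>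
     modular_form L \<Gamma> (k - real (b_plus L) / 2) (l - real (b_minus L) / 2) G \<and>
     (\<forall>\<tau>\<in>uhp. \<forall>\<zeta>\<in>cspan L. \<Phi> \<tau> \<zeta> = jacobi_of L v G \<tau> \<zeta>)"

section \<open>Tensor products and theta contractions\<close>

text \<open>A coset of \<open>L \<oplus> K\<close> is a product of a coset of \<open>L\<close> and a coset of \<open>K\<close>,
  recovered as its two projections.\<close>

definition tensor_form ::
  "'a::euclidean_space qlat \<Rightarrow> 'b::euclidean_space qlat \<Rightarrow>
   (complex \<Rightarrow> 'a gring) \<Rightarrow> (complex \<Rightarrow> 'b gring) \<Rightarrow> complex \<Rightarrow> ('a \<times> 'b) gring" where
  "tensor_form L K F H \<tau> = (\<lambda>\<gamma>. if \<gamma> \<in> disc (sum_lat L K)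
     then F \<tau> (fst ` \<gamma>) * H \<tau> (snd ` \<gamma>) else 0)"

text \<open>\<open>N\<^sup>* \<rightarrow> M\<^sup>* \<rightarrow> D\<^sub>M\<close>\<close>

definition disc_proj :: "'a::euclidean_space qlat \<Rightarrow> 'a qlat \<Rightarrow> 'a \<Rightarrow> 'a set" where
  "disc_proj N M x = coset M (oproj N (rspan M) x)"

text \<open>The coefficient of the theta kernel at the tensor of the basis vectors indexed by
  \<open>\<gamma>\<close> in \<open>disc N\<close> and \<open>\<delta>\<close> in \<open>disc M\<close>. The sum is over \<open>N\<^sup>*/M\<close>;
  none of the conditions and terms depends on the representative.\<close>

definition contraction_kernel ::
  "'a::euclidean_space qlat \<Rightarrow> 'a qlat \<Rightarrow> 'a gr \<Rightarrow> complex \<Rightarrow> 'a set \<Rightarrow> 'a set \<Rightarrow> complex" where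
  "contraction_kernel N M u' \<tau> \<gamma> \<delta> =
     (\<Sum>\<^sub>\<infinity>X\<in>{X \<in> coset M ` dual N. disc_proj N M (rep X) = \<delta> \<and> coset N (rep X) = \<gamma>}.
        ee (qexpt N u' \<tau> (rep X)))"

definition theta_contraction ::
  "'a::euclidean_space qlat \<Rightarrow> 'a qlat \<Rightarrow> (complex \<Rightarrow> 'a gring) \<Rightarrow> 'a gr \<Rightarrow> complex \<Rightarrow> 'a gring" where
  "theta_contraction N M E u' \<tau> = (\<lambda>\<delta>. if \<delta> \<in> disc M
     then gpair N (\<lambda>\<gamma>. contraction_kernel N M u' \<tau> \<gamma> \<delta>) (E \<tau>) else 0)"

text \<open>The orthogonal complement of a Grassmannian element \<open>u\<close> inside \<open>v\<close>, taken
  separately in the positive and the negative space.\<close>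

definition perp_gr :: "'a::euclidean_space qlat \<Rightarrow> 'a gr \<Rightarrow> 'a gr \<Rightarrow> 'a gr" where
  "perp_gr N u v = (ocompl_in N (fst u) (fst v), ocompl_in N (snd u) (snd v))"

text \<open>Transport of a group ring valued function on the image of a lattice under an injective
  linear map \<open>j\<close> back to the lattice itself.\<close>

definition pull_gring :: "('a \<Rightarrow> 'b) \<Rightarrow> (complex \<Rightarrow> 'b gring) \<Rightarrow> complex \<Rightarrow> 'a gring" where
  "pull_gring j F \<tau> = (\<lambda>\<gamma>. F \<tau> (j ` \<gamma>))"

text \<open>The contraction from \<open>L \<oplus> K\<close> to its sublattice \<open>graph_lat g L K\<close>, read
  on \<open>plus_lat g L K\<close>.\<close>

definition diag_contraction ::
  "('a::euclidean_space \<Rightarrow> 'b::euclidean_space) \<Rightarrow> 'a qlat \<Rightarrow> 'b qlat \<Rightarrow> 'a gr \<Rightarrow> 'b gr \<Rightarrow>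
   (complex \<Rightarrow> ('a \<times> 'b) gring) \<Rightarrow> complex \<Rightarrow> 'a gring" where
  "diag_contraction g L K v w E =
     pull_gring (graph_map g)
       (theta_contraction (sum_lat L K) (graph_lat g L K) E
          (perp_gr (sum_lat L K) (graph_map g ` fst v, graph_map g ` snd v) (sum_gr v w)))"

end

theory Submission
  imports Defs "HOL-Complex_Analysis.Complex_Analysis"
begin

text \<open>The product of the theta functions of \<open>L\<close> and \<open>K\<close> is a sum over \<open>L\<^sup>* \<times> K\<^sup>*\<close>. Grouping it by the
  cosets of the diagonal lattice \<open>M\<close> and splitting each vector into its projections to \<open>M\<close> and to the
  orthogonal complement of \<open>M\<close> writes the product as the contraction kernel paired with the theta function of
  \<open>L +\<^sub>\<iota> K\<close>. This gives the product formula. Its right hand side determines the vector valued coefficient,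
  because the components of a theta function are linearly independent (Fourier uniqueness). Hence the transformation
  behaviour of the contraction follows from that of the two Jacobi forms.

  The Weil representation is defined by a choice, so its existence has to be proved. Theta inversion
  (both sides are quasi-periodic in the same way, hence proportional, and the factor is found from the heat
  equation and the value at one point) gives the action of \<open>S\<close>, and \<open>S\<close>, \<open>T\<close> generate the
  metaplectic group. The matrices by which theta functions transform are unique by linear independence, so they
  form a representation.\<close>

text \<open>Neither Poisson summation nor a Gaussian integral enters. The factor in theta inversion
  is found from three facts. As a function of the width \<open>u\<close> along one orthonormal basis
  vector it satisfies \<open>c' = c / (2 * u)\<close>, so it is a product of square roots times its
  value at width one. At width one, inversion at the origin combined with inversion summed over all
  cosets shows that its square is \<open>1 / card (disc L)\<close>. Positivity of the two Gaussian
  sums selects the root. Separate complex widths are what copes with an indefinite form: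
  \<open>- \<i> * \<tau>\<close> on the positive vectors and \<open>\<i> * cnj \<tau>\<close> on the
  negative ones both have positive real part. The growth condition concerns every cusp, while no
  transformation law of the contraction kernel alone is at hand. A bound by a multiple of
  \<open>exp (C1 * Im \<tau> + C2 / Im \<tau>)\<close> on the whole half-plane settles all cusps at
  once. A lattice may span less than its ambient space. Uniqueness statements are therefore tested
  on the complex span only, whereas the series themselves converge and are smooth on the full
  ambient space, which supplies the extensions that \<open>smooth_on\<close> asks for.\<close>

abbreviation cor :: "real \<Rightarrow> complex" where "cor \<equiv> complex_of_real"

section \<open>Dominated infinite sums\<close>

lemma summable_on_dominated:
  fixes f :: "'i \<Rightarrow> 'b::banach"
  assumes "g summable_on A" and "\<And>x. x \<in> A \<Longrightarrow> norm (f x) \<le> g x"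
  shows "f summable_on A"
  using Infinite_Sum.abs_summable_on_comparison_test'[OF assms] Infinite_Sum.abs_summable_summable by blast

lemma norm_infsum_dominated:
  fixes f :: "'i \<Rightarrow> 'b::banach"
  assumes "g summable_on A" and "\<And>x. x \<in> A \<Longrightarrow> norm (f x) \<le> g x"
  shows "norm (infsum f A) \<le> infsum g A"
proof -
  have s: "(\<lambda>x. norm (f x)) summable_on A"
    using Infinite_Sum.abs_summable_on_comparison_test'[OF assms] .
  have "norm (infsum f A) \<le> infsum (\<lambda>x. norm (f x)) A"
    using norm_infsum_bound[OF s] .
  also have "\<dots> \<le> infsum g A"
    using infsum_mono[OF s assms(1)] assms(2) by blast
  finally show ?thesis .
qed

lemma summable_on_minus:
  fixes f g :: "'i \<Rightarrow> 'b::real_normed_vector"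
  assumes "f summable_on A" "g summable_on A"
  shows "(\<lambda>x. f x - g x) summable_on A"
proof -
  have "(\<lambda>x. - g x) summable_on A" using assms(2) by (simp add: summable_on_uminus)
  from summable_on_add[OF assms(1) this] show ?thesis by simp
qed

lemma infsum_minus:
  fixes f g :: "'i \<Rightarrow> 'b::real_normed_vector"
  assumes "f summable_on A" "g summable_on A"
  shows "(\<Sum>\<^sub>\<infinity>x\<in>A. f x - g x) = infsum f A - infsum g A"
proof -
  have "(\<lambda>x. - g x) summable_on A" using assms(2) by (simp add: summable_on_uminus)
  from infsum_add[OF assms(1) this] show ?thesis by (simp add: infsum_uminus)
qed

section \<open>Calculus of smooth functions\<close>

lemma has_derivative_cong_open:
  assumes "open U" "x \<in> U" "\<And>y. y \<in> U \<Longrightarrow> f y = g y"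
  shows "(f has_derivative D) (at x) \<longleftrightarrow> (g has_derivative D) (at x)"
  using has_derivative_transform_within_open[of f D x UNIV U g]
    has_derivative_transform_within_open[of g D x UNIV U f] assms by auto

lemma Ck_on_cong:
  assumes "open U" "\<And>y. y \<in> U \<Longrightarrow> f y = g y"
  shows "Ck_on n f U \<longleftrightarrow> Ck_on n g U"
  using assms(2)
proof (induction n arbitrary: f g)
  case 0
  then show ?case by (simp cong: continuous_on_cong)
next
  case (Suc n)
  have eq: "(f has_derivative D) (at x) \<longleftrightarrow> (g has_derivative D) (at x)" if "x \<in> U" for x D
    using has_derivative_cong_open[OF assms(1) that] Suc.prems by blast
  have fr: "frechet_derivative f (at x) = frechet_derivative g (at x)" if "x \<in> U" for x
    unfolding frechet_derivative_def using eq[OF that] by simp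
  have "f differentiable_on U \<longleftrightarrow> g differentiable_on U"
    using eq assms(1) by (auto simp: differentiable_on_eq_differentiable_at differentiable_def)
  moreover have "Ck_on n (\<lambda>x. frechet_derivative f (at x) d) U \<longleftrightarrow>
      Ck_on n (\<lambda>x. frechet_derivative g (at x) d) U" for d
    by (rule Suc.IH) (simp add: fr)
  ultimately show ?case by simp
qed

text \<open>Lets a proof name its derivative: by uniqueness the chosen
  \<open>frechet_derivative\<close> agrees with any \<open>f'\<close>, and on an open set
  \<open>differentiable_on\<close> means differentiability at each point.\<close>

lemma Ck_on_SucI:
  assumes "open U" "\<And>x. x \<in> U \<Longrightarrow> (f has_derivative f' x) (at x)"
    and "\<And>d. Ck_on n (\<lambda>x. f' x d) U"
  shows "Ck_on (Suc n) f U"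
proof -
  have "f differentiable_on U"
    using assms by (auto simp: differentiable_on_eq_differentiable_at differentiable_def)
  moreover have "Ck_on n (\<lambda>x. frechet_derivative f (at x) d) U" for d
    using assms(3)[of d] frechet_derivative_at[OF assms(2)]
    by (subst Ck_on_cong[OF assms(1), where g = "\<lambda>x. f' x d"]) auto
  ultimately show ?thesis by simp
qed

lemma Ck_on_SucE:
  assumes "open U" "Ck_on (Suc n) f U"
  obtains f' where "\<And>x. x \<in> U \<Longrightarrow> (f has_derivative f' x) (at x)" "\<And>d. Ck_on n (\<lambda>x. f' x d) U"
  using assms that[of "\<lambda>x. frechet_derivative f (at x)"]
  by (auto simp: differentiable_on_eq_differentiable_at frechet_derivative_works)

lemma Ck_on_mono_Suc: "open U \<Longrightarrow> Ck_on (Suc n) f U \<Longrightarrow> Ck_on n f U"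
proof (induction n arbitrary: f)
  case 0
  then show ?case by (simp add: differentiable_imp_continuous_on)
next
  case (Suc n)
  from Suc.prems(1,2) obtain f' where f': "\<And>x. x \<in> U \<Longrightarrow> (f has_derivative f' x) (at x)"
    "\<And>d. Ck_on (Suc n) (\<lambda>x. f' x d) U" by (rule Ck_on_SucE) blast
  show ?case
    by (rule Ck_on_SucI[OF Suc.prems(1) f'(1)]) (use f' Suc in auto)
qed

lemma Ck_on_subset: "open U \<Longrightarrow> open V \<Longrightarrow> V \<subseteq> U \<Longrightarrow> Ck_on n f U \<Longrightarrow> Ck_on n f V"
proof (induction n arbitrary: f)
  case 0
  then show ?case by (auto intro: continuous_on_subset)
next
  case (Suc n)
  from Suc.prems(1,4) obtain f' where f': "\<And>x. x \<in> U \<Longrightarrow> (f has_derivative f' x) (at x)"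
    "\<And>d. Ck_on n (\<lambda>x. f' x d) U" by (rule Ck_on_SucE) blast
  show ?case
    by (rule Ck_on_SucI[OF Suc.prems(2)]) (use f' Suc in auto)
qed

lemma Ck_on_const: "open U \<Longrightarrow> Ck_on n (\<lambda>x. c) U"
proof (induction n arbitrary: c)
  case (Suc n)
  show ?case by (rule Ck_on_SucI[OF Suc.prems, where f' = "\<lambda>x d. 0"]) (use Suc in auto)
qed simp

lemma Ck_on_add: "open U \<Longrightarrow> Ck_on n f U \<Longrightarrow> Ck_on n g U \<Longrightarrow> Ck_on n (\<lambda>x. f x + g x) U"
proof (induction n arbitrary: f g)
  case 0
  then show ?case by (auto intro: continuous_on_add)
next
  case (Suc n)
  from Suc.prems(1,2) obtain f' where f': "\<And>x. x \<in> U \<Longrightarrow> (f has_derivative f' x) (at x)"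
    "\<And>d. Ck_on n (\<lambda>x. f' x d) U" by (rule Ck_on_SucE) blast
  from Suc.prems(1,3) obtain g' where g': "\<And>x. x \<in> U \<Longrightarrow> (g has_derivative g' x) (at x)"
    "\<And>d. Ck_on n (\<lambda>x. g' x d) U" by (rule Ck_on_SucE) blast
  show ?case
    by (rule Ck_on_SucI[OF Suc.prems(1), where f' = "\<lambda>x d. f' x d + g' x d"])
      (use f' g' Suc in \<open>auto intro!: has_derivative_add\<close>)
qed

lemma Ck_on_mult:
  fixes f g :: "'a::euclidean_space \<Rightarrow> 'b::real_normed_algebra"
  shows "open U \<Longrightarrow> Ck_on n f U \<Longrightarrow> Ck_on n g U \<Longrightarrow> Ck_on n (\<lambda>x. f x * g x) U"
proof (induction n arbitrary: f g)
  case 0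
  then show ?case by (auto intro: continuous_on_mult)
next
  case (Suc n)
  from Suc.prems(1,2) obtain f' where f': "\<And>x. x \<in> U \<Longrightarrow> (f has_derivative f' x) (at x)"
    "\<And>d. Ck_on n (\<lambda>x. f' x d) U" by (rule Ck_on_SucE) blast
  from Suc.prems(1,3) obtain g' where g': "\<And>x. x \<in> U \<Longrightarrow> (g has_derivative g' x) (at x)"
    "\<And>d. Ck_on n (\<lambda>x. g' x d) U" by (rule Ck_on_SucE) blast
  \<comment> \<open>Each term of the product rule keeps one undifferentiated factor, so the
    induction also needs both factors at the lower order.\<close>
  note lower = Ck_on_mono_Suc[OF Suc.prems(1,2)] Ck_on_mono_Suc[OF Suc.prems(1,3)]
  show ?case
  proof (rule Ck_on_SucI[OF Suc.prems(1), where f' = "\<lambda>x d. f x * g' x d + f' x d * g x"])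
    show "((\<lambda>x. f x * g x) has_derivative (\<lambda>d. f x * g' x d + f' x d * g x)) (at x)"
      if "x \<in> U" for x
      using has_derivative_mult[OF f'(1)[OF that] g'(1)[OF that]] .
    show "Ck_on n (\<lambda>x. f x * g' x d + f' x d * g x) U" for d
      using Suc.IH[OF Suc.prems(1) lower(1) g'(2)[of d]] Suc.IH[OF Suc.prems(1) f'(2)[of d] lower(2)]
      by (rule Ck_on_add[OF Suc.prems(1)])
  qed
qed

lemma Ck_on_compose_fst:
  fixes f :: "'a::euclidean_space \<Rightarrow> 'c::real_normed_vector"
  shows "open U \<Longrightarrow> Ck_on n f U \<Longrightarrow>
    Ck_on n (\<lambda>p. f (fst p)) (U \<times> (UNIV :: 'b::euclidean_space set))"
proof (induction n arbitrary: f)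
  case 0
  then show ?case by (auto intro!: continuous_on_compose2[of U f] continuous_intros)
next
  case (Suc n)
  from Suc.prems(1,2) obtain f' where f': "\<And>x. x \<in> U \<Longrightarrow> (f has_derivative f' x) (at x)"
    "\<And>d. Ck_on n (\<lambda>x. f' x d) U" by (rule Ck_on_SucE) blast
  show ?case
  proof (rule Ck_on_SucI[where f' = "\<lambda>p d. f' (fst p) (fst d)"])
    show "((\<lambda>p. f (fst p)) has_derivative (\<lambda>d. f' (fst p) (fst d))) (at p)"
      if "p \<in> U \<times> (UNIV :: 'b set)" for p
    proof -
      have "(f has_derivative f' (fst p)) (at (fst p))" using f'(1)[of "fst p"] that by auto
      then show ?thesis
        using has_derivative_compose[OF has_derivative_fst[OF has_derivative_ident]] by blast
    qed
  qed (use Suc.prems Suc.IH f' in \<open>auto simp: open_Times\<close>)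
qed

lemma smooth_on_openI:
  assumes "open U" "S \<subseteq> U" "\<And>n. Ck_on n f U"
  shows "smooth_on f S"
  unfolding smooth_on_def using assms by blast

lemma smooth_on_cong:
  assumes "\<And>x. x \<in> S \<Longrightarrow> f x = g x" "smooth_on f S"
  shows "smooth_on g S"
  using assms unfolding smooth_on_def by (metis IntD2)

lemma smooth_on_const: "smooth_on (\<lambda>x. c) S"
  by (rule smooth_on_openI[of UNIV]) (auto intro: Ck_on_const)

lemma smooth_on_add:
  assumes "smooth_on f S" "smooth_on g S"
  shows "smooth_on (\<lambda>x. f x + g x) S"
  unfolding smooth_on_def
proof
  fix x assume "x \<in> S"
  then obtain U f' V g' where U: "open U" "x \<in> U" "\<forall>n. Ck_on n f' U" "\<forall>y\<in>U \<inter> S. f' y = f y"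
    and V: "open V" "x \<in> V" "\<forall>n. Ck_on n g' V" "\<forall>y\<in>V \<inter> S. g' y = g y"
    using assms unfolding smooth_on_def by meson
  have "Ck_on n f' (U \<inter> V)" "Ck_on n g' (U \<inter> V)" for n
    using U V Ck_on_subset[of U "U \<inter> V" n f'] Ck_on_subset[of V "U \<inter> V" n g'] by auto
  then show "\<exists>W h. open W \<and> x \<in> W \<and> (\<forall>n. Ck_on n h W) \<and> (\<forall>y\<in>W \<inter> S. h y = f y + g y)"
    using U V by (intro exI[of _ "U \<inter> V"] exI[of _ "\<lambda>x. f' x + g' x"]) (auto intro: Ck_on_add)
qed

lemma smooth_on_mult:
  fixes f g :: "'a::euclidean_space \<Rightarrow> 'b::real_normed_algebra"
  assumes "smooth_on f S" "smooth_on g S"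
  shows "smooth_on (\<lambda>x. f x * g x) S"
  unfolding smooth_on_def
proof
  fix x assume "x \<in> S"
  then obtain U f' V g' where U: "open U" "x \<in> U" "\<forall>n. Ck_on n f' U" "\<forall>y\<in>U \<inter> S. f' y = f y"
    and V: "open V" "x \<in> V" "\<forall>n. Ck_on n g' V" "\<forall>y\<in>V \<inter> S. g' y = g y"
    using assms unfolding smooth_on_def by meson
  have "Ck_on n f' (U \<inter> V)" "Ck_on n g' (U \<inter> V)" for n
    using U V Ck_on_subset[of U "U \<inter> V" n f'] Ck_on_subset[of V "U \<inter> V" n g'] by auto
  then show "\<exists>W h. open W \<and> x \<in> W \<and> (\<forall>n. Ck_on n h W) \<and> (\<forall>y\<in>W \<inter> S. h y = f y * g y)"
    using U V by (intro exI[of _ "U \<inter> V"] exI[of _ "\<lambda>x. f' x * g' x"]) (auto intro: Ck_on_mult)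
qed

lemma smooth_on_sum:
  assumes "finite A" "\<And>i. i \<in> A \<Longrightarrow> smooth_on (f i) S"
  shows "smooth_on (\<lambda>x. \<Sum>i\<in>A. f i x) S"
  using assms by (induction A rule: finite_induct) (auto intro: smooth_on_const smooth_on_add)

lemma smooth_on_compose_fst:
  fixes f :: "'a::euclidean_space \<Rightarrow> 'c::real_normed_vector" and T :: "'b::euclidean_space set"
  assumes "smooth_on f S"
  shows "smooth_on (\<lambda>p. f (fst p)) (S \<times> T)"
  unfolding smooth_on_def
proof
  fix p :: "'a \<times> 'b" assume "p \<in> S \<times> T"
  then obtain U g where U: "open U" "fst p \<in> U" "\<forall>n. Ck_on n g U" "\<forall>y\<in>U \<inter> S. g y = f y"
    using assms unfolding smooth_on_def by (metis mem_Times_iff)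
  then show "\<exists>U g. open U \<and> p \<in> U \<and> (\<forall>n. Ck_on n g U) \<and> (\<forall>y\<in>U \<inter> S \<times> T. g y = f (fst y))"
    by (intro exI[of _ "U \<times> (UNIV :: 'b set)"] exI[of _ "\<lambda>p. g (fst p)"])
      (auto intro: Ck_on_compose_fst simp: open_Times mem_Times_iff)
qed

section \<open>Smooth functions and exponential sums\<close>

text \<open>Common form of the series differentiated below: weights times exponentials of linear
  forms. A derivative in direction \<open>d\<close> only replaces the weights by
  \<open>w i * l i d\<close>, so the class is closed under differentiation.\<close>

definition expsum :: "'i set \<Rightarrow> ('i \<Rightarrow> complex) \<Rightarrow> ('i \<Rightarrow> 'e \<Rightarrow> complex) \<Rightarrow> 'e \<Rightarrow> complex" where
  "expsum I w l x = (\<Sum>\<^sub>\<infinity>i\<in>I. w i * exp (l i x))"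

text \<open>Trades a polynomial factor for an exponential of arbitrarily small rate.\<close>

lemma le_exp_scaled: "0 < \<eta> \<Longrightarrow> 0 \<le> t \<Longrightarrow> t \<le> exp (\<eta> * t) / \<eta>" for \<eta> t :: real
proof -
  assume "0 < \<eta>" "0 \<le> t"
  have "\<eta> * t \<le> exp (\<eta> * t)" using exp_ge_add_one_self[of "\<eta> * t"] by linarith
  with \<open>0 < \<eta>\<close> show ?thesis by (simp add: field_simps)
qed

lemma square_le_exp_scaled: "0 < \<eta> \<Longrightarrow> 0 \<le> t \<Longrightarrow> t\<^sup>2 \<le> 4 / \<eta>\<^sup>2 * exp (\<eta> * t)" for \<eta> t :: real
proof -
  assume a: "0 < \<eta>" "0 \<le> t"
  have "t\<^sup>2 \<le> (exp (\<eta>/2 * t) / (\<eta>/2))\<^sup>2"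
    using le_exp_scaled[of "\<eta>/2" t] a by (intro power_mono) auto
  also have "\<dots> = 4 / \<eta>\<^sup>2 * exp (\<eta> * t)"
    by (simp add: power_divide power2_eq_square mult_exp_exp field_simps)
  finally show ?thesis .
qed

text \<open>Differentiation brings down a factor of size \<open>N i * norm d\<close>. Half of the
  exponential slack \<open>\<eta>\<close> absorbs it, so the summability hypothesis survives with
  \<open>\<eta>/2\<close> and derivatives can be iterated.\<close>

lemma expsum_weight_closed:
  assumes "\<And>i d. i \<in> I \<Longrightarrow> cmod (l i d) \<le> N i * norm d" and "\<And>i. i \<in> I \<Longrightarrow> N i \<ge> 0"
    and "\<eta> > 0" "(\<lambda>i. cmod (w i) * exp (Re (l i x) + \<eta> * N i)) summable_on I"
  shows "(\<lambda>i. cmod (w i * l i d) * exp (Re (l i x) + \<eta>/2 * N i)) summable_on I"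
proof (rule summable_on_dominated)
  show "(\<lambda>i. (norm d * 2 / \<eta>) * (cmod (w i) * exp (Re (l i x) + \<eta> * N i))) summable_on I"
    using assms(4) by (rule summable_on_cmult_right)
  fix i assume i: "i \<in> I"
  have "cmod (l i d) \<le> exp (\<eta>/2 * N i) / (\<eta>/2) * norm d"
    using assms(1)[OF i, of d] le_exp_scaled[of "\<eta>/2" "N i"] assms(2)[OF i] assms(3)
      mult_right_mono[of "N i" "exp (\<eta>/2 * N i) / (\<eta>/2)" "norm d"] by auto
  then have "cmod (w i) * cmod (l i d) * exp (Re (l i x) + \<eta>/2 * N i) \<le>
     cmod (w i) * (exp (\<eta>/2 * N i) / (\<eta>/2) * norm d) * exp (Re (l i x) + \<eta>/2 * N i)"
    by (intro mult_right_mono mult_left_mono) auto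
  also have "\<dots> = (norm d * 2 / \<eta>) * (cmod (w i) * exp (Re (l i x) + \<eta> * N i))"
    by (simp add: mult_exp_exp field_simps)
  finally show "norm (cmod (w i * l i d) * exp (Re (l i x) + \<eta>/2 * N i)) \<le>
      (norm d * 2 / \<eta>) * (cmod (w i) * exp (Re (l i x) + \<eta> * N i))"
    by (simp add: norm_mult)
qed

lemma expsum_summable:
  assumes "\<And>i. i \<in> I \<Longrightarrow> N i \<ge> 0" "\<eta> > 0"
    and "(\<lambda>i. cmod (w i) * exp (Re (l i x) + \<eta> * N i)) summable_on I"
  shows "(\<lambda>i. w i * exp (l i x)) summable_on I"
  using assms(3) by (rule summable_on_dominated) (use assms in \<open>auto simp: norm_mult intro!: mult_left_mono\<close>)

text \<open>The quadratic Taylor remainder of \<open>exp\<close> bounds the error of each term by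
  \<open>(norm h)\<^sup>2\<close> times a summable quantity, uniformly for
  \<open>norm h < \<eta>/2\<close>; hence the difference quotient of the whole series
  converges.\<close>

lemma expsum_has_derivative:
  fixes l :: "'i \<Rightarrow> 'e::euclidean_space \<Rightarrow> complex"
  assumes lin: "\<And>i. i \<in> I \<Longrightarrow> linear (l i)"
    and bd: "\<And>i d. i \<in> I \<Longrightarrow> cmod (l i d) \<le> N i * norm d" and N: "\<And>i. i \<in> I \<Longrightarrow> N i \<ge> 0"
    and \<eta>: "\<eta> > 0" and sm: "(\<lambda>i. cmod (w i) * exp (Re (l i x) + \<eta> * N i)) summable_on I"
  shows "(expsum I w l has_derivative (\<lambda>d. expsum I (\<lambda>i. w i * l i d) l x)) (at x)"
proof -
  define D where "D = (\<lambda>d. expsum I (\<lambda>i. w i * l i d) l x)"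
  have s1: "(\<lambda>i. w i * l i d * exp (l i x)) summable_on I" for d
    by (rule expsum_summable[where N = N and \<eta> = "\<eta>/2"])
      (use N \<eta> expsum_weight_closed[of I l N \<eta> w x d] bd sm in auto)
  have "linear D"
  proof
    fix b1 b2
    show "D (b1 + b2) = D b1 + D b2"
      unfolding D_def expsum_def infsum_add[OF s1 s1, symmetric]
      by (intro infsum_cong) (simp add: linear_add[OF lin] algebra_simps)
  next
    fix r b
    show "D (r *\<^sub>R b) = r *\<^sub>R D b"
      unfolding D_def expsum_def infsum_scaleR_right[symmetric]
      by (intro infsum_cong) (simp add: linear_scale[OF lin] scaleR_conv_of_real algebra_simps)
  qed
  then have bl: "bounded_linear D" by (simp add: linear_conv_bounded_linear)
  \<comment> \<open>The slack \<open>\<eta>\<close> is split in two. One half pays for the growth of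
    the exponential between \<open>x\<close> and \<open>y\<close>, because
    \<open>norm h < \<eta>/2\<close>; the other bounds \<open>(N i)\<^sup>2\<close> with the
    constant \<open>4 / (\<eta>/2)\<^sup>2\<close>, which is
    \<open>16 / \<eta>\<^sup>2\<close>.\<close>
  define K where "K = (\<Sum>\<^sub>\<infinity>i\<in>I. 16 / \<eta>\<^sup>2 * (cmod (w i) * exp (Re (l i x) + \<eta> * N i)))"
  have est: "norm (expsum I w l y - expsum I w l x - D (y - x)) / norm (y - x) \<le> norm (y - x) * K"
    if y: "y \<noteq> x" "dist y x < \<eta>/2" for y
  proof -
    define h where "h = y - x"
    have h: "norm h < \<eta>/2" "h \<noteq> 0" using y by (auto simp: h_def dist_norm)
    have point: "cmod (w i * exp (l i y) - w i * exp (l i x) - w i * l i h * exp (l i x)) \<le>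
      (norm h)\<^sup>2 * (16 / \<eta>\<^sup>2 * (cmod (w i) * exp (Re (l i x) + \<eta> * N i)))" if i: "i \<in> I" for i
    proof -
      have "l i y = l i x + l i h" using linear_diff[OF lin[OF i]] by (simp add: h_def)
      then have "w i * exp (l i y) - w i * exp (l i x) - w i * l i h * exp (l i x)
         = w i * exp (l i x) * (exp (l i h) - 1 - l i h)" by (simp add: exp_add algebra_simps)
      moreover have "cmod (exp (l i h) - 1 - l i h) \<le> exp (\<eta>/2 * N i) * (4 / (\<eta>/2)\<^sup>2 * exp (\<eta>/2 * N i)) * (norm h)\<^sup>2"
      proof -
        have "cmod (exp (l i h) - 1 - l i h) \<le> exp \<bar>Re (l i h)\<bar> * (cmod (l i h))\<^sup>2"
          using Taylor_exp[of "l i h" 1] by (simp add: power2_eq_square diff_diff_eq)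
        also have "\<dots> \<le> exp (\<eta>/2 * N i) * (N i * norm h)\<^sup>2"
        proof (intro mult_mono power_mono)
          have "\<bar>Re (l i h)\<bar> \<le> N i * norm h" using abs_Re_le_cmod[of "l i h"] bd[OF i, of h] by linarith
          also have "\<dots> \<le> N i * (\<eta>/2)" using h N[OF i] by (intro mult_left_mono) auto
          finally show "exp \<bar>Re (l i h)\<bar> \<le> exp (\<eta>/2 * N i)" by (simp add: mult.commute)
        qed (use bd[OF i, of h] in auto)
        also have "\<dots> = exp (\<eta>/2 * N i) * (N i)\<^sup>2 * (norm h)\<^sup>2" by (simp add: power_mult_distrib)
        also have "\<dots> \<le> exp (\<eta>/2 * N i) * (4 / (\<eta>/2)\<^sup>2 * exp (\<eta>/2 * N i)) * (norm h)\<^sup>2"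
          using square_le_exp_scaled[of "\<eta>/2" "N i"] \<eta> N[OF i] by (intro mult_right_mono mult_left_mono) auto
        finally show ?thesis .
      qed
      ultimately have "cmod (w i * exp (l i y) - w i * exp (l i x) - w i * l i h * exp (l i x)) \<le>
        cmod (w i) * exp (Re (l i x)) * (exp (\<eta>/2 * N i) * (4 / (\<eta>/2)\<^sup>2 * exp (\<eta>/2 * N i)) * (norm h)\<^sup>2)"
        by (simp only: norm_mult norm_exp_eq_Re) (intro mult_left_mono, auto)
      also have "\<dots> = (norm h)\<^sup>2 * (16 / \<eta>\<^sup>2 * (cmod (w i) * (exp (Re (l i x)) * (exp (\<eta>/2 * N i) * exp (\<eta>/2 * N i)))))"
        by (simp add: power_divide)
      also have "exp (Re (l i x)) * (exp (\<eta>/2 * N i) * exp (\<eta>/2 * N i)) = exp (Re (l i x) + \<eta> * N i)"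
        by (simp add: exp_add[symmetric])
      finally show ?thesis .
    qed
    have smb: "(\<lambda>i. (norm h)\<^sup>2 * (16 / \<eta>\<^sup>2 * (cmod (w i) * exp (Re (l i x) + \<eta> * N i)))) summable_on I"
      by (intro summable_on_cmult_right sm)
    have sx: "(\<lambda>i. w i * exp (l i x)) summable_on I"
      by (rule expsum_summable[where N = N and \<eta> = \<eta>]) (use N \<eta> sm in auto)
    have sd: "(\<lambda>i. w i * exp (l i y) - w i * exp (l i x) - w i * l i h * exp (l i x)) summable_on I"
      using summable_on_dominated[OF smb point] .
    have sy: "(\<lambda>i. w i * exp (l i y)) summable_on I"
      using summable_on_add[OF sd summable_on_add[OF sx s1[of h]]] by simp
    have "expsum I w l y - expsum I w l x - D h =
       (\<Sum>\<^sub>\<infinity>i\<in>I. w i * exp (l i y) - w i * exp (l i x) - w i * l i h * exp (l i x))"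
      unfolding expsum_def D_def
      using infsum_minus[OF sy sx] infsum_minus[OF summable_on_minus[OF sy sx] s1[of h]] by simp
    also have "norm \<dots> \<le> (\<Sum>\<^sub>\<infinity>i\<in>I. (norm h)\<^sup>2 * (16 / \<eta>\<^sup>2 * (cmod (w i) * exp (Re (l i x) + \<eta> * N i))))"
      by (rule norm_infsum_dominated[OF smb point])
    also have "\<dots> = (norm h)\<^sup>2 * K" unfolding K_def by (rule infsum_cmult_right')
    finally show ?thesis using h by (simp add: h_def[symmetric] divide_le_eq power2_eq_square mult.commute mult.left_commute)
  qed
  have "(expsum I w l has_derivative D) (at x within UNIV)"
  proof (rule has_derivativeI_sandwich[where e = "\<eta>/2" and H = "\<lambda>y. norm (y - x) * K"])
    show "((\<lambda>y. norm (y - x) * K) \<longlongrightarrow> 0) (at x within UNIV)"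
      by (auto intro!: tendsto_eq_intros)
  qed (use \<eta> bl est in auto)
  then show ?thesis by (simp add: D_def)
qed

text \<open>The slack may depend on the point. This matters for theta functions, where it is a
  fraction of the imaginary part and shrinks towards the real axis.\<close>

lemma expsum_Ck_on:
  fixes l :: "'i \<Rightarrow> 'e::euclidean_space \<Rightarrow> complex"
  assumes "open U" and lin: "\<And>i. i \<in> I \<Longrightarrow> linear (l i)"
    and bd: "\<And>i d. i \<in> I \<Longrightarrow> cmod (l i d) \<le> N i * norm d" and N: "\<And>i. i \<in> I \<Longrightarrow> N i \<ge> 0"
    and "\<And>x. x \<in> U \<Longrightarrow> \<exists>\<eta>>0. (\<lambda>i. cmod (w i) * exp (Re (l i x) + \<eta> * N i)) summable_on I"
  shows "Ck_on n (expsum I w l) U"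
  using assms(5)
proof (induction n arbitrary: w)
  case 0
  have "continuous (at x) (expsum I w l)" if x: "x \<in> U" for x
  proof -
    obtain \<eta> where "\<eta> > 0" "(\<lambda>i. cmod (w i) * exp (Re (l i x) + \<eta> * N i)) summable_on I"
      using 0[OF x] by blast
    then have "(expsum I w l has_derivative (\<lambda>d. expsum I (\<lambda>i. w i * l i d) l x)) (at x)"
      by (intro expsum_has_derivative[where N = N and \<eta> = \<eta>]) (use lin bd N in auto)
    then show ?thesis by (rule has_derivative_continuous)
  qed
  then show ?case by (simp add: continuous_at_imp_continuous_on)
next
  case (Suc n)
  show ?case
  proof (rule Ck_on_SucI[OF assms(1), where f' = "\<lambda>x d. expsum I (\<lambda>i. w i * l i d) l x"])
    fix x assume "x \<in> U"
    then show "(expsum I w l has_derivative (\<lambda>d. expsum I (\<lambda>i. w i * l i d) l x)) (at x)"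
      using Suc.prems expsum_has_derivative[where I = I and l = l and N = N and w = w, OF lin bd N] by blast
  next
    fix d
    have "\<exists>\<eta>>0. (\<lambda>i. cmod (w i * l i d) * exp (Re (l i x) + \<eta> * N i)) summable_on I" if "x \<in> U" for x
      using Suc.prems[OF that] expsum_weight_closed[where I = I and l = l and N = N and w = w and d = d, OF bd N]
        half_gt_zero by blast
    then show "Ck_on n (\<lambda>x. expsum I (\<lambda>i. w i * l i d) l x) U"
      using Suc.IH[of "\<lambda>i. w i * l i d"] by blast
  qed
qed

lemma expsum_has_field_derivative:
  fixes \<alpha> :: "'i \<Rightarrow> complex"
  assumes \<eta>: "\<eta> > 0" and sm: "(\<lambda>i. cmod (w i) * exp (Re (\<alpha> i * x) + \<eta> * cmod (\<alpha> i))) summable_on I"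
  shows "((\<lambda>y. \<Sum>\<^sub>\<infinity>i\<in>I. w i * exp (\<alpha> i * y)) has_field_derivative
    (\<Sum>\<^sub>\<infinity>i\<in>I. w i * \<alpha> i * exp (\<alpha> i * x))) (at x)"
proof -
  have "(expsum I w (\<lambda>i y. \<alpha> i * y) has_derivative
      (\<lambda>d. expsum I (\<lambda>i. w i * (\<alpha> i * d)) (\<lambda>i y. \<alpha> i * y) x)) (at x)"
    by (rule expsum_has_derivative[where N = "\<lambda>i. cmod (\<alpha> i)" and \<eta> = \<eta>])
      (use \<eta> sm in \<open>auto simp: norm_mult intro!: linearI simp: algebra_simps scaleR_conv_of_real\<close>)
  moreover have "expsum I (\<lambda>i. w i * (\<alpha> i * d)) (\<lambda>i y. \<alpha> i * y) x =
      (\<Sum>\<^sub>\<infinity>i\<in>I. w i * \<alpha> i * exp (\<alpha> i * x)) * d" for d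
    unfolding expsum_def infsum_cmult_left'[symmetric] by (intro infsum_cong) (simp add: mult_ac)
  ultimately show ?thesis by (simp add: has_field_derivative_def expsum_def[abs_def])
qed

section \<open>Fourier coefficients\<close>

lemma ee_add: "ee (a + b) = ee a * ee b"
  by (simp add: ee_def exp_add[symmetric] algebra_simps)

lemma ee_0 [simp]: "ee 0 = 1" by (simp add: ee_def)

lemma ee_neq_0 [simp]: "ee a \<noteq> 0" by (simp add: ee_def)

lemma ee_uminus: "ee (- a) = inverse (ee a)" by (simp add: ee_def exp_minus)

lemma ee_diff: "ee (a - b) = ee a / ee b" by (simp add: ee_def exp_diff[symmetric] algebra_simps)

lemma ee_of_int [simp]: "ee (of_int n) = 1"
  unfolding ee_def exp_eq_1 by (auto intro!: exI[of _ n])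

lemma ee_Ints: "x \<in> \<int> \<Longrightarrow> ee x = 1"
  by (elim Ints_cases) simp

lemma norm_ee: "cmod (ee a) = exp (- 2 * pi * Im a)"
  by (simp add: ee_def norm_exp_eq_Re)

lemma norm_ee_of_real [simp]: "cmod (ee (of_real x)) = 1"
  by (simp add: norm_ee)

lemma cnj_ee: "cnj (ee a) = ee (- cnj a)"
  by (simp add: ee_def exp_cnj)

lemma continuous_on_ee [continuous_intros]: "continuous_on S f \<Longrightarrow> continuous_on S (\<lambda>x. ee (f x))"
  unfolding ee_def by (intro continuous_intros)

lemma has_integral_ee:
  "((\<lambda>t. ee (of_int n * of_real t)) has_integral (if n = 0 then 1 else 0)) {0..1::real}"
proof (cases "n = 0")
  case True
  then show ?thesis using has_integral_const_real[of "1::complex" 0 1] by simp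
next
  case False
  define c where "c = 2 * of_real pi * \<i> * of_int n"
  have c: "c \<noteq> 0" using False by (simp add: c_def)
  have "((\<lambda>t. ee (of_int n * of_real t)) has_integral
      ee (of_int n * of_real 1) / c - ee (of_int n * of_real 0) / c) {0..1::real}"
  proof (rule fundamental_theorem_of_calculus)
    fix x :: real
    have "((\<lambda>z. ee (of_int n * z) / c) has_field_derivative ee (of_int n * of_real x)) (at (of_real x))"
    proof -
      have "((\<lambda>z. exp (c * z) / c) has_field_derivative exp (c * of_real x)) (at (of_real x))"
        using c by (auto intro!: derivative_eq_intros)
      then show ?thesis by (simp add: ee_def c_def mult_ac)
    qed
    from has_vector_derivative_real_field[OF this]
    show "((\<lambda>t. ee (of_int n * of_real t) / c) has_vector_derivative ee (of_int n * of_real x)) (at x within {0..1})" .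
  qed simp
  then show ?thesis using False by simp
qed

lemma cos_sq_antimono:
  fixes s d :: real
  assumes "\<bar>d\<bar> \<le> \<bar>s\<bar>" "\<bar>s\<bar> \<le> 1/2"
  shows "(cos (pi * s))\<^sup>2 \<le> (cos (pi * d))\<^sup>2"
proof -
  have p: "pi * \<bar>d\<bar> \<le> pi * \<bar>s\<bar>" "pi * \<bar>s\<bar> \<le> pi * (1/2)" "0 \<le> pi * \<bar>d\<bar>"
    using assms by (auto intro!: mult_left_mono)
  have "cos (pi * \<bar>s\<bar>) \<le> cos (pi * \<bar>d\<bar>)"
    by (rule cos_monotone_0_pi_le) (use p pi_gt_zero in linarith)+
  moreover have "0 \<le> cos (pi * \<bar>s\<bar>)"
    by (rule cos_ge_zero) (use p pi_gt_zero in linarith)+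
  moreover have "cos (pi * \<bar>s\<bar>) = cos (pi * s)" for s by (cases "s \<ge> 0") auto
  ultimately show ?thesis by (metis power_mono)
qed

text \<open>The trigonometric polynomials \<open>sin\<^sup>2\<^sup>N (\<pi>t)\<close> peak at \<open>1/2\<close>.\<close>

lemma fourier_coeffs_zero_imp_zero:
  fixes k :: "real \<Rightarrow> complex"
  assumes cont: "continuous_on {0..1} k"
    and zero: "\<And>n::int. integral {0..1} (\<lambda>t. k t * ee (of_int n * of_real t)) = 0"
  shows "k (1/2) = 0"
proof (rule ccontr)
  assume nz: "k (1/2) \<noteq> 0"
  \<comment> \<open>Normalised to the value 1 at the midpoint, so that its real part is at least
    \<open>1/2\<close> on a neighbourhood.\<close>
  define k' where "k' t = k t / k (1/2)" for t
  have cont': "continuous_on {0..1} k'" unfolding k'_def by (intro continuous_intros cont) (use nz in auto)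
  define T :: "real \<Rightarrow> real" where "T t = (cos (pi * (t - 1/2)))\<^sup>2" for t
  \<comment> \<open>\<open>T\<close> is a trigonometric polynomial with frequencies -1, 0 and 1, so
    multiplying by it only combines integrals already known to vanish.\<close>
  have Tee: "of_real (T t) = 1/2 - ee (of_real t) / 4 - ee (- of_real t) / 4" for t
  proof -
    have "T t = (1 + cos (2 * (pi * (t - 1/2)))) / 2"
      unfolding T_def by (simp add: cos_double_cos)
    also have "2 * (pi * (t - 1/2)) = 2 * pi * t - pi" by (simp add: algebra_simps)
    also have "cos (2 * pi * t - pi) = - cos (2 * pi * t)" by (simp add: cos_diff)
    finally have r: "T t = 1/2 - (2 * cos (2 * pi * t)) / 4"
      by (simp add: field_simps)
    have A: "cor (T t) = 1/2 - of_real (2 * cos (2 * pi * t)) / 4"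
      unfolding r by simp
    have "of_real (2 * cos (2 * pi * t)) = 2 * cos (cor (2 * pi * t))"
      using cos_of_real[where 'a = complex, of "2 * pi * t"] by (simp only: of_real_mult of_real_numeral)
    also have "\<dots> = ee (of_real t) + ee (- of_real t)"
      by (simp add: cos_exp_eq ee_def mult_ac)
    finally show ?thesis unfolding A by (simp only: add_divide_distrib) simp
  qed
  have Tcont: "continuous_on {0..1} T" unfolding T_def by (intro continuous_intros)
  have int: "(\<lambda>t. k' t * of_real (T t) ^ N * ee (of_int n * of_real t)) integrable_on {0..1}" for N and n :: int
    by (intro integrable_continuous_interval continuous_intros cont' Tcont)
  have zeroN: "integral {0..1} (\<lambda>t. k' t * of_real (T t) ^ N * ee (of_int n * of_real t)) = 0" for N and n :: int
  proof (induction N arbitrary: n)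
    case 0
    then show ?case using zero[of n] by (simp add: k'_def)
  next
    case (Suc N)
    define g where "g n t = k' t * of_real (T t) ^ N * ee (of_int n * of_real t)" for n :: int and t :: real
    have g: "g n integrable_on {0..1}" "integral {0..1} (g n) = 0" for n
      using int Suc.IH by (auto simp: g_def[abs_def])
    have "k' t * of_real (T t) ^ Suc N * ee (of_int n * of_real t)
        = g n t / 2 - g (n + 1) t / 4 - g (n - 1) t / 4" for t
      by (simp add: g_def Tee ee_add ee_diff ee_uminus algebra_simps) (simp add: field_simps)
    moreover have "integral {0..1} (\<lambda>t. g n t / 2 - g (n + 1) t / 4 - g (n - 1) t / 4) = 0"
      using g by (simp add: integral_diff integrable_diff)
    ultimately show ?case by simp
  qed
  obtain M where M: "M > 0" "\<And>t. t \<in> {0..1} \<Longrightarrow> cmod (k' t) \<le> M"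
  proof -
    have "compact (k' ` {0..1})" by (intro compact_continuous_image cont') simp
    then have "bounded (k' ` {0..1})" by (rule compact_imp_bounded)
    then show ?thesis using that unfolding bounded_pos by auto
  qed
  have "continuous (at (1/2)) k'"
    using continuous_on_interior[OF cont', of "1/2"] by (simp add: interior_atLeastAtMost_real)
  then obtain d where d: "d > 0" "\<And>t. dist t (1/2) < d \<Longrightarrow> dist (k' t) (k' (1/2)) < 1/2"
    unfolding continuous_at_eps_delta by (metis half_gt_zero zero_less_one)
  define \<delta> where "\<delta> = min (d/2) (1/4)"
  have \<delta>: "0 < \<delta>" "\<delta> < d" "\<delta> < 1/2" using d by (auto simp: \<delta>_def)
  have k1: "k' (1/2) = 1" using nz by (simp add: k'_def)
  have near: "Re (k' t) \<ge> 1/2" if "\<bar>t - 1/2\<bar> \<le> \<delta>" for t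
  proof -
    have "dist (k' t) 1 < 1/2" using d(2)[of t] that \<delta> k1 by (simp add: dist_real_def)
    then have "\<bar>Re (k' t - 1)\<bar> < 1/2" using abs_Re_le_cmod[of "k' t - 1"] by (simp add: dist_norm)
    then show ?thesis unfolding abs_less_iff by simp
  qed
  \<comment> \<open>\<open>\<rho>'\<close> bounds \<open>T\<close> from below up to distance
    \<open>\<delta>/2\<close> from the midpoint, \<open>\<rho>\<close> bounds it from above beyond
    distance \<open>\<delta>\<close>; in between only the sign of the integrand is used. The gap
    between the two becomes decisive for large powers.\<close>
  define \<rho> \<rho>' where "\<rho> = (cos (pi * \<delta>))\<^sup>2" and "\<rho>' = (cos (pi * (\<delta>/2)))\<^sup>2"
  have "0 < pi * \<delta>" "pi * \<delta> < pi * (1/2)"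
    using \<delta> pi_gt_zero by (auto intro!: mult_strict_left_mono)
  then have pd: "0 < pi * \<delta>" "pi * \<delta> < pi / 2" "pi * (\<delta>/2) = pi * \<delta> / 2" by auto
  have c0: "0 < cos (pi * (\<delta>/2))" unfolding pd(3) by (rule cos_gt_zero_pi) (use pd(1,2) in linarith)+
  have "cos (pi * \<delta>) < cos (pi * (\<delta>/2))"
    unfolding pd(3) by (rule cos_monotone_0_pi) (use pd(1,2) in linarith)+
  moreover have "0 \<le> cos (pi * \<delta>)" by (rule cos_ge_zero) (use pd(1,2) in linarith)+
  ultimately have \<rho>: "0 \<le> \<rho>" "\<rho> < \<rho>'" "0 < \<rho>'"
    using c0 by (auto simp: \<rho>_def \<rho>'_def power_strict_mono)
  have main: "\<delta> * \<rho>' ^ N / 2 \<le> M * \<rho> ^ N" for N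
  proof -
    define f where "f t = Re (k' t) * T t ^ N" for t
    have mem: "t \<in> {1/2 - \<delta>/2..1/2 + \<delta>/2} \<longleftrightarrow> \<bar>t - 1/2\<bar> \<le> \<delta>/2" for t
      unfolding abs_le_iff atLeastAtMost_iff by linarith
    \<comment> \<open>A step function below \<open>f\<close>. The inner interval has length
      \<open>\<delta>\<close> and there the real part of \<open>k'\<close> is at least
      \<open>1/2\<close>, whence the integral
      \<open>\<delta> * \<rho>' ^ N / 2 - M * \<rho> ^ N\<close>; the integral of \<open>f\<close>
      is 0.\<close>
    define g where "g t = (if \<bar>t - 1/2\<bar> \<le> \<delta>/2 then \<rho>' ^ N / 2 else 0) - M * \<rho> ^ N" for t
    have T0: "0 \<le> T t" for t by (simp add: T_def)
    have "g t \<le> f t" if t: "t \<in> {0..1}" for t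
    proof -
      consider "\<bar>t - 1/2\<bar> \<le> \<delta>/2" | "\<delta>/2 < \<bar>t - 1/2\<bar>" "\<bar>t - 1/2\<bar> \<le> \<delta>" | "\<bar>t - 1/2\<bar> > \<delta>" by linarith
      then show ?thesis
      proof cases
        case 1
        have "\<rho>' \<le> T t"
          using cos_sq_antimono[of "t - 1/2" "\<delta>/2"] 1 \<delta> unfolding T_def \<rho>'_def by simp
        then have "\<rho>' ^ N \<le> T t ^ N" using \<rho> by (intro power_mono) auto
        moreover have "Re (k' t) \<ge> 1/2" using near 1 \<delta> by auto
        ultimately have "1/2 * \<rho>' ^ N \<le> f t" unfolding f_def using \<rho> by (intro mult_mono) auto
        moreover have "0 \<le> M * \<rho> ^ N" using M \<rho> by simp
        ultimately show ?thesis using 1 unfolding g_def by simp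
      next
        case 2
        then have "Re (k' t) \<ge> 1/2" using near by auto
        then have "0 \<le> f t" unfolding f_def using T0 by simp
        moreover have "0 \<le> M * \<rho> ^ N" using M \<rho> by simp
        moreover have "g t = - M * \<rho> ^ N" using 2(1) unfolding g_def by simp
        ultimately show ?thesis by simp
      next
        case 3
        have "T t \<le> \<rho>"
        proof -
          have "\<bar>t - 1/2\<bar> \<le> 1/2" using t unfolding abs_le_iff by auto
          then show ?thesis using cos_sq_antimono[of \<delta> "t - 1/2"] 3 \<delta> unfolding T_def \<rho>_def by simp
        qed
        then have "T t ^ N \<le> \<rho> ^ N" using T0 by (intro power_mono) auto
        moreover have "\<bar>Re (k' t)\<bar> \<le> M" using M(2)[OF t] abs_Re_le_cmod[of "k' t"] by linarith
        ultimately have "\<bar>f t\<bar> \<le> M * \<rho> ^ N"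
          unfolding f_def abs_mult using T0 M by (intro mult_mono) auto
        moreover have "g t = - M * \<rho> ^ N" using 3 \<delta> unfolding g_def by simp
        ultimately show ?thesis by simp
      qed
    qed
    moreover have "(g has_integral (\<delta> * \<rho>' ^ N / 2 - M * \<rho> ^ N)) {0..1}"
    proof -
      have "((\<lambda>t. \<rho>' ^ N / 2) has_integral \<delta> * (\<rho>' ^ N / 2)) {1/2 - \<delta>/2..1/2 + \<delta>/2}"
        using has_integral_const_real[of "\<rho>' ^ N / 2" "1/2 - \<delta>/2" "1/2 + \<delta>/2"] \<delta> by simp
      then have "((\<lambda>t. if t \<in> {1/2 - \<delta>/2..1/2 + \<delta>/2} then \<rho>' ^ N / 2 else 0) has_integral \<delta> * (\<rho>' ^ N / 2)) {0..1}"
        using \<delta> by (subst has_integral_restrict) auto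
      from has_integral_diff[OF this[unfolded mem] has_integral_const_real[of "M * \<rho> ^ N" 0 1]]
      show ?thesis unfolding g_def[abs_def] by simp
    qed
    moreover have "(f has_integral 0) {0..1}"
    proof -
      have "((\<lambda>t. k' t * of_real (T t) ^ N) has_integral 0) {0..1}"
        using int[of N 0] zeroN[of N 0] by (simp add: has_integral_integrable_integral)
      from has_integral_linear[OF this bounded_linear_Re]
      show ?thesis by (simp add: f_def[abs_def] o_def of_real_power[symmetric] del: of_real_power)
    qed
    ultimately show ?thesis using has_integral_le[of g _ "{0..1}" f 0] by force
  qed
  have "(\<lambda>N. (\<rho>/\<rho>') ^ N) \<longlonglongrightarrow> 0" using \<rho> by (intro LIMSEQ_realpow_zero) auto
  then have "\<forall>\<^sub>F N in sequentially. (\<rho>/\<rho>') ^ N < \<delta> / (2 * M)"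
    using \<delta> M by (intro order_tendstoD(2)) auto
  then obtain N where "(\<rho>/\<rho>') ^ N < \<delta> / (2 * M)" by (auto simp: eventually_sequentially)
  then have "M * \<rho> ^ N < \<delta> * \<rho>' ^ N / 2"
    using M \<rho> by (simp add: power_divide field_simps)
  with main[of N] show False by linarith
qed

text \<open>With a primitive \<open>G\<close> the integral is \<open>G (w + 1) - G w\<close>, and
  this has derivative \<open>g (w + 1) - g w = 0\<close>. It takes the place of a contour
  shift.\<close>

lemma integral_periodic_entire:
  assumes hol: "g holomorphic_on UNIV" and per: "\<And>z. g (z + 1) = g z"
  shows "integral {0..1} (\<lambda>t. g (w + of_real t)) = integral {0..1} (\<lambda>t. g (of_real t))"
proof -
  obtain G where G: "\<And>z. (G has_field_derivative g z) (at z)"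
    using holomorphic_convex_primitive'[OF _ _ hol] by auto
  have I: "integral {0..1} (\<lambda>t. g (w + of_real t)) = G (w + 1) - G w" for w
  proof -
    have "((\<lambda>t. g (w + of_real t)) has_integral G (w + of_real 1) - G (w + of_real 0)) {0..1::real}"
    proof (rule fundamental_theorem_of_calculus)
      fix x :: real
      have "((\<lambda>z. G (w + z)) has_field_derivative g (w + of_real x)) (at (of_real x))"
        using DERIV_shift[of G "g (w + of_real x)" "of_real x" w] G by (simp add: add.commute)
      from has_vector_derivative_real_field[OF this]
      show "((\<lambda>t. G (w + of_real t)) has_vector_derivative g (w + of_real x)) (at x within {0..1})" .
    qed simp
    then show ?thesis by (simp add: integral_unique)
  qed
  have "((\<lambda>w. G (w + 1) - G w) has_field_derivative 0) (at z within UNIV)" for z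
  proof -
    have "((\<lambda>w. G (w + 1)) has_field_derivative g z) (at z)"
      using DERIV_shift[of G "g z" z 1] G[of "z + 1"] per[of z] by simp
    from DERIV_diff[OF this G[of z]] show ?thesis by simp
  qed
  then obtain c where Gc: "\<And>w. G (w + 1) - G w = c"
    using has_field_derivative_zero_constant[of UNIV "\<lambda>w. G (w + 1) - G w"] by auto
  then show ?thesis using I[of w] I[of 0] Gc[of w] Gc[of 0] by simp
qed

section \<open>Averages over periods\<close>

definition av :: "'c::euclidean_space \<Rightarrow> ('c \<Rightarrow> complex) \<Rightarrow> 'c \<Rightarrow> complex" where
  "av u h z = integral {0..1} (\<lambda>t. h (z + t *\<^sub>R u))"

text \<open>Iterated mean over the periods in the list. For a basis of the lattice it is the zeroth
  Fourier coefficient on the real torus through a point, kept as a function of that point.\<close>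

definition avl :: "'c::euclidean_space list \<Rightarrow> ('c \<Rightarrow> complex) \<Rightarrow> 'c \<Rightarrow> complex" where
  "avl us = foldr av us"

lemma avl_Nil [simp]: "avl [] h = h" and avl_Cons [simp]: "avl (u # us) h = av u (avl us h)"
  by (simp_all add: avl_def)

lemma continuous_on_line:
  fixes h :: "'c::euclidean_space \<Rightarrow> complex"
  shows "continuous_on UNIV h \<Longrightarrow> continuous_on S (\<lambda>t. h (z + t *\<^sub>R u))"
  by (rule continuous_on_compose2[of UNIV h]) (auto intro!: continuous_intros)

lemma integrable_line:
  fixes h :: "'c::euclidean_space \<Rightarrow> complex"
  shows "continuous_on UNIV h \<Longrightarrow> (\<lambda>t. h (z + t *\<^sub>R u)) integrable_on {0..1}"
  by (intro integrable_continuous_interval continuous_on_line)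

lemma continuous_av:
  assumes "continuous_on UNIV h"
  shows "continuous_on UNIV (av u h)"
proof -
  have "continuous_on (UNIV \<times> cbox 0 1) (\<lambda>(z, t). h (z + t *\<^sub>R u))"
    unfolding case_prod_beta by (rule continuous_on_compose2[OF assms]) (auto intro!: continuous_intros)
  from integral_continuous_on_param[OF this] show ?thesis by (simp add: av_def[abs_def])
qed

lemma continuous_avl: "continuous_on UNIV h \<Longrightarrow> continuous_on UNIV (avl us h)"
  by (induction us) (auto intro: continuous_av)

lemma av_commute:
  assumes "continuous_on UNIV h"
  shows "av u (av u' h) = av u' (av u h)"
proof
  fix z
  have "continuous_on (cbox (0,0) (1,1)) (\<lambda>(s, t). h (z + s *\<^sub>R u + t *\<^sub>R u'))"
    unfolding case_prod_beta
    by (rule continuous_on_compose2[OF assms]) (auto intro!: continuous_intros)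
  from integral_swap_continuous[OF this]
  show "av u (av u' h) z = av u' (av u h) z"
    by (simp add: av_def add.assoc) (simp add: add.left_commute add.commute)
qed

lemma avl_av_commute: "continuous_on UNIV h \<Longrightarrow> av u (avl us h) = avl us (av u h)"
  by (induction us) (auto simp: av_commute continuous_avl)

lemma av_translate:
  assumes "\<And>z. h (z + d) = h z"
  shows "av u h (z + d) = av u h z"
proof -
  have "h (z + d + t *\<^sub>R u) = h (z + t *\<^sub>R u)" for t
    using assms[of "z + t *\<^sub>R u"] by (simp add: add_ac)
  then show ?thesis by (simp add: av_def)
qed

lemma avl_translate: "(\<And>z. h (z + d) = h z) \<Longrightarrow> avl us h (z + d) = avl us h z"
  by (induction us arbitrary: z) (auto intro: av_translate)

text \<open>On a complex line along which \<open>h\<close> is entire and has period 1, the mean over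
  the period loses its dependence on the imaginary direction as well.\<close>

lemma av_complex_translate:
  fixes j :: "complex \<Rightarrow> 'c::euclidean_space"
  assumes j: "linear j" and hol: "\<And>z. (\<lambda>x. h (z + j x)) holomorphic_on UNIV" and per: "\<And>z. h (z + j 1) = h z"
  shows "av (j 1) h (z + j w) = av (j 1) h z"
proof -
  have r: "j (of_real t) = t *\<^sub>R j 1" for t using linear_scale[OF j, of t 1] by (simp add: of_real_def)
  have "integral {0..1} (\<lambda>t. h (z + j (w + of_real t))) = integral {0..1} (\<lambda>t. h (z + j (of_real t)))"
    by (rule integral_periodic_entire[where g = "\<lambda>x. h (z + j x)", OF hol])
      (use per[of "z + j _"] in \<open>simp add: linear_add[OF j] add.assoc\<close>)
  then show ?thesis unfolding av_def by (simp add: linear_add[OF j] r add.assoc)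
qed

lemma avl_complex_translate:
  fixes j :: "complex \<Rightarrow> 'c::euclidean_space"
  assumes "linear j" "\<And>z. (\<lambda>x. h (z + j x)) holomorphic_on UNIV" "\<And>z. h (z + j 1) = h z"
    and "continuous_on UNIV h" "j 1 \<in> set us"
  shows "avl us h (z + j w) = avl us h z"
  using assms(5)
proof (induction us arbitrary: z)
  case (Cons u us)
  show ?case
  proof (cases "u = j 1")
    case True
    \<comment> \<open>Averages commute, so the one in direction \<open>j 1\<close> may be moved
      innermost, where it acts on \<open>h\<close> itself and the holomorphy of \<open>h\<close>
      applies.\<close>
    have "avl (u # us) h = avl us (av (j 1) h)" using avl_av_commute[OF assms(4)] True by simp
    then show ?thesis using avl_translate[of "av (j 1) h" "j w"] av_complex_translate[OF assms(1-3)] by simp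
  next
    case False
    then have "avl us h (z + j w) = avl us h z" for z using Cons by auto
    then show ?thesis using av_translate[of "avl us h" "j w"] by simp
  qed
qed simp

lemma av_bound:
  assumes "continuous_on UNIV h" "\<And>t. 0 \<le> t \<Longrightarrow> t \<le> 1 \<Longrightarrow> cmod (h (z + t *\<^sub>R u)) \<le> B"
  shows "cmod (av u h z) \<le> B"
  using integral_bound[of 0 1 "\<lambda>t. h (z + t *\<^sub>R u)" B] assms continuous_on_line[OF assms(1)]
  by (auto simp: av_def)

lemma avl_bound:
  assumes "continuous_on UNIV h" "\<And>z. z \<in> S \<Longrightarrow> cmod (h z) \<le> B"
    and "\<And>z t u. z \<in> S \<Longrightarrow> u \<in> set us \<Longrightarrow> z + t *\<^sub>R u \<in> S" and "z \<in> S"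
  shows "cmod (avl us h z) \<le> B"
  using assms(3,4)
proof (induction us arbitrary: z)
  case (Cons u us)
  then show ?case by (auto intro!: av_bound continuous_avl assms(1))
qed (use assms(2) in auto)

lemma av_diff:
  assumes "continuous_on UNIV f" "continuous_on UNIV g"
  shows "av u (\<lambda>z. f z - g z) = (\<lambda>z. av u f z - av u g z)"
  unfolding av_def using integral_diff[OF integrable_line[OF assms(1)] integrable_line[OF assms(2)]] by simp

lemma avl_diff:
  assumes "continuous_on UNIV f" "continuous_on UNIV g"
  shows "avl us (\<lambda>z. f z - g z) = (\<lambda>z. avl us f z - avl us g z)"
  by (induction us) (simp_all add: av_diff continuous_avl assms)

lemma av_factor:
  assumes "\<And>z t. \<xi> (z + t *\<^sub>R u) = \<xi> z"
  shows "av u (\<lambda>z. h z * \<xi> z) = (\<lambda>z. av u h z * \<xi> z)"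
  unfolding av_def using assms by simp

lemma avl_factor:
  assumes "\<And>u z t. u \<in> set us \<Longrightarrow> \<xi> (z + t *\<^sub>R u) = \<xi> z"
  shows "avl us (\<lambda>z. h z * \<xi> z) = (\<lambda>z. avl us h z * \<xi> z)"
  using assms by (induction us) (simp_all add: av_factor)

lemma avl_character:
  assumes "\<And>u z t. u \<in> set us \<Longrightarrow> \<xi> (z + t *\<^sub>R u) = ee (of_int (n u) * of_real t) * \<xi> z"
  shows "avl us \<xi> = (\<lambda>z. (\<Prod>u\<leftarrow>us. if n u = 0 then 1 else 0) * \<xi> z)"
  using assms
proof (induction us)
  case (Cons u us)
  have "av u (\<lambda>z. c * \<xi> z) z = c * ((if n u = 0 then 1 else 0) * \<xi> z)" for c z
    unfolding av_def using Cons.prems[of u] integral_unique[OF has_integral_ee[of "n u"]] by simp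
  moreover have "avl us \<xi> = (\<lambda>z. (\<Prod>u\<leftarrow>us. if n u = 0 then 1 else 0) * \<xi> z)"
    by (rule Cons.IH) (use Cons.prems in auto)
  ultimately show ?case by (simp del: mult_eq_0_iff)
qed simp

text \<open>Reduces Fourier uniqueness on a torus to one variable by removing one direction at a
  time. \<open>C\<close> plays the part of the characters and \<open>\<psi> u n\<close> of those
  that vary in the single direction \<open>u\<close>; once no direction is left, the hypothesis
  \<open>zero\<close> with the constant character is the claim.\<close>

lemma avl_unique:
  assumes "distinct us" "continuous_on UNIV h"
    and S: "\<And>z t u. z \<in> S \<Longrightarrow> u \<in> set us \<Longrightarrow> z + t *\<^sub>R u \<in> S"
    and one: "(\<lambda>z. 1) \<in> C" and cont: "\<And>\<xi>. \<xi> \<in> C \<Longrightarrow> continuous_on UNIV \<xi>"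
    and mult: "\<And>u \<xi> n. u \<in> set us \<Longrightarrow> \<xi> \<in> C \<Longrightarrow> (\<lambda>z. \<xi> z * \<psi> u n z) \<in> C"
    and \<psi>0: "\<And>u n z. u \<in> set us \<Longrightarrow> \<psi> u n z \<noteq> 0"
    and \<psi>1: "\<And>u n z t. u \<in> set us \<Longrightarrow> \<psi> u n (z + t *\<^sub>R u) = ee (of_int n * of_real t) * \<psi> u n z"
    and \<psi>2: "\<And>u u' n z t. u \<in> set us \<Longrightarrow> u' \<in> set us \<Longrightarrow> u \<noteq> u' \<Longrightarrow> \<psi> u n (z + t *\<^sub>R u') = \<psi> u n z"
    and zero: "\<And>\<xi> z. \<xi> \<in> C \<Longrightarrow> z \<in> S \<Longrightarrow> avl us (\<lambda>z. h z * \<xi> z) z = 0"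
    and z: "z \<in> S"
  shows "h z = 0"
  using assms(1) S mult \<psi>0 \<psi>1 \<psi>2 zero
proof (induction us)
  case Nil
  then show ?case using one z Nil(7)[of "\<lambda>z. 1" z] by simp
next
  case (Cons u us)
  show ?case
  proof (rule Cons.IH)
    fix \<xi> z assume \<xi>: "\<xi> \<in> C" and z: "z \<in> S"
    define k where "k = avl us (\<lambda>z. h z * \<xi> z)"
    have kc: "continuous_on UNIV k"
      unfolding k_def by (intro continuous_avl continuous_intros assms(2) cont \<xi>)
    \<comment> \<open>The one-variable lemma speaks about the midpoint of the interval, so the
      segment starts half a period before \<open>z\<close>.\<close>
    define z' where "z' = z + (-1/2) *\<^sub>R u"
    have z': "z' \<in> S" unfolding z'_def by (rule Cons.prems(2)[OF z]) simp
    have "k (z' + (1/2) *\<^sub>R u) = 0"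
    proof (rule fourier_coeffs_zero_imp_zero[where k = "\<lambda>t. k (z' + t *\<^sub>R u)"])
      show "continuous_on {0..1} (\<lambda>t. k (z' + t *\<^sub>R u))" by (rule continuous_on_line[OF kc])
      fix n :: int
      have "(\<lambda>z. k z * \<psi> u n z) = avl us (\<lambda>z. h z * (\<xi> z * \<psi> u n z))"
      proof -
        have "\<psi> u n (z + t *\<^sub>R u') = \<psi> u n z" if "u' \<in> set us" for u' z t
          using Cons.prems(6)[of u u'] that Cons.prems(1) by auto
        from avl_factor[of us "\<psi> u n" "\<lambda>z. h z * \<xi> z", OF this]
        show ?thesis unfolding k_def by (simp add: mult.assoc)
      qed
      moreover have "avl (u # us) (\<lambda>z. h z * (\<xi> z * \<psi> u n z)) z' = 0"
        using Cons.prems(7)[OF Cons.prems(3)[of u \<xi> n] z'] \<xi> by auto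
      ultimately have "av u (\<lambda>z. k z * \<psi> u n z) z' = 0" by simp
      then have "integral {0..1} (\<lambda>t. k (z' + t *\<^sub>R u) * ee (of_int n * of_real t) * \<psi> u n z') = 0"
        unfolding av_def using Cons.prems(5)[of u n z'] by (simp add: mult.assoc)
      then show "integral {0..1} (\<lambda>t. k (z' + t *\<^sub>R u) * ee (of_int n * of_real t)) = 0"
        using Cons.prems(4)[of u n z'] by simp
    qed
    then show "avl us (\<lambda>z. h z * \<xi> z) z = 0" by (simp add: k_def z'_def)
  qed (use Cons.prems in auto)
qed

section \<open>Orthonormal bases and lattices\<close>

lemma orthonormal_independent:
  assumes "bilinear B" "finite F" "\<forall>f\<in>F. \<forall>g\<in>F. B f g = (if f = g then c else (0::real))" "c \<noteq> 0"
  shows "independent (F :: 'a::euclidean_space set)"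
proof
  assume "dependent F"
  then obtain u g where u: "g \<in> F" "u g \<noteq> 0" "(\<Sum>f\<in>F. u f *\<^sub>R f) = 0"
    using dependent_finite[OF assms(2)] by blast
  have lin: "linear (\<lambda>x. B x g)" using assms(1) by (simp add: bilinear_def)
  have "0 = B (\<Sum>f\<in>F. u f *\<^sub>R f) g" using u(3) linear_0[OF lin] by simp
  also have "\<dots> = (\<Sum>f\<in>F. u f * B f g)"
    by (simp add: linear_sum[OF lin] linear_scale[OF lin])
  also have "\<dots> = (\<Sum>f\<in>F. if f = g then u f * c else 0)"
    using assms(3) u(1) by (intro sum.cong) auto
  also have "\<dots> = u g * c" using u(1) assms(2) by simp
  finally show False using u(2) assms(4) by simp
qed

text \<open>An orthonormal set of maximal size spans: from a vector of \<open>P\<close> outside its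
  span a Gram-Schmidt step would produce one more element.\<close>

lemma ex_orthonormal_basis:
  fixes P :: "'a::euclidean_space set"
  assumes P: "subspace P" and B: "bilinear B" and sym: "\<And>x y. x \<in> P \<Longrightarrow> y \<in> P \<Longrightarrow> B x y = B y x"
    and pos: "\<And>x. x \<in> P \<Longrightarrow> x \<noteq> 0 \<Longrightarrow> B x x > (0::real)"
  obtains F where "finite F" "F \<subseteq> P" "span F = P" "card F = dim P"
    "\<forall>f\<in>F. \<forall>g\<in>F. B f g = (if f = g then 1 else 0)"
proof -
  define ON where "ON F \<longleftrightarrow> finite F \<and> F \<subseteq> P \<and> (\<forall>f\<in>F. \<forall>g\<in>F. B f g = (if f = g then 1 else 0))" for F
  have ind: "independent F" if "ON F" for F
    by (rule orthonormal_independent[OF B, of F 1]) (use that in \<open>auto simp: ON_def\<close>)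
  have card: "card F < Suc (dim P)" if "ON F" for F
    using independent_card_le_dim[OF _ ind[OF that], of P] that by (auto simp: ON_def)
  have "ON {}" by (simp add: ON_def)
  then obtain F where F: "ON F" and max: "\<And>G. ON G \<Longrightarrow> card G \<le> card F"
    using Lattices_Big.ex_has_greatest_nat[of ON "{}" card "Suc (dim P)"] card by auto
  have FP: "finite F" "F \<subseteq> P" and on: "\<forall>f\<in>F. \<forall>g\<in>F. B f g = (if f = g then 1 else 0)"
    using F by (auto simp: ON_def)
  have "P \<subseteq> span F"
  proof (rule ccontr)
    assume "\<not> P \<subseteq> span F"
    then obtain x where x: "x \<in> P" "x \<notin> span F" by blast
    define y where "y = x - (\<Sum>f\<in>F. B x f *\<^sub>R f)"
    have sP: "(\<Sum>f\<in>F. B x f *\<^sub>R f) \<in> P"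
      using FP by (intro subspace_sum[OF P] subspace_scale[OF P]) auto
    have yP: "y \<in> P" unfolding y_def by (intro subspace_diff[OF P] x sP)
    have "(\<Sum>f\<in>F. B x f *\<^sub>R f) \<in> span F" by (intro span_sum span_scale span_base)
    then have "y \<noteq> 0" using x unfolding y_def by auto
    then have yy: "B y y > 0" using pos yP by blast
    have yg: "B y g = 0" if g: "g \<in> F" for g
    proof -
      have lin: "linear (\<lambda>x. B x g)" using B by (simp add: bilinear_def)
      have "B y g = B x g - (\<Sum>f\<in>F. B x f * B f g)"
        by (simp add: y_def linear_diff[OF lin] linear_sum[OF lin] linear_scale[OF lin])
      also have "(\<Sum>f\<in>F. B x f * B f g) = (\<Sum>f\<in>F. if f = g then B x f else 0)"
        using on g by (intro sum.cong) auto
      finally show ?thesis using g FP by simp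
    qed
    define z where "z = (1 / sqrt (B y y)) *\<^sub>R y"
    have zP: "z \<in> P" unfolding z_def by (intro subspace_scale[OF P] yP)
    have zz: "B z z = 1" unfolding z_def using yy by (simp add: bilinear_lmul[OF B] bilinear_rmul[OF B])
    have zg: "B z g = 0" if "g \<in> F" for g unfolding z_def using yg[OF that] by (simp add: bilinear_lmul[OF B])
    have gz: "B g z = 0" if "g \<in> F" for g using zg[OF that] sym[of g z] that FP zP by auto
    have "z \<notin> F" using zg[of z] zz by auto
    moreover have "ON (insert z F)" using F zP zz zg gz unfolding ON_def by auto
    ultimately show False using max[of "insert z F"] FP by simp
  qed
  then have sp: "span F = P" using FP span_minimal[OF _ P, of F] by blast
  moreover have "card F = dim P" using dim_eq_card[of F P] ind[OF F] sp P by (metis span_eq_iff)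
  ultimately show ?thesis using that FP on by blast
qed

text \<open>Several-variable geometric series; a dual vector will be encoded by its tuple of integer
  pairings.\<close>

lemma summable_on_prod_PiE:
  fixes g :: "'b \<Rightarrow> real"
  assumes "finite A" "g summable_on UNIV" "\<And>x. g x \<ge> 0"
  shows "(\<lambda>n. \<Prod>a\<in>A. g (n a)) summable_on (PiE A (\<lambda>_. UNIV))"
  using assms(1)
proof (induction A rule: finite_induct)
  case empty
  then show ?case by simp
next
  case (insert a A)
  define h where "h n = (\<Prod>a\<in>A. g (n a))" for n
  have h: "h summable_on (PiE A (\<lambda>_. UNIV))" using insert.IH by (simp add: h_def[abs_def])
  have "(\<lambda>(y, n). g y * h n) summable_on (UNIV \<times> PiE A (\<lambda>_. UNIV))"
  proof (rule summable_on_SigmaI[where g = "\<lambda>y. g y * infsum h (PiE A (\<lambda>_. UNIV))"])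
    show "((\<lambda>n. case (y, n) of (y, n) \<Rightarrow> g y * h n) has_sum g y * infsum h (PiE A (\<lambda>_. UNIV))) (PiE A (\<lambda>_. UNIV))" for y
      using has_sum_cmult_right[OF has_sum_infsum[OF h]] by simp
  qed (use assms in \<open>auto intro!: summable_on_cmult_left mult_nonneg_nonneg prod_nonneg simp: h_def\<close>)
  moreover have "(\<lambda>n. \<Prod>a\<in>insert a A. g (n a)) \<circ> (\<lambda>(y, n). n(a := y)) = (\<lambda>(y, n). g y * h n)"
  proof -
    have "(\<Prod>b\<in>A. g ((n(a := y)) b)) = h n" for n y
      unfolding h_def using insert.hyps by (intro prod.cong) auto
    then show ?thesis using insert.hyps by (auto simp: fun_eq_iff)
  qed
  ultimately show ?case
    using summable_on_reindex[OF inj_combinator[OF insert.hyps(2), of "\<lambda>_. UNIV"],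
        of "\<lambda>n. \<Prod>a\<in>insert a A. g (n a)"]
    by (simp add: PiE_insert_eq)
qed

lemma summable_on_exp_abs_int:
  fixes b :: real
  assumes "b > 0"
  shows "(\<lambda>n::int. exp (- b * \<bar>of_int n\<bar>)) summable_on UNIV"
proof -
  have nat: "(\<lambda>n::nat. exp (- b * real n)) summable_on UNIV"
  proof -
    have "summable (\<lambda>n::nat. norm (exp (- b) ^ n))" using assms by (simp add: norm_power)
    then have "(\<lambda>n::nat. exp (- b) ^ n) summable_on UNIV" by (rule norm_summable_imp_summable_on)
    then show ?thesis by (simp add: exp_of_nat_mult[symmetric] mult.commute)
  qed
  have 1: "(\<lambda>n::int. exp (- b * \<bar>of_int n\<bar>)) summable_on range int"
    by (subst summable_on_reindex) (use nat in \<open>auto simp: o_def\<close>)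
  have 2: "(\<lambda>n::int. exp (- b * \<bar>of_int n\<bar>)) summable_on range (\<lambda>n. - int n)"
    by (subst summable_on_reindex) (use nat in \<open>auto simp: o_def inj_on_def\<close>)
  have "(\<lambda>n::int. exp (- b * \<bar>of_int n\<bar>)) summable_on (range (\<lambda>n. - int n) - range int)"
    by (rule summable_on_subset_banach[OF 2]) auto
  from summable_on_Un_disjoint[OF 1 this]
  have "(\<lambda>n::int. exp (- b * \<bar>of_int n\<bar>)) summable_on (range int \<union> range (\<lambda>n. - int n))" by simp
  moreover have "n \<in> range int \<union> range (\<lambda>n. - int n)" for n
    by (cases n rule: int_cases2) auto
  then have "range int \<union> range (\<lambda>n. - int n) = UNIV" by blast
  ultimately show ?thesis by simp
qed

text \<open>Fixes a lattice basis \<open>E\<close> and orthonormal bases \<open>Fp\<close>,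
  \<open>Fm\<close> of the two spaces of \<open>v\<close>; in these coordinates projections and
  squares become finite sums. Such bases always exist (\<open>theta_lattice_exists\<close>), and the
  setting is used for \<open>L\<close>, \<open>K\<close>, their sum and the negated lattice.\<close>

locale theta_lattice =
  fixes L :: "'a::euclidean_space qlat" and v :: "'a gr" and E Fp Fm :: "'a set"
  assumes even: "even_lattice L" and gr: "v \<in> Gr (form L) (rspan L)"
    and finE: "finite E" and indE: "independent E"
    and ptsE: "pts L = {x. \<exists>c::'a \<Rightarrow> int. x = (\<Sum>e\<in>E. of_int (c e) *\<^sub>R e)}"
    and finFp: "finite Fp" and spanFp: "span Fp = fst v" and cardFp: "card Fp = dim (fst v)"
    and onFp: "\<forall>f\<in>Fp. \<forall>g\<in>Fp. form L f g = (if f = g then 1 else 0)"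
    and finFm: "finite Fm" and spanFm: "span Fm = snd v" and cardFm: "card Fm = dim (snd v)"
    and onFm: "\<forall>f\<in>Fm. \<forall>g\<in>Fm. form L f g = (if f = g then -1 else 0)"
begin

abbreviation B :: "'a \<Rightarrow> 'a \<Rightarrow> real" where "B \<equiv> form L"
abbreviation V :: "'a set" where "V \<equiv> rspan L"
definition F :: "'a set" where "F = Fp \<union> Fm"
definition eps :: "'a \<Rightarrow> real" where "eps f = (if f \<in> Fp then 1 else -1)"

lemma bil: "bilinear B" using even by (simp add: even_lattice_def)

lemmas B_simps = bilinear_ladd[OF bil] bilinear_radd[OF bil] bilinear_lmul[OF bil] bilinear_rmul[OF bil]
  bilinear_lneg[OF bil] bilinear_rneg[OF bil] bilinear_lsub[OF bil] bilinear_rsub[OF bil]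
  bilinear_lzero[OF bil] bilinear_rzero[OF bil]

lemma lin_left: "linear (\<lambda>x. B x y)" and lin_right: "linear (\<lambda>y. B x y)"
  using bil by (simp_all add: bilinear_def)

lemma B_sum_left: "B (sum g A) y = (\<Sum>i\<in>A. B (g i) y)"
  and B_sum_right: "B y (sum g A) = (\<Sum>i\<in>A. B y (g i))"
  using linear_sum[OF lin_left] linear_sum[OF lin_right] by auto

lemma finF [simp]: "finite F" using finFp finFm by (simp add: F_def)

lemma E_pts: "e \<in> E \<Longrightarrow> e \<in> pts L"
  unfolding ptsE using finE
  by (auto intro!: exI[of _ "\<lambda>x. if x = e then 1 else 0"] simp: if_distrib[of "\<lambda>x. x *\<^sub>R _"] if_distrib[of of_int] cong: if_cong)

lemma V_span: "V = span E"
proof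
  have "pts L \<subseteq> span E" unfolding ptsE
    by clarify (rule span_sum, rule span_scale, rule span_base)
  then show "V \<subseteq> span E" unfolding rspan_def by (simp add: span_minimal)
  show "span E \<subseteq> V" unfolding rspan_def using E_pts by (intro span_mono) auto
qed

lemma subspace_V: "subspace V" by (simp add: rspan_def)

lemma V_intros: "0 \<in> V" "x \<in> V \<Longrightarrow> y \<in> V \<Longrightarrow> x + y \<in> V" "x \<in> V \<Longrightarrow> y \<in> V \<Longrightarrow> x - y \<in> V"
   "x \<in> V \<Longrightarrow> - x \<in> V" "x \<in> V \<Longrightarrow> c *\<^sub>R x \<in> V" "(\<And>i. i \<in> A \<Longrightarrow> g i \<in> V) \<Longrightarrow> sum g A \<in> V"
  using subspace_V by (auto intro: subspace_0 subspace_add subspace_diff subspace_neg subspace_scale subspace_sum)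

lemma pts_V: "x \<in> pts L \<Longrightarrow> x \<in> V" unfolding rspan_def by (rule span_base)

lemma E_V: "e \<in> E \<Longrightarrow> e \<in> V" using E_pts pts_V by blast

lemma B_sym: assumes "x \<in> V" "y \<in> V" shows "B x y = B y x"
proof -
  have *: "B x y = B y x" if x: "x \<in> V" and y: "y \<in> pts L" for x y
  proof -
    have "linear (\<lambda>x. B x y)" "linear (\<lambda>x. B y x)" by (rule lin_left lin_right)+
    from linear_eq_on[OF this, of x "pts L"] show ?thesis
      using x y even by (auto simp: even_lattice_def rspan_def)
  qed
  have "linear (\<lambda>y. B x y)" "linear (\<lambda>y. B y x)" by (rule lin_left lin_right)+
  from linear_eq_on[OF this, of y "pts L"] show ?thesis
    using assms * by (auto simp: rspan_def)
qed

lemma v_sub: "subspace (fst v)" "subspace (snd v)"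
  and v_pos: "x \<in> fst v \<Longrightarrow> x \<noteq> 0 \<Longrightarrow> B x x > 0" and v_neg: "x \<in> snd v \<Longrightarrow> x \<noteq> 0 \<Longrightarrow> B x x < 0"
  and v_orth: "x \<in> fst v \<Longrightarrow> y \<in> snd v \<Longrightarrow> B x y = 0"
  using gr by (auto simp: Gr_def)

lemma v_sum: "V = {x + y | x y. x \<in> fst v \<and> y \<in> snd v}"
  using gr by (simp add: Gr_def case_prod_beta)

lemma v_V: "x \<in> fst v \<Longrightarrow> x \<in> V" "x \<in> snd v \<Longrightarrow> x \<in> V"
  using v_sum subspace_0[OF v_sub(1)] subspace_0[OF v_sub(2)] by force+

lemma Fp_v: "f \<in> Fp \<Longrightarrow> f \<in> fst v" and Fm_v: "f \<in> Fm \<Longrightarrow> f \<in> snd v"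
  using spanFp spanFm span_base by blast+

lemma F_V: "f \<in> F \<Longrightarrow> f \<in> V" unfolding F_def using Fp_v Fm_v v_V by auto

lemma F_disjoint: "Fp \<inter> Fm = {}" using onFp onFm by force

lemma eps_cases: "f \<in> Fp \<Longrightarrow> eps f = 1" "f \<in> Fm \<Longrightarrow> eps f = -1" "eps f * eps f = 1" "eps f \<noteq> 0"
  using F_disjoint by (auto simp: eps_def)

lemma B_F: "f \<in> F \<Longrightarrow> g \<in> F \<Longrightarrow> B f g = (if f = g then eps f else 0)"
  using onFp onFm F_disjoint v_orth[OF Fp_v Fm_v] B_sym[of f g] F_V
  by (auto simp: F_def eps_def)

lemma sum_F: "(\<Sum>f\<in>F. g f) = (\<Sum>f\<in>Fp. g f) + (\<Sum>f\<in>Fm. g f)" for g :: "'a \<Rightarrow> 'b::comm_monoid_add"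
  unfolding F_def using finFp finFm F_disjoint by (rule sum.union_disjoint)

lemma V_expand: assumes "x \<in> V" shows "x = (\<Sum>f\<in>F. (eps f * B x f) *\<^sub>R f)"
proof -
  have "V \<subseteq> span F"
    using v_sum spanFp spanFm span_mono[of Fp F] span_mono[of Fm F] by (auto simp: F_def intro!: span_add)
  then obtain c where c: "x = (\<Sum>f\<in>F. c f *\<^sub>R f)" using assms span_finite[of F] by auto
  have "B x g = c g * eps g" if "g \<in> F" for g
  proof -
    have "B x g = (\<Sum>f\<in>F. c f * B f g)" unfolding c by (simp add: B_sum_left B_simps)
    also have "\<dots> = (\<Sum>f\<in>F. if f = g then c f * eps f else 0)" using that B_F by (intro sum.cong) auto
    finally show ?thesis using that by simp
  qed
  then have "(\<Sum>f\<in>F. (eps f * B x f) *\<^sub>R f) = (\<Sum>f\<in>F. c f *\<^sub>R f)"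
    using eps_cases(3) by (intro sum.cong) (auto simp: mult.left_commute)
  then show ?thesis using c by simp
qed

lemma B_expand: "y \<in> V \<Longrightarrow> B x y = (\<Sum>f\<in>F. eps f * B x f * B y f)"
  by (subst V_expand[of y]) (simp_all add: B_sum_right B_simps mult_ac)

lemma nondegenerate_F: "x \<in> V \<Longrightarrow> (\<And>f. f \<in> F \<Longrightarrow> B x f = 0) \<Longrightarrow> x = 0"
  using V_expand[of x] by simp

lemma B_eqI: "x \<in> V \<Longrightarrow> y \<in> V \<Longrightarrow> (\<And>e. e \<in> E \<Longrightarrow> B x e = B y e) \<Longrightarrow> x = y"
proof -
  assume xy: "x \<in> V" "y \<in> V" and eq: "\<And>e. e \<in> E \<Longrightarrow> B x e = B y e"
  have "B (x - y) z = 0" if "z \<in> V" for z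
    using linear_eq_on[OF lin_right[of "x - y"] linear_zero, of z E] that eq by (auto simp: V_span B_simps)
  then have "x - y = 0" using nondegenerate_F[of "x - y"] F_V V_intros(3)[OF xy] by blast
  then show ?thesis by simp
qed

lemma oproj_plus: "oproj L (fst v) x = (\<Sum>f\<in>Fp. B x f *\<^sub>R f)"
  unfolding oproj_def
proof (rule the_equality)
  let ?a = "\<Sum>f\<in>Fp. B x f *\<^sub>R f"
  have a: "?a \<in> fst v" unfolding spanFp[symmetric] by (intro span_sum span_scale span_base)
  have ag: "B ?a g = B x g" if "g \<in> Fp" for g
  proof -
    have "B ?a g = (\<Sum>f\<in>Fp. if f = g then B x f else 0)"
      using onFp that by (auto simp: B_sum_left B_simps intro!: sum.cong)
    then show ?thesis using that finFp by simp
  qed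
  have "B (x - ?a) u = 0" if "u \<in> fst v" for u
    using linear_eq_on[OF lin_right[of "x - ?a"] linear_zero, of u Fp] that ag spanFp by (auto simp: B_simps)
  then show "?a \<in> fst v \<and> (\<forall>u\<in>fst v. B (x - ?a) u = 0)" using a by blast
  fix b assume b: "b \<in> fst v \<and> (\<forall>u\<in>fst v. B (x - b) u = 0)"
  then have ba: "b - ?a \<in> fst v" using a subspace_diff[OF v_sub(1)] by blast
  have "B (b - ?a) (b - ?a) = B (x - ?a) (b - ?a) - B (x - b) (b - ?a)" by (simp add: B_simps)
  also have "\<dots> = 0" using b ba \<open>\<And>u. u \<in> fst v \<Longrightarrow> B (x - ?a) u = 0\<close> by simp
  finally show "b = ?a" using v_pos[OF ba] by force
qed

lemma oproj_minus: "oproj L (snd v) x = (\<Sum>f\<in>Fm. - B x f *\<^sub>R f)"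
  unfolding oproj_def
proof (rule the_equality)
  let ?a = "\<Sum>f\<in>Fm. - B x f *\<^sub>R f"
  have a: "?a \<in> snd v" unfolding spanFm[symmetric] by (intro span_sum span_scale span_base)
  have ag: "B ?a g = B x g" if "g \<in> Fm" for g
  proof -
    have "B ?a g = (\<Sum>f\<in>Fm. if f = g then B x f else 0)"
      using onFm that by (auto simp: B_sum_left B_simps intro!: sum.cong)
    then show ?thesis using that finFm by simp
  qed
  have "B (x - ?a) u = 0" if "u \<in> snd v" for u
    using linear_eq_on[OF lin_right[of "x - ?a"] linear_zero, of u Fm] that ag spanFm by (auto simp: B_simps)
  then show "?a \<in> snd v \<and> (\<forall>u\<in>snd v. B (x - ?a) u = 0)" using a by blast
  fix b assume b: "b \<in> snd v \<and> (\<forall>u\<in>snd v. B (x - b) u = 0)"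
  then have ba: "b - ?a \<in> snd v" using a subspace_diff[OF v_sub(2)] by blast
  have "B (b - ?a) (b - ?a) = B (x - ?a) (b - ?a) - B (x - b) (b - ?a)" by (simp add: B_simps)
  also have "\<dots> = 0" using b ba \<open>\<And>u. u \<in> snd v \<Longrightarrow> B (x - ?a) u = 0\<close> by simp
  finally show "b = ?a" using v_neg[OF ba] by force
qed

text \<open>\<open>Qp\<close> is the square of the positive projection and \<open>Qm\<close> the
  negative of the square of the negative one. Their difference is the form, their sum the positive
  definite majorant that governs convergence.\<close>

definition Qp :: "'a \<Rightarrow> real" where "Qp x = (\<Sum>f\<in>Fp. (B x f)\<^sup>2)"
definition Qm :: "'a \<Rightarrow> real" where "Qm x = (\<Sum>f\<in>Fm. (B x f)\<^sup>2)"

lemma Qp_nonneg: "Qp x \<ge> 0" and Qm_nonneg: "Qm x \<ge> 0" by (auto simp: Qp_def Qm_def sum_nonneg)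

lemma form_proj_plus: "B (oproj L (fst v) x) (oproj L (fst v) y) = (\<Sum>f\<in>Fp. B x f * B y f)"
proof -
  have "B f (oproj L (fst v) y) = B y f" if "f \<in> Fp" for f
  proof -
    have "B f (oproj L (fst v) y) = (\<Sum>g\<in>Fp. if f = g then B y g else 0)"
      using onFp that unfolding oproj_plus by (auto simp: B_sum_right B_simps intro!: sum.cong)
    then show ?thesis using that finFp by simp
  qed
  then show ?thesis unfolding oproj_plus[of x] by (auto simp: B_sum_left B_simps)
qed

lemma form_proj_minus: "B (oproj L (snd v) x) (oproj L (snd v) y) = - (\<Sum>f\<in>Fm. B x f * B y f)"
proof -
  have "B f (oproj L (snd v) y) = B y f" if "f \<in> Fm" for f
  proof -
    have "B f (oproj L (snd v) y) = (\<Sum>g\<in>Fm. if f = g then B y g else 0)"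
      using onFm that unfolding oproj_minus by (auto simp: B_sum_right B_simps intro!: sum.cong)
    then show ?thesis using that finFm by simp
  qed
  then show ?thesis unfolding oproj_minus[of x] by (auto simp: B_sum_left B_simps sum_negf)
qed

lemma qexpt_eq: "qexpt L v \<tau> x = \<tau> * of_real (Qp x / 2) - cnj \<tau> * of_real (Qm x / 2)"
  by (simp add: qexpt_def form_proj_plus form_proj_minus Qp_def Qm_def power2_eq_square)

lemma B_self: "x \<in> V \<Longrightarrow> B x x = Qp x - Qm x"
  using B_expand[of x x] by (simp add: sum_F eps_cases Qp_def Qm_def power2_eq_square sum_negf)

lemma B_bound: obtains C where "C > 0" "\<And>x y. \<bar>B x y\<bar> \<le> C * norm x * norm y"
  using bilinear_bounded_pos[OF bil] by auto

text \<open>Compares the majorant with the norm of the ambient type, in which convergence is proved.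
  It is restricted to \<open>V\<close> because the orthonormal vectors span nothing more.\<close>

lemma Q_lower: obtains \<kappa> where "\<kappa> > 0" "\<And>x. x \<in> V \<Longrightarrow> \<kappa> * (norm x)\<^sup>2 \<le> Qp x + Qm x"
proof -
  define C where "C = (\<Sum>f\<in>F. norm f) + 1"
  have C: "C > 0" unfolding C_def using sum_nonneg[of F norm] by (simp add: add_nonneg_pos)
  have "(1 / C\<^sup>2) * (norm x)\<^sup>2 \<le> Qp x + Qm x" if "x \<in> V" for x
  proof -
    define s where "s = sqrt (Qp x + Qm x)"
    have Q: "Qp x + Qm x = (\<Sum>f\<in>F. (B x f)\<^sup>2)" by (simp add: sum_F Qp_def Qm_def)
    have b: "\<bar>B x f\<bar> \<le> s" if "f \<in> F" for f
    proof -
      have "(B x f)\<^sup>2 \<le> Qp x + Qm x" unfolding Q using that by (intro member_le_sum) auto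
      then show ?thesis unfolding s_def by (rule real_le_rsqrt[of "\<bar>B x f\<bar>", simplified])
    qed
    have s0: "s \<ge> 0" unfolding s_def using Qp_nonneg Qm_nonneg by simp
    have "norm x = norm (\<Sum>f\<in>F. (eps f * B x f) *\<^sub>R f)" using V_expand[OF that] by simp
    also have "\<dots> \<le> (\<Sum>f\<in>F. norm ((eps f * B x f) *\<^sub>R f))" by (rule norm_sum)
    also have "\<dots> \<le> (\<Sum>f\<in>F. s * norm f)"
      using b by (intro sum_mono) (auto simp: eps_def abs_mult intro!: mult_right_mono)
    also have "\<dots> \<le> s * C" unfolding C_def using s0 by (simp add: sum_distrib_left[symmetric] distrib_left)
    finally have "(norm x)\<^sup>2 \<le> (s * C)\<^sup>2" by (intro power_mono) auto
    also have "\<dots> = (Qp x + Qm x) * C\<^sup>2" using Qp_nonneg[of x] Qm_nonneg[of x] by (simp add: s_def power_mult_distrib)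
    finally show ?thesis using C by (simp add: field_simps)
  qed
  then show ?thesis using that[of "1 / C\<^sup>2"] C by simp
qed

lemma Q_upper: obtains C where "C > 0" "\<And>x. Qp x + Qm x \<le> C * (norm x)\<^sup>2"
proof -
  obtain C where C: "C > 0" "\<And>x y. \<bar>B x y\<bar> \<le> C * norm x * norm y" using B_bound by blast
  define D where "D = (\<Sum>f\<in>F. (C * norm f)\<^sup>2) + 1"
  have "Qp x + Qm x \<le> D * (norm x)\<^sup>2" for x
  proof -
    have "Qp x + Qm x = (\<Sum>f\<in>F. (B x f)\<^sup>2)" by (simp add: sum_F Qp_def Qm_def)
    also have "\<dots> \<le> (\<Sum>f\<in>F. (C * norm f)\<^sup>2 * (norm x)\<^sup>2)"
    proof (rule sum_mono)
      fix f
      have "(B x f)\<^sup>2 \<le> (C * norm x * norm f)\<^sup>2" using C(2)[of x f] by (metis abs_ge_zero power2_abs power_mono)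
      then show "(B x f)\<^sup>2 \<le> (C * norm f)\<^sup>2 * (norm x)\<^sup>2" by (simp add: power_mult_distrib mult_ac)
    qed
    also have "\<dots> \<le> D * (norm x)\<^sup>2" unfolding D_def by (simp add: sum_distrib_right[symmetric] distrib_right)
    finally show ?thesis .
  qed
  moreover have "D > 0" unfolding D_def by (intro add_nonneg_pos sum_nonneg) auto
  ultimately show ?thesis using that by blast
qed

definition co :: "'a \<Rightarrow> 'a \<Rightarrow> real" where
  "co e = (SOME g. linear g \<and> (\<forall>e'\<in>E. g e' = (if e' = e then 1 else 0)))"

lemma co: "linear (co e)" "e' \<in> E \<Longrightarrow> co e e' = (if e' = e then 1 else 0)"
proof -
  have "\<exists>g. linear g \<and> (\<forall>e'\<in>E. g e' = (if e' = e then 1 else (0::real)))"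
    using linear_independent_extend[OF indE, of "\<lambda>e'. if e' = e then 1 else (0::real)"] by blast
  from someI_ex[OF this] show "linear (co e)" "e' \<in> E \<Longrightarrow> co e e' = (if e' = e then 1 else 0)"
    unfolding co_def by blast+
qed

lemma co_expand: assumes "x \<in> V" shows "x = (\<Sum>e\<in>E. co e x *\<^sub>R e)"
proof -
  obtain c where c: "x = (\<Sum>e\<in>E. c e *\<^sub>R e)" using assms span_finite[OF finE] by (auto simp: V_span)
  have "co e x = c e" if "e \<in> E" for e
  proof -
    have "co e x = (\<Sum>e'\<in>E. if e' = e then c e' else 0)"
      unfolding c using co by (simp add: linear_sum[OF co(1)] linear_scale[OF co(1)]) (intro sum.cong, auto)
    then show ?thesis using that finE by simp
  qed
  then show ?thesis using c by simp
qed

text \<open>The basis dual to \<open>E\<close> under the form: the coordinate functional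
  \<open>co e\<close> represented by a vector, written out in the orthonormal basis.\<close>

definition db :: "'a \<Rightarrow> 'a" where "db e = (\<Sum>f\<in>F. (eps f * co e f) *\<^sub>R f)"

lemma db_V: "db e \<in> V" unfolding db_def by (intro V_intros F_V)

lemma B_db: assumes "x \<in> V" shows "B x (db e) = co e x" "B (db e) x = co e x"
proof -
  have "B x (db e) = (\<Sum>f\<in>F. co e ((eps f * B x f) *\<^sub>R f))"
    unfolding db_def by (simp add: B_sum_right B_simps linear_scale[OF co(1)] mult_ac)
  also have "\<dots> = co e x"
    using V_expand[OF assms] linear_sum[OF co(1)[of e], of "\<lambda>f. (eps f * B x f) *\<^sub>R f" F] by simp
  finally show "B x (db e) = co e x" .
  then show "B (db e) x = co e x" using B_sym[OF assms db_V] by simp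
qed

lemma dual_V: "x \<in> dual L \<Longrightarrow> x \<in> V" by (simp add: dual_def)

lemma pts_iff: "x \<in> pts L \<longleftrightarrow> x \<in> V \<and> (\<forall>e\<in>E. co e x \<in> \<int>)"
proof
  assume x: "x \<in> pts L"
  then obtain c :: "'a \<Rightarrow> int" where c: "x = (\<Sum>e\<in>E. of_int (c e) *\<^sub>R e)" unfolding ptsE by blast
  have "co e x = of_int (c e)" if "e \<in> E" for e
  proof -
    have "co e x = (\<Sum>e'\<in>E. if e' = e then of_int (c e') else 0)"
      unfolding c using co by (simp add: linear_sum[OF co(1)] linear_scale[OF co(1)]) (intro sum.cong, auto)
    then show ?thesis using that finE by simp
  qed
  then show "x \<in> V \<and> (\<forall>e\<in>E. co e x \<in> \<int>)" using pts_V[OF x] by auto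
next
  assume x: "x \<in> V \<and> (\<forall>e\<in>E. co e x \<in> \<int>)"
  have "x = (\<Sum>e\<in>E. of_int \<lfloor>co e x\<rfloor> *\<^sub>R e)"
    using co_expand[of x] x by (simp cong: sum.cong)
  then show "x \<in> pts L" unfolding ptsE by (auto intro: exI[of _ "\<lambda>e. \<lfloor>co e x\<rfloor>"])
qed

lemma pts_intros: "0 \<in> pts L" "x \<in> pts L \<Longrightarrow> y \<in> pts L \<Longrightarrow> x + y \<in> pts L"
  "x \<in> pts L \<Longrightarrow> y \<in> pts L \<Longrightarrow> x - y \<in> pts L" "x \<in> pts L \<Longrightarrow> - x \<in> pts L"
  by (auto simp: pts_iff V_intros linear_0[OF co(1)] linear_add[OF co(1)] linear_diff[OF co(1)] linear_neg[OF co(1)])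

lemma pts_pair: "x \<in> pts L \<Longrightarrow> y \<in> pts L \<Longrightarrow> B x y \<in> \<int>"
  and pts_even: "x \<in> pts L \<Longrightarrow> \<exists>n::int. B x x = 2 * of_int n"
  using even by (auto simp: even_lattice_def)

lemma pts_dual: "x \<in> pts L \<Longrightarrow> x \<in> dual L"
  unfolding dual_def using pts_V pts_pair by auto

lemma dual_pair: "x \<in> dual L \<Longrightarrow> y \<in> pts L \<Longrightarrow> B x y \<in> \<int>" "x \<in> dual L \<Longrightarrow> y \<in> pts L \<Longrightarrow> B y x \<in> \<int>"
  using B_sym[of x y] pts_V by (auto simp: dual_def)

lemma dual_intros: "0 \<in> dual L" "x \<in> dual L \<Longrightarrow> y \<in> dual L \<Longrightarrow> x + y \<in> dual L"
  "x \<in> dual L \<Longrightarrow> y \<in> dual L \<Longrightarrow> x - y \<in> dual L" "x \<in> dual L \<Longrightarrow> - x \<in> dual L"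
  "x \<in> dual L \<Longrightarrow> of_int n *\<^sub>R x \<in> dual L"
  by (auto simp: dual_def V_intros B_simps)

lemma db_dual: "db e \<in> dual L" if "e \<in> E"
  using that db_V pts_iff by (auto simp: dual_def B_db pts_V)

text \<open>Pairing with the dual basis returns the coordinates with respect to \<open>E\<close>,
  which are therefore integers.\<close>

lemma double_dual: "x \<in> V \<Longrightarrow> (\<And>m. m \<in> dual L \<Longrightarrow> B x m \<in> \<int>) \<Longrightarrow> x \<in> pts L"
  using db_dual B_db(1)[of x] by (fastforce simp: pts_iff)

text \<open>A dual vector is determined by its integer pairings with \<open>E\<close>, whose
  absolute values add up to at most a multiple of its norm. The series is thus dominated by a
  product of two-sided geometric series.\<close>

lemma summable_dual_exp: assumes a: "a > 0" shows "(\<lambda>x. exp (- a * norm x)) summable_on dual L"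
proof -
  obtain C where C: "C > 0" "\<And>x y. \<bar>B x y\<bar> \<le> C * norm x * norm y" using B_bound by blast
  define D where "D = (\<Sum>e\<in>E. C * norm e) + 1"
  have D: "D > 0" unfolding D_def using C by (intro add_nonneg_pos sum_nonneg) auto
  define b where "b = a / D"
  have b: "b > 0" using a D by (simp add: b_def)
  define h where "h x = (\<lambda>e\<in>E. \<lfloor>B x e\<rfloor>)" for x
  have hB: "of_int (h x e) = B x e" if "x \<in> dual L" "e \<in> E" for x e
    using dual_pair(1)[OF that(1) E_pts[OF that(2)]] that by (simp add: h_def)
  have inj: "inj_on h (dual L)"
  proof (rule inj_onI)
    fix x y assume xy: "x \<in> dual L" "y \<in> dual L" "h x = h y"
    show "x = y"
      by (rule B_eqI) (use xy dual_V hB in \<open>metis\<close>)+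
  qed
  have "(\<lambda>n. \<Prod>e\<in>E. exp (- b * \<bar>of_int (n e)\<bar>)) summable_on (PiE E (\<lambda>_. UNIV :: int set))"
    using summable_on_prod_PiE[OF finE summable_on_exp_abs_int[OF b]] by simp
  then have "(\<lambda>n. \<Prod>e\<in>E. exp (- b * \<bar>of_int (n e)\<bar>)) summable_on (h ` dual L)"
    by (rule summable_on_subset_banach) (auto simp: h_def)
  then have s: "(\<lambda>x. \<Prod>e\<in>E. exp (- b * \<bar>of_int (h x e)\<bar>)) summable_on dual L"
    by (subst (asm) summable_on_reindex[OF inj]) (simp add: o_def)
  show ?thesis
  proof (rule summable_on_dominated[OF s])
    fix x assume x: "x \<in> dual L"
    have "(\<Prod>e\<in>E. exp (- b * \<bar>of_int (h x e)\<bar>)) = exp (\<Sum>e\<in>E. - b * \<bar>B x e\<bar>)"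
      unfolding exp_sum[OF finE] using hB[OF x] by (intro prod.cong) auto
    also have "(\<Sum>e\<in>E. - b * \<bar>B x e\<bar>) = - b * (\<Sum>e\<in>E. \<bar>B x e\<bar>)" by (simp add: sum_distrib_left)
    moreover have "(\<Sum>e\<in>E. \<bar>B x e\<bar>) \<le> D * norm x"
    proof -
      have "(\<Sum>e\<in>E. \<bar>B x e\<bar>) \<le> (\<Sum>e\<in>E. C * norm e * norm x)"
        using C(2) by (intro sum_mono) (metis mult.assoc mult.commute)
      also have "\<dots> \<le> D * norm x" unfolding D_def by (simp add: sum_distrib_right[symmetric] distrib_right)
      finally show ?thesis .
    qed
    then have "- a * norm x \<le> - b * (\<Sum>e\<in>E. \<bar>B x e\<bar>)"
      using b D by (simp add: b_def field_simps)
    ultimately show "norm (exp (- a * norm x)) \<le> (\<Prod>e\<in>E. exp (- b * \<bar>of_int (h x e)\<bar>))" by simp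
  qed
qed

lemma summable_dual_gauss:
  assumes "\<kappa> > 0" shows "(\<lambda>x. exp (- \<kappa> * (norm x)\<^sup>2 + C * norm x)) summable_on dual L"
proof -
  \<comment> \<open>Completing the square bounds \<open>- \<kappa> * r\<^sup>2 + (C + 1) * r\<close>
    by \<open>(C + 1)\<^sup>2 / (4 * \<kappa>)\<close>; the extra \<open>r\<close> is what leaves
    the summable factor.\<close>
  have s: "(\<lambda>x. exp ((C + 1)\<^sup>2 / (4 * \<kappa>)) * exp (- 1 * norm x)) summable_on dual L"
    by (intro summable_on_cmult_right summable_dual_exp) simp
  show ?thesis
  proof (rule summable_on_dominated[OF s])
    fix x
    define r where "r = norm x"
    have "0 \<le> (2 * \<kappa> * r - (C + 1))\<^sup>2 / (4 * \<kappa>)" using assms by simp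
    also have "\<dots> = \<kappa> * r\<^sup>2 - (C + 1) * r + (C + 1)\<^sup>2 / (4 * \<kappa>)"
      using assms by (simp add: power2_eq_square field_simps)
    finally have "- \<kappa> * r\<^sup>2 + C * r \<le> (C + 1)\<^sup>2 / (4 * \<kappa>) + - 1 * r" by (simp add: algebra_simps)
    then have "exp (- \<kappa> * r\<^sup>2 + C * r) \<le> exp ((C + 1)\<^sup>2 / (4 * \<kappa>) + - 1 * r)" by simp
    then show "norm (exp (- \<kappa> * (norm x)\<^sup>2 + C * norm x)) \<le> exp ((C + 1)\<^sup>2 / (4 * \<kappa>)) * exp (- 1 * norm x)"
      unfolding r_def exp_add by simp
  qed
qed

end

lemma theta_lattice_exists:
  assumes even: "even_lattice L" and gr: "v \<in> Gr (form L) (rspan L)"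
  shows "\<exists>E Fp Fm. theta_lattice L v E Fp Fm"
proof -
  obtain E where E: "finite E" "independent E" "pts L = {x. \<exists>c::'a \<Rightarrow> int. x = (\<Sum>e\<in>E. of_int (c e) *\<^sub>R e)}"
    using even unfolding even_lattice_def by blast
  have bil: "bilinear (form L)" using even by (simp add: even_lattice_def)
  have sym: "form L x y = form L y x" if "x \<in> rspan L" "y \<in> rspan L" for x y
  proof -
    have lin: "linear (\<lambda>x. form L x y)" "linear (\<lambda>y. form L x y)" for x y
      using bil by (simp_all add: bilinear_def)
    have *: "form L x y = form L y x" if "x \<in> rspan L" "y \<in> pts L" for x y
      using linear_eq_on[OF lin(1)[of y] lin(2)[of y], of x "pts L"] that even
      by (auto simp: even_lattice_def rspan_def)
    show ?thesis using linear_eq_on[OF lin(2)[of x] lin(1)[of x], of y "pts L"] that *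
      by (auto simp: rspan_def)
  qed
  have v: "subspace (fst v)" "subspace (snd v)" "\<And>x. x \<in> fst v \<Longrightarrow> x \<noteq> 0 \<Longrightarrow> form L x x > 0"
    "\<And>x. x \<in> snd v \<Longrightarrow> x \<noteq> 0 \<Longrightarrow> form L x x < 0" "rspan L = {x + y | x y. x \<in> fst v \<and> y \<in> snd v}"
  proof -
    show "rspan L = {x + y | x y. x \<in> fst v \<and> y \<in> snd v}" using gr by (simp add: Gr_def case_prod_beta)
  qed (use gr in \<open>auto simp: Gr_def\<close>)
  have vV: "x \<in> fst v \<Longrightarrow> x \<in> rspan L" "x \<in> snd v \<Longrightarrow> x \<in> rspan L" for x
    unfolding v(5) using subspace_0[OF v(1)] subspace_0[OF v(2)] by force+
  obtain Fp where Fp: "finite Fp" "Fp \<subseteq> fst v" "span Fp = fst v" "card Fp = dim (fst v)"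
    "\<forall>f\<in>Fp. \<forall>g\<in>Fp. form L f g = (if f = g then 1 else 0)"
    using ex_orthonormal_basis[OF v(1) bil] sym vV v(3) by blast
  have bil': "bilinear (\<lambda>x y. - form L x y)"
    using bil unfolding bilinear_def by (auto intro!: linear_compose_neg)
  obtain Fm where Fm: "finite Fm" "Fm \<subseteq> snd v" "span Fm = snd v" "card Fm = dim (snd v)"
    "\<forall>f\<in>Fm. \<forall>g\<in>Fm. - form L f g = (if f = g then 1 else 0)"
  proof -
    have s: "- form L x y = - form L y x" if "x \<in> snd v" "y \<in> snd v" for x y using sym vV that by simp
    have p: "0 < - form L x x" if "x \<in> snd v" "x \<noteq> 0" for x using v(4) that by simp
    show ?thesis by (rule ex_orthonormal_basis[OF v(2) bil' s p]) (simp_all, rule that)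
  qed
  have "\<forall>f\<in>Fm. \<forall>g\<in>Fm. form L f g = (if f = g then -1 else 0)"
    using Fm(5) by (metis minus_minus neg_0_equal_iff_equal)
  then have "theta_lattice L v E Fp Fm"
    by unfold_locales (use even gr E Fp Fm in auto)
  then show ?thesis by blast
qed

section \<open>Algebra of averages and holomorphy of exponential sums along lines\<close>

lemma av_cong: "(\<And>t. h (z + t *\<^sub>R u) = k (z + t *\<^sub>R u)) \<Longrightarrow> av u h z = av u k z"
  by (simp add: av_def)

lemma avl_cong:
  assumes "\<And>z. z \<in> S \<Longrightarrow> h z = k z" "\<And>z t u. z \<in> S \<Longrightarrow> u \<in> set us \<Longrightarrow> z + t *\<^sub>R u \<in> S" "z \<in> S"
  shows "avl us h z = avl us k z"
  using assms(2,3)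
proof (induction us arbitrary: z)
  case (Cons u us)
  then show ?case by (auto intro!: av_cong)
qed (use assms(1) in auto)

lemma avl_shift: "avl us (\<lambda>z. h (z + d)) z = avl us h (z + d)"
  by (induction us arbitrary: z) (auto simp: av_def add_ac)

lemma avl_cmult: "avl us (\<lambda>z. c * h z) = (\<lambda>z. c * avl us h z)"
proof -
  have *: "av u (\<lambda>z. c * h z) = (\<lambda>z. c * av u h z)" for u h by (simp add: av_def fun_eq_iff)
  show ?thesis by (induction us) (simp_all add: *)
qed

lemma avl_0: "avl us (\<lambda>z. 0) = (\<lambda>z. 0)"
  using avl_cmult[of us 0 "\<lambda>z. 0"] by simp

lemma avl_add:
  assumes "continuous_on UNIV f" "continuous_on UNIV g"
  shows "avl us (\<lambda>z. f z + g z) = (\<lambda>z. avl us f z + avl us g z)"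
  using avl_diff[of f "\<lambda>z. - 1 * g z" us] avl_cmult[of us "-1" g] assms
  by (simp add: continuous_on_minus)

lemma avl_sum:
  assumes "finite M" "\<And>m. m \<in> M \<Longrightarrow> continuous_on UNIV (f m)"
  shows "avl us (\<lambda>z. \<Sum>m\<in>M. f m z) = (\<lambda>z. \<Sum>m\<in>M. avl us (f m) z)"
  using assms
proof (induction M rule: finite_induct)
  case (insert m M)
  have "continuous_on UNIV (\<lambda>z. \<Sum>m\<in>M. f m z)" using insert.prems by (intro continuous_on_sum) auto
  then show ?case using insert avl_add[of "f m" "\<lambda>z. \<Sum>m\<in>M. f m z" us] by simp
qed (simp add: avl_0)

text \<open>Termwise differentiation gives only a real derivative; that the exponents are complex
  linear along \<open>j\<close> makes it multiplication by a complex number.\<close>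

lemma expsum_line_holomorphic:
  fixes l :: "'i \<Rightarrow> 'e::euclidean_space \<Rightarrow> complex" and j :: "complex \<Rightarrow> 'e"
  assumes lin: "\<And>i. i \<in> I \<Longrightarrow> linear (l i)"
    and bd: "\<And>i d. i \<in> I \<Longrightarrow> cmod (l i d) \<le> N i * norm d" and N: "\<And>i. i \<in> I \<Longrightarrow> N i \<ge> 0"
    and sm: "\<And>x. \<exists>\<eta>>0. (\<lambda>i. cmod (w i) * exp (Re (l i x) + \<eta> * N i)) summable_on I"
    and j: "linear j" and cl: "\<And>i z. i \<in> I \<Longrightarrow> l i (j z) = z * l i (j 1)"
  shows "(\<lambda>z. expsum I w l (x + j z)) holomorphic_on UNIV"
proof -
  have "((\<lambda>z. expsum I w l (x + j z)) has_field_derivative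
      expsum I (\<lambda>i. w i * l i (j 1)) l (x + j z)) (at z)" for z
  proof -
    have bj: "bounded_linear j" using j by (simp add: linear_conv_bounded_linear)
    have dj: "((\<lambda>z. x + j z) has_derivative j) (at z)"
      using has_derivative_add[OF has_derivative_const bounded_linear_imp_has_derivative[OF bj]] by simp
    obtain \<eta> where \<eta>: "\<eta> > 0" "(\<lambda>i. cmod (w i) * exp (Re (l i (x + j z)) + \<eta> * N i)) summable_on I"
      using sm by blast
    have "(expsum I w l has_derivative (\<lambda>d. expsum I (\<lambda>i. w i * l i d) l (x + j z))) (at (x + j z))"
      by (rule expsum_has_derivative[where N = N and \<eta> = \<eta>]) (use lin bd N \<eta> in auto)
    from has_derivative_compose[OF dj this]
    have "((\<lambda>z. expsum I w l (x + j z)) has_derivative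
      (\<lambda>d. expsum I (\<lambda>i. w i * l i (j d)) l (x + j z))) (at z)" by simp
    moreover have "(\<lambda>d. expsum I (\<lambda>i. w i * l i (j d)) l (x + j z)) =
        (*) (expsum I (\<lambda>i. w i * l i (j 1)) l (x + j z))"
    proof
      fix d
      have "(\<Sum>\<^sub>\<infinity>i\<in>I. w i * l i (j d) * exp (l i (x + j z))) =
          (\<Sum>\<^sub>\<infinity>i\<in>I. w i * l i (j 1) * exp (l i (x + j z)) * d)"
        by (intro infsum_cong) (simp add: cl[of _ d] mult_ac)
      then show "expsum I (\<lambda>i. w i * l i (j d)) l (x + j z) =
          expsum I (\<lambda>i. w i * l i (j 1)) l (x + j z) * d"
        unfolding expsum_def infsum_cmult_left' .
    qed
    ultimately show ?thesis by (simp only: has_field_derivative_def)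
  qed
  then show ?thesis by (auto simp: holomorphic_on_def field_differentiable_def)
qed

section \<open>The heat equation and the inversion factor\<close>

lemma abs_power_le_exp: "\<bar>x\<bar> ^ k \<le> exp (real k * \<bar>x\<bar>)" for x :: real
proof -
  have "\<bar>x\<bar> \<le> exp \<bar>x\<bar>" using exp_ge_add_one_self[of "\<bar>x\<bar>"] by linarith
  then have "\<bar>x\<bar> ^ k \<le> exp \<bar>x\<bar> ^ k" by (intro power_mono) auto
  then show ?thesis by (simp add: exp_of_nat_mult)
qed

lemma gauss_dominated:
  assumes "\<And>\<epsilon> B. \<epsilon> > 0 \<Longrightarrow> (\<lambda>i. cmod (w i) * exp (- \<epsilon> * (l i)\<^sup>2 + B * \<bar>l i\<bar>)) summable_on I"
    and "\<epsilon> > 0" "\<And>i. i \<in> I \<Longrightarrow> cmod (f i) \<le> exp (- \<epsilon> * (l i)\<^sup>2 + B * \<bar>l i\<bar> + C)"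
  shows "(\<lambda>i. cmod (w i * f i)) summable_on I"
proof (rule summable_on_dominated)
  show "(\<lambda>i. exp C * (cmod (w i) * exp (- \<epsilon> * (l i)\<^sup>2 + B * \<bar>l i\<bar>))) summable_on I"
    by (intro summable_on_cmult_right assms)
  show "norm (cmod (w i * f i)) \<le> exp C * (cmod (w i) * exp (- \<epsilon> * (l i)\<^sup>2 + B * \<bar>l i\<bar>))" if "i \<in> I" for i
    using mult_left_mono[OF assms(3)[OF that], of "cmod (w i)"] by (simp add: norm_mult exp_add mult_ac)
qed

lemma Re_of_real_mult: "Re (of_real a * z) = a * Re z"
  by simp

lemma Re_mult_ge: "\<bar>Re (a * b)\<bar> \<le> cmod a * cmod b"
  using abs_Re_le_cmod[of "a * b"] by (simp add: norm_mult)

text \<open>Algebra of one differentiation in \<open>z\<close> of the inversion formula.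
  \<open>P\<close> stands for \<open>2 * pi\<close>, \<open>g\<close> for
  \<open>exp (pi * z\<^sup>2 / u)\<close>, \<open>S\<close> for the first moment of the lattice
  side, \<open>T0\<close> and \<open>T1\<close> for moments of the dual side.\<close>

lemma first_derivative_identity:
  fixes P u S c z g T0 T1 :: complex
  assumes "P \<noteq> 0" "u \<noteq> 0" "(P / u) * S = c * ((P * z / u) * g) * T0 + ((P * \<i>) * T1) * (c * g)"
  shows "S = c * g * (z * T0 + \<i> * u * T1)"
proof -
  have "S = (u / P) * ((P / u) * S)" using assms(1,2) by simp
  also have "\<dots> = c * g * (z * T0 + \<i> * u * T1)"
    unfolding assms(3) using assms(1,2) by (simp add: field_simps)
  finally show ?thesis .
qed

text \<open>The same after a second differentiation; \<open>W\<close> stands for the bracket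
  produced by the first.\<close>

lemma second_derivative_identity:
  fixes P u S c z g T0 T1 T2 W :: complex
  assumes "P \<noteq> 0" "u \<noteq> 0"
    and "(P / u) * S = c * ((P * z / u) * g) * W + ((1 * T0 + ((P * \<i>) * T1) * z) + \<i> * u * ((P * \<i>) * T2)) * (c * g)"
  shows "S = c * g * (z * W + u / P * T0 + \<i> * u * z * T1 - u\<^sup>2 * T2)"
proof -
  have "S = (u / P) * ((P / u) * S)" using assms(1,2) by simp
  also have "\<dots> = c * g * (z * W + u / P * T0 + \<i> * u * z * T1 - u\<^sup>2 * T2)"
    unfolding assms(3) using assms(1,2) by (simp add: field_simps power2_eq_square)
  finally show ?thesis .
qed

text \<open>The heat equation \<open>4\<pi> \<partial>\<^sub>u = \<partial>\<^sub>z\<^sup>2\<close> for the right hand side determines the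
  factor \<open>c\<close> in a theta inversion formula up to a constant.\<close>

lemma theta_factor_derivative:
  fixes l :: "'i \<Rightarrow> real" and \<mu> :: "'j \<Rightarrow> real" and w :: "'i \<Rightarrow> complex" and w' :: "'j \<Rightarrow> complex"
    and c :: "complex \<Rightarrow> complex" and u0 z0 :: complex
  assumes sI: "\<And>\<epsilon> B. \<epsilon> > 0 \<Longrightarrow> (\<lambda>i. cmod (w i) * exp (- \<epsilon> * (l i)\<^sup>2 + B * \<bar>l i\<bar>)) summable_on I"
    and sJ: "\<And>\<epsilon> B. \<epsilon> > 0 \<Longrightarrow> (\<lambda>j. cmod (w' j) * exp (- \<epsilon> * (\<mu> j)\<^sup>2 + B * \<bar>\<mu> j\<bar>)) summable_on J"
    and eq: "\<And>(u::complex) (z::complex). Re u > 0 \<Longrightarrow> (\<Sum>\<^sub>\<infinity>i\<in>I. w i * exp (- pi * (of_real (l i) - z)\<^sup>2 / u)) =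
       c u * (\<Sum>\<^sub>\<infinity>j\<in>J. w' j * exp (- pi * u * (of_real (\<mu> j))\<^sup>2 + 2 * pi * \<i> * \<mu> j * z))"
    and u0: "Re u0 > 0"
    and nz: "(\<Sum>\<^sub>\<infinity>j\<in>J. w' j * exp (- pi * u0 * (of_real (\<mu> j))\<^sup>2 + 2 * pi * \<i> * \<mu> j * z0)) \<noteq> 0"
  shows "(c has_field_derivative c u0 / (2 * u0)) (at u0)"
proof -
  have u0nz: "u0 \<noteq> 0" using u0 by auto
  have Rinv: "Re (1 / u0) > 0" using u0 by (simp add: Re_divide sum_power2_gt_zero_iff)
  \<comment> \<open>\<open>S k\<close> and \<open>T k\<close> are the two series with an additional
    \<open>k\<close>-th power, so that a derivative in \<open>z\<close> raises \<open>k\<close> by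
    one. In \<open>S\<close> the Gaussian factor in \<open>z\<close> has been taken out of the
    sum.\<close>
  define S where "S k z = (\<Sum>\<^sub>\<infinity>i\<in>I. w i * l i ^ k * exp (- pi * (l i)\<^sup>2 / u0) * exp ((2 * pi * l i / u0) * z))" for k and z :: complex
  define T where "T k u z = (\<Sum>\<^sub>\<infinity>j\<in>J. w' j * \<mu> j ^ k * exp (- pi * u * (\<mu> j)\<^sup>2) * exp ((2 * pi * \<i> * \<mu> j) * z))" for k and u z :: complex
  define A where "A u z = (\<Sum>\<^sub>\<infinity>i\<in>I. w i * exp (- pi * (of_real (l i) - z)\<^sup>2 / u))" for u z :: complex
  have sumS: "(\<lambda>i. cmod (w i * (l i ^ k * exp (- pi * (l i)\<^sup>2 / u0) * exp (Re ((2 * pi * l i / u0) * z) + 1 * cmod (2 * pi * l i / u0))))) summable_on I"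
    for k and z :: complex
  proof (rule gauss_dominated[OF sI, where \<epsilon> = "pi * Re (1 / u0)" and C = 0 and
        B = "real k + 2 * pi * cmod (z / u0) + 2 * pi * cmod (1 / u0)"])
    fix i assume "i \<in> I"
    have "cmod (exp (- pi * (l i)\<^sup>2 / u0)) = exp (- (pi * Re (1 / u0)) * (l i)\<^sup>2)"
    proof -
      have "- pi * (l i)\<^sup>2 / u0 = of_real (- pi * (l i)\<^sup>2) * (1 / u0)" by simp
      then have "Re (- pi * (l i)\<^sup>2 / u0) = (- pi * (l i)\<^sup>2) * Re (1 / u0)" by (metis Re_of_real_mult)
      then show ?thesis unfolding norm_exp_eq_Re by (simp add: mult_ac)
    qed
    moreover have "Re ((2 * pi * l i / u0) * z) \<le> 2 * pi * cmod (z / u0) * \<bar>l i\<bar>"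
      using abs_Re_le_cmod[of "(2 * pi * l i / u0) * z"] by (simp add: norm_mult norm_divide mult_ac)
    moreover have "cmod (2 * pi * l i / u0) = 2 * pi * cmod (1 / u0) * \<bar>l i\<bar>"
      by (simp add: norm_mult norm_divide)
    moreover have "cmod (cor (l i ^ k)) \<le> exp (real k * \<bar>l i\<bar>)"
      using abs_power_le_exp[of "l i" k] by (simp add: norm_power power_abs)
    ultimately have "cmod (of_real (l i ^ k)) * cmod (exp (- pi * (l i)\<^sup>2 / u0)) *
        exp (Re ((2 * pi * l i / u0) * z) + 1 * cmod (2 * pi * l i / u0))
      \<le> exp (real k * \<bar>l i\<bar>) * exp (- (pi * Re (1 / u0)) * (l i)\<^sup>2) *
        exp (2 * pi * cmod (z / u0) * \<bar>l i\<bar> + 2 * pi * cmod (1 / u0) * \<bar>l i\<bar>)"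
      by (intro mult_mono) auto
    also have "\<dots> = exp (- (pi * Re (1 / u0)) * (l i)\<^sup>2 + (real k + 2 * pi * cmod (z / u0) + 2 * pi * cmod (1 / u0)) * \<bar>l i\<bar> + 0)"
      by (simp add: exp_add[symmetric] algebra_simps)
    finally show "cmod (l i ^ k * exp (- pi * (l i)\<^sup>2 / u0) * exp (Re ((2 * pi * l i / u0) * z) + 1 * cmod (2 * pi * l i / u0)))
      \<le> exp (- (pi * Re (1 / u0)) * (l i)\<^sup>2 + (real k + 2 * pi * cmod (z / u0) + 2 * pi * cmod (1 / u0)) * \<bar>l i\<bar> + 0)"
      by (simp only: norm_mult norm_of_real abs_exp_cancel of_real_power)
  qed (assumption, rule mult_pos_pos[OF pi_gt_zero Rinv])
  have dS: "(S k has_field_derivative (2 * pi / u0) * S (Suc k) z) (at z)" for k and z :: complex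
  proof -
    have "(S k has_field_derivative (\<Sum>\<^sub>\<infinity>i\<in>I. (w i * l i ^ k * exp (- pi * (l i)\<^sup>2 / u0)) * (2 * pi * l i / u0) * exp ((2 * pi * l i / u0) * z))) (at z)"
      unfolding S_def[abs_def]
      by (rule expsum_has_field_derivative[where \<eta> = 1])
        (use sumS[of k z] in \<open>auto simp: norm_mult mult.assoc simp del: of_real_power\<close>)
    also have "(\<Sum>\<^sub>\<infinity>i\<in>I. (w i * l i ^ k * exp (- pi * (l i)\<^sup>2 / u0)) * (2 * pi * l i / u0) * exp ((2 * pi * l i / u0) * z)) = (2 * pi / u0) * S (Suc k) z"
      unfolding S_def infsum_cmult_right'[symmetric] by (intro infsum_cong) (simp add: mult_ac)
    finally show ?thesis .
  qed
  have sumT: "(\<lambda>j. cmod (w' j * (\<mu> j ^ k * exp (- pi * u0 * (\<mu> j)\<^sup>2) * exp (Re ((2 * pi * \<i> * \<mu> j) * z) + 1 * cmod (2 * pi * \<i> * \<mu> j))))) summable_on J"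
    for k and z :: complex
  proof (rule gauss_dominated[OF sJ, where \<epsilon> = "pi * Re u0" and C = 0 and
        B = "real k + 2 * pi * cmod z + 2 * pi"])
    fix i assume "i \<in> J"
    have "cmod (exp (- pi * u0 * (\<mu> i)\<^sup>2)) = exp (- (pi * Re u0) * (\<mu> i)\<^sup>2)"
    proof -
      have "- pi * u0 * (\<mu> i)\<^sup>2 = of_real (- pi * (\<mu> i)\<^sup>2) * u0" by simp
      then have "Re (- pi * u0 * (\<mu> i)\<^sup>2) = (- pi * (\<mu> i)\<^sup>2) * Re u0" by (metis Re_of_real_mult)
      then show ?thesis unfolding norm_exp_eq_Re by (simp add: mult_ac)
    qed
    moreover have "Re ((2 * pi * \<i> * \<mu> i) * z) \<le> 2 * pi * cmod z * \<bar>\<mu> i\<bar>"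
      using abs_Re_le_cmod[of "(2 * pi * \<i> * \<mu> i) * z"] by (simp add: norm_mult mult_ac)
    moreover have "cmod (2 * pi * \<i> * \<mu> i) = 2 * pi * \<bar>\<mu> i\<bar>"
      by (simp add: norm_mult)
    moreover have "cmod (cor (\<mu> i ^ k)) \<le> exp (real k * \<bar>\<mu> i\<bar>)"
      using abs_power_le_exp[of "\<mu> i" k] by (simp add: norm_power power_abs)
    ultimately have "cmod (of_real (\<mu> i ^ k)) * cmod (exp (- pi * u0 * (\<mu> i)\<^sup>2)) *
        exp (Re ((2 * pi * \<i> * \<mu> i) * z) + 1 * cmod (2 * pi * \<i> * \<mu> i))
      \<le> exp (real k * \<bar>\<mu> i\<bar>) * exp (- (pi * Re u0) * (\<mu> i)\<^sup>2) *
        exp (2 * pi * cmod z * \<bar>\<mu> i\<bar> + 2 * pi * \<bar>\<mu> i\<bar>)"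
      by (intro mult_mono) auto
    also have "\<dots> = exp (- (pi * Re u0) * (\<mu> i)\<^sup>2 + (real k + 2 * pi * cmod z + 2 * pi) * \<bar>\<mu> i\<bar> + 0)"
      by (simp add: exp_add[symmetric] algebra_simps)
    finally show "cmod (\<mu> i ^ k * exp (- pi * u0 * (\<mu> i)\<^sup>2) * exp (Re ((2 * pi * \<i> * \<mu> i) * z) + 1 * cmod (2 * pi * \<i> * \<mu> i)))
      \<le> exp (- (pi * Re u0) * (\<mu> i)\<^sup>2 + (real k + 2 * pi * cmod z + 2 * pi) * \<bar>\<mu> i\<bar> + 0)"
      by (simp only: norm_mult norm_of_real abs_exp_cancel of_real_power)
  qed (assumption, use u0 in simp)
  have dT: "(T k u0 has_field_derivative (2 * pi * \<i>) * T (Suc k) u0 z) (at z)" for k and z :: complex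
  proof -
    have "(T k u0 has_field_derivative (\<Sum>\<^sub>\<infinity>j\<in>J. (w' j * \<mu> j ^ k * exp (- pi * u0 * (\<mu> j)\<^sup>2)) * (2 * pi * \<i> * \<mu> j) * exp ((2 * pi * \<i> * \<mu> j) * z))) (at z)"
      unfolding T_def[abs_def]
      by (rule expsum_has_field_derivative[where \<eta> = 1])
        (use sumT[of k z] in \<open>auto simp: norm_mult mult.assoc simp del: of_real_power\<close>)
    also have "(\<Sum>\<^sub>\<infinity>j\<in>J. (w' j * \<mu> j ^ k * exp (- pi * u0 * (\<mu> j)\<^sup>2)) * (2 * pi * \<i> * \<mu> j) * exp ((2 * pi * \<i> * \<mu> j) * z)) = (2 * pi * \<i>) * T (Suc k) u0 z"
      unfolding T_def infsum_cmult_right'[symmetric] by (intro infsum_cong) (simp add: mult_ac)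
    finally show ?thesis .
  qed
  have dTu: "((\<lambda>u. T 0 u z0) has_field_derivative - pi * T 2 u0 z0) (at u0)"
  proof -
    have "(\<lambda>j. cmod (w' j * (exp ((2 * pi * \<i> * \<mu> j) * z0) * exp (Re ((- pi * (\<mu> j)\<^sup>2) * u0) + (Re u0 / 2) * cmod (- pi * (\<mu> j)\<^sup>2))))) summable_on J"
    proof (rule gauss_dominated[OF sJ, where \<epsilon> = "pi * Re u0 / 2" and C = 0 and B = "2 * pi * cmod z0"])
      fix j assume "j \<in> J"
      have "Re ((2 * pi * \<i> * \<mu> j) * z0) \<le> 2 * pi * cmod z0 * \<bar>\<mu> j\<bar>"
        using abs_Re_le_cmod[of "(2 * pi * \<i> * \<mu> j) * z0"] by (simp add: norm_mult mult_ac)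
      moreover have "Re (cor (- pi * (\<mu> j)\<^sup>2) * u0) = (- pi * (\<mu> j)\<^sup>2) * Re u0" by (rule Re_of_real_mult)
      moreover have "cmod (cor (- pi * (\<mu> j)\<^sup>2)) = pi * (\<mu> j)\<^sup>2" by (simp only: norm_of_real) (simp add: abs_mult)
      ultimately have "Re ((2 * pi * \<i> * \<mu> j) * z0) + (Re (cor (- pi * (\<mu> j)\<^sup>2) * u0) + (Re u0 / 2) * cmod (cor (- pi * (\<mu> j)\<^sup>2)))
        \<le> - (pi * Re u0 / 2) * (\<mu> j)\<^sup>2 + 2 * pi * cmod z0 * \<bar>\<mu> j\<bar> + 0"
        by (simp add: field_simps)
      then show "cmod (exp ((2 * pi * \<i> * \<mu> j) * z0) * exp (Re ((- pi * (\<mu> j)\<^sup>2) * u0) + (Re u0 / 2) * cmod (- pi * (\<mu> j)\<^sup>2)))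
        \<le> exp (- (pi * Re u0 / 2) * (\<mu> j)\<^sup>2 + 2 * pi * cmod z0 * \<bar>\<mu> j\<bar> + 0)"
        by (simp add: norm_mult exp_add[symmetric])
    qed (assumption, use u0 in simp)
    then have "((\<lambda>u::complex. \<Sum>\<^sub>\<infinity>j\<in>J. (w' j * exp ((2 * pi * \<i> * \<mu> j) * z0)) * exp ((- pi * (\<mu> j)\<^sup>2) * u)) has_field_derivative
       (\<Sum>\<^sub>\<infinity>j\<in>J. (w' j * exp ((2 * pi * \<i> * \<mu> j) * z0)) * (- pi * (\<mu> j)\<^sup>2) * exp ((- pi * (\<mu> j)\<^sup>2) * u0))) (at u0)"
      by (intro expsum_has_field_derivative[where \<eta> = "Re u0 / 2"])
        (use u0 in \<open>auto simp: norm_mult mult.assoc\<close>)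
    moreover have "(\<lambda>u::complex. \<Sum>\<^sub>\<infinity>j\<in>J. (w' j * exp ((2 * pi * \<i> * \<mu> j) * z0)) * exp ((- pi * (\<mu> j)\<^sup>2) * u)) = (\<lambda>u. T 0 u z0)"
      unfolding T_def by (intro ext infsum_cong) (simp add: mult_ac)
    moreover have "(\<Sum>\<^sub>\<infinity>j\<in>J. (w' j * exp ((2 * pi * \<i> * \<mu> j) * z0)) * (- pi * (\<mu> j)\<^sup>2) * exp ((- pi * (\<mu> j)\<^sup>2) * u0)) = - pi * T 2 u0 z0"
      unfolding T_def infsum_cmult_right'[symmetric] by (intro infsum_cong) (simp add: mult_ac)
    ultimately show ?thesis by simp
  qed
  have AS: "A u0 z = exp (- pi * z\<^sup>2 / u0) * S 0 z" for z :: complex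
  proof -
    have *: "exp (- pi * (of_real (l i) - z)\<^sup>2 / u0) =
       exp (- pi * z\<^sup>2 / u0) * (exp (- pi * (l i)\<^sup>2 / u0) * exp ((2 * pi * l i / u0) * z))" for i
    proof -
      have "- pi * (of_real (l i) - z)\<^sup>2 / u0 = - pi * z\<^sup>2 / u0 + (- pi * (l i)\<^sup>2 / u0 + (2 * pi * l i / u0) * z)"
        using u0nz by (simp add: field_simps power2_eq_square)
      then show ?thesis by (simp only: exp_add)
    qed
    show ?thesis unfolding A_def S_def infsum_cmult_right'[symmetric]
      by (rule infsum_cong) (simp only: * power_0 of_real_1 mult_1_right mult_1_left mult_ac)
  qed
  have eqT: "A u z = c u * T 0 u z" if "Re u > 0" for u z :: complex
    unfolding A_def eq[OF that] T_def
    by (rule arg_cong[where f = "\<lambda>x. c u * x"], rule infsum_cong) (simp only: exp_add power_0 of_real_1 of_real_power mult_1_right mult.assoc)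
  define g where "g z = exp (pi * z\<^sup>2 / u0)" for z :: complex
  have dg: "(g has_field_derivative (2 * pi * z / u0) * g z) (at z)" for z :: complex
    unfolding g_def[abs_def] using u0nz by (auto intro!: derivative_eq_intros simp: mult_ac)
  have gi: "exp (- pi * z\<^sup>2 / u0) * g z = 1" for z :: complex by (simp add: g_def mult_exp_exp)
  have S0: "S 0 z = c u0 * g z * T 0 u0 z" for z :: complex
  proof -
    have "g z * A u0 z = S 0 z" unfolding AS using gi[of z] by (simp add: mult_ac)
    then show ?thesis using eqT[OF u0, of z] by (simp add: mult_ac)
  qed
  have pnz: "cor (2 * pi) \<noteq> 0" by simp
  have S1: "S 1 z = c u0 * g z * (z * T 0 u0 z + \<i> * u0 * T 1 u0 z)" for z :: complex
  proof -
    have d1: "((\<lambda>z. c u0 * g z * T 0 u0 z) has_field_derivative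
        c u0 * ((2 * pi * z / u0) * g z) * T 0 u0 z + ((2 * pi * \<i>) * T (Suc 0) u0 z) * (c u0 * g z)) (at z)"
      by (rule DERIV_mult[OF DERIV_cmult[OF dg] dT])
    have d2: "((\<lambda>z. c u0 * g z * T 0 u0 z) has_field_derivative (2 * pi / u0) * S (Suc 0) z) (at z)"
    proof -
      have f: "S 0 = (\<lambda>z. c u0 * g z * T 0 u0 z)" by (rule ext) (rule S0)
      show ?thesis using dS[of 0 z] unfolding f .
    qed
    have *: "(2 * pi / u0) * S 1 z = c u0 * ((2 * pi * z / u0) * g z) * T 0 u0 z + ((2 * pi * \<i>) * T 1 u0 z) * (c u0 * g z)"
      using DERIV_unique[OF d2 d1] by (simp only: One_nat_def)
    show ?thesis by (rule first_derivative_identity[OF pnz u0nz *])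
  qed
  have S2: "S 2 z = c u0 * g z * (z * (z * T 0 u0 z + \<i> * u0 * T 1 u0 z) + u0 / (2 * pi) * T 0 u0 z + \<i> * u0 * z * T 1 u0 z - u0\<^sup>2 * T 2 u0 z)" for z :: complex
  proof -
    have "((\<lambda>z. z * T 0 u0 z + \<i> * u0 * T 1 u0 z) has_field_derivative
       (1 * T 0 u0 z + ((2 * pi * \<i>) * T (Suc 0) u0 z) * z) + \<i> * u0 * ((2 * pi * \<i>) * T (Suc 1) u0 z)) (at z)"
      by (rule DERIV_add[OF DERIV_mult[OF DERIV_ident dT] DERIV_cmult[OF dT]])
    from DERIV_mult[OF DERIV_cmult[OF dg, of "c u0"] this]
    have d1: "((\<lambda>z. c u0 * g z * (z * T 0 u0 z + \<i> * u0 * T 1 u0 z)) has_field_derivative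
        c u0 * ((2 * pi * z / u0) * g z) * (z * T 0 u0 z + \<i> * u0 * T 1 u0 z) +
        ((1 * T 0 u0 z + ((2 * pi * \<i>) * T (Suc 0) u0 z) * z) + \<i> * u0 * ((2 * pi * \<i>) * T (Suc 1) u0 z)) * (c u0 * g z)) (at z)" .
    have f1: "S 1 = (\<lambda>z. c u0 * g z * (z * T 0 u0 z + \<i> * u0 * T 1 u0 z))" by (rule ext) (rule S1)
    have d2: "((\<lambda>z. c u0 * g z * (z * T 0 u0 z + \<i> * u0 * T 1 u0 z)) has_field_derivative (2 * pi / u0) * S (Suc 1) z) (at z)"
      using dS[of 1 z] unfolding f1 .
    have "(2 * pi / u0) * S (Suc 1) z = c u0 * ((2 * pi * z / u0) * g z) * (z * T 0 u0 z + \<i> * u0 * T 1 u0 z) +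
        ((1 * T 0 u0 z + ((2 * pi * \<i>) * T (Suc 0) u0 z) * z) + \<i> * u0 * ((2 * pi * \<i>) * T (Suc 1) u0 z)) * (c u0 * g z)"
      by (rule DERIV_unique[OF d2 d1])
    then have *: "(2 * pi / u0) * S 2 z = c u0 * ((2 * pi * z / u0) * g z) * (z * T 0 u0 z + \<i> * u0 * T 1 u0 z) +
        ((1 * T 0 u0 z + ((2 * pi * \<i>) * T 1 u0 z) * z) + \<i> * u0 * ((2 * pi * \<i>) * T 2 u0 z)) * (c u0 * g z)"
      by (simp only: numeral_2_eq_2 One_nat_def)
    show ?thesis using second_derivative_identity[OF pnz u0nz *] by (simp only: of_real_mult of_real_numeral)
  qed
  \<comment> \<open>The second moment about \<open>z\<close>, which is what a derivative in
    \<open>u\<close> brings down on the lattice side; expressed by dual moments, all terms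
    containing \<open>z\<close> cancel.\<close>
  have comb: "S 2 z - 2 * z * S 1 z + z\<^sup>2 * S 0 z = c u0 * g z * (u0 / (2 * pi) * T 0 u0 z - u0\<^sup>2 * T 2 u0 z)" for z :: complex
    unfolding S0 S1 S2 by (simp add: algebra_simps power2_eq_square)
  \<comment> \<open>The lattice side depends on \<open>u\<close> through \<open>1 / u\<close> only,
    in which its exponents are linear, so it is differentiated in \<open>1 / u\<close> and the chain
    rule does the rest.\<close>
  define y0 where "y0 = 1 / u0"
  define a where "a i = - pi * (of_real (l i) - z0)\<^sup>2" for i
  have dAy: "((\<lambda>y. \<Sum>\<^sub>\<infinity>i\<in>I. w i * exp (a i * y)) has_field_derivative (\<Sum>\<^sub>\<infinity>i\<in>I. w i * a i * exp (a i * y0))) (at y0)"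
  proof (rule expsum_has_field_derivative[where \<eta> = "Re y0 / 2"])
    have "(\<lambda>i. cmod (w i * exp (Re (a i * y0) + (Re y0 / 2) * cmod (a i)))) summable_on I"
    proof (rule gauss_dominated[OF sI, where \<epsilon> = "pi * Re y0 / 2" and
          B = "2 * pi * cmod z0 * cmod y0 + pi * Re y0 * cmod z0" and C = "pi * (cmod z0)\<^sup>2 * cmod y0 + pi * Re y0 / 2 * (cmod z0)\<^sup>2"])
      fix i assume "i \<in> I"
      have "a i * y0 = of_real (- pi * (l i)\<^sup>2) * y0 + (of_real (2 * pi * l i) * (z0 * y0)) - of_real pi * (z0\<^sup>2 * y0)"
        unfolding a_def by (simp add: algebra_simps power2_eq_square)
      then have "Re (a i * y0) = - pi * (l i)\<^sup>2 * Re y0 + 2 * pi * l i * Re (z0 * y0) - pi * Re (z0\<^sup>2 * y0)"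
        by (simp only: plus_complex.sel minus_complex.sel Re_of_real_mult)
      moreover have "2 * pi * l i * Re (z0 * y0) \<le> 2 * pi * (\<bar>l i\<bar> * (cmod z0 * cmod y0))"
      proof -
        have "l i * Re (z0 * y0) \<le> \<bar>l i\<bar> * \<bar>Re (z0 * y0)\<bar>" by (metis abs_ge_self abs_mult)
        also have "\<dots> \<le> \<bar>l i\<bar> * (cmod z0 * cmod y0)" using Re_mult_ge by (intro mult_left_mono) auto
        finally show ?thesis using pi_gt_zero by (simp add: mult.assoc)
      qed
      moreover have "- (pi * Re (z0\<^sup>2 * y0)) \<le> pi * ((cmod z0)\<^sup>2 * cmod y0)"
      proof -
        have "- Re (z0\<^sup>2 * y0) \<le> (cmod z0)\<^sup>2 * cmod y0"
          using Re_mult_ge[of "z0\<^sup>2" y0] unfolding norm_power abs_le_iff by blast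
        from mult_left_mono[OF this pi_ge_zero] show ?thesis by (simp only: mult_minus_right)
      qed
      moreover have "cmod (a i) \<le> pi * ((l i)\<^sup>2 + 2 * \<bar>l i\<bar> * cmod z0 + (cmod z0)\<^sup>2)"
      proof -
        have "cmod (of_real (l i) - z0) \<le> \<bar>l i\<bar> + cmod z0" using norm_triangle_ineq4[of "of_real (l i)" z0] by simp
        then have "(cmod (of_real (l i) - z0))\<^sup>2 \<le> (\<bar>l i\<bar> + cmod z0)\<^sup>2" by (intro power_mono) auto
        also have "\<dots> = (l i)\<^sup>2 + 2 * \<bar>l i\<bar> * cmod z0 + (cmod z0)\<^sup>2" by (simp add: power2_sum)
        finally show ?thesis unfolding a_def by (simp add: norm_mult norm_power)
      qed
      then have "(Re y0 / 2) * cmod (a i) \<le> (Re y0 / 2) * (pi * ((l i)\<^sup>2 + 2 * \<bar>l i\<bar> * cmod z0 + (cmod z0)\<^sup>2))"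
        using Rinv by (intro mult_left_mono) (auto simp: y0_def)
      ultimately have "Re (a i * y0) + (Re y0 / 2) * cmod (a i) \<le> (- pi * (l i)\<^sup>2 * Re y0 + 2 * pi * (\<bar>l i\<bar> * (cmod z0 * cmod y0)) + pi * ((cmod z0)\<^sup>2 * cmod y0)) + (Re y0 / 2) * (pi * ((l i)\<^sup>2 + 2 * \<bar>l i\<bar> * cmod z0 + (cmod z0)\<^sup>2))"
        by linarith
      also have "\<dots> = - (pi * Re y0 / 2) * (l i)\<^sup>2 + (2 * pi * cmod z0 * cmod y0 + pi * Re y0 * cmod z0) * \<bar>l i\<bar> + (pi * (cmod z0)\<^sup>2 * cmod y0 + pi * Re y0 / 2 * (cmod z0)\<^sup>2)"
        by (simp add: field_simps)
      finally show "cmod (exp (Re (a i * y0) + (Re y0 / 2) * cmod (a i))) \<le> exp (- (pi * Re y0 / 2) * (l i)\<^sup>2 + (2 * pi * cmod z0 * cmod y0 + pi * Re y0 * cmod z0) * \<bar>l i\<bar> + (pi * (cmod z0)\<^sup>2 * cmod y0 + pi * Re y0 / 2 * (cmod z0)\<^sup>2))"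
        by simp
    qed (assumption, use Rinv in \<open>simp add: y0_def\<close>)
    then show "(\<lambda>i. cmod (w i) * exp (Re (a i * y0) + (Re y0 / 2) * cmod (a i))) summable_on I"
      by (simp add: norm_mult)
  qed (use Rinv in \<open>simp add: y0_def\<close>)
  have dAu: "((\<lambda>u. A u z0) has_field_derivative
      (\<Sum>\<^sub>\<infinity>i\<in>I. w i * a i * exp (a i * y0)) * (- 1 / u0\<^sup>2)) (at u0)"
  proof -
    have "((\<lambda>u. 1 / u) has_field_derivative - 1 / u0\<^sup>2) (at u0)"
      using u0nz by (auto intro!: derivative_eq_intros simp: power2_eq_square)
    from DERIV_chain2[OF dAy[unfolded y0_def] this]
    show ?thesis unfolding A_def a_def y0_def by simp
  qed
  have val: "(\<Sum>\<^sub>\<infinity>i\<in>I. w i * a i * exp (a i * y0)) = - pi * exp (- pi * z0\<^sup>2 / u0) * (S 2 z0 - 2 * z0 * S 1 z0 + z0\<^sup>2 * S 0 z0)"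
  proof -
    have s: "(\<lambda>i. w i * l i ^ k * exp (- pi * (l i)\<^sup>2 / u0) * exp ((2 * pi * l i / u0) * z0)) summable_on I" for k
      by (rule summable_on_dominated[OF sumS[of k z0]]) (auto simp: norm_mult mult.assoc intro!: mult_left_mono)
    have "S 2 z0 - 2 * z0 * S 1 z0 + z0\<^sup>2 * S 0 z0 = (\<Sum>\<^sub>\<infinity>i\<in>I. w i * (l i - z0)\<^sup>2 * exp (- pi * (l i)\<^sup>2 / u0) * exp ((2 * pi * l i / u0) * z0))"
    proof -
      have "S 2 z0 - 2 * z0 * S 1 z0 + z0\<^sup>2 * S 0 z0 =
        (\<Sum>\<^sub>\<infinity>i\<in>I. (w i * l i ^ 2 * exp (- pi * (l i)\<^sup>2 / u0) * exp ((2 * pi * l i / u0) * z0)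
          - 2 * z0 * (w i * l i ^ 1 * exp (- pi * (l i)\<^sup>2 / u0) * exp ((2 * pi * l i / u0) * z0)))
          + z0\<^sup>2 * (w i * l i ^ 0 * exp (- pi * (l i)\<^sup>2 / u0) * exp ((2 * pi * l i / u0) * z0)))"
        unfolding S_def infsum_cmult_right'[symmetric]
        by (subst infsum_minus[symmetric], (intro s summable_on_cmult_right)+)
          (subst infsum_add[symmetric], (intro s summable_on_cmult_right summable_on_minus)+, rule refl)
      also have "\<dots> = (\<Sum>\<^sub>\<infinity>i\<in>I. w i * (l i - z0)\<^sup>2 * exp (- pi * (l i)\<^sup>2 / u0) * exp ((2 * pi * l i / u0) * z0))"
        by (intro infsum_cong) (simp add: algebra_simps power2_eq_square)
      finally show ?thesis .
    qed
    moreover have "(\<Sum>\<^sub>\<infinity>i\<in>I. w i * a i * exp (a i * y0)) = - pi * exp (- pi * z0\<^sup>2 / u0) *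
      (\<Sum>\<^sub>\<infinity>i\<in>I. w i * (l i - z0)\<^sup>2 * exp (- pi * (l i)\<^sup>2 / u0) * exp ((2 * pi * l i / u0) * z0))"
      unfolding infsum_cmult_right'[symmetric]
    proof (rule infsum_cong)
      fix i
      have "a i * y0 = - pi * z0\<^sup>2 / u0 + (- pi * (l i)\<^sup>2 / u0 + (2 * pi * l i / u0) * z0)"
        unfolding a_def y0_def using u0nz by (simp add: field_simps power2_eq_square)
      then have "exp (a i * y0) = exp (- pi * z0\<^sup>2 / u0) * (exp (- pi * (l i)\<^sup>2 / u0) * exp ((2 * pi * l i / u0) * z0))"
        by (simp only: exp_add)
      then show "w i * a i * exp (a i * y0) = - pi * exp (- pi * z0\<^sup>2 / u0) *
        (w i * (l i - z0)\<^sup>2 * exp (- pi * (l i)\<^sup>2 / u0) * exp ((2 * pi * l i / u0) * z0))"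
        unfolding a_def by (simp add: mult_ac)
    qed
    ultimately show ?thesis by simp
  qed
  have T0nz: "T 0 u0 z0 \<noteq> 0"
    using nz unfolding T_def by (simp only: exp_add power_0 of_real_1 of_real_power mult_1_right mult.assoc not_False_eq_True)
  have dA': "((\<lambda>u. A u z0) has_field_derivative c u0 * (T 0 u0 z0 / (2 * u0) - pi * T 2 u0 z0)) (at u0)"
  proof -
    have "(\<Sum>\<^sub>\<infinity>i\<in>I. w i * a i * exp (a i * y0)) * (- 1 / u0\<^sup>2) =
       (pi / u0\<^sup>2) * (exp (- pi * z0\<^sup>2 / u0) * g z0) * (c u0 * (u0 / (2 * pi) * T 0 u0 z0 - u0\<^sup>2 * T 2 u0 z0))"
      unfolding val comb by simp
    also have "\<dots> = c u0 * (T 0 u0 z0 / (2 * u0) - pi * T 2 u0 z0)"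
      unfolding gi using u0nz by (simp add: field_simps power2_eq_square)
    finally show ?thesis using dAu by simp
  qed
  \<comment> \<open>Near \<open>u0\<close> the dual series stays non-zero and \<open>c\<close> is
    this quotient. In its derivative the two terms with \<open>T 2\<close> cancel, which is the
    effect of the heat equation.\<close>
  have "((\<lambda>u. A u z0 / T 0 u z0) has_field_derivative
     (c u0 * (T 0 u0 z0 / (2 * u0) - pi * T 2 u0 z0) * T 0 u0 z0 - A u0 z0 * (- pi * T 2 u0 z0)) / (T 0 u0 z0 * T 0 u0 z0)) (at u0)"
    by (rule DERIV_divide[OF dA' dTu T0nz])
  also have "(c u0 * (T 0 u0 z0 / (2 * u0) - pi * T 2 u0 z0) * T 0 u0 z0 - A u0 z0 * (- pi * T 2 u0 z0)) / (T 0 u0 z0 * T 0 u0 z0) = c u0 / (2 * u0)"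
    unfolding eqT[OF u0] using T0nz u0nz by (simp add: field_simps)
  finally have quot: "((\<lambda>u. A u z0 / T 0 u z0) has_field_derivative c u0 / (2 * u0)) (at u0)" .
  have "\<forall>\<^sub>F u in nhds u0. c u = A u z0 / T 0 u z0"
  proof -
    have "isCont (\<lambda>u. T 0 u z0) u0" using dTu DERIV_isCont by blast
    then have "\<forall>\<^sub>F u in at u0. T 0 u z0 \<noteq> 0" using T0nz isContD tendsto_imp_eventually_ne by blast
    then have "\<forall>\<^sub>F u in nhds u0. T 0 u z0 \<noteq> 0" using T0nz by (simp add: eventually_nhds_conv_at)
    moreover have "\<forall>\<^sub>F u in nhds u0. Re u > 0"
      using u0 open_halfspace_Re_gt[of 0] eventually_nhds_in_open[of "{u. Re u > 0}" u0] by auto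
    ultimately show ?thesis by eventually_elim (use eqT in auto)
  qed
  from DERIV_cong_ev[OF refl this refl] quot show ?thesis by (rule iffD2)
qed

section \<open>Complexified vectors and complex lines\<close>

definition jl :: "'a::euclidean_space \<Rightarrow> complex \<Rightarrow> 'a cplx" where
  "jl x z = cscale z (cvec x)"

lemma jl_eq: "jl x z = (Re z *\<^sub>R x, Im z *\<^sub>R x)"
  by (simp add: jl_def cscale_def cvec_def)

lemma linear_jl: "linear (jl x)"
  by (rule linearI) (simp_all add: jl_eq scaleR_left_distrib)

lemma jl_1: "jl x 1 = cvec x" by (simp add: jl_eq cvec_def)

lemma cvec_simps: "cvec (x + y) = cvec x + cvec y" "cvec (t *\<^sub>R x) = t *\<^sub>R cvec x" "cvec 0 = 0" "cvec (- x) = - cvec x"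
   "cvec (x - y) = cvec x - cvec y"
  by (simp_all add: cvec_def zero_prod_def)

lemma fst_cvec [simp]: "fst (cvec x) = x" by (simp add: cvec_def)

lemma ex_uniform_lower_bound:
  assumes "finite A" "\<And>x. x \<in> A \<Longrightarrow> (g x :: real) > 0"
  obtains a where "a > 0" "\<And>x. x \<in> A \<Longrightarrow> a \<le> g x"
proof (rule that[of "Min (insert 1 (g ` A))"])
  show "Min (insert 1 (g ` A)) > 0" using assms by (subst Min_gr_iff) auto
  show "Min (insert 1 (g ` A)) \<le> g x" if "x \<in> A" for x using assms(1) that by (intro Min_le) auto
qed

section \<open>Fourier series on the torus of a lattice\<close>

context theta_lattice
begin

definition pr :: "'a \<Rightarrow> 'a cplx \<Rightarrow> complex" where "pr x \<zeta> = cform L (cvec x) \<zeta>"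

lemma pr_eq: "pr x \<zeta> = Complex (B x (fst \<zeta>)) (B x (snd \<zeta>))"
  by (simp add: pr_def cform_def cvec_def B_simps)

lemma pr_simps: "pr x (\<zeta> + \<xi>) = pr x \<zeta> + pr x \<xi>" "pr x (t *\<^sub>R \<zeta>) = t *\<^sub>R pr x \<zeta>" "pr x (jl y z) = z * of_real (B x y)"
  "pr x (cvec y) = of_real (B x y)" "pr (x + y) \<zeta> = pr x \<zeta> + pr y \<zeta>" "pr (t *\<^sub>R x) \<zeta> = of_real t * pr x \<zeta>"
  "pr (- x) \<zeta> = - pr x \<zeta>" "pr (x - y) \<zeta> = pr x \<zeta> - pr y \<zeta>" "pr 0 \<zeta> = 0" "pr x 0 = 0"
  by (simp_all add: pr_eq jl_eq B_simps complex_eq_iff cvec_def)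

lemma linear_pr: "linear (pr x)"
  by (rule linearI) (simp_all add: pr_simps)

lemma pr_sum: "pr x (sum g A) = (\<Sum>i\<in>A. pr x (g i))"
  using linear_sum[OF linear_pr] by auto

lemma pr_bound: obtains C where "C > 0" "\<And>x \<zeta>. cmod (pr x \<zeta>) \<le> C * norm x * norm \<zeta>"
proof -
  obtain C where C: "C > 0" "\<And>x y. \<bar>B x y\<bar> \<le> C * norm x * norm y" using B_bound by blast
  have "cmod (pr x \<zeta>) \<le> 2 * C * norm x * norm \<zeta>" for x \<zeta>
  proof -
    have "cmod (pr x \<zeta>) \<le> \<bar>B x (fst \<zeta>)\<bar> + \<bar>B x (snd \<zeta>)\<bar>"
      using cmod_le[of "pr x \<zeta>"] by (simp add: pr_eq)
    also have "\<dots> \<le> C * norm x * norm \<zeta> + C * norm x * norm \<zeta>"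
    proof (rule add_mono)
      have n: "norm (fst \<zeta>) \<le> norm \<zeta>" "norm (snd \<zeta>) \<le> norm \<zeta>"
        using norm_fst_le[of "fst \<zeta>" "snd \<zeta>"] norm_snd_le[of "snd \<zeta>" "fst \<zeta>"] by simp_all
      have c: "0 \<le> C * norm x" using C by simp
      show "\<bar>B x (fst \<zeta>)\<bar> \<le> C * norm x * norm \<zeta>"
        using C(2)[of x "fst \<zeta>"] mult_left_mono[OF n(1) c] by linarith
      show "\<bar>B x (snd \<zeta>)\<bar> \<le> C * norm x * norm \<zeta>"
        using C(2)[of x "snd \<zeta>"] mult_left_mono[OF n(2) c] by linarith
    qed
    finally show ?thesis by simp
  qed
  then show ?thesis using that[of "2 * C"] C by simp
qed

lemma cspan_iff: "\<zeta> \<in> cspan L \<longleftrightarrow> fst \<zeta> \<in> V \<and> snd \<zeta> \<in> V"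
  by (cases \<zeta>) (simp add: cspan_def)

lemma cspan_intros: "0 \<in> cspan L" "\<zeta> \<in> cspan L \<Longrightarrow> \<xi> \<in> cspan L \<Longrightarrow> \<zeta> + \<xi> \<in> cspan L" "x \<in> V \<Longrightarrow> jl x z \<in> cspan L"
  "x \<in> V \<Longrightarrow> cvec x \<in> cspan L" "\<zeta> \<in> cspan L \<Longrightarrow> t *\<^sub>R \<zeta> \<in> cspan L" "(\<And>i. i \<in> A \<Longrightarrow> g i \<in> cspan L) \<Longrightarrow> sum g A \<in> cspan L"
proof -
  show "(\<And>i. i \<in> A \<Longrightarrow> g i \<in> cspan L) \<Longrightarrow> sum g A \<in> cspan L"
    by (simp add: cspan_iff fst_sum snd_sum V_intros)
qed (simp_all add: cspan_iff jl_eq cvec_def V_intros)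

lemma cspan_expand: assumes "\<zeta> \<in> cspan L"
  shows "\<zeta> = (\<Sum>e\<in>E. jl e (Complex (co e (fst \<zeta>)) (co e (snd \<zeta>))))"
proof (rule prod_eqI)
  let ?r = "\<Sum>e\<in>E. jl e (Complex (co e (fst \<zeta>)) (co e (snd \<zeta>)))"
  have "fst ?r = (\<Sum>e\<in>E. co e (fst \<zeta>) *\<^sub>R e)" "snd ?r = (\<Sum>e\<in>E. co e (snd \<zeta>) *\<^sub>R e)"
    by (simp_all add: fst_sum snd_sum jl_eq)
  then show "fst \<zeta> = fst ?r" "snd \<zeta> = snd ?r"
    using assms co_expand[of "fst \<zeta>", symmetric] co_expand[of "snd \<zeta>", symmetric] by (simp_all add: cspan_iff)
qed

lemma pr_expand: assumes "x \<in> V" "\<zeta> \<in> cspan L" shows "pr x \<zeta> = (\<Sum>f\<in>F. of_real (eps f * B f x) * pr f \<zeta>)"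
proof -
  have "B x y = (\<Sum>f\<in>F. eps f * B f x * B f y)" if "y \<in> V" for y
  proof -
    have "B x y = (\<Sum>f\<in>F. eps f * B x f * B y f)" by (rule B_expand[OF that])
    also have "\<dots> = (\<Sum>f\<in>F. eps f * B f x * B f y)"
    proof (rule sum.cong[OF refl])
      fix f assume "f \<in> F"
      then show "eps f * B x f * B y f = eps f * B f x * B f y"
        using B_sym[OF assms(1) F_V] B_sym[OF that F_V] by simp
    qed
    finally show ?thesis .
  qed
  then show ?thesis using assms by (simp add: pr_eq complex_eq_iff cspan_iff Re_sum Im_sum)
qed

definition us :: "'a cplx list" where
  "us = (SOME l. distinct l \<and> set l = cvec ` E)"

lemma us: "distinct us" "set us = cvec ` E"
proof -
  have "\<exists>l. distinct l \<and> set l = cvec ` E" using finite_distinct_list[of "cvec ` E"] finE by auto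
  from someI_ex[OF this] show "distinct us" "set us = cvec ` E" unfolding us_def by auto
qed

lemma cspan_us: "\<zeta> \<in> cspan L \<Longrightarrow> u \<in> set us \<Longrightarrow> \<zeta> + t *\<^sub>R u \<in> cspan L"
  by (auto simp: us intro!: cspan_intros E_V)

definition ch :: "'a \<Rightarrow> 'a cplx \<Rightarrow> complex" where "ch x \<zeta> = ee (pr x \<zeta>)"

lemma ch_add: "ch x (\<zeta> + \<xi>) = ch x \<zeta> * ch x \<xi>" "ch (x + y) \<zeta> = ch x \<zeta> * ch y \<zeta>" "ch (- x) \<zeta> = inverse (ch x \<zeta>)"
   "ch 0 \<zeta> = 1" "ch x \<zeta> \<noteq> 0"
  by (simp_all add: ch_def pr_simps ee_add ee_uminus)

lemma norm_ch_shift: "cmod (ch x (\<zeta> + cvec y)) = cmod (ch x \<zeta>)"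
  by (simp add: ch_add norm_mult) (simp add: ch_def pr_simps)

lemma continuous_pr: "continuous_on S (pr x)"
  using linear_continuous_on[of "pr x"] linear_pr by (simp add: linear_conv_bounded_linear)

lemma continuous_ch: "continuous_on S (ch x)"
  unfolding ch_def by (intro continuous_intros continuous_pr)

lemma ch_us: assumes "m \<in> dual L" "u \<in> set us"
  shows "ch m (\<zeta> + t *\<^sub>R u) = ee (of_int \<lfloor>B m (fst u)\<rfloor> * of_real t) * ch m \<zeta>"
proof -
  obtain e where e: "e \<in> E" "u = cvec e" using assms(2) us by auto
  have "B m e \<in> \<int>" using dual_pair(1)[OF assms(1) E_pts[OF e(1)]] .
  then have "of_int \<lfloor>B m e\<rfloor> = B m e" by simp
  then have "complex_of_int \<lfloor>B m e\<rfloor> = of_real (B m e)" by (metis of_real_of_int_eq)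
  then show ?thesis unfolding e(2) ch_add(1) by (simp add: ch_def pr_simps scaleR_conv_of_real mult_ac)
qed

lemma avl_ch: assumes "m \<in> dual L" shows "avl us (ch m) \<zeta> = (if m = 0 then 1 else 0)"
proof -
  have "avl us (ch m) = (\<lambda>z. (\<Prod>u\<leftarrow>us. if \<lfloor>B m (fst u)\<rfloor> = 0 then 1 else 0) * ch m z)"
    by (rule avl_character) (rule ch_us[OF assms])
  moreover have "(\<Prod>u\<leftarrow>us. if \<lfloor>B m (fst u)\<rfloor> = 0 then 1 else (0::complex)) = (if m = 0 then 1 else 0)"
  proof (cases "m = 0")
    case True
    have "(\<Prod>u\<leftarrow>l. if \<lfloor>B 0 (fst u)\<rfloor> = 0 then 1 else (0::complex)) = 1" for l :: "'a cplx list"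
      by (induction l) (simp_all add: B_simps)
    then show ?thesis using True by simp
  next
    case False
    have "\<exists>e\<in>E. B m e \<noteq> 0"
      using B_eqI[of m 0] False dual_V[OF assms] V_intros(1) by (auto simp: B_simps)
    then obtain e where e: "e \<in> E" "B m e \<noteq> 0" by blast
    have "of_int \<lfloor>B m e\<rfloor> = B m e" using dual_pair(1)[OF assms E_pts[OF e(1)]] by simp
    then have "\<lfloor>B m (fst (cvec e))\<rfloor> \<noteq> 0" using e by auto
    moreover have "cvec e \<in> set us" using us e by auto
    ultimately show ?thesis using False by (force simp: prod_list_zero_iff)
  qed
  ultimately show ?thesis by (simp add: ch_add)
qed

text \<open>Outside a finite set \<open>M'\<close> the series is small, uniformly on all real
  translates of \<open>\<zeta>\<close>, because a real translation does not change
  \<open>cmod (ch m \<zeta>)\<close>. On the finite part orthogonality of characters gives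
  \<open>a m0\<close> exactly, so the error is below every \<open>e\<close>.\<close>

lemma fourier_coefficient:
  assumes h: "\<And>\<zeta>. h \<zeta> = (\<Sum>\<^sub>\<infinity>m\<in>dual L. a m * ch m \<zeta>)" and cont: "continuous_on UNIV h"
    and sm': "(\<lambda>m. cmod (a m * ch m \<zeta>)) summable_on dual L" and m0: "m0 \<in> dual L" and \<zeta>: "\<zeta> \<in> cspan L"
  shows "avl us (\<lambda>\<zeta>. h \<zeta> * ch (- m0) \<zeta>) \<zeta> = a m0"
proof -
  define K where "K = cmod (ch (- m0) \<zeta>)"
  have K: "K > 0" unfolding K_def using ch_add(5)[of "- m0" \<zeta>] by simp
  have "cmod (avl us (\<lambda>\<zeta>. h \<zeta> * ch (- m0) \<zeta>) \<zeta> - a m0) \<le> e" if e: "e > 0" for e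
  proof -
    obtain M where M: "finite M" "M \<subseteq> dual L"
      "dist (\<Sum>m\<in>M. cmod (a m * ch m \<zeta>)) (\<Sum>\<^sub>\<infinity>m\<in>dual L. cmod (a m * ch m \<zeta>)) \<le> e / K"
      using infsum_finite_approximation[OF sm', of "e / K"] e K by auto
    define M' where "M' = insert m0 M"
    have M': "finite M'" "M' \<subseteq> dual L" "m0 \<in> M'" using M m0 by (auto simp: M'_def)
    have tail: "(\<Sum>\<^sub>\<infinity>m\<in>dual L - M'. cmod (a m * ch m \<zeta>)) \<le> e / K"
    proof -
      have "(\<Sum>\<^sub>\<infinity>m\<in>dual L - M'. cmod (a m * ch m \<zeta>)) = (\<Sum>\<^sub>\<infinity>m\<in>dual L. cmod (a m * ch m \<zeta>)) - (\<Sum>m\<in>M'. cmod (a m * ch m \<zeta>))"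
        using infsum_Diff[OF sm' _ M'(2)] M'(1) by simp
      also have "\<dots> \<le> (\<Sum>\<^sub>\<infinity>m\<in>dual L. cmod (a m * ch m \<zeta>)) - (\<Sum>m\<in>M. cmod (a m * ch m \<zeta>))"
        using M'(1) by (intro diff_left_mono sum_mono2) (auto simp: M'_def)
      also have "\<dots> \<le> e / K" using M(3) by (simp add: dist_real_def)
      finally show ?thesis .
    qed
    define r where "r \<xi> = h \<xi> - (\<Sum>m\<in>M'. a m * ch m \<xi>)" for \<xi>
    have rc: "continuous_on UNIV r" unfolding r_def by (intro continuous_intros cont continuous_ch)
    have "cmod (avl us (\<lambda>\<xi>. r \<xi> * ch (- m0) \<xi>) \<zeta>) \<le> e"
    \<comment> \<open>The real translates of \<open>\<zeta>\<close> are preserved by the period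
      directions, and on them every summand keeps its absolute value.\<close>
    proof (rule avl_bound[where S = "{\<zeta> + cvec x | x. x \<in> V}"])
      show "continuous_on UNIV (\<lambda>\<xi>. r \<xi> * ch (- m0) \<xi>)" by (intro continuous_intros rc continuous_ch)
    next
      fix \<xi> assume "\<xi> \<in> {\<zeta> + cvec x | x. x \<in> V}"
      then obtain x where x: "\<xi> = \<zeta> + cvec x" by blast
      have n: "cmod (a m * ch m \<xi>) = cmod (a m * ch m \<zeta>)" for m unfolding x by (simp add: norm_mult norm_ch_shift)
      have s2: "(\<lambda>m. cmod (a m * ch m \<zeta>)) summable_on A" if "A \<subseteq> dual L" for A
        using summable_on_subset_banach[OF sm' that] .
      have s3: "(\<lambda>m. a m * ch m \<xi>) summable_on A" if "A \<subseteq> dual L" for A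
        by (rule summable_on_dominated[OF s2[OF that]]) (simp add: n)
      have "r \<xi> = (\<Sum>\<^sub>\<infinity>m\<in>dual L - M'. a m * ch m \<xi>)"
        unfolding r_def h using infsum_Diff[OF s3[OF order_refl] _ M'(2)] M'(1) by simp
      also have "cmod \<dots> \<le> (\<Sum>\<^sub>\<infinity>m\<in>dual L - M'. cmod (a m * ch m \<zeta>))"
        by (rule norm_infsum_dominated[OF s2]) (auto simp: n)
      finally have "cmod (r \<xi>) \<le> e / K" using tail by linarith
      moreover have "cmod (ch (- m0) \<xi>) = K" unfolding x K_def by (rule norm_ch_shift)
      ultimately show "cmod (r \<xi> * ch (- m0) \<xi>) \<le> e" using K by (simp add: norm_mult field_simps)
    next
      fix z t u assume "z \<in> {\<zeta> + cvec x | x. x \<in> V}" "u \<in> set us"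
      then obtain x e where "z = \<zeta> + cvec x" "x \<in> V" "e \<in> E" "u = cvec e" using us by auto
      moreover from this have "x + t *\<^sub>R e \<in> V" using V_intros(2,5) E_V by blast
      ultimately show "z + t *\<^sub>R u \<in> {\<zeta> + cvec x | x. x \<in> V}"
        by (auto intro!: exI[of _ "x + t *\<^sub>R e"] simp: cvec_simps)
    next
      show "\<zeta> \<in> {\<zeta> + cvec x | x. x \<in> V}" using V_intros(1) by (auto intro!: exI[of _ 0] simp: cvec_simps)
    qed
    moreover have "avl us (\<lambda>\<xi>. r \<xi> * ch (- m0) \<xi>) \<zeta> = avl us (\<lambda>\<zeta>. h \<zeta> * ch (- m0) \<zeta>) \<zeta> - a m0"
    proof -
      have "avl us (\<lambda>\<xi>. r \<xi> * ch (- m0) \<xi>) \<zeta> = avl us (\<lambda>\<xi>. h \<xi> * ch (- m0) \<xi> - (\<Sum>m\<in>M'. a m * ch (m + - m0) \<xi>)) \<zeta>"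
        by (simp only: r_def left_diff_distrib sum_distrib_right ch_add(2) mult.assoc)
      also have "\<dots> = avl us (\<lambda>\<zeta>. h \<zeta> * ch (- m0) \<zeta>) \<zeta> - avl us (\<lambda>\<xi>. \<Sum>m\<in>M'. a m * ch (m + - m0) \<xi>) \<zeta>"
        by (subst avl_diff) (auto intro!: continuous_intros cont continuous_ch)
      also have "avl us (\<lambda>\<xi>. \<Sum>m\<in>M'. a m * ch (m + - m0) \<xi>) \<zeta> = (\<Sum>m\<in>M'. a m * avl us (ch (m + - m0)) \<zeta>)"
        by (subst avl_sum) (auto simp: avl_cmult M' intro!: continuous_intros continuous_ch)
      also have "\<dots> = (\<Sum>m\<in>M'. if m = m0 then a m else 0)"
      proof (rule sum.cong)
        fix m assume "m \<in> M'"
        then have "m + - m0 \<in> dual L" using M' m0 by (intro dual_intros) auto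
        from avl_ch[OF this] show "a m * avl us (ch (m + - m0)) \<zeta> = (if m = m0 then a m else 0)" by auto
      qed simp
      also have "\<dots> = a m0" using M' by simp
      finally show ?thesis .
    qed
    ultimately show ?thesis by simp
  qed
  then have "cmod (avl us (\<lambda>\<zeta>. h \<zeta> * ch (- m0) \<zeta>) \<zeta> - a m0) \<le> 0"
    by (metis dense_ge_bounded field_le_epsilon add_0 zero_less_one)
  then show ?thesis by simp
qed

text \<open>Instance of \<open>avl_unique\<close>: integral multiples of the dual basis vector
  \<open>db e\<close> give the characters that vary along \<open>cvec e\<close> and along no other
  basis direction.\<close>

lemma fourier_unique:
  assumes cont: "continuous_on UNIV h" and zero: "\<And>m \<zeta>. m \<in> dual L \<Longrightarrow> \<zeta> \<in> cspan L \<Longrightarrow> avl us (\<lambda>\<zeta>. h \<zeta> * ch (- m) \<zeta>) \<zeta> = 0"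
    and \<zeta>: "\<zeta> \<in> cspan L"
  shows "h \<zeta> = 0"
proof (rule avl_unique[OF us(1) cont cspan_us, where C = "{ch (- m) | m. m \<in> dual L}" and
      \<psi> = "\<lambda>u n. ch (of_int n *\<^sub>R db (fst u))"])
  show "(\<lambda>z. 1) \<in> {ch (- m) | m. m \<in> dual L}"
    using dual_intros(1) by (auto intro!: exI[of _ 0] simp: ch_add fun_eq_iff)
  show "continuous_on UNIV \<xi>" if "\<xi> \<in> {ch (- m) | m. m \<in> dual L}" for \<xi> using that continuous_ch by auto
  fix u \<xi> and n :: int assume u: "u \<in> set us"
  then obtain e where e: "e \<in> E" "u = cvec e" using us by auto
  show "(\<lambda>z. \<xi> z * ch (of_int n *\<^sub>R db (fst u)) z) \<in> {ch (- m) | m. m \<in> dual L}" if "\<xi> \<in> {ch (- m) | m. m \<in> dual L}"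
  proof -
    obtain m where m: "m \<in> dual L" "\<xi> = ch (- m)" using \<open>\<xi> \<in> _\<close> by blast
    have "m - of_int n *\<^sub>R db e \<in> dual L" using m e by (intro dual_intros db_dual)
    moreover have "(\<lambda>z. \<xi> z * ch (of_int n *\<^sub>R db (fst u)) z) = ch (- (m - of_int n *\<^sub>R db e))"
      using e by (simp add: m ch_add(2)[symmetric] fun_eq_iff)
    ultimately show ?thesis by blast
  qed
  show "ch (of_int n *\<^sub>R db (fst u)) z \<noteq> 0" for z by (rule ch_add)
  have key: "ch (of_int n *\<^sub>R db e) (z + t *\<^sub>R cvec e') = ee (of_real (of_int n * t * co e e')) * ch (of_int n *\<^sub>R db e) z" if "e' \<in> E" for z t e'
    using B_db(2)[OF E_V[OF that], of e] by (simp add: ch_add(1) mult.commute) (simp add: ch_def pr_simps B_simps scaleR_conv_of_real mult_ac)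
  show "ch (of_int n *\<^sub>R db (fst u)) (z + t *\<^sub>R u) = ee (of_int n * of_real t) * ch (of_int n *\<^sub>R db (fst u)) z" for z t
    using key[OF e(1), of z t] e co(2)[OF e(1), of e] by simp
  fix u' assume u': "u' \<in> set us" "u \<noteq> u'"
  then obtain e' where e': "e' \<in> E" "u' = cvec e'" using us by auto
  then have "e' \<noteq> e" using u' e by auto
  then show "ch (of_int n *\<^sub>R db (fst u)) (z + t *\<^sub>R u') = ch (of_int n *\<^sub>R db (fst u)) z" for z t
    using key[OF e'(1), of z t] e e' co(2)[OF e'(1), of e] by simp
qed (use zero \<zeta> in auto)

end

section \<open>Theta inversion\<close>

abbreviation cpi :: complex where "cpi \<equiv> cor pi"

lemma theta_factor_derivative':
  fixes l :: "'i \<Rightarrow> real" and \<mu> :: "'j \<Rightarrow> real" and w :: "'i \<Rightarrow> complex" and w' :: "'j \<Rightarrow> complex"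
    and c :: "complex \<Rightarrow> complex" and u0 z0 :: complex
  assumes sI: "\<And>\<epsilon> B. \<epsilon> > 0 \<Longrightarrow> (\<lambda>i. cmod (w i) * exp (- \<epsilon> * (l i)\<^sup>2 + B * \<bar>l i\<bar>)) summable_on I"
    and sJ: "\<And>\<epsilon> B. \<epsilon> > 0 \<Longrightarrow> (\<lambda>j. cmod (w' j) * exp (- \<epsilon> * (\<mu> j)\<^sup>2 + B * \<bar>\<mu> j\<bar>)) summable_on J"
    and eq: "\<And>(u::complex) (z::complex). Re u > 0 \<Longrightarrow> (\<Sum>\<^sub>\<infinity>i\<in>I. w i * exp (- cpi * (cor (l i) - z)\<^sup>2 / u)) =
       c u * (\<Sum>\<^sub>\<infinity>j\<in>J. w' j * exp (- cpi * u * (cor (\<mu> j))\<^sup>2 + 2 * cpi * \<i> * cor (\<mu> j) * z))"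
    and u0: "Re u0 > 0"
    and nz: "(\<Sum>\<^sub>\<infinity>j\<in>J. w' j * exp (- cpi * u0 * (cor (\<mu> j))\<^sup>2 + 2 * cpi * \<i> * cor (\<mu> j) * z0)) \<noteq> 0"
  shows "(c has_field_derivative c u0 / (2 * u0)) (at u0)"
  by (rule theta_factor_derivative[OF sI sJ _ u0, where ?z0.0 = z0]) (use eq nz in simp_all)


text \<open>The decay in \<open>a\<close> is controlled by \<open>Re (1 / s)\<close>; the shift by
  \<open>z\<close> costs only a linear term.\<close>

lemma norm_exp_minus_pi_quotient:
  fixes s z :: complex and a :: real
  shows "cmod (exp (- cpi * (cor a - z)\<^sup>2 / s)) \<le>
    exp (- (pi * Re (1 / s)) * a\<^sup>2 + (2 * pi * cmod z * cmod (1 / s)) * \<bar>a\<bar> + pi * (cmod z)\<^sup>2 * cmod (1 / s))"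
proof -
  define y where "y = 1 / s"
  have "- cpi * (cor a - z)\<^sup>2 / s = cor (- pi * a\<^sup>2) * y + (cor (2 * pi * a) * (z * y)) - cpi * (z\<^sup>2 * y)"
    unfolding y_def by (simp add: algebra_simps power2_eq_square diff_divide_distrib add_divide_distrib)
  then have "Re (- cpi * (cor a - z)\<^sup>2 / s) = - pi * a\<^sup>2 * Re y + 2 * pi * a * Re (z * y) - pi * Re (z\<^sup>2 * y)"
    by (simp only: plus_complex.sel minus_complex.sel Re_of_real_mult)
  moreover have "2 * pi * a * Re (z * y) \<le> 2 * pi * (\<bar>a\<bar> * (cmod z * cmod y))"
  proof -
    have "a * Re (z * y) \<le> \<bar>a\<bar> * \<bar>Re (z * y)\<bar>" by (metis abs_ge_self abs_mult)
    also have "\<dots> \<le> \<bar>a\<bar> * (cmod z * cmod y)" using Re_mult_ge by (intro mult_left_mono) auto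
    finally show ?thesis using pi_gt_zero by (simp add: mult.assoc)
  qed
  moreover have "- (pi * Re (z\<^sup>2 * y)) \<le> pi * ((cmod z)\<^sup>2 * cmod y)"
  proof -
    have "- Re (z\<^sup>2 * y) \<le> (cmod z)\<^sup>2 * cmod y"
      using Re_mult_ge[of "z\<^sup>2" y] unfolding norm_power abs_le_iff by blast
    from mult_left_mono[OF this pi_ge_zero] show ?thesis by (simp only: mult_minus_right)
  qed
  ultimately have "Re (- cpi * (cor a - z)\<^sup>2 / s) \<le> - pi * a\<^sup>2 * Re y + 2 * pi * (\<bar>a\<bar> * (cmod z * cmod y)) + pi * ((cmod z)\<^sup>2 * cmod y)"
    by linarith
  also have "\<dots> = - (pi * Re y) * a\<^sup>2 + (2 * pi * cmod z * cmod y) * \<bar>a\<bar> + pi * (cmod z)\<^sup>2 * cmod y"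
    by (simp add: algebra_simps)
  finally show ?thesis unfolding norm_exp_eq_Re y_def exp_le_cancel_iff .
qed

context theta_lattice
begin

lemma quad_lower:
  assumes "\<forall>f\<in>F. (g f :: real) > 0"
  obtains \<kappa> where "\<kappa> > 0" "\<And>x. x \<in> V \<Longrightarrow> \<kappa> * (norm x)\<^sup>2 \<le> (\<Sum>f\<in>F. g f * (B x f)\<^sup>2)"
proof -
  obtain a where a: "a > 0" "\<And>f. f \<in> F \<Longrightarrow> a \<le> g f" by (rule ex_uniform_lower_bound[OF finF, of g]) (use assms in auto)
  obtain k where k: "k > 0" "\<And>x. x \<in> V \<Longrightarrow> k * (norm x)\<^sup>2 \<le> Qp x + Qm x" using Q_lower by blast
  have "a * k * (norm x)\<^sup>2 \<le> (\<Sum>f\<in>F. g f * (B x f)\<^sup>2)" if "x \<in> V" for x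
  proof -
    have "a * k * (norm x)\<^sup>2 \<le> a * (Qp x + Qm x)" using mult_left_mono[OF k(2)[OF that], of a] a by (simp add: mult.assoc)
    also have "\<dots> = (\<Sum>f\<in>F. a * (B x f)\<^sup>2)" by (simp add: sum_F Qp_def Qm_def sum_distrib_left distrib_left)
    also have "\<dots> \<le> (\<Sum>f\<in>F. g f * (B x f)\<^sup>2)" using a by (intro sum_mono mult_right_mono) auto
    finally show ?thesis .
  qed
  then show ?thesis using that[of "a * k"] a k by simp
qed

lemma summable_gauss_dominated:
  fixes f :: "'a \<Rightarrow> 'b::banach"
  assumes "\<kappa> > 0" "I \<subseteq> dual L" "\<And>x. x \<in> I \<Longrightarrow> norm (f x) \<le> exp (- \<kappa> * (norm x)\<^sup>2 + C * norm x + D)"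
  shows "f summable_on I" "(\<lambda>x. norm (f x)) summable_on I"
proof -
  have "(\<lambda>x. exp D * exp (- \<kappa> * (norm x)\<^sup>2 + C * norm x)) summable_on I"
    using summable_on_subset_banach[OF summable_dual_gauss[OF assms(1)] assms(2)] by (rule summable_on_cmult_right)
  then have s: "(\<lambda>x. exp (- \<kappa> * (norm x)\<^sup>2 + C * norm x + D)) summable_on I" by (simp add: exp_add mult_ac)
  show "f summable_on I" by (rule summable_on_dominated[OF s assms(3)])
  show "(\<lambda>x. norm (f x)) summable_on I" by (rule summable_on_dominated[OF s]) (use assms(3) in auto)
qed

lemma pts_subset_dual: "pts L \<subseteq> dual L" using pts_dual by blast

lemma B_sym_F: "f \<in> F \<Longrightarrow> x \<in> V \<Longrightarrow> B f x = B x f" using B_sym F_V by blast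

text \<open>\<open>psi s\<close> and \<open>dth s\<close> are the two sides of the theta inversion formula, up to a factor; the
  Gaussian has the width \<open>s f\<close> along the basis vector \<open>f\<close>.\<close>

definition psi :: "('a \<Rightarrow> complex) \<Rightarrow> 'a cplx \<Rightarrow> complex" where
  "psi s \<zeta> = (\<Sum>\<^sub>\<infinity>x\<in>pts L. exp (\<Sum>f\<in>F. - cpi * (cor (B x f) - pr f \<zeta>)\<^sup>2 / s f))"

definition gq :: "('a \<Rightarrow> complex) \<Rightarrow> 'a \<Rightarrow> complex" where
  "gq s x = exp (\<Sum>f\<in>F. - cpi * s f * (cor (B x f))\<^sup>2)"

definition dth :: "('a \<Rightarrow> complex) \<Rightarrow> 'a cplx \<Rightarrow> complex" where
  "dth s \<zeta> = (\<Sum>\<^sub>\<infinity>x\<in>dual L. gq s x * ch x \<zeta>)"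

lemma norm_gq: "cmod (gq s x) = exp (- (\<Sum>f\<in>F. pi * Re (s f) * (B x f)\<^sup>2))"
proof -
  have "Re (- cpi * s f * (cor (B x f))\<^sup>2) = - (pi * Re (s f) * (B x f)\<^sup>2)" for f
  proof -
    have "- cpi * s f * (cor (B x f))\<^sup>2 = cor (- pi * (B x f)\<^sup>2) * s f" by simp
    then show ?thesis by (simp only: Re_of_real_mult) simp
  qed
  then show ?thesis unfolding gq_def norm_exp_eq_Re Re_sum by (simp add: sum_negf)
qed

lemma gq_bound:
  assumes "\<forall>f\<in>F. Re (s f) > 0"
  obtains \<kappa> where "\<kappa> > 0" "\<And>x. x \<in> V \<Longrightarrow> cmod (gq s x) \<le> exp (- \<kappa> * (norm x)\<^sup>2)"
proof -
  obtain \<kappa> where "\<kappa> > 0" "\<And>x. x \<in> V \<Longrightarrow> \<kappa> * (norm x)\<^sup>2 \<le> (\<Sum>f\<in>F. pi * Re (s f) * (B x f)\<^sup>2)"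
  proof -
    have "\<forall>f\<in>F. pi * Re (s f) > 0" using assms by simp
    from quad_lower[OF this] that show ?thesis by blast
  qed
  then show ?thesis using that[of \<kappa>] by (simp add: norm_gq)
qed

lemma norm_ch_le: obtains C where "C > 0" "\<And>x \<zeta>. cmod (ch x \<zeta>) \<le> exp (C * norm x * norm \<zeta>)"
proof -
  obtain C where C: "C > 0" "\<And>x \<zeta>. cmod (pr x \<zeta>) \<le> C * norm x * norm \<zeta>" using pr_bound by blast
  have "cmod (ch x \<zeta>) \<le> exp ((2 * pi * C) * norm x * norm \<zeta>)" for x \<zeta>
  proof -
    have "- Im (pr x \<zeta>) \<le> C * norm x * norm \<zeta>" using C(2)[of x \<zeta>] abs_Im_le_cmod[of "pr x \<zeta>"] by linarith
    then have "- 2 * pi * Im (pr x \<zeta>) \<le> 2 * pi * C * norm x * norm \<zeta>"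
      using mult_left_mono[of "- Im (pr x \<zeta>)" "C * norm x * norm \<zeta>" "2 * pi"] pi_ge_zero
      by (simp only: mult.assoc mult_minus_left mult_minus_right zero_le_mult_iff zero_le_numeral) argo
    then show ?thesis unfolding ch_def norm_ee exp_le_cancel_iff .
  qed
  then show ?thesis using that[of "2 * pi * C"] C by simp
qed

text \<open>The constant \<open>M\<close> lets the same lemma serve for \<open>dth\<close> and for
  linear combinations of theta components.\<close>

lemma gauss_series_summable:
  assumes "\<kappa> > 0" "M \<ge> 0" and a: "\<And>x. x \<in> dual L \<Longrightarrow> cmod (a x) \<le> M * exp (- \<kappa> * (norm x)\<^sup>2)"
  shows "(\<lambda>x. cmod (a x * ch x \<zeta>)) summable_on dual L"
proof -
  obtain C where C: "C > 0" "\<And>x \<zeta>. cmod (ch x \<zeta>) \<le> exp (C * norm x * norm \<zeta>)" using norm_ch_le by blast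
  have "(\<lambda>x. exp (- \<kappa> * (norm x)\<^sup>2 + C * norm \<zeta> * norm x + 0)) summable_on dual L"
    by (rule summable_gauss_dominated(1)[OF assms(1) order_refl, where C = "C * norm \<zeta>" and D = 0]) simp
  then have "(\<lambda>x. M * exp (- \<kappa> * (norm x)\<^sup>2 + C * norm \<zeta> * norm x + 0)) summable_on dual L" by (rule summable_on_cmult_right)
  then show ?thesis
  proof (rule summable_on_dominated)
    fix x assume "x \<in> dual L"
    then have "cmod (a x) * cmod (ch x \<zeta>) \<le> (M * exp (- \<kappa> * (norm x)\<^sup>2)) * exp (C * norm x * norm \<zeta>)"
      using a C assms(2) by (intro mult_mono) auto
    also have "\<dots> = M * (exp (- \<kappa> * (norm x)\<^sup>2) * exp (C * norm x * norm \<zeta>))" by (simp only: mult.assoc)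
    also have "exp (- \<kappa> * (norm x)\<^sup>2) * exp (C * norm x * norm \<zeta>) = exp (- \<kappa> * (norm x)\<^sup>2 + C * norm \<zeta> * norm x + 0)"
      by (simp add: mult_exp_exp algebra_simps)
    finally show "norm (cmod (a x * ch x \<zeta>)) \<le> M * exp (- \<kappa> * (norm x)\<^sup>2 + C * norm \<zeta> * norm x + 0)"
      by (simp add: norm_mult)
  qed
qed

lemma gauss_series_continuous:
  assumes "\<kappa> > 0" "M \<ge> 0" and a: "\<And>x. x \<in> dual L \<Longrightarrow> cmod (a x) \<le> M * exp (- \<kappa> * (norm x)\<^sup>2)"
  shows "continuous_on UNIV (\<lambda>\<zeta>. \<Sum>\<^sub>\<infinity>x\<in>dual L. a x * ch x \<zeta>)"
proof -
  obtain C where C: "C > 0" "\<And>x \<zeta>. cmod (pr x \<zeta>) \<le> C * norm x * norm \<zeta>" using pr_bound by blast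
  have eq: "(\<lambda>\<zeta>. \<Sum>\<^sub>\<infinity>x\<in>dual L. a x * ch x \<zeta>) = expsum (dual L) a (\<lambda>x \<zeta>. 2 * cpi * \<i> * pr x \<zeta>)"
    by (simp add: expsum_def ch_def ee_def fun_eq_iff)
  have "Ck_on 0 (expsum (dual L) a (\<lambda>x \<zeta>. 2 * cpi * \<i> * pr x \<zeta>)) UNIV"
  proof (rule expsum_Ck_on[where N = "\<lambda>x. 2 * pi * C * norm x"])
    show "linear (\<lambda>\<zeta>. 2 * cpi * \<i> * pr x \<zeta>)" for x
      by (rule linearI) (simp_all add: pr_simps algebra_simps scaleR_conv_of_real)
    show "cmod (2 * cpi * \<i> * pr x d) \<le> 2 * pi * C * norm x * norm d" for x d
      using C(2)[of x d] by (simp add: norm_mult mult_ac)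
    fix \<zeta> :: "'a cplx"
    have "(\<lambda>x. exp (- \<kappa> * (norm x)\<^sup>2 + (2 * pi * C * norm \<zeta> + 2 * pi * C) * norm x + 0)) summable_on dual L"
      by (rule summable_gauss_dominated(1)[OF assms(1) order_refl, where C = "2 * pi * C * norm \<zeta> + 2 * pi * C" and D = 0]) simp
    then have sm: "(\<lambda>x. M * exp (- \<kappa> * (norm x)\<^sup>2 + (2 * pi * C * norm \<zeta> + 2 * pi * C) * norm x + 0)) summable_on dual L"
      by (rule summable_on_cmult_right)
    have "(\<lambda>x. cmod (a x) * exp (Re (2 * cpi * \<i> * pr x \<zeta>) + 1 * (2 * pi * C * norm x))) summable_on dual L"
    proof (rule summable_on_dominated[OF sm])
      fix x assume x: "x \<in> dual L"
      have "Re (2 * cpi * \<i> * pr x \<zeta>) \<le> cmod (2 * cpi * \<i> * pr x \<zeta>)" by (rule complex_Re_le_cmod)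
      also have "\<dots> \<le> 2 * pi * C * norm \<zeta> * norm x" using C(2)[of x \<zeta>] by (simp add: norm_mult mult_ac)
      finally have re: "Re (2 * cpi * \<i> * pr x \<zeta>) \<le> 2 * pi * C * norm \<zeta> * norm x" .
      have "cmod (a x) * exp (Re (2 * cpi * \<i> * pr x \<zeta>) + 1 * (2 * pi * C * norm x))
          \<le> (M * exp (- \<kappa> * (norm x)\<^sup>2)) * exp (2 * pi * C * norm \<zeta> * norm x + 1 * (2 * pi * C * norm x))"
        by (rule mult_mono[OF a[OF x] iffD2[OF exp_le_cancel_iff add_right_mono[OF re]] mult_nonneg_nonneg[OF assms(2) exp_ge_zero] exp_ge_zero])
      also have "\<dots> = M * (exp (- \<kappa> * (norm x)\<^sup>2) * exp (2 * pi * C * norm \<zeta> * norm x + 1 * (2 * pi * C * norm x)))" by (simp only: mult.assoc)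
      also have "exp (- \<kappa> * (norm x)\<^sup>2) * exp (2 * pi * C * norm \<zeta> * norm x + 1 * (2 * pi * C * norm x)) = exp (- \<kappa> * (norm x)\<^sup>2 + (2 * pi * C * norm \<zeta> + 2 * pi * C) * norm x + 0)"
        by (simp add: mult_exp_exp algebra_simps)
      finally show "norm (cmod (a x) * exp (Re (2 * cpi * \<i> * pr x \<zeta>) + 1 * (2 * pi * C * norm x)))
        \<le> M * exp (- \<kappa> * (norm x)\<^sup>2 + (2 * pi * C * norm \<zeta> + 2 * pi * C) * norm x + 0)"
        by (simp only: real_norm_def abs_mult abs_norm_cancel abs_exp_cancel)
    qed
    then show "\<exists>\<eta>>0. (\<lambda>x. cmod (a x) * exp (Re (2 * cpi * \<i> * pr x \<zeta>) + \<eta> * (2 * pi * C * norm x))) summable_on dual L"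
      by (intro exI[of _ 1]) auto
  qed (use C in auto)
  then show ?thesis unfolding eq by simp
qed

lemma dth_summable:
  assumes s: "\<forall>f\<in>F. Re (s f) > 0"
  shows "(\<lambda>x. cmod (gq s x * ch x \<zeta>)) summable_on dual L"
proof -
  obtain \<kappa> where \<kappa>: "\<kappa> > 0" "\<And>x. x \<in> V \<Longrightarrow> cmod (gq s x) \<le> exp (- \<kappa> * (norm x)\<^sup>2)" using gq_bound[OF s] by blast
  show ?thesis by (rule gauss_series_summable[OF \<kappa>(1), of 1]) (use \<kappa>(2) dual_V in auto)
qed

lemma dth_continuous:
  assumes s: "\<forall>f\<in>F. Re (s f) > 0"
  shows "continuous_on UNIV (dth s)"
proof -
  obtain \<kappa> where \<kappa>: "\<kappa> > 0" "\<And>x. x \<in> V \<Longrightarrow> cmod (gq s x) \<le> exp (- \<kappa> * (norm x)\<^sup>2)" using gq_bound[OF s] by blast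
  show ?thesis unfolding dth_def by (rule gauss_series_continuous[OF \<kappa>(1), of 1]) (use \<kappa>(2) dual_V in auto)
qed

lemma dth_coefficient:
  assumes "\<forall>f\<in>F. Re (s f) > 0" "m \<in> dual L" "\<zeta> \<in> cspan L"
  shows "avl us (\<lambda>\<zeta>. dth s \<zeta> * ch (- m) \<zeta>) \<zeta> = gq s m"
  by (rule fourier_coefficient[OF _ dth_continuous dth_summable]) (use assms in \<open>auto simp: dth_def\<close>)

text \<open>If it vanished on the complex span, so would its zeroth Fourier coefficient, which is
  \<open>gq s 0\<close>, an exponential.\<close>

lemma dth_nonzero:
  assumes s: "\<forall>f\<in>F. Re (s f) > 0"
  obtains \<zeta> where "\<zeta> \<in> cspan L" "dth s \<zeta> \<noteq> 0"
proof -
  have "\<exists>\<zeta>\<in>cspan L. dth s \<zeta> \<noteq> 0"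
  proof (rule ccontr)
    assume "\<not> ?thesis"
    then have z: "dth s \<zeta> * ch (- 0) \<zeta> = 0" if "\<zeta> \<in> cspan L" for \<zeta> using that by auto
    have "avl us (\<lambda>\<zeta>. dth s \<zeta> * ch (- 0) \<zeta>) 0 = avl us (\<lambda>\<zeta>. 0) 0"
      by (rule avl_cong[OF z cspan_us cspan_intros(1)])
    then have "gq s 0 = 0" using dth_coefficient[OF s dual_intros(1) cspan_intros(1)] by (simp add: avl_0)
    then show False by (simp add: gq_def)
  qed
  then show ?thesis using that by blast
qed

text \<open>\<open>psw\<close> and \<open>psl\<close> are the weights and linear exponents that
  exhibit \<open>psi\<close> as an \<open>expsum\<close>, after the factor quadratic in
  \<open>\<zeta>\<close> and independent of the lattice vector is taken out.\<close>

definition psw :: "('a \<Rightarrow> complex) \<Rightarrow> 'a \<Rightarrow> complex" where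
  "psw s x = exp (\<Sum>f\<in>F. - cpi * (cor (B x f))\<^sup>2 / s f)"

definition psl :: "('a \<Rightarrow> complex) \<Rightarrow> 'a \<Rightarrow> 'a cplx \<Rightarrow> complex" where
  "psl s x \<zeta> = (\<Sum>f\<in>F. 2 * cpi * cor (B x f) / s f * pr f \<zeta>)"

lemma psi_expsum:
  assumes s: "\<forall>f\<in>F. s f \<noteq> 0"
  shows "psi s \<zeta> = exp (\<Sum>f\<in>F. - cpi * (pr f \<zeta>)\<^sup>2 / s f) * expsum (pts L) (psw s) (psl s) \<zeta>"
  unfolding psi_def expsum_def infsum_cmult_right'[symmetric]
proof (rule infsum_cong)
  fix x
  have "- cpi * (cor (B x f) - pr f \<zeta>)\<^sup>2 / s f = - cpi * (pr f \<zeta>)\<^sup>2 / s f + (- cpi * (cor (B x f))\<^sup>2 / s f + 2 * cpi * cor (B x f) / s f * pr f \<zeta>)"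
    if "f \<in> F" for f using s[rule_format, OF that] by (simp add: field_simps power2_eq_square)
  then have "(\<Sum>f\<in>F. - cpi * (cor (B x f) - pr f \<zeta>)\<^sup>2 / s f) = (\<Sum>f\<in>F. - cpi * (pr f \<zeta>)\<^sup>2 / s f) + ((\<Sum>f\<in>F. - cpi * (cor (B x f))\<^sup>2 / s f) + (\<Sum>f\<in>F. 2 * cpi * cor (B x f) / s f * pr f \<zeta>))"
    unfolding sum.distrib[symmetric] by (intro sum.cong) auto
  then show "exp (\<Sum>f\<in>F. - cpi * (cor (B x f) - pr f \<zeta>)\<^sup>2 / s f) = exp (\<Sum>f\<in>F. - cpi * (pr f \<zeta>)\<^sup>2 / s f) * (psw s x * exp (psl s x \<zeta>))"
    by (simp only: exp_add psw_def psl_def)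
qed

lemma Re_inverse_pos: "Re z > 0 \<Longrightarrow> Re (1 / z) > 0"
  by (simp add: Re_divide) (metis divide_pos_pos add_pos_nonneg zero_le_power2 zero_less_power)

lemma psl_facts:
  obtains C where "C \<ge> 0" "\<And>x \<zeta>. cmod (psl s x \<zeta>) \<le> C * norm x * norm \<zeta>"
proof -
  obtain C1 where C1: "C1 > 0" "\<And>x y. \<bar>B x y\<bar> \<le> C1 * norm x * norm y" using B_bound by blast
  obtain C2 where C2: "C2 > 0" "\<And>x \<zeta>. cmod (pr x \<zeta>) \<le> C2 * norm x * norm \<zeta>" using pr_bound by blast
  define C where "C = (\<Sum>f\<in>F. 2 * pi * (C1 * norm f) / cmod (s f) * (C2 * norm f))"
  have "cmod (psl s x \<zeta>) \<le> C * norm x * norm \<zeta>" for x \<zeta>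
  proof -
    have "cmod (psl s x \<zeta>) \<le> (\<Sum>f\<in>F. cmod (2 * cpi * cor (B x f) / s f * pr f \<zeta>))" unfolding psl_def by (rule norm_sum)
    also have "\<dots> \<le> (\<Sum>f\<in>F. 2 * pi * (C1 * norm x * norm f) / cmod (s f) * (C2 * norm f * norm \<zeta>))"
    proof (rule sum_mono)
      fix f
      have "2 * pi * \<bar>B x f\<bar> / cmod (s f) * cmod (pr f \<zeta>) \<le> 2 * pi * (C1 * norm x * norm f) / cmod (s f) * (C2 * norm f * norm \<zeta>)"
        using C1 C2 by (intro mult_mono divide_right_mono mult_left_mono) auto
      then show "cmod (2 * cpi * cor (B x f) / s f * pr f \<zeta>) \<le> 2 * pi * (C1 * norm x * norm f) / cmod (s f) * (C2 * norm f * norm \<zeta>)"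
        by (simp add: norm_mult norm_divide)
    qed
    also have "\<dots> = C * norm x * norm \<zeta>" unfolding C_def sum_distrib_right by (rule sum.cong) (simp_all add: mult_ac)
    finally show ?thesis .
  qed
  moreover have "C \<ge> 0" unfolding C_def using C1 C2 by (intro sum_nonneg) auto
  ultimately show ?thesis using that by blast
qed

lemma linear_psl: "linear (psl s x)"
proof (rule linearI)
  show "psl s x (\<zeta> + \<xi>) = psl s x \<zeta> + psl s x \<xi>" for \<zeta> \<xi>
    by (simp only: psl_def pr_simps distrib_left sum.distrib)
  show "psl s x (c *\<^sub>R \<zeta>) = c *\<^sub>R psl s x \<zeta>" for c \<zeta>
    by (simp add: psl_def pr_simps scaleR_conv_of_real sum_distrib_left mult_ac)
qed

lemma psl_summable:
  assumes s: "\<forall>f\<in>F. Re (s f) > 0" and C: "C \<ge> 0" "\<And>x \<zeta>. cmod (psl s x \<zeta>) \<le> C * norm x * norm \<zeta>"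
  shows "\<exists>\<eta>>0. (\<lambda>x. cmod (psw s x) * exp (Re (psl s x \<zeta>) + \<eta> * (C * norm x))) summable_on pts L"
proof -
  obtain \<kappa> where \<kappa>: "\<kappa> > 0" "\<And>x. x \<in> V \<Longrightarrow> cmod (gq (\<lambda>f. 1 / s f) x) \<le> exp (- \<kappa> * (norm x)\<^sup>2)"
  proof -
    have "\<forall>f\<in>F. Re (1 / s f) > 0" using s Re_inverse_pos by blast
    from gq_bound[OF this] that show ?thesis by blast
  qed
  have psw: "psw s x = gq (\<lambda>f. 1 / s f) x" for x by (simp add: psw_def gq_def)
  have "(\<lambda>x. cmod (psw s x) * exp (Re (psl s x \<zeta>) + 1 * (C * norm x))) summable_on pts L"
  proof (rule summable_gauss_dominated(1)[OF \<kappa>(1) pts_subset_dual, where C = "C * norm \<zeta> + C" and D = 0])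
    fix x assume x: "x \<in> pts L"
    have "Re (psl s x \<zeta>) \<le> C * norm x * norm \<zeta>" using complex_Re_le_cmod[of "psl s x \<zeta>"] C(2)[of x \<zeta>] by linarith
    then have "cmod (psw s x) * exp (Re (psl s x \<zeta>) + 1 * (C * norm x)) \<le> exp (- \<kappa> * (norm x)\<^sup>2) * exp (C * norm x * norm \<zeta> + 1 * (C * norm x))"
      using \<kappa>(2)[OF pts_V[OF x]] unfolding psw by (intro mult_mono) auto
    also have "\<dots> = exp (- \<kappa> * (norm x)\<^sup>2 + (C * norm \<zeta> + C) * norm x + 0)" by (simp add: exp_add[symmetric] algebra_simps)
    finally show "norm (cmod (psw s x) * exp (Re (psl s x \<zeta>) + 1 * (C * norm x))) \<le> exp (- \<kappa> * (norm x)\<^sup>2 + (C * norm \<zeta> + C) * norm x + 0)" by simp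
  qed
  then show ?thesis by (intro exI[of _ 1]) auto
qed

lemma psi_continuous:
  assumes s: "\<forall>f\<in>F. Re (s f) > 0"
  shows "continuous_on UNIV (psi s)"
proof -
  obtain C where C: "C \<ge> 0" "\<And>x \<zeta>. cmod (psl s x \<zeta>) \<le> C * norm x * norm \<zeta>" using psl_facts by blast
  have s0: "\<forall>f\<in>F. s f \<noteq> 0" using s by force
  have psi_eq: "psi s = (\<lambda>\<zeta>. exp (\<Sum>f\<in>F. - cpi * (pr f \<zeta>)\<^sup>2 / s f) * expsum (pts L) (psw s) (psl s) \<zeta>)"
    by (rule ext) (rule psi_expsum[OF s0])
  have "Ck_on 0 (expsum (pts L) (psw s) (psl s)) UNIV"
    by (rule expsum_Ck_on[where N = "\<lambda>x. C * norm x"]) (use C linear_psl psl_summable[OF s C] in auto)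
  then have "continuous_on UNIV (\<lambda>\<zeta>. exp (\<Sum>f\<in>F. - cpi * (pr f \<zeta>)\<^sup>2 / s f) * expsum (pts L) (psw s) (psl s) \<zeta>)"
    by (auto intro!: continuous_intros continuous_pr simp: s0)
  then show ?thesis unfolding psi_eq .
qed

lemma psi_line_holomorphic:
  assumes s: "\<forall>f\<in>F. Re (s f) > 0"
  shows "(\<lambda>z. psi s (\<zeta> + jl y z)) holomorphic_on UNIV"
proof -
  obtain C where C: "C \<ge> 0" "\<And>x \<zeta>. cmod (psl s x \<zeta>) \<le> C * norm x * norm \<zeta>" using psl_facts by blast
  have s0: "\<forall>f\<in>F. s f \<noteq> 0" using s by force
  have psi_eq: "psi s = (\<lambda>\<zeta>. exp (\<Sum>f\<in>F. - cpi * (pr f \<zeta>)\<^sup>2 / s f) * expsum (pts L) (psw s) (psl s) \<zeta>)"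
    by (rule ext) (rule psi_expsum[OF s0])
  have "(\<lambda>z. expsum (pts L) (psw s) (psl s) (\<zeta> + jl y z)) holomorphic_on UNIV"
    by (rule expsum_line_holomorphic[where N = "\<lambda>x. C * norm x"])
      (use C linear_psl psl_summable[OF s C] linear_jl in \<open>auto simp: psl_def pr_simps sum_distrib_left mult_ac\<close>)
  then have "(\<lambda>z. exp (\<Sum>f\<in>F. - cpi * (pr f \<zeta> + z * cor (B f y))\<^sup>2 / s f) * expsum (pts L) (psw s) (psl s) (\<zeta> + jl y z)) holomorphic_on UNIV"
    by (intro holomorphic_intros) (auto simp: s0)
  then show ?thesis unfolding psi_eq by (simp add: pr_simps)
qed

lemma psi_periodic:
  assumes y: "y \<in> pts L" shows "psi s (\<zeta> + cvec y) = psi s \<zeta>"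
proof -
  have "psi s (\<zeta> + cvec y) = (\<Sum>\<^sub>\<infinity>x\<in>pts L. exp (\<Sum>f\<in>F. - cpi * (cor (B (x - y) f) - pr f \<zeta>)\<^sup>2 / s f))"
    unfolding psi_def
  proof (intro infsum_cong arg_cong[where f = exp] sum.cong refl)
    fix x f assume "f \<in> F"
    then have "cor (B x f) - pr f (\<zeta> + cvec y) = cor (B (x - y) f) - pr f \<zeta>"
      using B_sym_F[of f y] pts_V[OF y] by (simp add: pr_simps B_simps)
    then show "- cpi * (cor (B x f) - pr f (\<zeta> + cvec y))\<^sup>2 / s f = - cpi * (cor (B (x - y) f) - pr f \<zeta>)\<^sup>2 / s f" by simp
  qed
  also have "\<dots> = psi s \<zeta>" unfolding psi_def
  proof (rule infsum_reindex_bij_betw)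
    show "bij_betw (\<lambda>x. x - y) (pts L) (pts L)"
      by (rule bij_betwI[where g = "\<lambda>x. x + y"]) (use y pts_intros in auto)
  qed
  finally show ?thesis .
qed

text \<open>The complex translation that completes the square when \<open>psi s\<close> is
  multiplied by the character of \<open>- m\<close>.\<close>

definition dsh :: "('a \<Rightarrow> complex) \<Rightarrow> 'a \<Rightarrow> 'a cplx" where
  "dsh s m = (\<Sum>f\<in>F. jl f (\<i> * s f * cor (B m f)))"

lemma dsh_cspan: "dsh s m \<in> cspan L" unfolding dsh_def by (intro cspan_intros F_V)

lemma pr_dsh: "f \<in> F \<Longrightarrow> pr f (dsh s m) = \<i> * s f * cor (eps f * B m f)"
proof -
  assume f: "f \<in> F"
  have "pr f (dsh s m) = (\<Sum>g\<in>F. \<i> * s g * cor (B m g) * cor (B f g))"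
    unfolding dsh_def by (simp add: pr_sum pr_simps)
  also have "\<dots> = (\<Sum>g\<in>F. if f = g then \<i> * s g * cor (B m g) * cor (eps g) else 0)"
    by (rule sum.cong) (use f B_F in auto)
  finally have "pr f (dsh s m) = (\<Sum>g\<in>F. if f = g then \<i> * s g * cor (B m g) * cor (eps g) else 0)" .
  then show ?thesis using f by (simp add: mult_ac)
qed

text \<open>Complete the square in each coordinate. The leftover cross term is
  \<open>2 * cpi * \<i> * cor (B x m)\<close>; it vanishes in the exponential because a lattice
  vector pairs integrally with \<open>m\<close>.\<close>

lemma psi_quasi_periodic:
  assumes s: "\<forall>f\<in>F. s f \<noteq> 0" and m: "m \<in> dual L" and \<zeta>: "\<zeta> \<in> cspan L"
  shows "psi s \<zeta> * ch (- m) \<zeta> = gq s m * psi s (\<zeta> + dsh s m)"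
  unfolding psi_def infsum_cmult_left'[symmetric] infsum_cmult_right'[symmetric]
proof (rule infsum_cong)
  fix x assume x: "x \<in> pts L"
  have eq: "- cpi * (cor (B x f) - pr f (\<zeta> + dsh s m))\<^sup>2 / s f =
      - cpi * (cor (B x f) - pr f \<zeta>)\<^sup>2 / s f + cpi * s f * (cor (B m f))\<^sup>2
      + (2 * cpi * \<i> * cor (eps f * B x f * B m f) - 2 * cpi * \<i> * (cor (eps f * B m f) * pr f \<zeta>))"
    if f: "f \<in> F" for f
  proof -
    define e where "e = cor (eps f)"
    have ee: "e * e = 1" unfolding e_def using eps_cases(3)[of f] by (metis of_real_1 of_real_mult)
    define b c p where "b = cor (B x f)" and "c = cor (B m f)" and "p = pr f \<zeta>"
    have "- cpi * (b - (p + \<i> * s f * (e * c)))\<^sup>2 = - cpi * (b - p)\<^sup>2 + (2 * cpi * \<i> * e * c * (b - p)) * s f + cpi * (s f * s f) * (e * e) * (c * c)"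
      by (simp add: power2_eq_square algebra_simps)
    then have "- cpi * (b - (p + \<i> * s f * (e * c)))\<^sup>2 / s f = - cpi * (b - p)\<^sup>2 / s f + 2 * cpi * \<i> * e * c * (b - p) + cpi * s f * (c * c)"
      using s[rule_format, OF f] unfolding ee by (simp add: add_divide_distrib diff_divide_distrib)
    then show ?thesis using f by (simp add: pr_simps pr_dsh b_def c_def p_def e_def power2_eq_square algebra_simps)
  qed
  have eqN: "(\<Sum>f\<in>F. - cpi * (cor (B x f) - pr f (\<zeta> + dsh s m))\<^sup>2 / s f) =
      (\<Sum>f\<in>F. - cpi * (cor (B x f) - pr f \<zeta>)\<^sup>2 / s f) - (\<Sum>f\<in>F. - cpi * s f * (cor (B m f))\<^sup>2)
      + (2 * cpi * \<i> * cor (B x m) - 2 * cpi * \<i> * pr m \<zeta>)"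
  proof -
    have "cor (B x m) = (\<Sum>f\<in>F. cor (eps f * B x f * B m f))"
      using B_expand[OF dual_V[OF m], of x] by simp
    moreover have "pr m \<zeta> = (\<Sum>f\<in>F. cor (eps f * B m f) * pr f \<zeta>)"
      using pr_expand[OF dual_V[OF m] \<zeta>] B_sym_F[OF _ dual_V[OF m]] by simp
    moreover have "(\<Sum>f\<in>F. - cpi * (cor (B x f) - pr f (\<zeta> + dsh s m))\<^sup>2 / s f) =
      (\<Sum>f\<in>F. - cpi * (cor (B x f) - pr f \<zeta>)\<^sup>2 / s f + cpi * s f * (cor (B m f))\<^sup>2
      + (2 * cpi * \<i> * cor (eps f * B x f * B m f) - 2 * cpi * \<i> * (cor (eps f * B m f) * pr f \<zeta>)))"
      by (rule sum.cong[OF refl]) (rule eq)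
    moreover have "(\<Sum>f\<in>F. - cpi * s f * (cor (B m f))\<^sup>2) = - (\<Sum>f\<in>F. cpi * s f * (cor (B m f))\<^sup>2)"
      by (simp add: sum_negf)
    ultimately show ?thesis
      by (simp only: sum.distrib sum_subtractf sum_distrib_left diff_minus_eq_add)
  qed
  have eX: "exp (2 * cpi * \<i> * cor (B x m)) = 1"
    using ee_Ints[of "cor (B x m)"] dual_pair(2)[OF m x] by (auto simp: ee_def elim!: Ints_cases)
  have eC: "ch (- m) \<zeta> = exp (- (2 * cpi * \<i> * pr m \<zeta>))" by (simp add: ch_def ee_def pr_simps)
  have "gq s m * exp (\<Sum>f\<in>F. - cpi * (cor (B x f) - pr f (\<zeta> + dsh s m))\<^sup>2 / s f) =
      exp ((\<Sum>f\<in>F. - cpi * (cor (B x f) - pr f \<zeta>)\<^sup>2 / s f) + (2 * cpi * \<i> * cor (B x m) + - (2 * cpi * \<i> * pr m \<zeta>)))"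
    unfolding gq_def eqN exp_add[symmetric] by simp
  also have "\<dots> = exp (\<Sum>f\<in>F. - cpi * (cor (B x f) - pr f \<zeta>)\<^sup>2 / s f) * ch (- m) \<zeta>"
    by (simp only: exp_add eX eC mult_1_left)
  finally show "exp (\<Sum>f\<in>F. - cpi * (cor (B x f) - pr f \<zeta>)\<^sup>2 / s f) * ch (- m) \<zeta> =
      gq s m * exp (\<Sum>f\<in>F. - cpi * (cor (B x f) - pr f (\<zeta> + dsh s m))\<^sup>2 / s f)" ..
qed

text \<open>The zeroth Fourier coefficient of \<open>psi s\<close> at the origin, a Gaussian
  integral in disguise. It is evaluated by \<open>cst_eq_prod\<close> and
  \<open>cst_one\<close>.\<close>

definition cst :: "('a \<Rightarrow> complex) \<Rightarrow> complex" where "cst s = avl us (psi s) 0"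

text \<open>\<open>psi s\<close> is entire and periodic along the complex line of each lattice basis
  vector, so its average is constant along these lines, and they generate the complex span.\<close>

lemma avl_psi_const:
  assumes s: "\<forall>f\<in>F. Re (s f) > 0" and \<zeta>: "\<zeta> \<in> cspan L"
  shows "avl us (psi s) \<zeta> = cst s"
proof -
  have step: "avl us (psi s) (\<xi> + jl e z) = avl us (psi s) \<xi>" if "e \<in> E" for \<xi> e z
    by (rule avl_complex_translate[OF linear_jl psi_line_holomorphic[OF s] _ psi_continuous[OF s]])
      (use that us psi_periodic[OF E_pts[OF that]] in \<open>auto simp: jl_1\<close>)
  have "avl us (psi s) (\<Sum>e\<in>A. jl e (g e)) = cst s" if "finite A" "A \<subseteq> E" for A g
    using that
  proof (induction A rule: finite_induct)
    case empty
    then show ?case by (simp add: cst_def)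
  next
    case (insert a A)
    then show ?case using step[of a "\<Sum>e\<in>A. jl e (g e)" "g a"] by (simp add: add.commute)
  qed
  from this[OF finE order_refl, of "\<lambda>e. Complex (co e (fst \<zeta>)) (co e (snd \<zeta>))"]
  show ?thesis using cspan_expand[OF \<zeta>] by simp
qed

text \<open>All Fourier coefficients agree. The one of \<open>psi s\<close> at \<open>m\<close> is
  \<open>gq s m\<close> times the zeroth coefficient at a translated point, and the latter is
  \<open>cst s\<close> at every point.\<close>

lemma psi_eq_dth:
  assumes s: "\<forall>f\<in>F. Re (s f) > 0" and \<zeta>: "\<zeta> \<in> cspan L"
  shows "psi s \<zeta> = cst s * dth s \<zeta>"
proof -
  have s0: "\<forall>f\<in>F. s f \<noteq> 0" using s by force
  have psi_eq: "psi s = (\<lambda>\<zeta>. exp (\<Sum>f\<in>F. - cpi * (pr f \<zeta>)\<^sup>2 / s f) * expsum (pts L) (psw s) (psl s) \<zeta>)"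
    by (rule ext) (rule psi_expsum[OF s0])
  have "psi s \<zeta> - cst s * dth s \<zeta> = 0"
  proof (rule fourier_unique[OF _ _ \<zeta>])
    show "continuous_on UNIV (\<lambda>\<zeta>. psi s \<zeta> - cst s * dth s \<zeta>)"
      by (intro continuous_intros psi_continuous dth_continuous s)
    fix m \<zeta> assume m: "m \<in> dual L" and \<zeta>: "\<zeta> \<in> cspan L"
    have 1: "avl us (\<lambda>\<zeta>. psi s \<zeta> * ch (- m) \<zeta>) \<zeta> = gq s m * cst s"
    proof -
      have "avl us (\<lambda>\<zeta>. psi s \<zeta> * ch (- m) \<zeta>) \<zeta> = avl us (\<lambda>\<zeta>. gq s m * psi s (\<zeta> + dsh s m)) \<zeta>"
        by (rule avl_cong[OF psi_quasi_periodic[OF s0 m] cspan_us \<zeta>])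
      also have "\<dots> = gq s m * avl us (psi s) (\<zeta> + dsh s m)" by (simp add: avl_cmult avl_shift)
      finally show ?thesis using avl_psi_const[OF s cspan_intros(2)[OF \<zeta> dsh_cspan]] by simp
    qed
    have "avl us (\<lambda>\<zeta>. (psi s \<zeta> - cst s * dth s \<zeta>) * ch (- m) \<zeta>) \<zeta> =
       avl us (\<lambda>\<zeta>. psi s \<zeta> * ch (- m) \<zeta> - cst s * (dth s \<zeta> * ch (- m) \<zeta>)) \<zeta>" by (simp add: algebra_simps)
    also have "\<dots> = avl us (\<lambda>\<zeta>. psi s \<zeta> * ch (- m) \<zeta>) \<zeta> - cst s * avl us (\<lambda>\<zeta>. dth s \<zeta> * ch (- m) \<zeta>) \<zeta>"
      by (subst avl_diff) (auto simp: avl_cmult intro!: continuous_intros psi_continuous dth_continuous continuous_ch s)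
    also have "\<dots> = 0" using 1 dth_coefficient[OF s m \<zeta>] by simp
    finally show "avl us (\<lambda>\<zeta>. (psi s \<zeta> - cst s * dth s \<zeta>) * ch (- m) \<zeta>) \<zeta> = 0" .
  qed
  then show ?thesis by simp
qed

lemma cst_cong: "\<forall>f\<in>F. s f = s' f \<Longrightarrow> cst s = cst s'"
  unfolding cst_def psi_def by (simp cong: sum.cong)

text \<open>All widths but the one along \<open>f\<close> are frozen and the argument moves only in
  direction \<open>f\<close>. Both sides of the inversion formula then are one-variable series with
  fixed weights, as the heat equation argument requires.\<close>

lemma cst_derivative:
  assumes s: "\<forall>f\<in>F. Re (s f) > 0" and f: "f \<in> F" and u: "Re u > 0"
  shows "((\<lambda>u. cst (s(f := u))) has_field_derivative cst (s(f := u)) / (2 * u)) (at u)"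
proof -
  have su: "\<forall>g\<in>F. Re ((s(f := u)) g) > 0" if "Re u > 0" for u using s that by auto
  obtain \<zeta> where \<zeta>: "\<zeta> \<in> cspan L" "dth (s(f := u)) \<zeta> \<noteq> 0" using dth_nonzero[OF su[OF u]] by blast
  define z0 where "z0 = pr f \<zeta>"
  \<comment> \<open>The point \<open>\<zeta>\<close> with its coordinate along \<open>f\<close>
    removed; \<open>eps f\<close> compensates for \<open>B f f\<close>. On \<open>zt\<close> this
    coordinate is the free variable and the others stay fixed, and \<open>zt z0\<close> is
    \<open>\<zeta>\<close> again, where the dual series is non-zero.\<close>
  define \<zeta>0 where "\<zeta>0 = \<zeta> + jl f (cor (eps f) * - z0)"
  have \<zeta>0: "\<zeta>0 \<in> cspan L" unfolding \<zeta>0_def by (intro cspan_intros \<zeta> F_V f)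
  have e2: "cor (eps f) * (cor (eps f) :: complex) = 1" using eps_cases(3)[of f] by (metis of_real_1 of_real_mult)
  have p0: "pr f \<zeta>0 = 0"
    using f B_F[OF f f] e2 unfolding \<zeta>0_def z0_def by (simp add: pr_simps mult.assoc mult.left_commute)
  define zt where "zt z = \<zeta>0 + jl f (cor (eps f) * z)" for z
  have zt: "zt z \<in> cspan L" for z unfolding zt_def by (intro cspan_intros \<zeta>0 F_V f)
  have ztf: "pr f (zt z) = z" for z
    using f B_F[OF f f] e2 p0 unfolding zt_def by (simp add: pr_simps mult.assoc mult.left_commute)
  have ztg: "pr g (zt z) = pr g \<zeta>0" if "g \<in> F" "g \<noteq> f" for g z
    using f that B_F[OF that(1) f] unfolding zt_def by (simp add: pr_simps)
  have zt0: "zt z0 = \<zeta>"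
    unfolding zt_def \<zeta>0_def using linear_add[OF linear_jl, of f "cor (eps f) * - z0" "cor (eps f) * z0"]
    by (simp add: add.assoc linear_0[OF linear_jl])
  define w where "w x = exp (\<Sum>g\<in>F - {f}. - cpi * (cor (B x g) - pr g \<zeta>0)\<^sup>2 / s g)" for x
  define w' where "w' x = exp (\<Sum>g\<in>F - {f}. - cpi * s g * (cor (B x g))\<^sup>2) * ch x \<zeta>0" for x
  have psi: "psi (s(f := u)) (zt z) = (\<Sum>\<^sub>\<infinity>x\<in>pts L. w x * exp (- cpi * (cor (B x f) - z)\<^sup>2 / u))" for u z
    unfolding psi_def
  proof (rule infsum_cong)
    fix x
    have "(\<Sum>g\<in>F. - cpi * (cor (B x g) - pr g (zt z))\<^sup>2 / (s(f := u)) g) =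
      - cpi * (cor (B x f) - z)\<^sup>2 / u + (\<Sum>g\<in>F - {f}. - cpi * (cor (B x g) - pr g \<zeta>0)\<^sup>2 / s g)"
      by (subst sum.remove[OF finF f]) (use ztf ztg in \<open>auto intro!: sum.cong\<close>)
    then show "exp (\<Sum>g\<in>F. - cpi * (cor (B x g) - pr g (zt z))\<^sup>2 / (s(f := u)) g) = w x * exp (- cpi * (cor (B x f) - z)\<^sup>2 / u)"
      by (simp only: exp_add w_def mult.commute)
  qed
  have dth: "dth (s(f := u)) (zt z) = (\<Sum>\<^sub>\<infinity>x\<in>dual L. w' x * exp (- cpi * u * (cor (eps f * B x f))\<^sup>2 + 2 * cpi * \<i> * cor (eps f * B x f) * z))"
    for u z :: complex
    unfolding dth_def
  proof (rule infsum_cong)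
    fix x assume x: "x \<in> dual L"
    have "(\<Sum>g\<in>F. - cpi * (s(f := u)) g * (cor (B x g))\<^sup>2) = - cpi * u * (cor (B x f))\<^sup>2 + (\<Sum>g\<in>F - {f}. - cpi * s g * (cor (B x g))\<^sup>2)"
      by (subst sum.remove[OF finF f]) (auto intro!: sum.cong)
    then have 1: "gq (s(f := u)) x = exp (- cpi * u * (cor (B x f))\<^sup>2) * exp (\<Sum>g\<in>F - {f}. - cpi * s g * (cor (B x g))\<^sup>2)"
      unfolding gq_def by (simp only: exp_add)
    have 2: "ch x (zt z) = ch x \<zeta>0 * exp (2 * cpi * \<i> * cor (eps f * B x f) * z)"
      unfolding zt_def by (simp add: ch_add(1)) (simp add: ch_def ee_def pr_simps mult_ac)
    have 3: "(cor (eps f * B x f))\<^sup>2 = (cor (B x f))\<^sup>2"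
      using e2 by (simp add: power_mult_distrib power2_eq_square)
    show "gq (s(f := u)) x * ch x (zt z) = w' x * exp (- cpi * u * (cor (eps f * B x f))\<^sup>2 + 2 * cpi * \<i> * cor (eps f * B x f) * z)"
      unfolding 1 2 3 exp_add w'_def by (simp only: mult_ac)
  qed
  obtain C where C: "C > 0" "\<And>x y. \<bar>B x y\<bar> \<le> C * norm x * norm y" using B_bound by blast
  show ?thesis
  proof (rule theta_factor_derivative'[where I = "pts L" and J = "dual L" and l = "\<lambda>x. B x f" and \<mu> = "\<lambda>x. eps f * B x f" and w = w and w' = w' and ?z0.0 = z0])
    fix \<epsilon> D :: real assume \<epsilon>: "\<epsilon> > 0"
    define g where "g h = (if h = f then \<epsilon> else pi * Re (1 / s h))" for h
    have g: "\<forall>h\<in>F. g h > 0" using \<epsilon> s Re_inverse_pos unfolding g_def by simp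
    obtain \<kappa> where \<kappa>: "\<kappa> > 0" "\<And>x. x \<in> V \<Longrightarrow> \<kappa> * (norm x)\<^sup>2 \<le> (\<Sum>f\<in>F. g f * (B x f)\<^sup>2)" using quad_lower[OF g] by blast
    define H where "H = \<bar>D\<bar> * (C * norm f) + (\<Sum>h\<in>F - {f}. 2 * pi * cmod (pr h \<zeta>0) * cmod (1 / s h) * (C * norm h))"
    define K where "K = (\<Sum>h\<in>F - {f}. pi * (cmod (pr h \<zeta>0))\<^sup>2 * cmod (1 / s h))"
    show "(\<lambda>x. cmod (w x) * exp (- \<epsilon> * (B x f)\<^sup>2 + D * \<bar>B x f\<bar>)) summable_on pts L"
    proof (rule summable_gauss_dominated(1)[OF \<kappa>(1) pts_subset_dual, where C = H and D = K])
      fix x assume x: "x \<in> pts L"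
      have b: "\<bar>B x h\<bar> \<le> C * norm h * norm x" for h using C(2)[of x h] by (simp add: mult_ac)
      have "cmod (w x) = (\<Prod>h\<in>F - {f}. cmod (exp (- cpi * (cor (B x h) - pr h \<zeta>0)\<^sup>2 / s h)))"
        unfolding w_def by (simp only: exp_sum finite_Diff finF prod_norm)
      also have "\<dots> \<le> (\<Prod>h\<in>F - {f}. exp (- (pi * Re (1 / s h)) * (B x h)\<^sup>2 + (2 * pi * cmod (pr h \<zeta>0) * cmod (1 / s h)) * \<bar>B x h\<bar> + pi * (cmod (pr h \<zeta>0))\<^sup>2 * cmod (1 / s h)))"
        by (intro prod_mono conjI norm_ge_zero norm_exp_minus_pi_quotient)
      also have "\<dots> = exp (\<Sum>h\<in>F - {f}. - (pi * Re (1 / s h)) * (B x h)\<^sup>2 + (2 * pi * cmod (pr h \<zeta>0) * cmod (1 / s h)) * \<bar>B x h\<bar> + pi * (cmod (pr h \<zeta>0))\<^sup>2 * cmod (1 / s h))"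
        by (simp add: exp_sum)
      also have "\<dots> \<le> exp (\<Sum>h\<in>F - {f}. - (g h * (B x h)\<^sup>2) + (2 * pi * cmod (pr h \<zeta>0) * cmod (1 / s h)) * (C * norm h) * norm x + pi * (cmod (pr h \<zeta>0))\<^sup>2 * cmod (1 / s h))"
      proof (subst exp_le_cancel_iff, rule sum_mono)
        fix h assume h: "h \<in> F - {f}"
        have "(2 * pi * cmod (pr h \<zeta>0) * cmod (1 / s h)) * \<bar>B x h\<bar> \<le> (2 * pi * cmod (pr h \<zeta>0) * cmod (1 / s h)) * (C * norm h * norm x)"
          using b by (intro mult_left_mono) auto
        moreover have "g h = pi * Re (1 / s h)" using h by (simp add: g_def)
        ultimately show "- (pi * Re (1 / s h)) * (B x h)\<^sup>2 + (2 * pi * cmod (pr h \<zeta>0) * cmod (1 / s h)) * \<bar>B x h\<bar> + pi * (cmod (pr h \<zeta>0))\<^sup>2 * cmod (1 / s h)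
            \<le> - (g h * (B x h)\<^sup>2) + (2 * pi * cmod (pr h \<zeta>0) * cmod (1 / s h)) * (C * norm h) * norm x + pi * (cmod (pr h \<zeta>0))\<^sup>2 * cmod (1 / s h)"
          by (simp only: mult_minus_left mult.assoc)
      qed
      also have "(\<Sum>h\<in>F - {f}. - (g h * (B x h)\<^sup>2) + (2 * pi * cmod (pr h \<zeta>0) * cmod (1 / s h)) * (C * norm h) * norm x + pi * (cmod (pr h \<zeta>0))\<^sup>2 * cmod (1 / s h))
          = - (\<Sum>h\<in>F - {f}. g h * (B x h)\<^sup>2) + (\<Sum>h\<in>F - {f}. 2 * pi * cmod (pr h \<zeta>0) * cmod (1 / s h) * (C * norm h)) * norm x + K"
        unfolding K_def by (simp only: sum.distrib sum_negf sum_distrib_right)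
      finally have w: "cmod (w x) \<le> exp (- (\<Sum>h\<in>F - {f}. g h * (B x h)\<^sup>2) + (\<Sum>h\<in>F - {f}. 2 * pi * cmod (pr h \<zeta>0) * cmod (1 / s h) * (C * norm h)) * norm x + K)" .
      have "D * \<bar>B x f\<bar> \<le> \<bar>D\<bar> * (C * norm f * norm x)" using b[of f] by (intro mult_mono) auto
      then have "cmod (w x) * exp (- \<epsilon> * (B x f)\<^sup>2 + D * \<bar>B x f\<bar>) \<le>
          exp (- (\<Sum>h\<in>F - {f}. g h * (B x h)\<^sup>2) + (\<Sum>h\<in>F - {f}. 2 * pi * cmod (pr h \<zeta>0) * cmod (1 / s h) * (C * norm h)) * norm x + K) * exp (- \<epsilon> * (B x f)\<^sup>2 + \<bar>D\<bar> * (C * norm f * norm x))"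
        by (intro mult_mono w) auto
      also have "\<dots> = exp (- (\<Sum>h\<in>F. g h * (B x h)\<^sup>2) + H * norm x + K)"
        unfolding H_def sum.remove[OF finF f, of "\<lambda>h. g h * (B x h)\<^sup>2"] by (simp add: exp_add[symmetric] g_def algebra_simps)
      also have "\<dots> \<le> exp (- \<kappa> * (norm x)\<^sup>2 + H * norm x + K)" using \<kappa>(2)[OF pts_V[OF x]] by simp
      finally show "norm (cmod (w x) * exp (- \<epsilon> * (B x f)\<^sup>2 + D * \<bar>B x f\<bar>)) \<le> exp (- \<kappa> * (norm x)\<^sup>2 + H * norm x + K)" by simp
    qed
  next
    fix \<epsilon> D :: real assume \<epsilon>: "\<epsilon> > 0"
    define s' where "s' = s(f := cor (\<epsilon> / pi))"
    have s': "\<forall>h\<in>F. Re (s' h) > 0" using \<epsilon> s unfolding s'_def by auto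
    obtain \<kappa> where \<kappa>: "\<kappa> > 0" "\<And>x. x \<in> V \<Longrightarrow> cmod (gq s' x) \<le> exp (- \<kappa> * (norm x)\<^sup>2)" using gq_bound[OF s'] by blast
    obtain C' where C': "C' > 0" "\<And>x \<zeta>. cmod (ch x \<zeta>) \<le> exp (C' * norm x * norm \<zeta>)" using norm_ch_le by blast
    have eb: "(eps f * b)\<^sup>2 = b\<^sup>2" "\<bar>eps f * b\<bar> = \<bar>b\<bar>" for b by (auto simp: eps_def)
    show "(\<lambda>x. cmod (w' x) * exp (- \<epsilon> * (eps f * B x f)\<^sup>2 + D * \<bar>eps f * B x f\<bar>)) summable_on dual L"
      unfolding eb
    proof (rule summable_gauss_dominated(1)[OF \<kappa>(1) order_refl, where C = "C' * norm \<zeta>0 + \<bar>D\<bar> * (C * norm f)" and D = 0])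
      fix x assume x: "x \<in> dual L"
      have "gq s' x = exp (- cpi * cor (\<epsilon> / pi) * (cor (B x f))\<^sup>2) * exp (\<Sum>g\<in>F - {f}. - cpi * s g * (cor (B x g))\<^sup>2)"
      proof -
        have "(\<Sum>g\<in>F - {f}. - cpi * s' g * (cor (B x g))\<^sup>2) = (\<Sum>g\<in>F - {f}. - cpi * s g * (cor (B x g))\<^sup>2)"
          by (rule sum.cong) (auto simp: s'_def)
        moreover have "s' f = cor (\<epsilon> / pi)" by (simp add: s'_def)
        ultimately show ?thesis unfolding gq_def sum.remove[OF finF f] by (simp only: exp_add)
      qed
      also have "- cpi * cor (\<epsilon> / pi) * (cor (B x f))\<^sup>2 = cor (- \<epsilon> * (B x f)\<^sup>2)" by simp
      finally have q: "cmod (gq s' x) = exp (- \<epsilon> * (B x f)\<^sup>2) * cmod (exp (\<Sum>g\<in>F - {f}. - cpi * s g * (cor (B x g))\<^sup>2))"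
        by (simp only: norm_mult norm_exp_eq_Re Re_complex_of_real)
      have "cmod (w' x) * exp (- \<epsilon> * (B x f)\<^sup>2 + D * \<bar>B x f\<bar>) = cmod (gq s' x) * cmod (ch x \<zeta>0) * exp (D * \<bar>B x f\<bar>)"
        by (simp only: q w'_def norm_mult exp_add mult_ac)
      also have "\<dots> \<le> exp (- \<kappa> * (norm x)\<^sup>2) * exp (C' * norm x * norm \<zeta>0) * exp (\<bar>D\<bar> * (C * norm f * norm x))"
      proof -
        have "D * \<bar>B x f\<bar> \<le> \<bar>D\<bar> * (C * norm f * norm x)" using C(2)[of x f] by (intro mult_mono) (auto simp: mult_ac)
        then show ?thesis using \<kappa>(2)[OF dual_V[OF x]] C'(2)[of x \<zeta>0] by (intro mult_mono) auto
      qed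
      also have "\<dots> = exp (- \<kappa> * (norm x)\<^sup>2 + (C' * norm \<zeta>0 + \<bar>D\<bar> * (C * norm f)) * norm x + 0)"
        by (simp add: exp_add[symmetric] algebra_simps)
      finally show "norm (cmod (w' x) * exp (- \<epsilon> * (B x f)\<^sup>2 + D * \<bar>B x f\<bar>)) \<le> exp (- \<kappa> * (norm x)\<^sup>2 + (C' * norm \<zeta>0 + \<bar>D\<bar> * (C * norm f)) * norm x + 0)" by simp
    qed
  next
    fix u z :: complex assume u: "Re u > 0"
    show "(\<Sum>\<^sub>\<infinity>x\<in>pts L. w x * exp (- cpi * (cor (B x f) - z)\<^sup>2 / u)) = cst (s(f := u)) * (\<Sum>\<^sub>\<infinity>x\<in>dual L. w' x * exp (- cpi * u * (cor (eps f * B x f))\<^sup>2 + 2 * cpi * \<i> * cor (eps f * B x f) * z))"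
      unfolding psi[symmetric] dth[symmetric] by (rule psi_eq_dth[OF su[OF u] zt])
  next
    show "(\<Sum>\<^sub>\<infinity>x\<in>dual L. w' x * exp (- cpi * u * (cor (eps f * B x f))\<^sup>2 + 2 * cpi * \<i> * cor (eps f * B x f) * z0)) \<noteq> 0"
      unfolding dth[symmetric] zt0 by (rule \<zeta>(2))
  qed (rule u)
qed

text \<open>\<open>csqrt\<close> solves the same differential equation, so the quotient is constant
  on the right half-plane, which is convex and avoids the branch cut.\<close>

lemma cst_scale_one:
  assumes s: "\<forall>f\<in>F. Re (s f) > 0" and f: "f \<in> F" and u: "Re u > 0"
  shows "cst (s(f := u)) = csqrt u * cst (s(f := 1))"
proof -
  have d: "((\<lambda>u. cst (s(f := u)) / csqrt u) has_field_derivative 0) (at u)" if u: "Re u > 0" for u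
  proof -
    have nz: "csqrt u \<noteq> 0" "u \<noteq> 0" using u by auto
    have dr: "(csqrt has_field_derivative inverse (2 * csqrt u)) (at u)"
      by (rule has_field_derivative_csqrt) (use u in \<open>auto simp: complex_nonpos_Reals_iff\<close>)
    have cs: "csqrt u * csqrt u = u" using power2_csqrt[of u] by (simp add: power2_eq_square)
    have "cst (s(f := u)) / (2 * u) * csqrt u - cst (s(f := u)) * inverse (2 * csqrt u) = 0"
      using nz cs by (simp add: field_simps)
    then show ?thesis using DERIV_divide[OF cst_derivative[OF s f u] dr nz(1)] by (simp only: div_0)
  qed
  have "\<exists>c. \<forall>x\<in>{u. Re u > 0}. cst (s(f := x)) / csqrt x = c"
  proof (rule has_field_derivative_zero_constant)
    show "convex {u. Re u > 0}" by (rule convex_halfspace_Re_gt)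
    show "((\<lambda>u. cst (s(f := u)) / csqrt u) has_field_derivative 0) (at x within {u. Re u > 0})" if "x \<in> {u. Re u > 0}" for x
      using d that has_field_derivative_at_within by blast
  qed
  then obtain c where c: "\<And>x. Re x > 0 \<Longrightarrow> cst (s(f := x)) / csqrt x = c" by auto
  have "cst (s(f := u)) / csqrt u = cst (s(f := 1))" using c[OF u] c[of 1] by simp
  moreover have "csqrt u \<noteq> 0" using u by auto
  ultimately show ?thesis by (simp add: field_simps)
qed

text \<open>The widths are changed from 1 to \<open>s f\<close> one basis vector at a time.\<close>

lemma cst_eq_prod:
  assumes s: "\<forall>f\<in>F. Re (s f) > 0"
  shows "cst s = cst (\<lambda>_. 1) * (\<Prod>f\<in>F. csqrt (s f))"
proof -
  have "cst (\<lambda>f. if f \<in> G then s f else 1) = cst (\<lambda>_. 1) * (\<Prod>f\<in>G. csqrt (s f))" if "finite G" "G \<subseteq> F" for G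
    using that
  proof (induction G rule: finite_induct)
    case empty
    then show ?case by simp
  next
    case (insert g G)
    define t where "t = (\<lambda>f. if f \<in> G then s f else 1)"
    have t: "\<forall>f\<in>F. Re (t f) > 0" using s by (auto simp: t_def)
    have "(\<lambda>f. if f \<in> insert g G then s f else 1) = t(g := s g)" by (auto simp: t_def)
    moreover have "t(g := 1) = t" using insert.hyps by (auto simp: t_def)
    ultimately have "cst (\<lambda>f. if f \<in> insert g G then s f else 1) = csqrt (s g) * cst t"
      using cst_scale_one[OF t, of g "s g"] s insert.prems by simp
    then show ?case using insert by (simp add: t_def mult_ac)
  qed
  from this[OF finF order_refl] show ?thesis
    using cst_cong[of "\<lambda>f. if f \<in> F then s f else 1" s] by simp
qed

end

section \<open>Generators of the metaplectic group\<close>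

lemma uhp_iff: "\<tau> \<in> uhp \<longleftrightarrow> Im \<tau> > 0" by (simp add: uhp_def)

lemma open_uhp: "open uhp" unfolding uhp_def by (rule open_halfspace_Im_gt)

lemma i_uhp: "\<i> \<in> uhp" by (simp add: uhp_iff)

lemma matrix_mult_2: "((A :: real^2^2) ** B) $ i $ j = A $ i $ 1 * B $ 1 $ j + A $ i $ 2 * B $ 2 $ j"
  by (simp add: matrix_matrix_mult_def sum_2)

lemma SL2R_det: "A \<in> SL2R \<Longrightarrow> A $ 1 $ 1 * A $ 2 $ 2 - A $ 1 $ 2 * A $ 2 $ 1 = 1"
  by (simp add: SL2R_def det_2)

lemma SL2R_mult: "A \<in> SL2R \<Longrightarrow> C \<in> SL2R \<Longrightarrow> A ** C \<in> SL2R"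
  by (simp add: SL2R_def det_mul)

lemma SL2Z_SL2R: "A \<in> SL2Z \<Longrightarrow> A \<in> SL2R" by (simp add: SL2Z_def)

lemma SL2Z_mult: "A \<in> SL2Z \<Longrightarrow> C \<in> SL2Z \<Longrightarrow> A ** C \<in> SL2Z"
  by (auto simp: SL2Z_def SL2R_mult matrix_mult_2)

lemma Im_jfac: "Im (jfac A \<tau>) = A $ 2 $ 1 * Im \<tau>" and Re_jfac: "Re (jfac A \<tau>) = A $ 2 $ 1 * Re \<tau> + A $ 2 $ 2"
  by (simp_all add: jfac_def)

lemma jfac_nonzero: assumes "A \<in> SL2R" "\<tau> \<in> uhp" shows "jfac A \<tau> \<noteq> 0"
proof
  assume z: "jfac A \<tau> = 0"
  then have "A $ 2 $ 1 = 0" using Im_jfac[of A \<tau>] assms(2) by (simp add: uhp_iff)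
  moreover from this have "A $ 2 $ 2 = 0" using Re_jfac[of A \<tau>] z by simp
  ultimately show False using SL2R_det[OF assms(1)] by simp
qed

lemma Im_moeb: assumes "A \<in> SL2R" "\<tau> \<in> uhp" shows "Im (moeb A \<tau>) = Im \<tau> / (cmod (jfac A \<tau>))\<^sup>2"
proof -
  define a b c d x y where "a = A $ 1 $ 1" and "b = A $ 1 $ 2" and "c = A $ 2 $ 1" and "d = A $ 2 $ 2"
    and "x = Re \<tau>" and "y = Im \<tau>"
  have "Im (moeb A \<tau>) = ((a * y) * (c * x + d) - (a * x + b) * (c * y)) / (cmod (jfac A \<tau>))\<^sup>2"
    unfolding moeb_def Im_divide cmod_power2 by (simp add: jfac_def a_def b_def c_def d_def x_def y_def)
  also have "(a * y) * (c * x + d) - (a * x + b) * (c * y) = (a * d - b * c) * y" by (simp add: algebra_simps)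
  also have "a * d - b * c = 1" using SL2R_det[OF assms(1)] by (simp add: a_def b_def c_def d_def)
  finally show ?thesis by (simp add: y_def)
qed

lemma moeb_uhp: assumes "A \<in> SL2R" "\<tau> \<in> uhp" shows "moeb A \<tau> \<in> uhp"
  using Im_moeb[OF assms] jfac_nonzero[OF assms] assms(2) by (simp add: uhp_iff)

lemma jfac_mult: assumes "C \<in> SL2R" "\<tau> \<in> uhp"
  shows "jfac (A ** C) \<tau> = jfac A (moeb C \<tau>) * jfac C \<tau>"
  using jfac_nonzero[OF assms] unfolding jfac_def[of A] jfac_def[of "A ** C"] moeb_def
  by (simp add: matrix_mult_2 field_simps) (simp add: jfac_def field_simps)

lemma moeb_mult: assumes "C \<in> SL2R" "\<tau> \<in> uhp"
  shows "moeb (A ** C) \<tau> = moeb A (moeb C \<tau>)"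
proof -
  have nz: "jfac C \<tau> \<noteq> 0" using jfac_nonzero[OF assms] .
  have "of_real ((A ** C) $ 1 $ 1) * \<tau> + of_real ((A ** C) $ 1 $ 2) =
     (of_real (A $ 1 $ 1) * moeb C \<tau> + of_real (A $ 1 $ 2)) * jfac C \<tau>"
    using nz unfolding moeb_def by (simp add: matrix_mult_2 field_simps) (simp add: jfac_def field_simps)
  then show ?thesis using nz unfolding moeb_def[of "A ** C"] jfac_mult[OF assms] moeb_def[of A] by simp
qed

abbreviation mpm :: "mp \<Rightarrow> mp \<Rightarrow> mp" where "mpm g h \<equiv> g \<otimes>\<^bsub>Mp2Z\<^esub> h"

lemma mpm_eq: "mpm g h = (fst g ** fst h, (\<lambda>\<tau>\<in>uhp. snd g (moeb (fst h) \<tau>) * snd h \<tau>))"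
  by (simp add: Mp2Z_def Mp2R_def case_prod_beta)

lemma Mp2Z_iff: "g \<in> carrier Mp2Z \<longleftrightarrow> fst g \<in> SL2Z \<and> snd g \<in> extensional uhp \<and> snd g holomorphic_on uhp \<and>
    (\<forall>\<tau>\<in>uhp. (snd g \<tau>)\<^sup>2 = jfac (fst g) \<tau>)"
  using SL2Z_SL2R by (cases g) (auto simp: Mp2Z_def Mp2R_def)

lemma holomorphic_moeb: "A \<in> SL2R \<Longrightarrow> moeb A holomorphic_on uhp"
  unfolding moeb_def[abs_def] using jfac_nonzero by (auto intro!: holomorphic_intros simp: jfac_def[abs_def])

lemma Mp2Z_closed:
  assumes "g \<in> carrier Mp2Z" "h \<in> carrier Mp2Z" shows "mpm g h \<in> carrier Mp2Z"
proof -
  have g: "fst g \<in> SL2Z" "snd g holomorphic_on uhp" "\<And>\<tau>. \<tau> \<in> uhp \<Longrightarrow> (snd g \<tau>)\<^sup>2 = jfac (fst g) \<tau>"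
    and h: "fst h \<in> SL2Z" "snd h holomorphic_on uhp" "\<And>\<tau>. \<tau> \<in> uhp \<Longrightarrow> (snd h \<tau>)\<^sup>2 = jfac (fst h) \<tau>"
    using assms by (auto simp: Mp2Z_iff)
  note h' = SL2Z_SL2R[OF h(1)]
  have "(\<lambda>\<tau>. snd g (moeb (fst h) \<tau>) * snd h \<tau>) holomorphic_on uhp"
    using holomorphic_on_compose_gen[OF holomorphic_moeb[OF h'] g(2)] moeb_uhp[OF h'] h(2)
    by (auto intro!: holomorphic_on_mult simp: o_def)
  then have "(\<lambda>\<tau>\<in>uhp. snd g (moeb (fst h) \<tau>) * snd h \<tau>) holomorphic_on uhp"
    by (rule holomorphic_transform) simp
  then show ?thesis
    using SL2Z_mult[OF g(1) h(1)] g(3) h(3) moeb_uhp[OF h'] jfac_mult[OF h']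
    by (auto simp: Mp2Z_iff mpm_eq power_mult_distrib)
qed

definition Umat :: "int \<Rightarrow> real^2^2" where "Umat m = vector [vector [1, of_int m], vector [0, 1]]"
definition Smat :: "real^2^2" where "Smat = vector [vector [0, -1], vector [1, 0]]"

lemma Umat_entries: "Umat m $ 1 $ 1 = 1" "Umat m $ 1 $ 2 = of_int m" "Umat m $ 2 $ 1 = 0" "Umat m $ 2 $ 2 = 1"
  and Smat_entries: "Smat $ 1 $ 1 = 0" "Smat $ 1 $ 2 = -1" "Smat $ 2 $ 1 = 1" "Smat $ 2 $ 2 = 0"
  by (simp_all add: Umat_def Smat_def vector_2)

lemma T_mp_eq: "T_mp = (Umat 1, (\<lambda>\<tau>\<in>uhp. 1))" and S_mp_eq: "S_mp = (Smat, (\<lambda>\<tau>\<in>uhp. csqrt \<tau>))"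
  by (simp_all add: T_mp_def S_mp_def Umat_def Smat_def)

lemma Umat_SL2Z: "Umat m \<in> SL2Z" and Smat_SL2Z: "Smat \<in> SL2Z"
  by (auto simp: SL2Z_def SL2R_def det_2 Umat_entries Smat_entries forall_2)

lemma moeb_Umat: "moeb (Umat m) \<tau> = \<tau> + of_int m" and jfac_Umat: "jfac (Umat m) \<tau> = 1"
  and moeb_Smat: "moeb Smat \<tau> = - 1 / \<tau>" and jfac_Smat: "jfac Smat \<tau> = \<tau>"
  by (simp_all add: moeb_def jfac_def Umat_entries Smat_entries)

lemma csqrt_uhp: assumes "\<tau> \<in> uhp" shows "Re (csqrt \<tau>) > 0" "Im (csqrt \<tau>) > 0"
proof -
  have "2 * Re (csqrt \<tau>) * Im (csqrt \<tau>) = Im \<tau>" using power2_csqrt[of \<tau>] by (metis Im_power2)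
  then have "0 < 2 * Re (csqrt \<tau>) * Im (csqrt \<tau>)" using assms by (simp add: uhp_iff)
  moreover have "0 \<le> Re (csqrt \<tau>)" using csqrt_principal[of \<tau>] by auto
  ultimately show "Re (csqrt \<tau>) > 0" "Im (csqrt \<tau>) > 0" by (auto simp: zero_less_mult_iff)
qed

lemma T_mp_carrier: "T_mp \<in> carrier Mp2Z" and S_mp_carrier: "S_mp \<in> carrier Mp2Z"
proof -
  have "(\<lambda>\<tau>\<in>uhp. 1 :: complex) holomorphic_on uhp" by (rule holomorphic_transform[of "\<lambda>_. 1"]) auto
  then show "T_mp \<in> carrier Mp2Z" by (simp add: Mp2Z_iff T_mp_eq Umat_SL2Z jfac_Umat)
  have "csqrt holomorphic_on uhp"
    by (rule holomorphic_on_subset[OF holomorphic_on_csqrt]) (auto simp: uhp_iff complex_nonpos_Reals_iff)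
  then have "(\<lambda>\<tau>\<in>uhp. csqrt \<tau>) holomorphic_on uhp" by (rule holomorphic_transform) auto
  then show "S_mp \<in> carrier Mp2Z" by (simp add: Mp2Z_iff S_mp_eq Smat_SL2Z jfac_Smat)
qed

text \<open>The product squares to -1, and both roots lie in the open first quadrant, so its
  imaginary part is positive. This fixes the sign in the square of \<open>S_mp\<close>.\<close>

lemma csqrt_inverse_uhp: assumes "\<tau> \<in> uhp" shows "csqrt (- 1 / \<tau>) * csqrt \<tau> = \<i>"
proof -
  define w where "w = csqrt (- 1 / \<tau>) * csqrt \<tau>"
  have "\<tau> \<noteq> 0" using assms by (auto simp: uhp_iff)
  then have "w\<^sup>2 = -1" by (simp add: w_def power_mult_distrib)
  then have "(w - \<i>) * (w + \<i>) = 0" by (simp add: algebra_simps power2_eq_square)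
  then have w: "w = \<i> \<or> w = - \<i>" by (auto simp: eq_neg_iff_add_eq_0)
  have "- 1 / \<tau> \<in> uhp" using moeb_uhp[OF SL2Z_SL2R[OF Smat_SL2Z] assms] by (simp add: moeb_Smat)
  then have "Im w > 0" using csqrt_uhp[of "- 1 / \<tau>"] csqrt_uhp[OF assms] unfolding w_def by (simp add: add_pos_pos)
  then have "w = \<i>" using w by auto
  then show ?thesis by (simp add: w_def)
qed

text \<open>Euclid's algorithm on the lower left entry.\<close>

lemma Mp2Z_induct:
  assumes g: "g \<in> carrier Mp2Z" and S: "P S_mp" and T: "P T_mp"
    and mult: "\<And>g h. g \<in> carrier Mp2Z \<Longrightarrow> h \<in> carrier Mp2Z \<Longrightarrow> P g \<Longrightarrow> P h \<Longrightarrow> P (mpm g h)"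
    and cancel: "\<And>g h. g \<in> carrier Mp2Z \<Longrightarrow> h \<in> carrier Mp2Z \<Longrightarrow> P h \<Longrightarrow> P (mpm h g) \<Longrightarrow> P g"
  shows "P g"
proof -
  \<comment> \<open>The \<open>cancel\<close> hypothesis stands in for closure under inverses. It
    makes \<open>P\<close> insensitive to left multiplication by either generator, so that
    \<open>g\<close> can be reduced by row operations.\<close>
  have TP: "P (mpm T_mp g) \<longleftrightarrow> P g" and SP: "P (mpm S_mp g) \<longleftrightarrow> P g" if "g \<in> carrier Mp2Z" for g
    using that S T mult cancel T_mp_carrier S_mp_carrier by blast+
  have U_carrier: "(Umat m ** fst g, snd g) \<in> carrier Mp2Z" if "g \<in> carrier Mp2Z" for g m
  proof -
    have "jfac (Umat m ** fst g) \<tau> = jfac (fst g) \<tau>" for \<tau> by (simp add: jfac_def matrix_mult_2 Umat_entries)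
    then show ?thesis using that SL2Z_mult[OF Umat_SL2Z] by (simp add: Mp2Z_iff)
  qed
  have U_step: "mpm T_mp (Umat m ** fst g, snd g) = (Umat (m + 1) ** fst g, snd g)" if "g \<in> carrier Mp2Z" for g m
  proof -
    have "(\<lambda>\<tau>\<in>uhp. (\<lambda>\<tau>\<in>uhp. 1) (moeb (Umat m ** fst g) \<tau>) * snd g \<tau>) = snd g"
      using that moeb_uhp[OF SL2Z_SL2R[OF SL2Z_mult[OF Umat_SL2Z]]]
      by (intro extensionalityI[of _ uhp]) (auto simp: Mp2Z_iff)
    moreover have "Umat 1 ** (Umat m ** fst g) = Umat (m + 1) ** fst g"
      by (simp add: vec_eq_iff forall_2 matrix_mult_2 Umat_entries algebra_simps)
    ultimately show ?thesis by (simp add: mpm_eq T_mp_eq)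
  qed
  have UP: "P (Umat m ** fst g, snd g) \<longleftrightarrow> P g" if g: "g \<in> carrier Mp2Z" for g and m :: int
  proof (induction m rule: int_induct[of _ 0])
    case base
    have "Umat 0 ** fst g = fst g" by (simp add: vec_eq_iff forall_2 matrix_mult_2 Umat_entries)
    then show ?case by simp
  next
    case (step1 m)
    then show ?case using TP[OF U_carrier[OF g, of m]] U_step[OF g, of m] by simp
  next
    case (step2 m)
    then show ?case using TP[OF U_carrier[OF g, of "m - 1"]] U_step[OF g, of "m - 1"] by simp
  qed
  \<comment> \<open>The elements above \<open>mat 1\<close> and \<open>- mat 1\<close> have a
    constant second component of square 1 or -1. There are four, and multiplying by
    \<open>S_mp\<close> twice runs through them cyclically.\<close>
  define K where "K A z = (A, (\<lambda>\<tau>\<in>uhp. z))" for A :: "real^2^2" and z :: complex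
  have moeb_pm: "moeb A \<tau> = \<tau>" if "A = mat 1 \<or> A = - mat 1" for A \<tau>
    using that by (auto simp: moeb_def jfac_def mat_def)
  have KC: "K A z \<in> carrier Mp2Z" if "A = mat 1 \<and> z\<^sup>2 = 1 \<or> A = - mat 1 \<and> z\<^sup>2 = -1" for A z
  proof -
    have "(\<lambda>\<tau>\<in>uhp. z) holomorphic_on uhp" by (rule holomorphic_transform[of "\<lambda>_. z"]) auto
    then show ?thesis using that by (auto simp: Mp2Z_iff K_def SL2Z_def SL2R_def det_2 mat_def jfac_def)
  qed
  have SSP: "P (K (- A) (\<i> * z)) \<longleftrightarrow> P (K A z)" if A: "A = mat 1 \<and> z\<^sup>2 = 1 \<or> A = - mat 1 \<and> z\<^sup>2 = -1" for A z
  proof -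
    have A': "A = mat 1 \<or> A = - mat 1" using A by auto
    have m1: "moeb A \<tau> = \<tau>" for \<tau> by (rule moeb_pm[OF A'])
    have AC: "fst (K A z) \<in> SL2R" using KC[OF A] SL2Z_SL2R by (auto simp: Mp2Z_iff)
    have m2: "moeb (Smat ** A) \<tau> = - 1 / \<tau>" if "\<tau> \<in> uhp" for \<tau>
      using moeb_mult[OF AC that, of Smat] by (simp add: K_def m1 moeb_Smat)
    have u: "- 1 / \<tau> \<in> uhp" if "\<tau> \<in> uhp" for \<tau>
      using moeb_uhp[OF SL2Z_SL2R[OF Smat_SL2Z] that] by (simp add: moeb_Smat)
    have "mpm S_mp (mpm S_mp (K A z)) = (Smat ** (Smat ** A), (\<lambda>\<tau>\<in>uhp. csqrt (- 1 / \<tau>) * (csqrt \<tau> * z)))"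
      using m1 m2 u by (auto simp: mpm_eq S_mp_eq K_def fun_eq_iff)
    also have "\<dots> = K (- A) (\<i> * z)"
      using csqrt_inverse_uhp unfolding K_def
      by (auto simp: fun_eq_iff mult.assoc[symmetric] vec_eq_iff forall_2 matrix_mult_2 Smat_entries)
    finally show ?thesis using SP[OF KC[OF A]] SP[OF Mp2Z_closed[OF S_mp_carrier KC[OF A]]] by simp
  qed
  have K1: "P (K (mat 1) 1)"
  proof (rule cancel[OF KC T_mp_carrier T])
    have "mpm T_mp (K (mat 1) 1) = T_mp"
      using moeb_pm[of "mat 1"] by (auto simp: mpm_eq K_def T_mp_eq fun_eq_iff)
    then show "P (mpm T_mp (K (mat 1) 1))" using T by simp
  qed simp
  have K2: "P (K (- mat 1) (- \<i>))" using SSP[of "- mat 1" "- \<i>"] K1 by simp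
  have K3: "P (K (mat 1) (- 1))" using SSP[of "mat 1" "- 1"] K2 by simp
  have K4: "P (K (- mat 1) \<i>)" using SSP[of "- mat 1" "\<i>"] K3 by simp
  have "P g" if "g \<in> carrier Mp2Z" "nat \<lfloor>\<bar>fst g $ 2 $ 1\<bar>\<rfloor> = n" for g :: mp and n
    using that
  proof (induction n arbitrary: g rule: less_induct)
    case (less n)
    define A \<phi> where "A = fst g" and "\<phi> = snd g"
    have gA: "A \<in> SL2Z" "\<phi> \<in> extensional uhp" "\<phi> holomorphic_on uhp" "\<And>\<tau>. \<tau> \<in> uhp \<Longrightarrow> (\<phi> \<tau>)\<^sup>2 = jfac A \<tau>"
      using less.prems(1) by (auto simp: Mp2Z_iff A_def \<phi>_def)
    have ints: "A $ i $ j \<in> \<int>" for i j using gA(1) by (simp add: SL2Z_def)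
    obtain a b c d :: int where abcd: "A $ 1 $ 1 = of_int a" "A $ 1 $ 2 = of_int b" "A $ 2 $ 1 = of_int c" "A $ 2 $ 2 = of_int d"
      using ints by (metis Ints_cases)
    have det: "a * d - b * c = 1"
      using SL2R_det[OF SL2Z_SL2R[OF gA(1)]] unfolding abcd by (simp flip: of_int_mult of_int_diff)
    have n: "n = nat \<bar>c\<bar>" using less.prems(2) by (simp add: A_def[symmetric] abcd flip: of_int_abs)
    show ?case
    proof (cases "c = 0")
      case True
      then have ad: "a * d = 1" using det by simp
      then have ad': "a = 1 \<and> d = 1 \<or> a = -1 \<and> d = -1" by (metis zmult_eq_1_iff)
      \<comment> \<open>Since \<open>a\<close> and \<open>d\<close> are both 1 or both -1, adding
        \<open>- b * d\<close> times the second row clears the upper right entry.\<close>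
      define h where "h = (Umat (- b * d) ** A, \<phi>)"
      have h: "h \<in> carrier Mp2Z" using U_carrier[OF less.prems(1)] by (simp add: h_def A_def \<phi>_def)
      have "b - b * (d * d) = 0" using ad' by auto
      then have fh: "fst h = (if d = 1 then mat 1 else - mat 1)"
        using ad' True by (auto simp: h_def vec_eq_iff forall_2 matrix_mult_2 Umat_entries abcd mat_def)
      \<comment> \<open>A continuous function on the connected half-plane with values in a finite
        set, here the square roots of \<open>d\<close>, is constant.\<close>
      have "\<exists>z. \<forall>\<tau>\<in>uhp. \<phi> \<tau> = z"
      proof -
        have sq: "(\<phi> \<tau>)\<^sup>2 = of_int d" if "\<tau> \<in> uhp" for \<tau> using gA(4)[OF that] True by (simp add: jfac_def abcd)
        have "finite {w::complex. w\<^sup>2 = of_int d}"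
        proof (rule finite_subset)
          show "{w::complex. w\<^sup>2 = of_int d} \<subseteq> {csqrt (of_int d), - csqrt (of_int d)}"
            using power2_csqrt by (auto simp: power2_eq_iff) (metis power2_csqrt power2_eq_iff)
        qed simp
        then have "finite (\<phi> ` uhp)" by (rule finite_subset[rotated]) (use sq in auto)
        moreover have "connected (\<phi> ` uhp)"
          using holomorphic_on_imp_continuous_on[OF gA(3)]
          by (intro connected_continuous_image) (auto simp: uhp_def convex_connected convex_halfspace_Im_gt)
        ultimately have "\<phi> ` uhp = {} \<or> (\<exists>z. \<phi> ` uhp = {z})" using connected_finite_iff_sing by blast
        then show ?thesis using i_uhp by blast
      qed
      then obtain z where z: "\<And>\<tau>. \<tau> \<in> uhp \<Longrightarrow> \<phi> \<tau> = z" by blast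
      have z2: "z\<^sup>2 = of_int d" using gA(4)[OF i_uhp] z[OF i_uhp] True by (simp add: jfac_def abcd)
      have "h = K (fst h) z"
        using gA(2) z unfolding K_def h_def by (auto intro!: extensionalityI[of _ uhp])
      moreover have "P (K (fst h) z)"
      proof (cases "d = 1")
        case True
        then have "(z - 1) * (z + 1) = 0" using z2 by (simp add: algebra_simps power2_eq_square)
        then have "z = 1 \<or> z = -1" by (auto simp: eq_neg_iff_add_eq_0)
        then show ?thesis using K1 K3 fh True by auto
      next
        case False
        then have "d = -1" using ad' by auto
        then have "(z - \<i>) * (z + \<i>) = 0" using z2 by (simp add: algebra_simps power2_eq_square)
        then have "z = \<i> \<or> z = - \<i>" by (auto simp: eq_neg_iff_add_eq_0)
        then show ?thesis using K2 K4 fh False by auto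
      qed
      ultimately have "P h" by simp
      then show ?thesis using UP[OF less.prems(1)] by (simp add: h_def A_def \<phi>_def)
    next
      case False
      \<comment> \<open>The row operation replaces \<open>a\<close> by \<open>a mod c\<close>, and
        \<open>S_mp\<close> moves this remainder into the lower left corner, where its absolute
        value is smaller than that of \<open>c\<close>.\<close>
      define h where "h = (Umat (- (a div c)) ** A, \<phi>)"
      have h: "h \<in> carrier Mp2Z" using U_carrier[OF less.prems(1)] by (simp add: h_def A_def \<phi>_def)
      define k where "k = mpm S_mp h"
      have k: "k \<in> carrier Mp2Z" unfolding k_def by (rule Mp2Z_closed[OF S_mp_carrier h])
      have "fst k $ 2 $ 1 = of_int a - of_int (a div c) * of_int c"
        by (simp add: k_def mpm_eq S_mp_eq h_def matrix_mult_2 Smat_entries Umat_entries abcd)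
      also have "\<dots> = of_int (a mod c)" by (simp add: minus_div_mult_eq_mod flip: of_int_mult of_int_diff)
      finally have k21: "fst k $ 2 $ 1 = of_int (a mod c)" .
      have "nat \<lfloor>\<bar>fst k $ 2 $ 1\<bar>\<rfloor> < n" unfolding k21 n using False abs_mod_less[of c a] by (simp flip: of_int_abs)
      from less.IH[OF this k refl] have "P k" .
      then have "P h" unfolding k_def using SP[OF h] by simp
      then show ?thesis using UP[OF less.prems(1)] by (simp add: h_def A_def \<phi>_def)
    qed
  qed
  then show ?thesis using g by blast
qed

section \<open>Transformation of theta functions\<close>

lemma ee_of_real_eq_1: "ee (cor x) = 1 \<longleftrightarrow> x \<in> \<int>"
proof
  assume "ee (cor x) = 1"
  then obtain n :: int where "2 * pi * x = of_int (2 * n) * pi" unfolding ee_def exp_eq_1 by auto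
  then have "x = of_int n" by simp
  then show "x \<in> \<int>" by simp
qed (auto elim!: Ints_cases)

lemma infsum_sum_swap:
  assumes "finite A" "\<And>a. a \<in> A \<Longrightarrow> (f a) summable_on X"
  shows "(\<Sum>a\<in>A. infsum (f a) X) = infsum (\<lambda>x. \<Sum>a\<in>A. f a x :: complex) X"
proof -
  have "((\<lambda>x. \<Sum>a\<in>A. f a x) has_sum (\<Sum>a\<in>A. infsum (f a) X)) X"
    using assms by (induction A rule: finite_induct) (auto intro!: has_sum_add)
  then show ?thesis by (simp add: infsumI)
qed

context theta_lattice
begin

lemma mem_coset: "z \<in> coset L x \<longleftrightarrow> z - x \<in> pts L"
proof
  show "z - x \<in> pts L \<Longrightarrow> z \<in> coset L x" unfolding coset_def by (rule image_eqI[of _ _ "z - x"]) auto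
qed (auto simp: coset_def)

lemma coset_eq_iff: "coset L x = coset L y \<longleftrightarrow> x - y \<in> pts L"
proof
  assume "coset L x = coset L y"
  moreover have "x \<in> coset L x" by (simp add: mem_coset pts_intros)
  ultimately show "x - y \<in> pts L" using mem_coset by auto
next
  assume xy: "x - y \<in> pts L"
  have "z - x \<in> pts L \<longleftrightarrow> z - y \<in> pts L" for z
    using pts_intros(2)[OF _ xy, of "z - x"] pts_intros(3)[OF _ xy, of "z - y"] by auto
  then show "coset L x = coset L y" by (auto simp: mem_coset)
qed

lemma coset_disc: "x \<in> dual L \<Longrightarrow> coset L x \<in> disc L" by (simp add: disc_def)

lemma disc_mem: assumes "\<gamma> \<in> disc L" "x \<in> \<gamma>" shows "x \<in> dual L" "coset L x = \<gamma>"
proof -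
  obtain y where y: "y \<in> dual L" "\<gamma> = coset L y" using assms(1) by (auto simp: disc_def)
  have xy: "x - y \<in> pts L" using assms(2) y mem_coset by simp
  then show "coset L x = \<gamma>" using y coset_eq_iff by simp
  show "x \<in> dual L" using dual_intros(2)[OF y(1) pts_dual[OF xy]] by simp
qed

lemma rep_mem: assumes "\<gamma> \<in> disc L" shows "rep \<gamma> \<in> \<gamma>"
proof -
  obtain x where "\<gamma> = coset L x" using assms by (auto simp: disc_def)
  then have "x \<in> \<gamma>" by (simp add: mem_coset pts_intros)
  then show ?thesis unfolding rep_def by (rule someI)
qed

lemma rep_dual: "\<gamma> \<in> disc L \<Longrightarrow> rep \<gamma> \<in> dual L" and coset_rep: "\<gamma> \<in> disc L \<Longrightarrow> coset L (rep \<gamma>) = \<gamma>"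
  using disc_mem rep_mem by auto

lemma rep_coset: "x \<in> dual L \<Longrightarrow> rep (coset L x) - x \<in> pts L"
  using rep_mem[OF coset_disc] mem_coset by blast

lemma ee_pair_cong:
  assumes "x \<in> dual L" "y \<in> dual L" "x - x' \<in> pts L" "y - y' \<in> pts L"
  shows "ee (cor (B x y)) = ee (cor (B x' y'))"
proof -
  have x': "x' \<in> dual L" using dual_intros(3)[OF assms(1) pts_dual[OF assms(3)]] by simp
  have "B x y = B x' y' + (B (x - x') y + B x' (y - y'))" by (simp add: B_simps)
  moreover have "B (x - x') y + B x' (y - y') \<in> \<int>"
    using dual_pair(2)[OF assms(2,3)] dual_pair(1)[OF x' assms(4)] by simp
  then have "ee (cor (B (x - x') y + B x' (y - y'))) = 1" using ee_of_real_eq_1 by blast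
  ultimately show ?thesis by (simp only: of_real_add ee_add mult_1_right)
qed

text \<open>Subtracting the integral parts of the coordinates gives every class a representative of
  norm at most \<open>R\<close>. Only finitely many dual vectors satisfy such a bound, as they are
  determined by bounded integer pairings with \<open>E\<close>.\<close>

lemma finite_disc: "finite (disc L)"
proof -
  obtain C where C: "C > 0" "\<And>x y. \<bar>B x y\<bar> \<le> C * norm x * norm y" using B_bound by blast
  define R where "R = (\<Sum>e\<in>E. norm e)"
  define S where "S = {x \<in> dual L. norm x \<le> R}"
  define h where "h x = (\<lambda>e\<in>E. \<lfloor>B x e\<rfloor>)" for x
  have hB: "of_int (h x e) = B x e" if "x \<in> dual L" "e \<in> E" for x e
    using dual_pair(1)[OF that(1) E_pts[OF that(2)]] that by (simp add: h_def)
  have "inj_on h S"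
  proof (rule inj_onI)
    fix x y assume xy: "x \<in> S" "y \<in> S" "h x = h y"
    then have d: "x \<in> dual L" "y \<in> dual L" by (auto simp: S_def)
    show "x = y"
    proof (rule B_eqI)
      fix e assume "e \<in> E"
      then show "B x e = B y e" using hB[OF d(1)] hB[OF d(2)] xy(3) by metis
    qed (use d dual_V in auto)
  qed
  moreover have "h ` S \<subseteq> (\<Pi>\<^sub>E e\<in>E. {- \<lceil>C * R * norm e\<rceil>..\<lceil>C * R * norm e\<rceil>})"
  proof (intro subsetI PiE_I)
    fix f e assume f: "f \<in> h ` S" and e: "e \<in> E"
    then obtain x where x: "f = h x" "x \<in> dual L" "norm x \<le> R" by (auto simp: S_def)
    have "\<bar>B x e\<bar> \<le> C * norm x * norm e" by (rule C(2))
    also have "\<dots> \<le> C * R * norm e" using x(3) C(1) by (intro mult_mono mult_left_mono) (auto simp: R_def sum_nonneg)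
    finally have "\<bar>of_int (h x e)\<bar> \<le> C * R * norm e" using hB[OF x(2) e] by simp
    then show "f e \<in> {- \<lceil>C * R * norm e\<rceil>..\<lceil>C * R * norm e\<rceil>}" unfolding x(1) by (simp add: abs_le_iff) linarith
  qed (auto simp: h_def)
  ultimately have "finite S"
    using finite_PiE[OF finE, of "\<lambda>e. {- \<lceil>C * R * norm e\<rceil>..\<lceil>C * R * norm e\<rceil>}"] inj_on_finite by blast
  moreover have "disc L \<subseteq> coset L ` S"
  proof
    fix \<gamma> assume g: "\<gamma> \<in> disc L"
    define x where "x = rep \<gamma>"
    have x: "x \<in> dual L" "coset L x = \<gamma>" using rep_dual[OF g] coset_rep[OF g] by (auto simp: x_def)
    define y where "y = (\<Sum>e\<in>E. of_int \<lfloor>co e x\<rfloor> *\<^sub>R e)"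
    have y: "y \<in> pts L" unfolding ptsE y_def by (auto intro!: exI[of _ "\<lambda>e. \<lfloor>co e x\<rfloor>"])
    have "x - y = (\<Sum>e\<in>E. frac (co e x) *\<^sub>R e)"
    proof -
      have "(\<Sum>e\<in>E. co e x *\<^sub>R e) - y = (\<Sum>e\<in>E. frac (co e x) *\<^sub>R e)"
        unfolding y_def by (simp add: sum_subtractf[symmetric] scaleR_left_diff_distrib[symmetric] frac_def)
      then show ?thesis using co_expand[OF dual_V[OF x(1)]] by simp
    qed
    also have "norm \<dots> \<le> (\<Sum>e\<in>E. norm (frac (co e x) *\<^sub>R e))" by (rule norm_sum)
    also have "\<dots> \<le> R" unfolding R_def
      by (rule sum_mono) (auto simp: frac_ge_0 frac_lt_1 less_imp_le intro!: mult_left_le_one_le)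
    finally have "x - y \<in> S" using dual_intros(3)[OF x(1) pts_dual[OF y]] by (simp add: S_def)
    moreover have "coset L (x - y) = \<gamma>" using x(2) coset_eq_iff[of "x - y" x] pts_intros(4)[OF y] by simp
    ultimately show "\<gamma> \<in> coset L ` S" by blast
  qed
  ultimately show ?thesis using finite_subset by blast
qed

lemma disc_nonempty: "disc L \<noteq> {}" using coset_disc[OF dual_intros(1)] by blast

lemma card_disc_pos: "card (disc L) > 0" using finite_disc disc_nonempty by (simp add: card_gt_0_iff)

lemma infsum_dual_disc:
  fixes f :: "'a \<Rightarrow> complex"
  assumes "f summable_on dual L"
  shows "infsum f (dual L) = (\<Sum>\<gamma>\<in>disc L. infsum f \<gamma>)"
proof -
  have U: "(\<Union>\<gamma>\<in>disc L. \<gamma>) = dual L"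
  proof (intro equalityI subsetI)
    fix x assume "x \<in> dual L"
    then show "x \<in> (\<Union>\<gamma>\<in>disc L. \<gamma>)"
      by (intro UN_I[of "coset L x"] coset_disc) (simp_all add: mem_coset pts_intros)
  qed (use disc_mem(1) in blast)
  have "(\<Sum>\<gamma>\<in>disc L. infsum f \<gamma>) = infsum f (\<Union>\<gamma>\<in>disc L. \<gamma>)"
  proof (rule sum_infsum[OF finite_disc])
    show "f summable_on \<gamma>" if "\<gamma> \<in> disc L" for \<gamma>
      by (rule summable_on_subset_banach[OF assms]) (use that disc_mem in blast)
    show "\<gamma> \<inter> \<delta> = {}" if "\<gamma> \<in> disc L" "\<delta> \<in> disc L" "\<gamma> \<noteq> \<delta>" for \<gamma> \<delta>
      using that disc_mem(2) by blast
  qed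
  then show ?thesis unfolding U by simp
qed

text \<open>For \<open>m\<close> outside the lattice, \<open>double_dual\<close> yields a dual
  vector \<open>d\<close> with non-integral \<open>B m d\<close>. Translating all classes by
  \<open>d\<close> multiplies the sum by a factor different from 1, so the sum is 0.\<close>

lemma character_sum:
  assumes m: "m \<in> dual L"
  shows "(\<Sum>\<gamma>\<in>disc L. ee (cor (B m (rep \<gamma>)))) = (if m \<in> pts L then of_nat (card (disc L)) else 0)"
proof (cases "m \<in> pts L")
  case True
  have "ee (cor (B m (rep \<gamma>))) = 1" if "\<gamma> \<in> disc L" for \<gamma>
    using dual_pair(2)[OF rep_dual[OF that] True] ee_of_real_eq_1 by blast
  then show ?thesis using True by simp
next
  case False
  then obtain d where d: "d \<in> dual L" "B m d \<notin> \<int>" using double_dual[OF dual_V[OF m]] by blast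
  define c where "c = ee (cor (B m d))"
  have c1: "c \<noteq> 1" unfolding c_def using d(2) ee_of_real_eq_1 by blast
  define \<sigma> where "\<sigma> \<gamma> = coset L (rep \<gamma> + d)" for \<gamma>
  define \<sigma>' where "\<sigma>' \<gamma> = coset L (rep \<gamma> - d)" for \<gamma>
  have \<sigma>: "\<sigma> \<gamma> \<in> disc L" "\<sigma>' \<gamma> \<in> disc L" if "\<gamma> \<in> disc L" for \<gamma>
    using rep_dual[OF that] d(1) unfolding \<sigma>_def \<sigma>'_def by (intro coset_disc dual_intros; simp)+
  have inv: "\<sigma>' (\<sigma> \<gamma>) = \<gamma>" "\<sigma> (\<sigma>' \<gamma>) = \<gamma>" if g: "\<gamma> \<in> disc L" for \<gamma>
  proof -
    have "rep (\<sigma> \<gamma>) - (rep \<gamma> + d) \<in> pts L" "rep (\<sigma>' \<gamma>) - (rep \<gamma> - d) \<in> pts L"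
      unfolding \<sigma>_def \<sigma>'_def using rep_dual[OF g] d(1) by (intro rep_coset dual_intros; simp)+
    then have "coset L (rep (\<sigma> \<gamma>) - d) = coset L (rep \<gamma>)" "coset L (rep (\<sigma>' \<gamma>) + d) = coset L (rep \<gamma>)"
      unfolding coset_eq_iff by (simp_all add: algebra_simps)
    then show "\<sigma>' (\<sigma> \<gamma>) = \<gamma>" "\<sigma> (\<sigma>' \<gamma>) = \<gamma>" unfolding \<sigma>_def[of "\<sigma>' \<gamma>"] \<sigma>'_def[of "\<sigma> \<gamma>"] using coset_rep[OF g] by simp_all
  qed
  have bij: "bij_betw \<sigma> (disc L) (disc L)"
    by (rule bij_betwI[where g = \<sigma>']) (use \<sigma> inv in auto)
  define s where "s = (\<Sum>\<gamma>\<in>disc L. ee (cor (B m (rep \<gamma>))))"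
  have "s = (\<Sum>\<gamma>\<in>disc L. ee (cor (B m (rep (\<sigma> \<gamma>)))))"
    unfolding s_def using sum.reindex_bij_betw[OF bij, of "\<lambda>\<gamma>. ee (cor (B m (rep \<gamma>)))"] by simp
  also have "\<dots> = (\<Sum>\<gamma>\<in>disc L. c * ee (cor (B m (rep \<gamma>))))"
  proof (rule sum.cong[OF refl])
    fix \<gamma> assume g: "\<gamma> \<in> disc L"
    have rd: "rep \<gamma> + d \<in> dual L" using rep_dual[OF g] d(1) by (rule dual_intros)
    have "ee (cor (B m (rep (\<sigma> \<gamma>)))) = ee (cor (B m (rep \<gamma> + d)))"
      by (rule ee_pair_cong[OF m]) (use \<sigma>[OF g] rep_dual rep_coset[OF rd] pts_intros(1) in \<open>auto simp: \<sigma>_def\<close>)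
    then show "ee (cor (B m (rep (\<sigma> \<gamma>)))) = c * ee (cor (B m (rep \<gamma>)))"
      by (simp add: c_def B_simps ee_add)
  qed
  also have "\<dots> = c * s" by (simp add: s_def sum_distrib_left)
  finally have "(1 - c) * s = 0" by (simp add: algebra_simps)
  then show ?thesis using c1 False by (simp add: s_def)
qed

section \<open>The inversion factor at width one\<close>

lemma psi_cvec:
  "psi s (- cvec x0) = (\<Sum>\<^sub>\<infinity>x\<in>coset L x0. exp (\<Sum>f\<in>F. - cpi * (cor (B x f))\<^sup>2 / s f))" if "x0 \<in> V"
proof -
  have "psi s (- cvec x0) = (\<Sum>\<^sub>\<infinity>x\<in>pts L. exp (\<Sum>f\<in>F. - cpi * (cor (B (x0 + x) f))\<^sup>2 / s f))"
    unfolding psi_def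
  proof (intro infsum_cong arg_cong[where f = exp] sum.cong refl)
    fix x f assume f: "f \<in> F"
    have "pr f (- cvec x0) = - cor (B f x0)" by (simp add: cvec_simps(4)[symmetric] pr_simps B_simps)
    then have "cor (B x f) - pr f (- cvec x0) = cor (B (x0 + x) f)"
      using B_sym_F[OF f that] by (simp add: B_simps)
    then show "- cpi * (cor (B x f) - pr f (- cvec x0))\<^sup>2 / s f = - cpi * (cor (B (x0 + x) f))\<^sup>2 / s f" by simp
  qed
  also have "\<dots> = (\<Sum>\<^sub>\<infinity>x\<in>coset L x0. exp (\<Sum>f\<in>F. - cpi * (cor (B x f))\<^sup>2 / s f))"
    unfolding coset_def by (subst infsum_reindex) (auto simp: inj_on_def o_def)
  finally show ?thesis .
qed

lemma ch_cvec: "ch m (- cvec x) = ee (cor (- B m x))"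
  by (simp add: ch_def cvec_simps(4)[symmetric] pr_simps B_simps)

text \<open>Summed over all classes, the characters project the dual lattice onto the lattice
  itself.\<close>

lemma dth_cvec_disc:
  assumes s: "\<forall>f\<in>F. Re (s f) > 0"
  shows "(\<Sum>\<gamma>\<in>disc L. dth s (- cvec (rep \<gamma>))) = of_nat (card (disc L)) * infsum (gq s) (pts L)"
proof -
  have sm: "(\<lambda>m. gq s m * ch m \<zeta>) summable_on dual L" for \<zeta>
    by (rule summable_on_dominated[OF dth_summable[OF s, of \<zeta>]]) simp
  have "(\<Sum>\<gamma>\<in>disc L. dth s (- cvec (rep \<gamma>))) = (\<Sum>\<^sub>\<infinity>m\<in>dual L. \<Sum>\<gamma>\<in>disc L. gq s m * ch m (- cvec (rep \<gamma>)))"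
    unfolding dth_def by (rule infsum_sum_swap[OF finite_disc sm])
  also have "\<dots> = (\<Sum>\<^sub>\<infinity>m\<in>dual L. if m \<in> pts L then of_nat (card (disc L)) * gq s m else 0)"
  proof (rule infsum_cong)
    fix m assume m: "m \<in> dual L"
    have "(\<Sum>\<gamma>\<in>disc L. gq s m * ch m (- cvec (rep \<gamma>))) = gq s m * (\<Sum>\<gamma>\<in>disc L. ee (cor (B (- m) (rep \<gamma>))))"
      by (simp add: sum_distrib_left ch_cvec B_simps)
    also have "\<dots> = (if m \<in> pts L then of_nat (card (disc L)) * gq s m else 0)"
      using character_sum[OF dual_intros(4)[OF m]] pts_intros(4)[of m] pts_intros(4)[of "- m"] by auto
    finally show "(\<Sum>\<gamma>\<in>disc L. gq s m * ch m (- cvec (rep \<gamma>))) = (if m \<in> pts L then of_nat (card (disc L)) * gq s m else 0)" .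
  qed
  also have "\<dots> = (\<Sum>\<^sub>\<infinity>m\<in>pts L. of_nat (card (disc L)) * gq s m)"
    by (rule infsum_cong_neutral) (use pts_dual in auto)
  finally show ?thesis by (simp add: infsum_cmult_right')
qed

text \<open>Let \<open>G\<close> and \<open>H\<close> be the Gaussian sums over the lattice and over
  its dual. Inversion at the origin gives \<open>G = cst s * H\<close>; inversion summed over all
  classes gives \<open>H = cst s * card (disc L) * G\<close>. So the square of \<open>cst s\<close>
  is \<open>1 / card (disc L)\<close>, and \<open>G / H\<close> is positive.\<close>

lemma cst_one: "cst (\<lambda>_. 1) = 1 / cor (sqrt (real (card (disc L))))"
proof -
  define s :: "'a \<Rightarrow> complex" where "s = (\<lambda>_. 1)"
  have s: "\<forall>f\<in>F. Re (s f) > 0" by (simp add: s_def)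
  define w where "w x = exp (- pi * (Qp x + Qm x))" for x
  have gq: "gq s x = cor (w x)" for x
    by (simp add: gq_def s_def w_def sum_F Qp_def Qm_def sum_distrib_left sum_negf exp_of_real[symmetric] distrib_left)
  have smc: "gq s summable_on dual L"
    using summable_on_dominated[OF dth_summable[OF s, of 0], of "gq s"] by (simp add: ch_def pr_simps norm_mult)
  have sm: "w summable_on dual L"
    using summable_on_Re[OF smc] by (simp add: gq)
  note smp = summable_on_subset_banach[OF sm pts_subset_dual]
  define G H where "G = infsum w (pts L)" and "H = infsum w (dual L)"
  have Gc: "infsum (gq s) (pts L) = cor G" "infsum (gq s) (dual L) = cor H"
    unfolding gq G_def H_def
    by (intro infsumI has_sum_of_real has_sum_infsum smp sm)+
  have pos: "G > 0" "H > 0"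
  proof -
    have "w 0 \<le> G" unfolding G_def
      using finite_sum_le_infsum[OF smp, of "{0}"] pts_intros(1) by (simp add: w_def)
    moreover have "w 0 \<le> H" unfolding H_def
      using finite_sum_le_infsum[OF sm, of "{0}"] dual_intros(1) by (simp add: w_def)
    moreover have "w 0 > 0" by (simp add: w_def)
    ultimately show "G > 0" "H > 0" by auto
  qed
  have psw: "exp (\<Sum>f\<in>F. - cpi * (cor (B x f))\<^sup>2 / s f) = gq s x" for x by (simp add: gq_def s_def)
  have z: "- cvec 0 = (0 :: 'a cplx)" by (simp add: cvec_simps)
  have "cor G = cst s * cor H"
  proof -
    have c0: "coset L 0 = pts L" by (auto simp: mem_coset)
    have "psi s 0 = cor G" using psi_cvec[OF V_intros(1), of s] unfolding psw z c0 Gc .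
    moreover have "dth s 0 = cor H" by (simp add: dth_def ch_def pr_simps Gc)
    ultimately show ?thesis using psi_eq_dth[OF s cspan_intros(1)] by simp
  qed
  moreover have "cor H = cst s * (of_nat (card (disc L)) * cor G)"
  proof -
    have "cor H = (\<Sum>\<gamma>\<in>disc L. infsum (gq s) \<gamma>)" unfolding Gc[symmetric] by (rule infsum_dual_disc[OF smc])
    also have "\<dots> = (\<Sum>\<gamma>\<in>disc L. cst s * dth s (- cvec (rep \<gamma>)))"
    proof (rule sum.cong[OF refl])
      fix \<gamma> assume g: "\<gamma> \<in> disc L"
      have V: "rep \<gamma> \<in> V" using rep_dual[OF g] dual_V by blast
      have "- cvec (rep \<gamma>) \<in> cspan L" using cspan_intros(4)[OF V_intros(4)[OF V]] by (simp add: cvec_simps)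
      from psi_eq_dth[OF s this] show "infsum (gq s) \<gamma> = cst s * dth s (- cvec (rep \<gamma>))"
        unfolding psi_cvec[OF V] psw coset_rep[OF g] .
    qed
    also have "\<dots> = cst s * (of_nat (card (disc L)) * cor G)"
      by (simp add: sum_distrib_left[symmetric] dth_cvec_disc[OF s] Gc)
    finally show ?thesis .
  qed
  ultimately have eq: "cor G = cst s * (cst s * (of_nat (card (disc L)) * cor G))" by simp
  define k where "k = G / H"
  have k: "cst s = cor k" "k > 0"
    using \<open>cor G = cst s * cor H\<close> pos by (simp_all add: k_def field_simps)
  have "cor G = cor (k * (k * (real (card (disc L)) * G)))" using eq by (simp add: k)
  then have "G = k * (k * (real (card (disc L)) * G))" by (simp only: of_real_eq_iff)
  then have kk: "k * k * real (card (disc L)) = 1" using pos by simp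
  then have "sqrt (real (card (disc L))) = 1 / k"
    using k(2) by (intro real_sqrt_unique) (auto simp: power2_eq_square field_simps)
  then show ?thesis using k by (simp add: s_def[symmetric])
qed

text \<open>The widths for which the Gaussian \<open>gq\<close> becomes the summand of the Siegel
  theta function. Conjugation on the negative vectors gives positive real parts throughout.\<close>

definition sv :: "complex \<Rightarrow> 'a \<Rightarrow> complex" where "sv \<tau> f = (if f \<in> Fp then - \<i> * \<tau> else \<i> * cnj \<tau>)"

lemma sv_cases: "f \<in> Fp \<Longrightarrow> sv \<tau> f = - \<i> * \<tau>" "f \<in> Fm \<Longrightarrow> sv \<tau> f = \<i> * cnj \<tau>"
  using F_disjoint by (auto simp: sv_def)

lemma sv_pos: "\<tau> \<in> uhp \<Longrightarrow> \<forall>f\<in>F. Re (sv \<tau> f) > 0"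
  by (simp add: sv_def uhp_iff)

lemma ee_qexpt: "ee (qexpt L v \<tau> x) = gq (sv \<tau>) x"
proof -
  have "(\<Sum>f\<in>F. - cpi * sv \<tau> f * (cor (B x f))\<^sup>2) =
     cpi * \<i> * \<tau> * cor (Qp x) - cpi * \<i> * cnj \<tau> * cor (Qm x)"
    by (simp add: sum_F sv_cases Qp_def Qm_def sum_distrib_left sum_negf mult_ac cong: sum.cong)
  also have "\<dots> = 2 * cpi * \<i> * qexpt L v \<tau> x" by (simp add: qexpt_eq algebra_simps)
  finally show ?thesis by (simp add: ee_def gq_def)
qed

abbreviation th :: "complex \<Rightarrow> 'a cplx \<Rightarrow> 'a gring" where "th \<equiv> siegel_theta L v"

lemma siegel_theta_eq: "\<gamma> \<in> disc L \<Longrightarrow> th \<tau> \<zeta> \<gamma> = (\<Sum>\<^sub>\<infinity>x\<in>\<gamma>. gq (sv \<tau>) x * ch x \<zeta>)"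
  by (simp add: siegel_theta_def ee_add ee_qexpt ch_def pr_def)

lemma siegel_summable:
  assumes "\<tau> \<in> uhp" shows "(\<lambda>x. gq (sv \<tau>) x * ch x \<zeta>) summable_on dual L"
  by (rule summable_on_dominated[OF dth_summable[OF sv_pos[OF assms], of \<zeta>]]) simp

lemma siegel_gring: "th \<tau> \<zeta> \<in> gring L"
  by (simp add: siegel_theta_def gring_def)

lemma pr_cscale: "pr x (cscale c \<xi>) = c * pr x \<xi>"
  by (simp add: pr_eq cscale_def B_simps complex_eq_iff)

lemma pr_proj_plus: assumes "\<zeta> \<in> cspan L" "f \<in> F"
  shows "pr f (cmap (oproj L (fst v)) \<zeta>) = (if f \<in> Fp then pr f \<zeta> else 0)"
proof -
  have "B f (oproj L (fst v) a) = (if f \<in> Fp then B f a else 0)" if "a \<in> V" for a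
  proof -
    have "B f (oproj L (fst v) a) = (\<Sum>g\<in>Fp. if f = g then B a g * eps g else 0)"
      unfolding oproj_plus using B_F assms(2) by (auto simp: B_sum_right B_simps F_def intro!: sum.cong)
    also have "\<dots> = (if f \<in> Fp then B a f else 0)" using finFp eps_cases by simp
    finally show ?thesis using B_sym_F[OF assms(2) that] by simp
  qed
  then show ?thesis using assms by (auto simp: pr_eq cmap_def cspan_iff complex_eq_iff)
qed

lemma pr_proj_minus: assumes "\<zeta> \<in> cspan L" "f \<in> F"
  shows "pr f (cmap (oproj L (snd v)) \<zeta>) = (if f \<in> Fm then pr f \<zeta> else 0)"
proof -
  have "B f (oproj L (snd v) a) = (if f \<in> Fm then B f a else 0)" if "a \<in> V" for a
  proof -
    have "B f (oproj L (snd v) a) = (\<Sum>g\<in>Fm. if f = g then - B a g * eps g else 0)"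
      unfolding oproj_minus using B_F assms(2) by (auto simp: B_sum_right B_simps F_def intro!: sum.cong)
    also have "\<dots> = (if f \<in> Fm then B a f else 0)" using finFm eps_cases by simp
    finally show ?thesis using B_sym_F[OF assms(2) that] by simp
  qed
  then show ?thesis using assms by (auto simp: pr_eq cmap_def cspan_iff complex_eq_iff)
qed

lemma proj_V: "oproj L (fst v) x \<in> V" "oproj L (snd v) x \<in> V"
  unfolding oproj_plus oproj_minus using F_V by (auto intro!: V_intros simp: F_def)

lemma cscale_cspan: "\<zeta> \<in> cspan L \<Longrightarrow> cscale c \<zeta> \<in> cspan L"
  by (simp add: cspan_iff cscale_def V_intros)

lemma cmap_cspan: "cmap (oproj L (fst v)) \<zeta> \<in> cspan L" "cmap (oproj L (snd v)) \<zeta> \<in> cspan L"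
  by (simp_all add: cspan_iff cmap_def proj_V)

lemma cspan_eqI: assumes "\<zeta> \<in> cspan L" "\<xi> \<in> cspan L" "\<And>f. f \<in> F \<Longrightarrow> pr f \<zeta> = pr f \<xi>" shows "\<zeta> = \<xi>"
proof -
  have eq: "B f (fst \<zeta>) = B f (fst \<xi>)" "B f (snd \<zeta>) = B f (snd \<xi>)" if "f \<in> F" for f
    using assms(3)[OF that] by (simp_all add: pr_eq complex_eq_iff)
  have "x - y = 0" if "x \<in> V" "y \<in> V" "\<And>f. f \<in> F \<Longrightarrow> B f x = B f y" for x y
    by (rule nondegenerate_F) (use that in \<open>auto simp: V_intros B_simps B_sym_F[symmetric]\<close>)
  then have "fst \<zeta> - fst \<xi> = 0" "snd \<zeta> - snd \<xi> = 0" using assms(1,2) eq by (auto simp: cspan_iff)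
  then show ?thesis by (simp add: prod_eq_iff)
qed

text \<open>The substitution in the elliptic variable that belongs to the matrix in the Jacobi
  transformation law.\<close>

definition gact :: "real^2^2 \<Rightarrow> complex \<Rightarrow> 'a cplx \<Rightarrow> 'a cplx" where
  "gact A \<tau> \<zeta> = cscale (1 / jfac A \<tau>) (cmap (oproj L (fst v)) \<zeta>) + cscale (1 / cnj (jfac A \<tau>)) (cmap (oproj L (snd v)) \<zeta>)"

lemma gact_cspan: "gact A \<tau> \<zeta> \<in> cspan L"
  unfolding gact_def by (intro cspan_intros cscale_cspan cmap_cspan)

lemma pr_gact: assumes "\<zeta> \<in> cspan L"
  shows "f \<in> Fp \<Longrightarrow> pr f (gact A \<tau> \<zeta>) = pr f \<zeta> / jfac A \<tau>" "f \<in> Fm \<Longrightarrow> pr f (gact A \<tau> \<zeta>) = pr f \<zeta> / cnj (jfac A \<tau>)"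
  using F_disjoint pr_proj_plus[OF assms] pr_proj_minus[OF assms]
  by (auto simp: gact_def pr_simps pr_cscale F_def)

definition zp :: "'a cplx \<Rightarrow> complex" where "zp \<zeta> = (\<Sum>f\<in>Fp. (pr f \<zeta>)\<^sup>2)"
definition zm :: "'a cplx \<Rightarrow> complex" where "zm \<zeta> = - (\<Sum>f\<in>Fm. (pr f \<zeta>)\<^sup>2)"

lemma cform_proj: assumes "\<zeta> \<in> cspan L"
  shows "cform L (cmap (oproj L (fst v)) \<zeta>) (cmap (oproj L (fst v)) \<zeta>) = zp \<zeta>"
    "cform L (cmap (oproj L (snd v)) \<zeta>) (cmap (oproj L (snd v)) \<zeta>) = zm \<zeta>"
proof -
  have s: "B (fst \<zeta>) f = B f (fst \<zeta>)" "B (snd \<zeta>) f = B f (snd \<zeta>)" if "f \<in> F" for f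
    using assms B_sym_F[OF that] by (auto simp: cspan_iff)
  show "cform L (cmap (oproj L (fst v)) \<zeta>) (cmap (oproj L (fst v)) \<zeta>) = zp \<zeta>"
    using s unfolding cform_def cmap_def zp_def
    by (simp add: form_proj_plus complex_eq_iff pr_eq power2_eq_square F_def sum.distrib sum_subtractf sum_distrib_left mult.commute cong: sum.cong)
  show "cform L (cmap (oproj L (snd v)) \<zeta>) (cmap (oproj L (snd v)) \<zeta>) = zm \<zeta>"
    using s unfolding cform_def cmap_def zm_def
    by (simp add: form_proj_minus complex_eq_iff pr_eq power2_eq_square F_def sum.distrib sum_subtractf sum_negf sum_distrib_left mult.commute cong: sum.cong)
qed

lemma zp_gact: assumes "\<zeta> \<in> cspan L"
  shows "zp (gact A \<tau> \<zeta>) = zp \<zeta> / (jfac A \<tau>)\<^sup>2" "zm (gact A \<tau> \<zeta>) = zm \<zeta> / (cnj (jfac A \<tau>))\<^sup>2"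
  by (simp_all add: zp_def zm_def pr_gact[OF assms] power_divide sum_divide_distrib)

text \<open>The scalar part of the theta transformation law: half the signature as weight, since the
  square of \<open>snd g\<close> is the automorphy factor, times the index factor.\<close>

definition thfac :: "mp \<Rightarrow> complex \<Rightarrow> 'a cplx \<Rightarrow> complex" where
  "thfac g \<tau> \<zeta> = (snd g \<tau>) ^ card Fp * (cnj (snd g \<tau>)) ^ card Fm *
     ee (cor (fst g $ 2 $ 1) * zp \<zeta> / (2 * jfac (fst g) \<tau>) + cor (fst g $ 2 $ 1) * zm \<zeta> / (2 * cnj (jfac (fst g) \<tau>)))"

text \<open>The matrix \<open>r\<close> must serve for all \<open>\<tau>\<close> and
  \<open>\<zeta>\<close> at once; this constancy is why its values on \<open>disc L\<close> are
  determined by \<open>g\<close>.\<close>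

definition TR :: "mp \<Rightarrow> ('a set \<Rightarrow> 'a set \<Rightarrow> complex) \<Rightarrow> bool" where
  "TR g r \<longleftrightarrow> (\<forall>\<tau>\<in>uhp. \<forall>\<zeta>\<in>cspan L. \<forall>\<gamma>\<in>disc L. th (moeb (fst g) \<tau>) (gact (fst g) \<tau> \<zeta>) \<gamma> =
     thfac g \<tau> \<zeta> * (\<Sum>\<delta>\<in>disc L. r \<gamma> \<delta> * th \<tau> \<zeta> \<delta>))"

lemma TRD: "TR g r \<Longrightarrow> \<tau> \<in> uhp \<Longrightarrow> \<zeta> \<in> cspan L \<Longrightarrow> \<gamma> \<in> disc L \<Longrightarrow>
  th (moeb (fst g) \<tau>) (gact (fst g) \<tau> \<zeta>) \<gamma> = thfac g \<tau> \<zeta> * (\<Sum>\<delta>\<in>disc L. r \<gamma> \<delta> * th \<tau> \<zeta> \<delta>)"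
  by (auto simp: TR_def)

text \<open>A combination of components is a Fourier series over the dual lattice whose coefficient
  at \<open>x\<close> is \<open>c (coset L x)\<close> times a Gaussian. If it vanishes on the
  complex span, so do its coefficients, and the Gaussian is never 0.\<close>

lemma theta_independent:
  assumes \<tau>: "\<tau> \<in> uhp" and z: "\<And>\<zeta>. \<zeta> \<in> cspan L \<Longrightarrow> (\<Sum>\<delta>\<in>disc L. c \<delta> * th \<tau> \<zeta> \<delta>) = 0"
    and \<gamma>: "\<gamma> \<in> disc L"
  shows "c \<gamma> = 0"
proof -
  define a where "a x = c (coset L x) * gq (sv \<tau>) x" for x
  define h where "h \<zeta> = (\<Sum>\<^sub>\<infinity>x\<in>dual L. a x * ch x \<zeta>)" for \<zeta>
  define M where "M = (\<Sum>\<delta>\<in>disc L. cmod (c \<delta>))"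
  have M: "M \<ge> 0" unfolding M_def by (intro sum_nonneg) auto
  obtain \<kappa> where \<kappa>: "\<kappa> > 0" "\<And>x. x \<in> V \<Longrightarrow> cmod (gq (sv \<tau>) x) \<le> exp (- \<kappa> * (norm x)\<^sup>2)" using gq_bound[OF sv_pos[OF \<tau>]] by blast
  have ab: "cmod (a x) \<le> M * exp (- \<kappa> * (norm x)\<^sup>2)" if x: "x \<in> dual L" for x
    unfolding a_def norm_mult
  proof (rule mult_mono[OF _ \<kappa>(2)[OF dual_V[OF x]] M norm_ge_zero])
    show "cmod (c (coset L x)) \<le> M" unfolding M_def
      by (rule member_le_sum[OF coset_disc[OF x]]) (auto simp: finite_disc)
  qed
  have sm: "(\<lambda>x. cmod (a x * ch x \<zeta>)) summable_on dual L" for \<zeta> by (rule gauss_series_summable[OF \<kappa>(1) M ab])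
  have h0: "h \<zeta> = 0" if \<zeta>: "\<zeta> \<in> cspan L" for \<zeta>
  proof -
    have "h \<zeta> = (\<Sum>\<delta>\<in>disc L. \<Sum>\<^sub>\<infinity>x\<in>\<delta>. a x * ch x \<zeta>)"
      unfolding h_def by (rule infsum_dual_disc) (rule summable_on_dominated[OF sm[of \<zeta>]], simp)
    also have "\<dots> = (\<Sum>\<delta>\<in>disc L. c \<delta> * th \<tau> \<zeta> \<delta>)"
    proof (rule sum.cong[OF refl])
      fix \<delta> assume d: "\<delta> \<in> disc L"
      have "(\<Sum>\<^sub>\<infinity>x\<in>\<delta>. a x * ch x \<zeta>) = (\<Sum>\<^sub>\<infinity>x\<in>\<delta>. c \<delta> * (gq (sv \<tau>) x * ch x \<zeta>))"
        by (rule infsum_cong) (simp add: a_def disc_mem(2)[OF d] mult.assoc)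
      then show "(\<Sum>\<^sub>\<infinity>x\<in>\<delta>. a x * ch x \<zeta>) = c \<delta> * th \<tau> \<zeta> \<delta>"
        by (simp add: siegel_theta_eq[OF d] infsum_cmult_right')
    qed
    finally show ?thesis using z[OF \<zeta>] by simp
  qed
  have hc: "continuous_on UNIV h" unfolding h_def by (rule gauss_series_continuous[OF \<kappa>(1) M ab])
  have m: "rep \<gamma> \<in> dual L" by (rule rep_dual[OF \<gamma>])
  have "avl us (\<lambda>\<zeta>. h \<zeta> * ch (- rep \<gamma>) \<zeta>) 0 = a (rep \<gamma>)"
    by (rule fourier_coefficient[OF h_def hc sm m cspan_intros(1)])
  moreover have "avl us (\<lambda>\<zeta>. h \<zeta> * ch (- rep \<gamma>) \<zeta>) 0 = avl us (\<lambda>\<zeta>. 0) 0"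
    by (rule avl_cong[OF _ cspan_us cspan_intros(1)]) (simp add: h0)
  ultimately have "a (rep \<gamma>) = 0" by (simp add: avl_0)
  then show ?thesis by (simp add: a_def coset_rep[OF \<gamma>] gq_def)
qed

lemma TR_T: "TR T_mp (\<lambda>\<gamma> \<delta>. if \<gamma> = \<delta> then ee (cor (B (rep \<gamma>) (rep \<gamma>) / 2)) else 0)"
  unfolding TR_def
proof (intro ballI)
  fix \<tau> \<zeta> \<gamma> assume \<tau>: "\<tau> \<in> uhp" and \<zeta>: "\<zeta> \<in> cspan L" and \<gamma>: "\<gamma> \<in> disc L"
  have g: "gact (Umat 1) \<tau> \<zeta> = \<zeta>"
    by (rule cspan_eqI[OF gact_cspan \<zeta>]) (auto simp: F_def pr_gact[OF \<zeta>] jfac_Umat)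
  have f: "thfac T_mp \<tau> \<zeta> = 1" using \<tau> by (simp add: thfac_def T_mp_eq Umat_entries)
  have "th (\<tau> + 1) \<zeta> \<gamma> = (\<Sum>\<^sub>\<infinity>x\<in>\<gamma>. ee (cor (B (rep \<gamma>) (rep \<gamma>) / 2)) * (gq (sv \<tau>) x * ch x \<zeta>))"
    unfolding siegel_theta_eq[OF \<gamma>]
  proof (rule infsum_cong)
    fix x assume x: "x \<in> \<gamma>"
    define y where "y = rep \<gamma>"
    have yd: "y \<in> dual L" "x \<in> dual L" unfolding y_def using rep_dual[OF \<gamma>] disc_mem[OF \<gamma> x] by auto
    have xy: "x - y \<in> pts L" unfolding y_def using x coset_rep[OF \<gamma>] mem_coset by blast
    have "qexpt L v (\<tau> + 1) x = qexpt L v \<tau> x + cor (B x x / 2)"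
      unfolding B_self[OF dual_V[OF yd(2)]] by (simp add: qexpt_eq field_simps)
    \<comment> \<open>Evenness of the lattice enters here: within a coset of the dual lattice,
      \<open>B x x / 2\<close> changes by integers.\<close>
    moreover have "ee (cor (B x x / 2)) = ee (cor (B y y / 2))"
    proof -
      obtain n :: int where n: "B (x - y) (x - y) = 2 * of_int n" using pts_even[OF xy] by blast
      have "B (x - y) y = B y (x - y)" using B_sym[OF pts_V[OF xy] dual_V[OF yd(1)]] .
      then have "B x x / 2 = B y y / 2 + (B y (x - y) + B (x - y) (x - y) / 2)" by (simp add: B_simps field_simps)
      moreover have "B y (x - y) + B (x - y) (x - y) / 2 \<in> \<int>" using dual_pair(1)[OF yd(1) xy] n by simp
      then have "ee (cor (B y (x - y) + B (x - y) (x - y) / 2)) = 1" using ee_of_real_eq_1 by blast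
      ultimately show ?thesis by (simp only: of_real_add ee_add mult_1_right)
    qed
    ultimately have "gq (sv (\<tau> + 1)) x = ee (cor (B (rep \<gamma>) (rep \<gamma>) / 2)) * gq (sv \<tau>) x"
      unfolding ee_qexpt[symmetric] by (simp add: ee_add y_def mult.commute)
    then show "gq (sv (\<tau> + 1)) x * ch x \<zeta> = ee (cor (B (rep \<gamma>) (rep \<gamma>) / 2)) * (gq (sv \<tau>) x * ch x \<zeta>)" by simp
  qed
  also have "\<dots> = ee (cor (B (rep \<gamma>) (rep \<gamma>) / 2)) * th \<tau> \<zeta> \<gamma>"
    by (simp add: siegel_theta_eq[OF \<gamma>] infsum_cmult_right')
  also have "\<dots> = (\<Sum>\<delta>\<in>disc L. (if \<gamma> = \<delta> then ee (cor (B (rep \<gamma>) (rep \<gamma>) / 2)) else 0) * th \<tau> \<zeta> \<delta>)"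
    using \<gamma> finite_disc by (simp add: if_distrib[of "\<lambda>x. x * _"] cong: if_cong)
  finally show "th (moeb (fst T_mp) \<tau>) (gact (fst T_mp) \<tau> \<zeta>) \<gamma> = thfac T_mp \<tau> \<zeta> *
      (\<Sum>\<delta>\<in>disc L. (if \<gamma> = \<delta> then ee (cor (B (rep \<gamma>) (rep \<gamma>) / 2)) else 0) * th \<tau> \<zeta> \<delta>)"
    unfolding f by (simp add: T_mp_eq moeb_Umat g)
qed

text \<open>The scalar of the Weil representation at \<open>S_mp\<close>, with the signature
  expressed by the sizes of the orthonormal bases; \<open>signature\<close> identifies the two
  later.\<close>

definition ws :: complex where
  "ws = ee ((of_nat (card Fm) - of_nat (card Fp)) / 8) / cor (sqrt (real (card (disc L))))"

text \<open>On the half-plane \<open>csqrt (- \<i> * \<tau>)\<close> is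
  \<open>ee (- 1 / 8) * csqrt \<tau>\<close>: turning the first quadrant by -45 degrees keeps it in
  the right half-plane. Negative vectors contribute conjugates, and the eighth roots of unity
  collect to the signature factor.\<close>

lemma cst_sv: assumes \<tau>: "\<tau> \<in> uhp" shows "cst (sv \<tau>) = ws * csqrt \<tau> ^ card Fp * cnj (csqrt \<tau>) ^ card Fm"
proof -
  define w where "w = ee (- 1 / 8) * csqrt \<tau>"
  have e: "ee (- 1 / 8) = cor (cos (pi / 4)) - \<i> * cor (sin (pi / 4))"
  proof -
    have "ee (- 1 / 8) = exp (\<i> * cor (- (pi / 4)))" by (simp add: ee_def field_simps)
    also have "\<dots> = cor (cos (pi / 4)) - \<i> * cor (sin (pi / 4))"
      by (simp only: exp_Euler cos_of_real sin_of_real) simp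
    finally show ?thesis .
  qed
  have "Re w = (sqrt 2 / 2) * (Re (csqrt \<tau>) + Im (csqrt \<tau>))"
    unfolding w_def e by (simp add: cos_45 sin_45 algebra_simps)
  moreover have "sqrt 2 / 2 * (Re (csqrt \<tau>) + Im (csqrt \<tau>)) > 0"
    using csqrt_uhp[OF \<tau>] by (intro mult_pos_pos add_pos_pos) auto
  ultimately have Rw: "Re w > 0" by simp
  have "ee (- 1 / 8) * ee (- 1 / 8) = - \<i>"
  proof -
    have "ee (- 1 / 8) * ee (- 1 / 8) = exp (- (\<i> * cor (pi / 2)))"
      unfolding ee_add[symmetric] by (simp add: ee_def field_simps)
    also have "\<dots> = inverse (exp (\<i> * cor (pi / 2)))" by (rule exp_minus)
    also have "exp (\<i> * cor (pi / 2)) = \<i>" by (simp only: exp_Euler cos_of_real sin_of_real) simp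
    finally show ?thesis by simp
  qed
  then have w2: "w\<^sup>2 = - \<i> * \<tau>"
    unfolding w_def power_mult_distrib power2_csqrt by (simp add: power2_eq_square)
  have cp: "csqrt (- (\<i> * \<tau>)) = w" by (rule csqrt_unique) (use w2 Rw in auto)
  have "(cnj w)\<^sup>2 = \<i> * cnj \<tau>" using arg_cong[OF w2, of cnj] by simp
  then have cm: "csqrt (\<i> * cnj \<tau>) = cnj w" by (rule csqrt_unique) (use Rw in auto)
  have "(\<Prod>f\<in>F. csqrt (sv \<tau> f)) = (\<Prod>f\<in>Fp. csqrt (sv \<tau> f)) * (\<Prod>f\<in>Fm. csqrt (sv \<tau> f))"
    unfolding F_def by (rule prod.union_disjoint[OF finFp finFm F_disjoint])
  also have "\<dots> = w ^ card Fp * cnj w ^ card Fm" by (simp add: sv_cases cp cm cong: prod.cong)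
  also have "\<dots> = (ee (- 1 / 8) ^ card Fp * ee (1 / 8) ^ card Fm) * csqrt \<tau> ^ card Fp * cnj (csqrt \<tau>) ^ card Fm"
    by (simp add: w_def power_mult_distrib cnj_ee)
  also have "ee (- 1 / 8) ^ card Fp * ee (1 / 8) ^ card Fm = ee ((of_nat (card Fm) - of_nat (card Fp)) / 8)"
  proof -
    have pw: "ee z ^ n = ee (of_nat n * z)" for z n
      by (simp add: ee_def exp_of_nat_mult[symmetric] mult_ac)
    show ?thesis unfolding pw ee_add[symmetric] by (simp add: diff_divide_distrib)
  qed
  finally show ?thesis unfolding cst_eq_prod[OF sv_pos[OF \<tau>]] cst_one ws_def by simp
qed

text \<open>At \<open>- 1 / \<tau>\<close> the widths are inverted, and the sum over a coset becomes
  \<open>psi\<close> at a translated argument. Inversion turns it into a sum over the dual lattice,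
  where the translation survives as the characters in the matrix.\<close>

lemma TR_S: "TR S_mp (\<lambda>\<gamma> \<delta>. ws * ee (cor (- B (rep \<gamma>) (rep \<delta>))))"
  unfolding TR_def
proof (intro ballI)
  fix \<tau> \<zeta> \<gamma> assume \<tau>: "\<tau> \<in> uhp" and \<zeta>: "\<zeta> \<in> cspan L" and \<gamma>: "\<gamma> \<in> disc L"
  have t0: "\<tau> \<noteq> 0" using \<tau> by (auto simp: uhp_iff)
  define s where "s = sv \<tau>"
  have s: "\<forall>f\<in>F. Re (s f) > 0" unfolding s_def by (rule sv_pos[OF \<tau>])
  then have s0: "s f \<noteq> 0" if "f \<in> F" for f using that by force
  define x0 where "x0 = rep \<gamma>"
  have x0: "x0 \<in> dual L" "x0 \<in> V" "coset L x0 = \<gamma>" unfolding x0_def using rep_dual[OF \<gamma>] dual_V coset_rep[OF \<gamma>] by auto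
  define \<xi> where "\<xi> = gact Smat \<tau> \<zeta>"
  have \<xi>: "\<xi> \<in> cspan L" unfolding \<xi>_def by (rule gact_cspan)
  \<comment> \<open>Written with \<open>s f\<close> and \<open>eps f\<close>, the positive and
    negative vectors obey the same two formulas.\<close>
  have s': "sv (- 1 / \<tau>) f = 1 / s f" "cor (eps f) * pr f \<xi> = - \<i> * pr f \<zeta> / (s f)" if f: "f \<in> F" for f
  proof -
    have "f \<in> Fp \<or> f \<in> Fm" using f by (simp add: F_def)
    then show "sv (- 1 / \<tau>) f = 1 / s f" "cor (eps f) * pr f \<xi> = - \<i> * pr f \<zeta> / (s f)"
      using t0 by (auto simp: s_def sv_cases \<xi>_def pr_gact[OF \<zeta>] jfac_Smat eps_cases field_simps)
  qed
  \<comment> \<open>The part of the exponent that is quadratic in \<open>\<zeta>\<close> and free of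
    the lattice vector; it becomes the index factor.\<close>
  define K where "K = exp (\<Sum>f\<in>F. cpi * (pr f \<zeta>)\<^sup>2 / s f)"
  have tm: "gq (sv (- 1 / \<tau>)) (x0 + x) * ch (x0 + x) \<xi> =
      K * exp (\<Sum>f\<in>F. - cpi * (cor (B x f) - pr f (\<zeta> - cvec x0))\<^sup>2 / s f)" if x: "x \<in> pts L" for x
  proof -
    have xV: "x0 + x \<in> V" using V_intros(2)[OF x0(2) pts_V[OF x]] .
    have "pr (x0 + x) \<xi> = (\<Sum>f\<in>F. cor (B f (x0 + x)) * (cor (eps f) * pr f \<xi>))"
      unfolding pr_expand[OF xV \<xi>] by (simp add: mult_ac)
    also have "\<dots> = (\<Sum>f\<in>F. cor (B (x0 + x) f) * (- \<i> * pr f \<zeta> / s f))"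
      by (rule sum.cong[OF refl]) (simp only: s' B_sym_F[OF _ xV])
    finally have c: "2 * cpi * \<i> * pr (x0 + x) \<xi> = (\<Sum>f\<in>F. 2 * cpi * cor (B (x0 + x) f) * pr f \<zeta> / s f)"
      by (simp add: sum_distrib_left mult_ac)
    have g: "(\<Sum>f\<in>F. - cpi * sv (- 1 / \<tau>) f * (cor (B (x0 + x) f))\<^sup>2) = (\<Sum>f\<in>F. - cpi * (cor (B (x0 + x) f))\<^sup>2 / s f)"
      by (rule sum.cong[OF refl]) (simp only: s'(1), simp)
    have "(\<Sum>f\<in>F. - cpi * (cor (B (x0 + x) f))\<^sup>2 / s f) + (\<Sum>f\<in>F. 2 * cpi * cor (B (x0 + x) f) * pr f \<zeta> / s f)
       = (\<Sum>f\<in>F. cpi * (pr f \<zeta>)\<^sup>2 / s f) + (\<Sum>f\<in>F. - cpi * (cor (B x f) - pr f (\<zeta> - cvec x0))\<^sup>2 / s f)"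
      unfolding sum.distrib[symmetric]
    proof (rule sum.cong[OF refl])
      fix f assume f: "f \<in> F"
      define b where "b = cor (B (x0 + x) f)"
      have "pr f (\<zeta> - cvec x0) = pr f \<zeta> - cor (B x0 f)"
      proof -
        have "pr f (- cvec x0) = - cor (B f x0)" by (simp add: cvec_simps(4)[symmetric] pr_simps B_simps)
        then show ?thesis using pr_simps(1)[of f \<zeta> "- cvec x0"] B_sym_F[OF f x0(2)] by simp
      qed
      then have "cor (B x f) - pr f (\<zeta> - cvec x0) = b - pr f \<zeta>" by (simp add: b_def B_simps)
      moreover have "- cpi * b\<^sup>2 / s f + 2 * cpi * b * pr f \<zeta> / s f = cpi * (pr f \<zeta>)\<^sup>2 / s f + - cpi * (b - pr f \<zeta>)\<^sup>2 / s f"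
        by (simp add: add_divide_distrib[symmetric] power2_eq_square algebra_simps)
      ultimately show "- cpi * (cor (B (x0 + x) f))\<^sup>2 / s f + 2 * cpi * cor (B (x0 + x) f) * pr f \<zeta> / s f =
        cpi * (pr f \<zeta>)\<^sup>2 / s f + - cpi * (cor (B x f) - pr f (\<zeta> - cvec x0))\<^sup>2 / s f" by (simp only: b_def)
    qed
    then show ?thesis unfolding gq_def ch_def ee_def K_def g c exp_add[symmetric] by (rule arg_cong)
  qed
  have \<zeta>x: "\<zeta> - cvec x0 \<in> cspan L" using cspan_intros(2)[OF \<zeta> cspan_intros(4)[OF V_intros(4)[OF x0(2)]]] by (simp add: cvec_simps)
  have "th (- 1 / \<tau>) \<xi> \<gamma> = (\<Sum>\<^sub>\<infinity>x\<in>pts L. gq (sv (- 1 / \<tau>)) (x0 + x) * ch (x0 + x) \<xi>)"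
    unfolding siegel_theta_eq[OF \<gamma>] unfolding x0(3)[symmetric] coset_def by (subst infsum_reindex) (auto simp: inj_on_def o_def)
  also have "\<dots> = K * psi s (\<zeta> - cvec x0)"
    unfolding psi_def infsum_cmult_right'[symmetric] by (rule infsum_cong) (rule tm)
  also have "\<dots> = K * (cst s * dth s (\<zeta> - cvec x0))" using psi_eq_dth[OF s \<zeta>x] by simp
  also have "dth s (\<zeta> - cvec x0) = (\<Sum>\<delta>\<in>disc L. ee (cor (- B (rep \<gamma>) (rep \<delta>))) * th \<tau> \<zeta> \<delta>)"
  proof -
    have "dth s (\<zeta> - cvec x0) = (\<Sum>\<delta>\<in>disc L. \<Sum>\<^sub>\<infinity>x\<in>\<delta>. gq s x * ch x (\<zeta> - cvec x0))"
      unfolding dth_def s_def by (rule infsum_dual_disc[OF siegel_summable[OF \<tau>]])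
    also have "\<dots> = (\<Sum>\<delta>\<in>disc L. ee (cor (- B (rep \<gamma>) (rep \<delta>))) * th \<tau> \<zeta> \<delta>)"
    proof (rule sum.cong[OF refl])
      fix \<delta> assume d: "\<delta> \<in> disc L"
      have "(\<Sum>\<^sub>\<infinity>x\<in>\<delta>. gq s x * ch x (\<zeta> - cvec x0)) = (\<Sum>\<^sub>\<infinity>x\<in>\<delta>. ee (cor (- B (rep \<gamma>) (rep \<delta>))) * (gq s x * ch x \<zeta>))"
      proof (rule infsum_cong)
        fix x assume x: "x \<in> \<delta>"
        have xd: "x \<in> dual L" "x - rep \<delta> \<in> pts L" using disc_mem[OF d x] x coset_rep[OF d] mem_coset by auto
        have "ch x (\<zeta> - cvec x0) = ch x \<zeta> * ee (cor (- B x x0))"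
          using ch_add(1)[of x \<zeta> "- cvec x0"] by (simp add: ch_cvec)
        also have "B x x0 = B x0 x" using B_sym[OF dual_V[OF xd(1)] x0(2)] .
        also have "ee (cor (- B x0 x)) = ee (cor (- B x0 (rep \<delta>)))"
          using ee_pair_cong[OF x0(1) xd(1) _ xd(2), of x0] pts_intros(1) by (simp add: ee_uminus)
        finally show "gq s x * ch x (\<zeta> - cvec x0) = ee (cor (- B (rep \<gamma>) (rep \<delta>))) * (gq s x * ch x \<zeta>)"
          by (simp add: x0_def)
      qed
      then show "(\<Sum>\<^sub>\<infinity>x\<in>\<delta>. gq s x * ch x (\<zeta> - cvec x0)) = ee (cor (- B (rep \<gamma>) (rep \<delta>))) * th \<tau> \<zeta> \<delta>"
        by (simp add: siegel_theta_eq[OF d] infsum_cmult_right' s_def)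
    qed
    finally show ?thesis .
  qed
  also have "K = ee (zp \<zeta> / (2 * \<tau>) + zm \<zeta> / (2 * cnj \<tau>))"
  proof -
    have "(\<Sum>f\<in>F. cpi * (pr f \<zeta>)\<^sup>2 / s f) = cpi * \<i> / \<tau> * zp \<zeta> + cpi * \<i> / cnj \<tau> * zm \<zeta>"
    proof -
      have i: "1 / (- \<i> * \<tau>) = \<i> / \<tau>" "1 / (\<i> * cnj \<tau>) = - \<i> / cnj \<tau>" using t0 by (simp_all add: field_simps)
      have "(\<Sum>f\<in>Fp. cpi * (pr f \<zeta>)\<^sup>2 / s f) = cpi * \<i> / \<tau> * zp \<zeta>"
        unfolding zp_def sum_distrib_left
      proof (rule sum.cong[OF refl])
        fix f assume "f \<in> Fp"
        then have "cpi * (pr f \<zeta>)\<^sup>2 / s f = cpi * (pr f \<zeta>)\<^sup>2 * (1 / (- \<i> * \<tau>))" by (simp add: s_def sv_cases)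
        then show "cpi * (pr f \<zeta>)\<^sup>2 / s f = cpi * \<i> / \<tau> * (pr f \<zeta>)\<^sup>2" unfolding i by simp
      qed
      moreover have "(\<Sum>f\<in>Fm. cpi * (pr f \<zeta>)\<^sup>2 / s f) = cpi * \<i> / cnj \<tau> * zm \<zeta>"
        unfolding zm_def sum_negf[symmetric] sum_distrib_left
      proof (rule sum.cong[OF refl])
        fix f assume "f \<in> Fm"
        then have "cpi * (pr f \<zeta>)\<^sup>2 / s f = cpi * (pr f \<zeta>)\<^sup>2 * (1 / (\<i> * cnj \<tau>))" by (simp add: s_def sv_cases)
        then show "cpi * (pr f \<zeta>)\<^sup>2 / s f = cpi * \<i> / cnj \<tau> * - (pr f \<zeta>)\<^sup>2" unfolding i by simp
      qed
      ultimately show ?thesis by (simp add: sum_F)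
    qed
    then show ?thesis unfolding K_def ee_def by (simp add: algebra_simps)
  qed
  finally have "th (- 1 / \<tau>) \<xi> \<gamma> = ee (zp \<zeta> / (2 * \<tau>) + zm \<zeta> / (2 * cnj \<tau>)) * (cst s *
     (\<Sum>\<delta>\<in>disc L. ee (cor (- B (rep \<gamma>) (rep \<delta>))) * th \<tau> \<zeta> \<delta>))" .
  moreover have "thfac S_mp \<tau> \<zeta> = csqrt \<tau> ^ card Fp * cnj (csqrt \<tau>) ^ card Fm * ee (zp \<zeta> / (2 * \<tau>) + zm \<zeta> / (2 * cnj \<tau>))"
    using \<tau> by (simp add: thfac_def S_mp_eq Smat_entries jfac_Smat)
  ultimately show "th (moeb (fst S_mp) \<tau>) (gact (fst S_mp) \<tau> \<zeta>) \<gamma> = thfac S_mp \<tau> \<zeta> *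
      (\<Sum>\<delta>\<in>disc L. ws * ee (cor (- B (rep \<gamma>) (rep \<delta>))) * th \<tau> \<zeta> \<delta>)"
    unfolding s_def cst_sv[OF \<tau>] by (simp add: S_mp_eq moeb_Smat \<xi>_def sum_distrib_left mult_ac)
qed

text \<open>The composition rule for the exponents in the index factor; after clearing the
  denominator it comes down to \<open>C\<close> having determinant 1.\<close>

lemma cocycle:
  assumes C: "C \<in> SL2R" and \<tau>: "\<tau> \<in> uhp"
  shows "cor (A $ 2 $ 1) / jfac C \<tau> + cor (C $ 2 $ 1) * jfac A (moeb C \<tau>) = cor ((A ** C) $ 2 $ 1)"
proof -
  have nz: "jfac C \<tau> \<noteq> 0" by (rule jfac_nonzero[OF C \<tau>])
  have det: "cor (C $ 1 $ 1) * cor (C $ 2 $ 2) = 1 + cor (C $ 1 $ 2) * cor (C $ 2 $ 1)"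
  proof -
    have "C $ 1 $ 1 * C $ 2 $ 2 = 1 + C $ 1 $ 2 * C $ 2 $ 1" using SL2R_det[OF C] by simp
    from arg_cong[OF this, of cor] show ?thesis by simp
  qed
  have w: "moeb C \<tau> * jfac C \<tau> = cor (C $ 1 $ 1) * \<tau> + cor (C $ 1 $ 2)"
    using nz by (simp add: moeb_def)
  have "(cor (A $ 2 $ 1) / jfac C \<tau> + cor (C $ 2 $ 1) * jfac A (moeb C \<tau>)) * jfac C \<tau> =
     cor (A $ 2 $ 1) + cor (C $ 2 $ 1) * (cor (A $ 2 $ 1) * (moeb C \<tau> * jfac C \<tau>) + cor (A $ 2 $ 2) * jfac C \<tau>)"
    using nz unfolding jfac_def[of A] by (simp add: distrib_right distrib_left mult.assoc)
  also have "\<dots> = cor ((A ** C) $ 2 $ 1) * jfac C \<tau>"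
  proof -
    have "cor (A $ 2 $ 1) * (cor (C $ 1 $ 1) * cor (C $ 2 $ 2)) =
       cor (A $ 2 $ 1) * (1 + cor (C $ 1 $ 2) * cor (C $ 2 $ 1))" by (simp only: det)
    then show ?thesis unfolding w by (simp add: jfac_def matrix_mult_2 algebra_simps)
  qed
  finally show ?thesis using nz by simp
qed

lemma gact_mult: assumes C: "C \<in> SL2R" and \<tau>: "\<tau> \<in> uhp" and \<zeta>: "\<zeta> \<in> cspan L"
  shows "gact (A ** C) \<tau> \<zeta> = gact A (moeb C \<tau>) (gact C \<tau> \<zeta>)"
  by (rule cspan_eqI[OF gact_cspan gact_cspan])
    (auto simp: F_def pr_gact[OF \<zeta>] pr_gact[OF gact_cspan] jfac_mult[OF C \<tau>] mult.commute)

lemma thfac_mult: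
  assumes h: "h \<in> carrier Mp2Z" and \<tau>: "\<tau> \<in> uhp" and \<zeta>: "\<zeta> \<in> cspan L" and g: "g \<in> carrier Mp2Z"
  shows "thfac (mpm g h) \<tau> \<zeta> = thfac g (moeb (fst h) \<tau>) (gact (fst h) \<tau> \<zeta>) * thfac h \<tau> \<zeta>"
proof -
  have hC: "fst h \<in> SL2R" and gC: "fst g \<in> SL2R" using h g SL2Z_SL2R by (auto simp: Mp2Z_iff)
  define a c q j k where "a = cor (fst g $ 2 $ 1)" and "c = cor (fst h $ 2 $ 1)"
    and "q = cor ((fst g ** fst h) $ 2 $ 1)" and "j = jfac (fst h) \<tau>" and "k = jfac (fst g) (moeb (fst h) \<tau>)"
  have nz: "j \<noteq> 0" "k \<noteq> 0" unfolding j_def k_def using jfac_nonzero hC gC \<tau> moeb_uhp by auto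
  have co: "a / j + c * k = q" unfolding a_def c_def q_def j_def k_def by (rule cocycle[OF hC \<tau>])
  have cnja: "cnj a = a" "cnj c = c" "cnj q = q" by (simp_all add: a_def c_def q_def)
  \<comment> \<open>The matrix entries are real, so conjugation turns the identity for the positive
    space into the one for the negative space.\<close>
  have co': "a / cnj j + c * cnj k = q" using arg_cong[OF co, of cnj] by (simp add: cnja)
  have key: "q * z / (2 * (k * j)) = a * (z / j\<^sup>2) / (2 * k) + c * z / (2 * j)" if "j \<noteq> 0" "k \<noteq> 0" "a / j + c * k = q" for z j k
  proof -
    have "q * z / (2 * (k * j)) = (a / j) * (z / (2 * (k * j))) + (c * k) * (z / (2 * (k * j)))"
      unfolding that(3)[symmetric] by (simp add: distrib_right add_divide_distrib)
    also have "(a / j) * (z / (2 * (k * j))) = a * (z / j\<^sup>2) / (2 * k)" by (simp add: power2_eq_square mult_ac)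
    also have "(c * k) * (z / (2 * (k * j))) = c * z / (2 * j)" using that(2) by simp
    finally show ?thesis .
  qed
  have "ee (q * zp \<zeta> / (2 * (k * j)) + q * zm \<zeta> / (2 * (cnj k * cnj j))) =
     ee (a * (zp \<zeta> / j\<^sup>2) / (2 * k) + a * (zm \<zeta> / (cnj j)\<^sup>2) / (2 * cnj k)) * ee (c * zp \<zeta> / (2 * j) + c * zm \<zeta> / (2 * cnj j))"
    unfolding ee_add[symmetric] using key[OF nz co, of "zp \<zeta>"] key[OF _ _ co', of "zm \<zeta>"] nz by (simp add: add_ac)
  then show ?thesis
    using \<tau> unfolding thfac_def zp_gact[OF \<zeta>]
    by (simp add: mpm_eq jfac_mult[OF hC \<tau>] power_mult_distrib a_def[symmetric] c_def[symmetric] q_def[symmetric] j_def[symmetric] k_def[symmetric])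
qed

lemma thfac_nonzero: assumes g: "g \<in> carrier Mp2Z" and \<tau>: "\<tau> \<in> uhp" shows "thfac g \<tau> \<zeta> \<noteq> 0"
proof -
  have "(snd g \<tau>)\<^sup>2 \<noteq> 0" using g \<tau> jfac_nonzero[OF SL2Z_SL2R] by (auto simp: Mp2Z_iff)
  then show ?thesis by (simp add: thfac_def)
qed

section \<open>The transformation matrices and their inverses\<close>

lemma TR_mult:
  assumes g: "g \<in> carrier Mp2Z" and h: "h \<in> carrier Mp2Z" and "TR g r" "TR h q"
  shows "TR (mpm g h) (\<lambda>\<gamma> \<delta>. \<Sum>\<epsilon>\<in>disc L. r \<gamma> \<epsilon> * q \<epsilon> \<delta>)"
  unfolding TR_def
proof (intro ballI)
  fix \<tau> \<zeta> \<gamma> assume \<tau>: "\<tau> \<in> uhp" and \<zeta>: "\<zeta> \<in> cspan L" and \<gamma>: "\<gamma> \<in> disc L"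
  have hC: "fst h \<in> SL2R" using h SL2Z_SL2R by (auto simp: Mp2Z_iff)
  have m: "fst (mpm g h) = fst g ** fst h" by (simp add: mpm_eq)
  have "th (moeb (fst (mpm g h)) \<tau>) (gact (fst (mpm g h)) \<tau> \<zeta>) \<gamma> =
     th (moeb (fst g) (moeb (fst h) \<tau>)) (gact (fst g) (moeb (fst h) \<tau>) (gact (fst h) \<tau> \<zeta>)) \<gamma>"
    unfolding m by (simp add: moeb_mult[OF hC \<tau>] gact_mult[OF hC \<tau> \<zeta>])
  also have "\<dots> = thfac g (moeb (fst h) \<tau>) (gact (fst h) \<tau> \<zeta>) * (\<Sum>\<epsilon>\<in>disc L. r \<gamma> \<epsilon> * th (moeb (fst h) \<tau>) (gact (fst h) \<tau> \<zeta>) \<epsilon>)"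
    by (rule TRD[OF assms(3) moeb_uhp[OF hC \<tau>] gact_cspan \<gamma>])
  also have "(\<Sum>\<epsilon>\<in>disc L. r \<gamma> \<epsilon> * th (moeb (fst h) \<tau>) (gact (fst h) \<tau> \<zeta>) \<epsilon>) =
     (\<Sum>\<epsilon>\<in>disc L. r \<gamma> \<epsilon> * (thfac h \<tau> \<zeta> * (\<Sum>\<delta>\<in>disc L. q \<epsilon> \<delta> * th \<tau> \<zeta> \<delta>)))"
    by (rule sum.cong[OF refl]) (simp add: TRD[OF assms(4) \<tau> \<zeta>])
  also have "\<dots> = thfac h \<tau> \<zeta> * (\<Sum>\<epsilon>\<in>disc L. \<Sum>\<delta>\<in>disc L. r \<gamma> \<epsilon> * q \<epsilon> \<delta> * th \<tau> \<zeta> \<delta>)"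
    by (simp add: sum_distrib_left mult_ac)
  also have "(\<Sum>\<epsilon>\<in>disc L. \<Sum>\<delta>\<in>disc L. r \<gamma> \<epsilon> * q \<epsilon> \<delta> * th \<tau> \<zeta> \<delta>) = (\<Sum>\<delta>\<in>disc L. (\<Sum>\<epsilon>\<in>disc L. r \<gamma> \<epsilon> * q \<epsilon> \<delta>) * th \<tau> \<zeta> \<delta>)"
    by (subst sum.swap) (simp add: sum_distrib_right)
  finally show "th (moeb (fst (mpm g h)) \<tau>) (gact (fst (mpm g h)) \<tau> \<zeta>) \<gamma> = thfac (mpm g h) \<tau> \<zeta> *
      (\<Sum>\<delta>\<in>disc L. (\<Sum>\<epsilon>\<in>disc L. r \<gamma> \<epsilon> * q \<epsilon> \<delta>) * th \<tau> \<zeta> \<delta>)"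
    by (simp add: thfac_mult[OF h \<tau> \<zeta> g] mult.assoc)
qed

text \<open>Since the matrices are constant, comparing the two laws at the single point
  \<open>\<i>\<close> and using independence there is enough.\<close>

lemma TR_unique:
  assumes g: "g \<in> carrier Mp2Z" and "TR g r" "TR g q" "\<gamma> \<in> disc L" "\<delta> \<in> disc L"
  shows "r \<gamma> \<delta> = q \<gamma> \<delta>"
proof -
  have "r \<gamma> \<delta> - q \<gamma> \<delta> = 0"
  proof (rule theta_independent[OF i_uhp _ assms(5)])
    fix \<zeta> assume \<zeta>: "\<zeta> \<in> cspan L"
    have "thfac g \<i> \<zeta> * (\<Sum>\<delta>\<in>disc L. r \<gamma> \<delta> * th \<i> \<zeta> \<delta>) = thfac g \<i> \<zeta> * (\<Sum>\<delta>\<in>disc L. q \<gamma> \<delta> * th \<i> \<zeta> \<delta>)"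
      using TRD[OF assms(2) i_uhp \<zeta> assms(4)] TRD[OF assms(3) i_uhp \<zeta> assms(4)] by (simp only:)
    then show "(\<Sum>\<delta>\<in>disc L. (r \<gamma> \<delta> - q \<gamma> \<delta>) * th \<i> \<zeta> \<delta>) = 0"
      using thfac_nonzero[OF g i_uhp] by (simp add: left_diff_distrib sum_subtractf)
  qed
  then show ?thesis by simp
qed

text \<open>One-sided inverses of matrices over \<open>disc L\<close>. They are carried through the
  induction so that the matrix of a known factor can be divided off.\<close>

definition minv :: "('a set \<Rightarrow> 'a set \<Rightarrow> complex) \<Rightarrow> ('a set \<Rightarrow> 'a set \<Rightarrow> complex) \<Rightarrow> bool" where
  "minv r q \<longleftrightarrow> (\<forall>\<gamma>\<in>disc L. \<forall>\<delta>\<in>disc L. (\<Sum>\<epsilon>\<in>disc L. r \<gamma> \<epsilon> * q \<epsilon> \<delta>) = (if \<gamma> = \<delta> then 1 else 0))"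

lemma minv_apply:
  assumes "minv r q" "\<gamma> \<in> disc L"
  shows "(\<Sum>\<epsilon>\<in>disc L. r \<gamma> \<epsilon> * (\<Sum>\<delta>\<in>disc L. q \<epsilon> \<delta> * U \<delta>)) = U \<gamma>"
proof -
  have "(\<Sum>\<epsilon>\<in>disc L. r \<gamma> \<epsilon> * (\<Sum>\<delta>\<in>disc L. q \<epsilon> \<delta> * U \<delta>)) = (\<Sum>\<delta>\<in>disc L. (\<Sum>\<epsilon>\<in>disc L. r \<gamma> \<epsilon> * q \<epsilon> \<delta>) * U \<delta>)"
    unfolding sum_distrib_left sum_distrib_right by (subst sum.swap) (simp add: mult.assoc)
  also have "\<dots> = (\<Sum>\<delta>\<in>disc L. if \<gamma> = \<delta> then U \<delta> else 0)" using assms by (intro sum.cong) (auto simp: minv_def)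
  finally show ?thesis using assms(2) finite_disc by simp
qed

lemma minv_mult:
  assumes "minv r r'" "minv q q'"
  shows "minv (\<lambda>\<gamma> \<delta>. \<Sum>\<epsilon>\<in>disc L. r \<gamma> \<epsilon> * q \<epsilon> \<delta>) (\<lambda>\<gamma> \<delta>. \<Sum>\<epsilon>\<in>disc L. q' \<gamma> \<epsilon> * r' \<epsilon> \<delta>)"
  unfolding minv_def
proof (intro ballI)
  fix \<gamma> \<delta> assume d: "\<gamma> \<in> disc L" "\<delta> \<in> disc L"
  have "(\<Sum>\<epsilon>\<in>disc L. (\<Sum>\<alpha>\<in>disc L. r \<gamma> \<alpha> * q \<alpha> \<epsilon>) * (\<Sum>\<beta>\<in>disc L. q' \<epsilon> \<beta> * r' \<beta> \<delta>)) =
      (\<Sum>\<alpha>\<in>disc L. r \<gamma> \<alpha> * (\<Sum>\<epsilon>\<in>disc L. q \<alpha> \<epsilon> * (\<Sum>\<beta>\<in>disc L. q' \<epsilon> \<beta> * r' \<beta> \<delta>)))"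
    unfolding sum_distrib_right by (subst sum.swap) (simp add: sum_distrib_left mult.assoc)
  also have "\<dots> = (\<Sum>\<alpha>\<in>disc L. r \<gamma> \<alpha> * r' \<alpha> \<delta>)"
    by (rule sum.cong[OF refl]) (simp add: minv_apply[OF assms(2), of _ "\<lambda>\<beta>. r' \<beta> \<delta>"])
  finally show "(\<Sum>\<epsilon>\<in>disc L. (\<Sum>\<alpha>\<in>disc L. r \<gamma> \<alpha> * q \<alpha> \<epsilon>) * (\<Sum>\<beta>\<in>disc L. q' \<epsilon> \<beta> * r' \<beta> \<delta>)) = (if \<gamma> = \<delta> then 1 else 0)"
    using assms(1) d by (simp add: minv_def)
qed

lemma character_sum_disc:
  assumes "\<gamma> \<in> disc L" "\<delta> \<in> disc L"
  shows "(\<Sum>\<epsilon>\<in>disc L. ee (cor (- B (rep \<gamma>) (rep \<epsilon>))) * ee (cor (B (rep \<epsilon>) (rep \<delta>)))) = (if \<gamma> = \<delta> then of_nat (card (disc L)) else 0)"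
proof -
  have "rep \<delta> - rep \<gamma> \<in> dual L" by (intro dual_intros(3) rep_dual assms)
  moreover have "rep \<delta> - rep \<gamma> \<in> pts L \<longleftrightarrow> \<gamma> = \<delta>"
    unfolding coset_eq_iff[symmetric] using coset_rep assms by auto
  moreover have "ee (cor (- B (rep \<gamma>) (rep \<epsilon>))) * ee (cor (B (rep \<epsilon>) (rep \<delta>))) = ee (cor (B (rep \<delta> - rep \<gamma>) (rep \<epsilon>)))"
    if "\<epsilon> \<in> disc L" for \<epsilon>
    using B_sym[OF dual_V[OF rep_dual[OF that]] dual_V[OF rep_dual[OF assms(2)]]] by (simp add: ee_add[symmetric] B_simps)
  ultimately show ?thesis using character_sum[of "rep \<delta> - rep \<gamma>"] by (simp cong: sum.cong)
qed

text \<open>The matrix is attached to the group element through its effect on theta functions, so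
  different words in the generators cannot conflict: \<open>TR_unique\<close> identifies their
  matrices.\<close>

lemma ex_TR: assumes "g \<in> carrier Mp2Z" shows "\<exists>r q. TR g r \<and> minv r q \<and> minv q r"
proof (rule Mp2Z_induct[OF assms])
  define c where "c \<gamma> = ee (cor (B (rep \<gamma>) (rep \<gamma>) / 2))" for \<gamma>
  have c0: "c \<gamma> \<noteq> 0" for \<gamma> by (simp add: c_def)
  have "minv (\<lambda>\<gamma> \<delta>. if \<gamma> = \<delta> then c \<gamma> else 0) (\<lambda>\<gamma> \<delta>. if \<gamma> = \<delta> then 1 / c \<gamma> else 0)"
    "minv (\<lambda>\<gamma> \<delta>. if \<gamma> = \<delta> then 1 / c \<gamma> else 0) (\<lambda>\<gamma> \<delta>. if \<gamma> = \<delta> then c \<gamma> else 0)"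
    unfolding minv_def using c0 finite_disc by (auto simp: if_distrib[of "\<lambda>x. x * _"] cong: if_cong)
  then show "\<exists>r q. TR T_mp r \<and> minv r q \<and> minv q r" using TR_T unfolding c_def by blast
next
  have ws0: "ws \<noteq> 0" using card_disc_pos by (simp add: ws_def)
  define n where "n = complex_of_nat (card (disc L))"
  have n0: "n \<noteq> 0" using card_disc_pos by (simp add: n_def)
  have sym: "ee (cor (B (rep \<gamma>) (rep \<delta>))) = ee (cor (B (rep \<delta>) (rep \<gamma>)))" if "\<gamma> \<in> disc L" "\<delta> \<in> disc L" for \<gamma> \<delta>
    using B_sym[OF dual_V[OF rep_dual[OF that(1)]] dual_V[OF rep_dual[OF that(2)]]] by simp
  have 1: "minv (\<lambda>\<gamma> \<delta>. ws * ee (cor (- B (rep \<gamma>) (rep \<delta>)))) (\<lambda>\<gamma> \<delta>. ee (cor (B (rep \<gamma>) (rep \<delta>))) / (ws * n))"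
    unfolding minv_def
  proof (intro ballI)
    fix \<gamma> \<delta> assume d: "\<gamma> \<in> disc L" "\<delta> \<in> disc L"
    have "(\<Sum>\<epsilon>\<in>disc L. ws * ee (cor (- B (rep \<gamma>) (rep \<epsilon>))) * (ee (cor (B (rep \<epsilon>) (rep \<delta>))) / (ws * n))) =
      (\<Sum>\<epsilon>\<in>disc L. ee (cor (- B (rep \<gamma>) (rep \<epsilon>))) * ee (cor (B (rep \<epsilon>) (rep \<delta>)))) / n"
      using ws0 n0 by (simp add: sum_divide_distrib)
    then show "(\<Sum>\<epsilon>\<in>disc L. ws * ee (cor (- B (rep \<gamma>) (rep \<epsilon>))) * (ee (cor (B (rep \<epsilon>) (rep \<delta>))) / (ws * n))) = (if \<gamma> = \<delta> then 1 else 0)"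
      unfolding character_sum_disc[OF d] using n0 by (simp add: n_def)
  qed
  have 2: "minv (\<lambda>\<gamma> \<delta>. ee (cor (B (rep \<gamma>) (rep \<delta>))) / (ws * n)) (\<lambda>\<gamma> \<delta>. ws * ee (cor (- B (rep \<gamma>) (rep \<delta>))))"
    unfolding minv_def
  proof (intro ballI)
    fix \<gamma> \<delta> assume d: "\<gamma> \<in> disc L" "\<delta> \<in> disc L"
    have "(\<Sum>\<epsilon>\<in>disc L. ee (cor (B (rep \<gamma>) (rep \<epsilon>))) / (ws * n) * (ws * ee (cor (- B (rep \<epsilon>) (rep \<delta>))))) =
      (\<Sum>\<epsilon>\<in>disc L. ee (cor (- B (rep \<delta>) (rep \<epsilon>))) * ee (cor (B (rep \<epsilon>) (rep \<gamma>)))) / n"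
      unfolding sum_divide_distrib using ws0 n0 sym d by (intro sum.cong) (auto simp: ee_uminus)
    then show "(\<Sum>\<epsilon>\<in>disc L. ee (cor (B (rep \<gamma>) (rep \<epsilon>))) / (ws * n) * (ws * ee (cor (- B (rep \<epsilon>) (rep \<delta>))))) = (if \<gamma> = \<delta> then 1 else 0)"
      unfolding character_sum_disc[OF d(2,1)] using n0 by (auto simp: n_def)
  qed
  show "\<exists>r q. TR S_mp r \<and> minv r q \<and> minv q r" using TR_S 1 2 by blast
next
  fix g h assume gh: "g \<in> carrier Mp2Z" "h \<in> carrier Mp2Z" "\<exists>r q. TR g r \<and> minv r q \<and> minv q r" "\<exists>r q. TR h r \<and> minv r q \<and> minv q r"
  then obtain r r' q q' where r: "TR g r" "minv r r'" "minv r' r" and q: "TR h q" "minv q q'" "minv q' q" by blast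
  show "\<exists>r q. TR (mpm g h) r \<and> minv r q \<and> minv q r"
    using TR_mult[OF gh(1,2) r(1) q(1)] minv_mult[OF r(2) q(2)] minv_mult[OF q(3) r(3)] by blast
next
  fix g h assume gh: "g \<in> carrier Mp2Z" "h \<in> carrier Mp2Z" "\<exists>r q. TR h r \<and> minv r q \<and> minv q r" "\<exists>r q. TR (mpm h g) r \<and> minv r q \<and> minv q r"
  then obtain r r' q q' where r: "TR h r" "minv r r'" "minv r' r" and q: "TR (mpm h g) q" "minv q q'" "minv q' q" by blast
  \<comment> \<open>The law for \<open>mpm h g\<close> is the law for \<open>h\<close> read at the
    point moved by \<open>g\<close>. Applying the inverse of the matrix of \<open>h\<close> isolates
    the law for \<open>g\<close>.\<close>
  have TRg: "TR g (\<lambda>\<gamma> \<delta>. \<Sum>\<epsilon>\<in>disc L. r' \<gamma> \<epsilon> * q \<epsilon> \<delta>)"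
    unfolding TR_def
  proof (intro ballI)
    fix \<tau> \<zeta> \<gamma> assume \<tau>: "\<tau> \<in> uhp" and \<zeta>: "\<zeta> \<in> cspan L" and \<gamma>: "\<gamma> \<in> disc L"
    have gC: "fst g \<in> SL2R" using gh SL2Z_SL2R by (auto simp: Mp2Z_iff)
    have m: "fst (mpm h g) = fst h ** fst g" by (simp add: mpm_eq)
    define X where "X \<delta> = th (moeb (fst g) \<tau>) (gact (fst g) \<tau> \<zeta>) \<delta>" for \<delta>
    define Y where "Y \<delta> = th \<tau> \<zeta> \<delta>" for \<delta>
    have "(\<Sum>\<epsilon>\<in>disc L. r \<delta> \<epsilon> * X \<epsilon>) = thfac g \<tau> \<zeta> * (\<Sum>\<epsilon>\<in>disc L. q \<delta> \<epsilon> * Y \<epsilon>)" if d: "\<delta> \<in> disc L" for \<delta>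
    proof -
      have "thfac h (moeb (fst g) \<tau>) (gact (fst g) \<tau> \<zeta>) * (\<Sum>\<epsilon>\<in>disc L. r \<delta> \<epsilon> * X \<epsilon>) =
          th (moeb (fst h) (moeb (fst g) \<tau>)) (gact (fst h) (moeb (fst g) \<tau>) (gact (fst g) \<tau> \<zeta>)) \<delta>"
        unfolding X_def by (rule TRD[OF r(1) moeb_uhp[OF gC \<tau>] gact_cspan d, symmetric])
      also have "\<dots> = th (moeb (fst (mpm h g)) \<tau>) (gact (fst (mpm h g)) \<tau> \<zeta>) \<delta>"
        unfolding m by (simp add: moeb_mult[OF gC \<tau>] gact_mult[OF gC \<tau> \<zeta>])
      also have "\<dots> = thfac h (moeb (fst g) \<tau>) (gact (fst g) \<tau> \<zeta>) * (thfac g \<tau> \<zeta> * (\<Sum>\<epsilon>\<in>disc L. q \<delta> \<epsilon> * Y \<epsilon>))"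
        unfolding Y_def using TRD[OF q(1) \<tau> \<zeta> d] by (simp add: thfac_mult[OF gh(1) \<tau> \<zeta> gh(2)] mult.assoc)
      finally show ?thesis using thfac_nonzero[OF gh(2) moeb_uhp[OF gC \<tau>]] by simp
    qed
    then have "(\<Sum>\<delta>\<in>disc L. r' \<gamma> \<delta> * (\<Sum>\<epsilon>\<in>disc L. r \<delta> \<epsilon> * X \<epsilon>)) = (\<Sum>\<delta>\<in>disc L. r' \<gamma> \<delta> * (thfac g \<tau> \<zeta> * (\<Sum>\<epsilon>\<in>disc L. q \<delta> \<epsilon> * Y \<epsilon>)))"
      by (simp cong: sum.cong)
    then have "X \<gamma> = (\<Sum>\<delta>\<in>disc L. r' \<gamma> \<delta> * (thfac g \<tau> \<zeta> * (\<Sum>\<epsilon>\<in>disc L. q \<delta> \<epsilon> * Y \<epsilon>)))"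
      using minv_apply[OF r(3) \<gamma>, of X] by simp
    also have "\<dots> = thfac g \<tau> \<zeta> * (\<Sum>\<epsilon>\<in>disc L. (\<Sum>\<delta>\<in>disc L. r' \<gamma> \<delta> * q \<delta> \<epsilon>) * Y \<epsilon>)"
      unfolding sum_distrib_left sum_distrib_right by (subst sum.swap) (simp add: mult_ac)
    finally show "th (moeb (fst g) \<tau>) (gact (fst g) \<tau> \<zeta>) \<gamma> = thfac g \<tau> \<zeta> * (\<Sum>\<delta>\<in>disc L. (\<Sum>\<epsilon>\<in>disc L. r' \<gamma> \<epsilon> * q \<epsilon> \<delta>) * th \<tau> \<zeta> \<delta>)"
      by (simp add: X_def Y_def)
  qed
  show "\<exists>r q. TR g r \<and> minv r q \<and> minv q r" using TRg minv_mult[OF r(3) q(2)] minv_mult[OF q(3) r(2)] by blast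
qed

end

section \<open>The Weil representation\<close>

lemma GrD:
  assumes "v \<in> Gr f V"
  shows "subspace (fst v)" "subspace (snd v)" "x \<in> fst v \<Longrightarrow> x \<noteq> 0 \<Longrightarrow> f x x > 0" "x \<in> snd v \<Longrightarrow> x \<noteq> 0 \<Longrightarrow> f x x < 0"
    "x \<in> fst v \<Longrightarrow> y \<in> snd v \<Longrightarrow> f x y = 0" "V = {x + y | x y. x \<in> fst v \<and> y \<in> snd v}"
  using assms by (cases v, simp add: Gr_def)+

text \<open>A positive definite subspace meets \<open>snd v\<close> in 0 only, so its dimension is
  at most \<open>dim (rspan L) - dim (snd v)\<close>, which \<open>fst v\<close> attains.\<close>

lemma b_plus_Gr:
  assumes v: "v \<in> Gr (form L) (rspan L)"
  shows "b_plus L = dim (fst v)"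
proof -
  note g = GrD[OF v]
  have V: "subspace (rspan L)" by (simp add: rspan_def)
  have i: "U \<inter> snd v \<subseteq> {0}" if "\<forall>x\<in>U. x \<noteq> 0 \<longrightarrow> form L x x > 0" for U
  proof
    fix x assume "x \<in> U \<inter> snd v"
    then show "x \<in> {0}" using that g(4)[of x] by (cases "x = 0") auto
  qed
  have sum: "dim {x + y | x y. x \<in> U \<and> y \<in> snd v} = dim U + dim (snd v)"
    if "subspace U" "\<forall>x\<in>U. x \<noteq> 0 \<longrightarrow> form L x x > 0" for U
  proof -
    have "dim (U \<inter> snd v) = 0" using i[OF that(2)] unfolding dim_eq_0 .
    then show ?thesis using dim_sums_Int[OF that(1) g(2)] by linarith
  qed
  have S: "snd v \<subseteq> rspan L" "fst v \<subseteq> rspan L"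
  proof -
    have "0 + y \<in> rspan L" if "y \<in> snd v" for y unfolding g(6) using that subspace_0[OF g(1)] by blast
    moreover have "x + 0 \<in> rspan L" if "x \<in> fst v" for x unfolding g(6) using that subspace_0[OF g(2)] by blast
    ultimately show "snd v \<subseteq> rspan L" "fst v \<subseteq> rspan L" by auto
  qed
  have dV: "dim (rspan L) = dim (fst v) + dim (snd v)" unfolding g(6) using sum[OF g(1)] g(3) by blast
  let ?S = "{dim U | U. subspace U \<and> U \<subseteq> rspan L \<and> (\<forall>x\<in>U. x \<noteq> 0 \<longrightarrow> form L x x > 0)}"
  have le: "n \<le> dim (fst v)" if n: "n \<in> ?S" for n
  proof -
    obtain U where U: "n = dim U" "subspace U" "U \<subseteq> rspan L" "\<forall>x\<in>U. x \<noteq> 0 \<longrightarrow> form L x x > 0" using n by blast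
    have "{x + y | x y. x \<in> U \<and> y \<in> snd v} \<subseteq> rspan L" using U(3) S(1) subspace_add[OF V] by blast
    then show ?thesis using dim_subset[of "{x + y | x y. x \<in> U \<and> y \<in> snd v}" "rspan L"] sum[OF U(2,4)] dV U(1) by simp
  qed
  have "Max ?S = dim (fst v)"
  proof (rule Max_eqI)
    show "finite ?S" by (rule finite_subset[of _ "{..dim (fst v)}"]) (use le in auto)
    show "dim (fst v) \<in> ?S" using g(1,3) S(2) by blast
  qed (use le in blast)
  then show ?thesis by (simp add: b_plus_def)
qed

lemma neg_lat_simps [simp]: "pts (neg_lat L) = pts L" "form (neg_lat L) = (\<lambda>x y. - form L x y)"
  "rspan (neg_lat L) = rspan L" "dual (neg_lat L) = dual L" "coset (neg_lat L) = coset L"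
  "disc (neg_lat L) = disc L" "gring (neg_lat L) = gring L" "cspan (neg_lat L) = cspan L"
proof -
  show 1: "pts (neg_lat L) = pts L" "form (neg_lat L) = (\<lambda>x y. - form L x y)" by (auto simp: neg_lat_def)
  show 2: "rspan (neg_lat L) = rspan L" by (simp add: rspan_def 1)
  show 3: "dual (neg_lat L) = dual L" by (auto simp: dual_def 1 2)
  show 4: "coset (neg_lat L) = coset L" by (simp add: coset_def[abs_def] 1)
  show 5: "disc (neg_lat L) = disc L" by (simp add: disc_def 3 4)
  show "gring (neg_lat L) = gring L" "cspan (neg_lat L) = cspan L" by (simp_all add: gring_def cspan_def 2 5)
qed

lemma bilinear_neg: "bilinear f \<Longrightarrow> bilinear (\<lambda>x y. - f x y :: real)"
  by (simp add: bilinear_def linear_compose_neg)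

lemma even_neg_lat: assumes "even_lattice L" shows "even_lattice (neg_lat L)"
proof -
  have "\<exists>n. - form L x x = 2 * of_int n" if ex: "\<exists>n::int. form L x x = 2 * of_int n" for x
  proof -
    obtain n :: int where "form L x x = 2 * of_int n" using ex by blast
    then show ?thesis by (intro exI[of _ "- n"]) simp
  qed
  then show ?thesis using assms unfolding even_lattice_def by (simp add: bilinear_neg)
qed

lemma Gr_neg_lat:
  assumes "v \<in> Gr (form L) (rspan L)" and sym: "\<And>x y. x \<in> rspan L \<Longrightarrow> y \<in> rspan L \<Longrightarrow> form L x y = form L y x"
  shows "(snd v, fst v) \<in> Gr (form (neg_lat L)) (rspan (neg_lat L))"
proof -
  note g = GrD[OF assms(1)]
  have "rspan L = {x + y |x y. x \<in> snd v \<and> y \<in> fst v}" unfolding g(6) by (rule Collect_cong) (metis add.commute)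
  moreover have "form L x y = 0" if xy: "x \<in> snd v" "y \<in> fst v" for x y
  proof -
    have "0 + x \<in> rspan L" unfolding g(6) using xy subspace_0[OF g(1)] by blast
    moreover have "y + 0 \<in> rspan L" unfolding g(6) using xy subspace_0[OF g(2)] by blast
    ultimately show ?thesis using sym[of x y] g(5)[OF xy(2,1)] by simp
  qed
  ultimately show ?thesis using g(1-4) by (auto simp: Gr_def)
qed

lemma b_minus_neg_lat: "b_minus L = b_plus (neg_lat L)"
  by (simp add: b_minus_def b_plus_def)

section \<open>Existence and uniqueness of the representation\<close>

context theta_lattice
begin

lemma neg_gr: "(snd v, fst v) \<in> Gr (form (neg_lat L)) (rspan (neg_lat L))"
  by (rule Gr_neg_lat[OF gr B_sym])

lemma signature: "b_plus L = card Fp" "b_minus L = card Fm"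
  using b_plus_Gr[OF gr] b_plus_Gr[OF neg_gr] by (simp_all add: cardFp cardFm b_minus_neg_lat)

definition rg :: "mp \<Rightarrow> 'a set \<Rightarrow> 'a set \<Rightarrow> complex" where
  "rg g = (SOME r. \<exists>q. TR g r \<and> minv r q \<and> minv q r)"

lemma rg: assumes "g \<in> carrier Mp2Z" shows "TR g (rg g)" "\<exists>q. minv (rg g) q \<and> minv q (rg g)"
proof -
  have "\<exists>q. TR g (rg g) \<and> minv (rg g) q \<and> minv q (rg g)"
    using someI_ex[OF ex_TR[OF assms]] unfolding rg_def .
  then show "TR g (rg g)" "\<exists>q. minv (rg g) q \<and> minv q (rg g)" by blast+
qed

text \<open>The representation realised by theta functions; coefficient functions are treated as
  column vectors.\<close>

definition wr :: "mp \<Rightarrow> 'a gring \<Rightarrow> 'a gring" where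
  "wr g U = (\<lambda>\<gamma>. if \<gamma> \<in> disc L then \<Sum>\<delta>\<in>disc L. rg g \<gamma> \<delta> * U \<delta> else 0)"

lemma wr_gring: "wr g U \<in> gring L" by (simp add: wr_def gring_def)

lemma wr_eq: assumes "g \<in> carrier Mp2Z" "TR g r" "\<gamma> \<in> disc L" shows "wr g U \<gamma> = (\<Sum>\<delta>\<in>disc L. r \<gamma> \<delta> * U \<delta>)"
  unfolding wr_def using TR_unique[OF assms(1) rg(1)[OF assms(1)] assms(2) assms(3)] assms(3)
  by (simp cong: sum.cong)

lemma gring_eqI: "U \<in> gring L \<Longrightarrow> W \<in> gring L \<Longrightarrow> (\<And>\<gamma>. \<gamma> \<in> disc L \<Longrightarrow> U \<gamma> = W \<gamma>) \<Longrightarrow> U = W"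
proof
  fix \<gamma>
  assume "U \<in> gring L" "W \<in> gring L" "\<And>\<gamma>. \<gamma> \<in> disc L \<Longrightarrow> U \<gamma> = W \<gamma>"
  then show "U \<gamma> = W \<gamma>" by (cases "\<gamma> \<in> disc L") (simp_all add: gring_def)
qed

lemma gring_intros: "U \<in> gring L \<Longrightarrow> (\<lambda>\<gamma>. c * U \<gamma>) \<in> gring L" "\<gamma> \<in> disc L \<Longrightarrow> ebas \<gamma> \<in> gring L"
  "(\<And>i. i \<in> A \<Longrightarrow> u i \<in> gring L) \<Longrightarrow> (\<lambda>\<gamma>. \<Sum>i\<in>A. u i \<gamma>) \<in> gring L"
  by (auto simp: gring_def ebas_def)

lemma wr_inj:
  assumes g: "g \<in> carrier Mp2Z" and "U \<in> gring L" "W \<in> gring L" "wr g U = wr g W" shows "U = W"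
proof (rule gring_eqI[OF assms(2,3)])
  fix \<gamma> assume \<gamma>: "\<gamma> \<in> disc L"
  obtain q where q: "minv q (rg g)" using rg(2)[OF g] by blast
  have "(\<Sum>\<delta>\<in>disc L. rg g \<epsilon> \<delta> * U \<delta>) = (\<Sum>\<delta>\<in>disc L. rg g \<epsilon> \<delta> * W \<delta>)" if "\<epsilon> \<in> disc L" for \<epsilon>
    using fun_cong[OF assms(4), of \<epsilon>] that by (simp add: wr_def)
  then have "(\<Sum>\<epsilon>\<in>disc L. q \<gamma> \<epsilon> * (\<Sum>\<delta>\<in>disc L. rg g \<epsilon> \<delta> * U \<delta>)) = (\<Sum>\<epsilon>\<in>disc L. q \<gamma> \<epsilon> * (\<Sum>\<delta>\<in>disc L. rg g \<epsilon> \<delta> * W \<delta>))"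
    by (simp cong: sum.cong)
  then show "U \<gamma> = W \<gamma>" unfolding minv_apply[OF q \<gamma>] .
qed

lemma wr_mult:
  assumes g: "g \<in> carrier Mp2Z" and h: "h \<in> carrier Mp2Z" shows "wr (mpm g h) U = wr g (wr h U)"
proof (rule gring_eqI[OF wr_gring wr_gring])
  fix \<gamma> assume \<gamma>: "\<gamma> \<in> disc L"
  have "wr (mpm g h) U \<gamma> = (\<Sum>\<delta>\<in>disc L. (\<Sum>\<epsilon>\<in>disc L. rg g \<gamma> \<epsilon> * rg h \<epsilon> \<delta>) * U \<delta>)"
    by (rule wr_eq[OF Mp2Z_closed[OF g h] TR_mult[OF g h rg(1)[OF g] rg(1)[OF h]] \<gamma>])
  also have "\<dots> = (\<Sum>\<epsilon>\<in>disc L. rg g \<gamma> \<epsilon> * (\<Sum>\<delta>\<in>disc L. rg h \<epsilon> \<delta> * U \<delta>))"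
    unfolding sum_distrib_left sum_distrib_right by (subst sum.swap) (simp add: mult.assoc)
  finally show "wr (mpm g h) U \<gamma> = wr g (wr h U) \<gamma>" using \<gamma> by (simp add: wr_def cong: sum.cong)
qed

lemma ebas_sum: "\<gamma> \<in> disc L \<Longrightarrow> (\<Sum>\<delta>\<in>disc L. f \<delta> * ebas \<gamma> \<delta>) = f \<gamma>"
  "(\<Sum>\<delta>\<in>disc L. f \<delta> * ebas \<delta> \<gamma>) = (if \<gamma> \<in> disc L then f \<gamma> else 0)"
  using finite_disc by (simp_all add: ebas_def if_distrib[of "\<lambda>x. _ * x"] cong: if_cong)

lemma wr_T: "\<gamma> \<in> disc L \<Longrightarrow> wr T_mp U \<gamma> = ee (cor (B (rep \<gamma>) (rep \<gamma>) / 2)) * U \<gamma>"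
  unfolding wr_eq[OF T_mp_carrier TR_T] using finite_disc by (simp add: if_distrib[of "\<lambda>x. x * _"] cong: if_cong)

lemma wr_S: "\<gamma> \<in> disc L \<Longrightarrow> wr S_mp U \<gamma> = ws * (\<Sum>\<delta>\<in>disc L. ee (cor (- B (rep \<gamma>) (rep \<delta>))) * U \<delta>)"
  unfolding wr_eq[OF S_mp_carrier TR_S] by (simp add: sum_distrib_left mult.assoc)

lemma rep_sym: "\<gamma> \<in> disc L \<Longrightarrow> \<delta> \<in> disc L \<Longrightarrow> B (rep \<gamma>) (rep \<delta>) = B (rep \<delta>) (rep \<gamma>)"
  by (intro B_sym dual_V rep_dual)

text \<open>By multiplicativity the identity acts as an idempotent, and an injective idempotent is
  the identity map.\<close>

lemma wr_one: assumes "U \<in> gring L" shows "wr \<one>\<^bsub>Mp2Z\<^esub> U = U"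
proof -
  define e where "e = \<one>\<^bsub>Mp2Z\<^esub>"
  have e: "e = (mat 1, (\<lambda>\<tau>\<in>uhp. 1))" by (simp add: e_def Mp2Z_def Mp2R_def)
  have m: "moeb (mat 1) \<tau> = \<tau>" for \<tau> by (simp add: moeb_def jfac_def mat_def)
  have "(\<lambda>\<tau>\<in>uhp. 1 :: complex) holomorphic_on uhp" by (rule holomorphic_transform[of "\<lambda>_. 1"]) auto
  then have ec: "e \<in> carrier Mp2Z" by (auto simp: Mp2Z_iff e SL2Z_def SL2R_def det_2 mat_def jfac_def)
  have ee: "mpm e e = e" by (simp add: mpm_eq e m fun_eq_iff)
  have "wr e (wr e U) = wr e U" unfolding wr_mult[OF ec ec, symmetric] ee ..
  then show ?thesis unfolding e_def[symmetric] by (rule wr_inj[OF ec wr_gring assms])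
qed

lemma is_weil_rep_wr: "is_weil_rep L wr"
  unfolding is_weil_rep_def
proof (intro conjI ballI allI)
  show "wr g U \<in> gring L" for g U by (rule wr_gring)
  show "wr g (\<lambda>\<gamma>. a * U \<gamma> + b * W \<gamma>) = (\<lambda>\<gamma>. a * wr g U \<gamma> + b * wr g W \<gamma>)" for g U W a b
    by (auto simp: wr_def fun_eq_iff sum_distrib_left sum.distrib algebra_simps)
  show "U \<in> gring L \<Longrightarrow> wr \<one>\<^bsub>Mp2Z\<^esub> U = U" for U by (rule wr_one)
  show "g \<in> carrier Mp2Z \<Longrightarrow> h \<in> carrier Mp2Z \<Longrightarrow> wr (mpm g h) U = wr g (wr h U)" for g h U by (rule wr_mult)
  fix \<gamma> assume \<gamma>: "\<gamma> \<in> disc L"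
  show "wr T_mp (ebas \<gamma>) = (\<lambda>\<delta>. ee (cor (B (rep \<gamma>) (rep \<gamma>) / 2)) * ebas \<gamma> \<delta>)"
    by (rule gring_eqI[OF wr_gring gring_intros(1)[OF gring_intros(2)[OF \<gamma>]]]) (auto simp: wr_T ebas_def)
  show "wr S_mp (ebas \<gamma>) = (\<lambda>\<eta>. ee ((of_nat (b_minus L) - of_nat (b_plus L)) / 8) / cor (sqrt (real (card (disc L)))) *
            (\<Sum>\<delta>\<in>disc L. ee (cor (- B (rep \<gamma>) (rep \<delta>))) * ebas \<delta> \<eta>))"
  proof (rule gring_eqI[OF wr_gring])
    show "(\<lambda>\<eta>. ee ((of_nat (b_minus L) - of_nat (b_plus L)) / 8) / cor (sqrt (real (card (disc L)))) *
            (\<Sum>\<delta>\<in>disc L. ee (cor (- B (rep \<gamma>) (rep \<delta>))) * ebas \<delta> \<eta>)) \<in> gring L"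
      by (intro gring_intros)
    \<comment> \<open>The definition lists the image of a basis vector, \<open>wr\<close> a row of
      the matrix; the two agree because the matrix of \<open>S_mp\<close> is symmetric.\<close>
    show "wr S_mp (ebas \<gamma>) \<eta> = ee ((of_nat (b_minus L) - of_nat (b_plus L)) / 8) / cor (sqrt (real (card (disc L)))) *
            (\<Sum>\<delta>\<in>disc L. ee (cor (- B (rep \<gamma>) (rep \<delta>))) * ebas \<delta> \<eta>)" if \<eta>: "\<eta> \<in> disc L" for \<eta>
      unfolding wr_S[OF \<eta>] ebas_sum(1)[OF \<gamma>] ebas_sum(2) using \<eta> rep_sym[OF \<eta> \<gamma>] by (simp add: ws_def signature)
  qed
qed

lemma is_weil_repD:
  assumes "is_weil_rep L \<rho>" "\<gamma> \<in> disc L"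
  shows "\<rho> T_mp (ebas \<gamma>) = (\<lambda>\<delta>. ee (cor (B (rep \<gamma>) (rep \<gamma>) / 2)) * ebas \<gamma> \<delta>)"
    and "\<rho> S_mp (ebas \<gamma>) = (\<lambda>\<eta>. ee ((of_nat (b_minus L) - of_nat (b_plus L)) / 8) / cor (sqrt (real (card (disc L)))) *
            (\<Sum>\<delta>\<in>disc L. ee (cor (- B (rep \<gamma>) (rep \<delta>))) * ebas \<delta> \<eta>))"
  using assms unfolding is_weil_rep_def by blast+

lemma weil_rep_sum:
  assumes \<rho>: "is_weil_rep L \<rho>" and g: "g \<in> carrier Mp2Z" and "finite A" "\<And>i. i \<in> A \<Longrightarrow> u i \<in> gring L"
  shows "\<rho> g (\<lambda>\<gamma>. \<Sum>i\<in>A. c i * u i \<gamma>) = (\<lambda>\<gamma>. \<Sum>i\<in>A. c i * \<rho> g (u i) \<gamma>)"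
  using assms(3,4)
proof (induction A rule: finite_induct)
  have lin: "\<rho> g (\<lambda>\<gamma>. a * U \<gamma> + b * W \<gamma>) = (\<lambda>\<gamma>. a * \<rho> g U \<gamma> + b * \<rho> g W \<gamma>)" if "U \<in> gring L" "W \<in> gring L" for U W a b
    using \<rho> g that unfolding is_weil_rep_def by blast
  have z: "(\<lambda>_. 0) \<in> gring L" by (simp add: gring_def)
  {
    case empty
    show ?case using lin[OF z z, of 0 0] by simp
  next
    case (insert j A)
    have A: "(\<lambda>\<gamma>. \<Sum>i\<in>A. c i * u i \<gamma>) \<in> gring L" using insert.prems by (intro gring_intros) auto
    show ?case using lin[OF _ A, of "u j" "c j" 1] insert by simp
  }
qed

text \<open>Linearity reduces agreement on the generators to basis vectors, and the induction over
  the group cancels factors by injectivity of \<open>wr h\<close>. Applied to the choice in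
  \<open>weil_rep\<close>, it makes that representation computable.\<close>

lemma weil_rep_unique:
  assumes \<rho>: "is_weil_rep L \<rho>" and g: "g \<in> carrier Mp2Z"
  shows "\<forall>U\<in>gring L. \<rho> g U = wr g U"
proof -
  have basis: "\<forall>U\<in>gring L. \<rho> h U = wr h U" if h: "h \<in> carrier Mp2Z" and eq: "\<And>\<gamma>. \<gamma> \<in> disc L \<Longrightarrow> \<rho> h (ebas \<gamma>) = wr h (ebas \<gamma>)" for h
  proof
    fix U assume U: "U \<in> gring L"
    then have ex: "U = (\<lambda>\<gamma>. \<Sum>\<delta>\<in>disc L. U \<delta> * ebas \<delta> \<gamma>)" by (auto simp: ebas_sum gring_def)
    show "\<rho> h U = wr h U"
      by (subst (1 2) ex) (simp add: weil_rep_sum[OF \<rho> h finite_disc gring_intros(2)] weil_rep_sum[OF is_weil_rep_wr h finite_disc gring_intros(2)] eq cong: sum.cong)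
  qed
  have mult: "\<rho> (mpm g h) U = \<rho> g (\<rho> h U)" and gr: "\<rho> g U \<in> gring L" if "g \<in> carrier Mp2Z" "h \<in> carrier Mp2Z" "U \<in> gring L" for g h U
    using \<rho> that unfolding is_weil_rep_def by blast+
  show ?thesis
  proof (rule Mp2Z_induct[OF g])
    show "\<forall>U\<in>gring L. \<rho> S_mp U = wr S_mp U" "\<forall>U\<in>gring L. \<rho> T_mp U = wr T_mp U"
      by (intro basis S_mp_carrier T_mp_carrier; simp only: is_weil_repD[OF \<rho>] is_weil_repD[OF is_weil_rep_wr])+
  next
    fix g h assume "g \<in> carrier Mp2Z" "h \<in> carrier Mp2Z" "\<forall>U\<in>gring L. \<rho> g U = wr g U" "\<forall>U\<in>gring L. \<rho> h U = wr h U"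
    then show "\<forall>U\<in>gring L. \<rho> (mpm g h) U = wr (mpm g h) U" using mult wr_mult wr_gring by simp
  next
    fix g h assume gh: "g \<in> carrier Mp2Z" "h \<in> carrier Mp2Z" and h: "\<forall>U\<in>gring L. \<rho> h U = wr h U" and hg: "\<forall>U\<in>gring L. \<rho> (mpm h g) U = wr (mpm h g) U"
    show "\<forall>U\<in>gring L. \<rho> g U = wr g U"
    proof
      fix U assume U: "U \<in> gring L"
      have "wr h (\<rho> g U) = wr h (wr g U)" using h gr[OF gh U] mult[OF gh(2,1) U] hg U wr_mult[OF gh(2,1)] by simp
      then show "\<rho> g U = wr g U" by (rule wr_inj[OF gh(2) gr[OF gh U] wr_gring])
    qed
  qed
qed

lemma weil_rep_eq: "g \<in> carrier Mp2Z \<Longrightarrow> U \<in> gring L \<Longrightarrow> weil_rep L g U = wr g U"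
  using weil_rep_unique[of "weil_rep L"] someI[of "is_weil_rep L" wr] is_weil_rep_wr unfolding weil_rep_def by blast

lemma theta_transform:
  assumes "g \<in> carrier Mp2Z" "\<tau> \<in> uhp" "\<zeta> \<in> cspan L"
  shows "th (moeb (fst g) \<tau>) (gact (fst g) \<tau> \<zeta>) = (\<lambda>\<gamma>. thfac g \<tau> \<zeta> * wr g (th \<tau> \<zeta>) \<gamma>)"
  by (rule gring_eqI[OF siegel_gring gring_intros(1)[OF wr_gring]])
    (use TRD[OF rg(1)[OF assms(1)] assms(2,3)] in \<open>simp add: wr_def\<close>)

text \<open>Invariance of the pairing passes through products and cancellations, so it is checked on
  generators. For \<open>T_mp\<close> the phases cancel; for \<open>S_mp\<close> the two scalars
  multiply to \<open>1 / card (disc L)\<close> and character orthogonality supplies the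
  rest.\<close>

lemma dual_pairing:
  assumes g: "g \<in> carrier Mp2Z"
  shows "\<forall>U\<in>gring L. \<forall>W\<in>gring L. gpair L (wr g U) (dual_weil_rep L g W) = gpair L U W"
proof -
  \<comment> \<open>Negating the form exchanges the two spaces of \<open>v\<close>, so the whole
    theory applies to \<open>neg_lat L\<close> with the swapped pair.\<close>
  obtain E' Fp' Fm' where "theta_lattice (neg_lat L) (snd v, fst v) E' Fp' Fm'"
    using theta_lattice_exists[OF even_neg_lat[OF even] neg_gr] by blast
  then interpret N: theta_lattice "neg_lat L" "(snd v, fst v)" E' Fp' Fm' .
  have cards: "card Fp' = card Fm" "card Fm' = card Fp" using N.cardFp N.cardFm cardFp cardFm by simp_all
  have "\<forall>U\<in>gring L. \<forall>W\<in>gring L. gpair L (wr g U) (N.wr g W) = gpair L U W"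
  proof (rule Mp2Z_induct[OF g])
    show "\<forall>U\<in>gring L. \<forall>W\<in>gring L. gpair L (wr T_mp U) (N.wr T_mp W) = gpair L U W"
    proof (intro ballI)
      fix U W
      have "wr T_mp U \<gamma> * N.wr T_mp W \<gamma> = U \<gamma> * W \<gamma>" if \<gamma>: "\<gamma> \<in> disc L" for \<gamma>
      proof -
        have "ee (cor (B (rep \<gamma>) (rep \<gamma>) / 2)) * ee (cor (- B (rep \<gamma>) (rep \<gamma>) / 2)) = 1"
          unfolding ee_add[symmetric] by (simp add: ee_def)
        then show ?thesis using wr_T[OF \<gamma>] N.wr_T[of \<gamma>] \<gamma> by (simp add: mult_ac)
      qed
      then show "gpair L (wr T_mp U) (N.wr T_mp W) = gpair L U W" by (simp add: gpair_def cong: sum.cong)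
    qed
    show "\<forall>U\<in>gring L. \<forall>W\<in>gring L. gpair L (wr S_mp U) (N.wr S_mp W) = gpair L U W"
    proof (intro ballI)
      fix U W
      define n where "n = complex_of_nat (card (disc L))"
      have n0: "n \<noteq> 0" using card_disc_pos by (simp add: n_def)
      have "ee ((complex_of_nat (card Fm) - of_nat (card Fp)) / 8) * ee ((of_nat (card Fp) - of_nat (card Fm)) / 8) = 1"
        unfolding ee_add[symmetric] add_divide_distrib[symmetric] by (simp add: ee_def)
      moreover have "cor (sqrt (real (card (disc L)))) * cor (sqrt (real (card (disc L)))) = n"
        unfolding of_real_mult[symmetric] n_def by simp
      ultimately have ww: "ws * N.ws = 1 / n" by (simp add: ws_def N.ws_def cards times_divide_times_eq)
      define e where "e \<gamma> \<delta> = ee (cor (B (rep \<gamma>) (rep \<delta>)))" for \<gamma> \<delta>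
      define e' where "e' \<gamma> \<delta> = ee (cor (- B (rep \<gamma>) (rep \<delta>)))" for \<gamma> \<delta>
      have esym: "e' \<gamma> \<delta> = e' \<delta> \<gamma>" if "\<gamma> \<in> disc L" "\<delta> \<in> disc L" for \<gamma> \<delta> using rep_sym[OF that] by (simp add: e'_def)
      have "gpair L (wr S_mp U) (N.wr S_mp W) = (\<Sum>\<gamma>\<in>disc L. \<Sum>\<delta>\<in>disc L. \<Sum>\<epsilon>\<in>disc L. (ws * N.ws) * (U \<delta> * W \<epsilon> * (e' \<delta> \<gamma> * e \<gamma> \<epsilon>)))"
        unfolding gpair_def
      proof (rule sum.cong[OF refl])
        fix \<gamma> assume \<gamma>: "\<gamma> \<in> disc L"
        have 1: "wr S_mp U \<gamma> = ws * (\<Sum>\<delta>\<in>disc L. e' \<delta> \<gamma> * U \<delta>)"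
          unfolding wr_S[OF \<gamma>] using esym[OF \<gamma>] by (simp add: e'_def cong: sum.cong)
        have 2: "N.wr S_mp W \<gamma> = N.ws * (\<Sum>\<epsilon>\<in>disc L. e \<gamma> \<epsilon> * W \<epsilon>)"
          using N.wr_S[of \<gamma> W] \<gamma> by (simp add: e_def)
        show "wr S_mp U \<gamma> * N.wr S_mp W \<gamma> = (\<Sum>\<delta>\<in>disc L. \<Sum>\<epsilon>\<in>disc L. (ws * N.ws) * (U \<delta> * W \<epsilon> * (e' \<delta> \<gamma> * e \<gamma> \<epsilon>)))"
        proof -
          have "wr S_mp U \<gamma> * N.wr S_mp W \<gamma> = (ws * N.ws) * ((\<Sum>\<delta>\<in>disc L. e' \<delta> \<gamma> * U \<delta>) * (\<Sum>\<epsilon>\<in>disc L. e \<gamma> \<epsilon> * W \<epsilon>))"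
            unfolding 1 2 by (simp only: mult_ac)
          also have "\<dots> = (\<Sum>\<delta>\<in>disc L. \<Sum>\<epsilon>\<in>disc L. (ws * N.ws) * (U \<delta> * W \<epsilon> * (e' \<delta> \<gamma> * e \<gamma> \<epsilon>)))"
            unfolding sum_product by (simp only: sum_distrib_left mult_ac)
          finally show ?thesis .
        qed
      qed
      also have "\<dots> = (\<Sum>\<delta>\<in>disc L. \<Sum>\<epsilon>\<in>disc L. (ws * N.ws) * (U \<delta> * W \<epsilon> * (\<Sum>\<gamma>\<in>disc L. e' \<delta> \<gamma> * e \<gamma> \<epsilon>)))"
        by (subst sum.swap, rule sum.cong[OF refl], subst sum.swap) (simp add: sum_distrib_left)
      also have "\<dots> = (\<Sum>\<delta>\<in>disc L. \<Sum>\<epsilon>\<in>disc L. if \<delta> = \<epsilon> then U \<delta> * W \<epsilon> else 0)"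
      proof (intro sum.cong refl)
        fix \<delta> \<epsilon> assume d: "\<delta> \<in> disc L" "\<epsilon> \<in> disc L"
        have "(\<Sum>\<gamma>\<in>disc L. e' \<delta> \<gamma> * e \<gamma> \<epsilon>) = (if \<delta> = \<epsilon> then n else 0)"
          unfolding e'_def e_def n_def by (rule character_sum_disc[OF d])
        then show "(ws * N.ws) * (U \<delta> * W \<epsilon> * (\<Sum>\<gamma>\<in>disc L. e' \<delta> \<gamma> * e \<gamma> \<epsilon>)) = (if \<delta> = \<epsilon> then U \<delta> * W \<epsilon> else 0)"
          using n0 by (simp add: ww)
      qed
      also have "\<dots> = gpair L U W" using finite_disc by (simp add: gpair_def)
      finally show "gpair L (wr S_mp U) (N.wr S_mp W) = gpair L U W" .
    qed
  next
    fix g h assume gh: "g \<in> carrier Mp2Z" "h \<in> carrier Mp2Z"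
      and 1: "\<forall>U\<in>gring L. \<forall>W\<in>gring L. gpair L (wr g U) (N.wr g W) = gpair L U W"
        "\<forall>U\<in>gring L. \<forall>W\<in>gring L. gpair L (wr h U) (N.wr h W) = gpair L U W"
    show "\<forall>U\<in>gring L. \<forall>W\<in>gring L. gpair L (wr (mpm g h) U) (N.wr (mpm g h) W) = gpair L U W"
      using 1 wr_gring N.wr_gring by (simp add: wr_mult[OF gh] N.wr_mult[OF gh])
  next
    fix g h assume gh: "g \<in> carrier Mp2Z" "h \<in> carrier Mp2Z"
      and 1: "\<forall>U\<in>gring L. \<forall>W\<in>gring L. gpair L (wr h U) (N.wr h W) = gpair L U W"
        "\<forall>U\<in>gring L. \<forall>W\<in>gring L. gpair L (wr (mpm h g) U) (N.wr (mpm h g) W) = gpair L U W"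
    show "\<forall>U\<in>gring L. \<forall>W\<in>gring L. gpair L (wr g U) (N.wr g W) = gpair L U W"
    proof (intro ballI)
      fix U W assume UW: "U \<in> gring L" "W \<in> gring L"
      have "N.wr g W \<in> gring L" using N.wr_gring by simp
      then have "gpair L (wr g U) (N.wr g W) = gpair L (wr h (wr g U)) (N.wr h (N.wr g W))" using 1(1) wr_gring by simp
      also have "\<dots> = gpair L U W" using 1(2) UW unfolding wr_mult[OF gh(2,1)] N.wr_mult[OF gh(2,1)] by simp
      finally show "gpair L (wr g U) (N.wr g W) = gpair L U W" .
    qed
  qed
  then show ?thesis using N.weil_rep_eq[OF g] by (simp add: dual_weil_rep_def)
qed

lemma dual_weil_gring: assumes g: "g \<in> carrier Mp2Z" and "U \<in> gring L" shows "dual_weil_rep L g U \<in> gring L"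
proof -
  obtain E' Fp' Fm' where "theta_lattice (neg_lat L) (snd v, fst v) E' Fp' Fm'"
    using theta_lattice_exists[OF even_neg_lat[OF even] neg_gr] by blast
  then interpret N: theta_lattice "neg_lat L" "(snd v, fst v)" E' Fp' Fm' .
  show ?thesis using N.weil_rep_eq[OF g] N.wr_gring assms(2) by (simp add: dual_weil_rep_def)
qed

end

section \<open>From modular forms to Jacobi forms\<close>

lemma lin_exp_growth_pair:
  assumes "lin_exp_growth f" "lin_exp_growth h" "A \<in> SL2Z"
  obtains C D where "\<And>R. \<exists>c d y0. \<forall>x y. \<bar>x\<bar> \<le> R \<and> y > 0 \<and> y \<ge> y0 \<longrightarrow>
    cmod (f (moeb A (Complex x y))) \<le> c * exp (C * y) \<and> cmod (h (moeb A (Complex x y))) \<le> d * exp (D * y)"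
proof -
  obtain C where C: "\<And>R. \<exists>c y0. \<forall>x y. \<bar>x\<bar> \<le> R \<and> y > 0 \<and> y \<ge> y0 \<longrightarrow> cmod (f (moeb A (Complex x y))) \<le> c * exp (C * y)"
    using assms(1,3) unfolding lin_exp_growth_def by blast
  obtain D where D: "\<And>R. \<exists>d y0. \<forall>x y. \<bar>x\<bar> \<le> R \<and> y > 0 \<and> y \<ge> y0 \<longrightarrow> cmod (h (moeb A (Complex x y))) \<le> d * exp (D * y)"
    using assms(2,3) unfolding lin_exp_growth_def by blast
  show ?thesis
  proof (rule that)
    fix R
    obtain c y0 where c: "\<And>x y. \<bar>x\<bar> \<le> R \<and> y > 0 \<and> y \<ge> y0 \<Longrightarrow> cmod (f (moeb A (Complex x y))) \<le> c * exp (C * y)" using C by blast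
    obtain d y1 where d: "\<And>x y. \<bar>x\<bar> \<le> R \<and> y > 0 \<and> y \<ge> y1 \<Longrightarrow> cmod (h (moeb A (Complex x y))) \<le> d * exp (D * y)" using D by blast
    show "\<exists>c d y0. \<forall>x y. \<bar>x\<bar> \<le> R \<and> y > 0 \<and> y \<ge> y0 \<longrightarrow>
      cmod (f (moeb A (Complex x y))) \<le> c * exp (C * y) \<and> cmod (h (moeb A (Complex x y))) \<le> d * exp (D * y)"
      by (rule exI[of _ c], rule exI[of _ d], rule exI[of _ "max y0 y1"]) (use c d in auto)
  qed
qed

lemma lin_exp_growth_mult:
  assumes "lin_exp_growth f" "lin_exp_growth h" shows "lin_exp_growth (\<lambda>\<tau>. f \<tau> * h \<tau>)"
  unfolding lin_exp_growth_def
proof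
  fix A assume "A \<in> SL2Z"
  then obtain C D where CD: "\<And>R. \<exists>c d y0. \<forall>x y. \<bar>x\<bar> \<le> R \<and> y > 0 \<and> y \<ge> y0 \<longrightarrow>
    cmod (f (moeb A (Complex x y))) \<le> c * exp (C * y) \<and> cmod (h (moeb A (Complex x y))) \<le> d * exp (D * y)"
    using lin_exp_growth_pair[OF assms] by blast
  have "a * b \<le> (c * d) * exp ((C + D) * y)" if "a \<le> c * exp (C * y)" "b \<le> d * exp (D * y)" "a \<ge> 0" "b \<ge> 0" for a b c d y :: real
    using mult_mono[OF that(1,2) order_trans[OF that(3,1)] that(4)] unfolding distrib_right exp_add by (simp only: mult_ac)
  with CD show "\<exists>C. \<forall>R. \<exists>c y0. \<forall>x y. \<bar>x\<bar> \<le> R \<and> y > 0 \<and> y \<ge> y0 \<longrightarrow> cmod (f (moeb A (Complex x y)) * h (moeb A (Complex x y))) \<le> c * exp (C * y)"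
    unfolding norm_mult by (meson norm_ge_zero)
qed

lemma lin_exp_growth_add:
  assumes "lin_exp_growth f" "lin_exp_growth h" shows "lin_exp_growth (\<lambda>\<tau>. f \<tau> + h \<tau>)"
  unfolding lin_exp_growth_def
proof
  fix A assume "A \<in> SL2Z"
  then obtain C D where CD: "\<And>R. \<exists>c d y0. \<forall>x y. \<bar>x\<bar> \<le> R \<and> y > 0 \<and> y \<ge> y0 \<longrightarrow>
    cmod (f (moeb A (Complex x y))) \<le> c * exp (C * y) \<and> cmod (h (moeb A (Complex x y))) \<le> d * exp (D * y)"
    using lin_exp_growth_pair[OF assms] by blast
  have "cmod (a + b) \<le> (\<bar>c\<bar> + \<bar>d\<bar>) * exp (max C D * y)" if "cmod a \<le> c * exp (C * y)" "cmod b \<le> d * exp (D * y)" "y > 0" for a b c d y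
  proof -
    have "c * exp (C * y) \<le> \<bar>c\<bar> * exp (max C D * y)" "d * exp (D * y) \<le> \<bar>d\<bar> * exp (max C D * y)"
      using that(3) by (auto intro!: mult_mono mult_right_mono)
    then show ?thesis using norm_triangle_mono[OF that(1,2)] unfolding distrib_right by linarith
  qed
  with CD show "\<exists>C. \<forall>R. \<exists>c y0. \<forall>x y. \<bar>x\<bar> \<le> R \<and> y > 0 \<and> y \<ge> y0 \<longrightarrow> cmod (f (moeb A (Complex x y)) + h (moeb A (Complex x y))) \<le> c * exp (C * y)"
    by meson
qed

lemma lin_exp_growth_sum:
  assumes "finite S" "\<And>i. i \<in> S \<Longrightarrow> lin_exp_growth (f i)" shows "lin_exp_growth (\<lambda>\<tau>. \<Sum>i\<in>S. f i \<tau>)"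
  using assms
proof (induction S rule: finite_induct)
  case empty
  show ?case unfolding lin_exp_growth_def by (auto intro!: exI[of _ 0])
next
  case (insert j S)
  then show ?case by (simp add: lin_exp_growth_add)
qed

text \<open>Connects the weight of the modular form with that of the Jacobi form: subtracting half a
  natural number lowers the floor in \<open>autf\<close> by exactly that number.\<close>

lemma autf_shift:
  assumes "\<phi> \<tau> \<noteq> 0"
  shows "autf \<phi> (k - real m / 2) (l - real n / 2) \<tau> * (\<phi> \<tau> ^ m * cnj (\<phi> \<tau>) ^ n) = autf \<phi> k l \<tau>"
proof -
  have p: "w powi \<lfloor>2 * (r - real i / 2)\<rfloor> * w ^ i = w powi \<lfloor>2 * r\<rfloor>" if "w \<noteq> 0" for w :: complex and r :: real and i :: nat
  proof -
    have "2 * (r - real i / 2) = 2 * r - of_int (int i)" by simp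
    then have f: "\<lfloor>2 * (r - real i / 2)\<rfloor> = \<lfloor>2 * r\<rfloor> - int i" by (simp only: floor_diff_of_int)
    show ?thesis unfolding f power_int_diff[OF disjI1[OF that]] using that by simp
  qed
  have c: "cnj (\<phi> \<tau>) \<noteq> 0" using assms by simp
  have "autf \<phi> (k - real m / 2) (l - real n / 2) \<tau> * (\<phi> \<tau> ^ m * cnj (\<phi> \<tau>) ^ n) =
    (\<phi> \<tau> powi \<lfloor>2 * (k - real m / 2)\<rfloor> * \<phi> \<tau> ^ m) * (cnj (\<phi> \<tau>) powi \<lfloor>2 * (l - real n / 2)\<rfloor> * cnj (\<phi> \<tau>) ^ n)"
    unfolding autf_def by (simp only: mult_ac)
  then show ?thesis unfolding p[OF assms] p[OF c] autf_def .
qed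

lemma half_int_shift: "half_int (k - real n / 2) \<longleftrightarrow> half_int k"
proof -
  have "2 * (k - real n / 2) = 2 * k - real n" by simp
  moreover have "2 * k - real n \<in> \<int> \<longleftrightarrow> 2 * k \<in> \<int>"
    using Ints_add[of "2 * k - real n" "real n"] Ints_diff[of "2 * k" "real n"] Ints_of_nat[of n] by auto
  ultimately show ?thesis by (simp only: half_int_def)
qed

section \<open>Analytic properties of theta functions and of their pairings\<close>

context theta_lattice
begin

text \<open>The exponent of a theta term as a function of both variables jointly. It is only real
  linear, because of \<open>cnj \<tau>\<close>, and that is what \<open>expsum\<close>
  requires.\<close>

definition tl :: "'a \<Rightarrow> complex \<times> 'a cplx \<Rightarrow> complex" where
  "tl x p = 2 * cpi * \<i> * (fst p * cor (Qp x / 2) - cnj (fst p) * cor (Qm x / 2) + pr x (snd p))"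

lemma ee_tl: "ee (qexpt L v \<tau> x + cform L (cvec x) \<zeta>) = exp (tl x (\<tau>, \<zeta>))"
  by (simp add: ee_def tl_def qexpt_eq pr_def)

lemma theta_term: "ee (qexpt L v \<tau> x + cform L (cvec x) \<zeta>) = gq (sv \<tau>) x * ch x \<zeta>"
  by (simp add: ee_add ee_qexpt ch_def pr_def)

lemma linear_tl: "linear (tl x)"
proof -
  define a b where "a = cor (Qp x / 2)" and "b = cor (Qm x / 2)"
  have t: "tl x = (\<lambda>p. 2 * cpi * \<i> * (fst p * a - cnj (fst p) * b + pr x (snd p)))" by (simp add: tl_def[abs_def] a_def b_def)
  show ?thesis unfolding t by (rule linearI) (simp_all add: pr_simps scaleR_conv_of_real algebra_simps)
qed

lemma tl_bound: obtains C where "C > 0" "\<And>x p. cmod (tl x p) \<le> C * ((norm x)\<^sup>2 + norm x) * norm p"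
proof -
  obtain C1 where C1: "C1 > 0" "\<And>x. Qp x + Qm x \<le> C1 * (norm x)\<^sup>2" using Q_upper by blast
  obtain C2 where C2: "C2 > 0" "\<And>x \<zeta>. cmod (pr x \<zeta>) \<le> C2 * norm x * norm \<zeta>" using pr_bound by blast
  define C where "C = 2 * pi * (C1 + C2)"
  have "cmod (tl x p) \<le> C * ((norm x)\<^sup>2 + norm x) * norm p" for x p
  proof -
    have n: "norm (fst p) \<le> norm p" "norm (snd p) \<le> norm p" using norm_fst_le[of "fst p" "snd p"] norm_snd_le[of "snd p" "fst p"] by simp_all
    have "cmod (fst p * cor (Qp x / 2) - cnj (fst p) * cor (Qm x / 2) + pr x (snd p)) \<le>
      cmod (fst p) * (Qp x / 2) + cmod (fst p) * (Qm x / 2) + cmod (pr x (snd p))"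
    proof -
      have "cmod (fst p * cor (Qp x / 2)) = cmod (fst p) * (Qp x / 2)" "cmod (cnj (fst p) * cor (Qm x / 2)) = cmod (fst p) * (Qm x / 2)"
        using Qp_nonneg[of x] Qm_nonneg[of x] by (simp_all add: norm_mult norm_divide)
      then show ?thesis
        using norm_triangle_ineq[of "fst p * cor (Qp x / 2) - cnj (fst p) * cor (Qm x / 2)" "pr x (snd p)"]
          norm_triangle_ineq4[of "fst p * cor (Qp x / 2)" "cnj (fst p) * cor (Qm x / 2)"] by linarith
    qed
    also have "\<dots> = cmod (fst p) * ((Qp x + Qm x) / 2) + cmod (pr x (snd p))" by (simp add: field_simps)
    also have "\<dots> \<le> norm p * (C1 * (norm x)\<^sup>2) + C2 * norm x * norm p"
    proof (rule add_mono)
      have "(Qp x + Qm x) / 2 \<le> C1 * (norm x)\<^sup>2" 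
        by (rule order_trans[OF _ C1(2)]) (use Qp_nonneg[of x] Qm_nonneg[of x] in simp)
      then show "cmod (fst p) * ((Qp x + Qm x) / 2) \<le> norm p * (C1 * (norm x)\<^sup>2)"
        using n(1) Qp_nonneg[of x] Qm_nonneg[of x] by (intro mult_mono) auto
      show "cmod (pr x (snd p)) \<le> C2 * norm x * norm p"
        by (rule order_trans[OF C2(2)]) (use C2(1) n(2) in \<open>auto intro!: mult_left_mono\<close>)
    qed
    also have "\<dots> \<le> (C1 + C2) * ((norm x)\<^sup>2 + norm x) * norm p"
      using C1(1) C2(1) by (simp add: algebra_simps)
    finally show ?thesis by (simp add: tl_def norm_mult C_def mult.assoc)
  qed
  moreover have "C > 0" using C1(1) C2(1) by (simp add: C_def)
  ultimately show ?thesis using that by blast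
qed

lemma Re_tl: "Re (tl x (\<tau>, \<zeta>)) = - pi * Im \<tau> * (Qp x + Qm x) - 2 * pi * Im (pr x \<zeta>)"
  by (simp add: tl_def algebra_simps)

lemma tl_summable:
  assumes \<tau>: "\<tau> \<in> uhp" and C: "C > 0"
  shows "\<exists>\<eta>>0. (\<lambda>x. exp (Re (tl x (\<tau>, \<zeta>)) + \<eta> * (C * ((norm x)\<^sup>2 + norm x)))) summable_on dual L"
proof -
  obtain \<kappa> where \<kappa>: "\<kappa> > 0" "\<And>x. x \<in> V \<Longrightarrow> \<kappa> * (norm x)\<^sup>2 \<le> Qp x + Qm x" using Q_lower by blast
  obtain C2 where C2: "C2 > 0" "\<And>x \<zeta>. cmod (pr x \<zeta>) \<le> C2 * norm x * norm \<zeta>" using pr_bound by blast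
  have y: "Im \<tau> > 0" using \<tau> by (simp add: uhp_iff)
  \<comment> \<open>Half of the Gaussian decay pays for the slack, which grows quadratically in
    \<open>x\<close> because the exponents do; the other half remains for convergence.\<close>
  define k where "k = pi * Im \<tau> * \<kappa> / 2"
  have k: "k > 0" using y \<kappa>(1) by (simp add: k_def)
  define D where "D = 2 * pi * C2 * norm \<zeta> + k"
  have "(\<lambda>x. exp (Re (tl x (\<tau>, \<zeta>)) + k / C * (C * ((norm x)\<^sup>2 + norm x)))) summable_on dual L"
  proof (rule summable_on_dominated[OF summable_dual_gauss[OF k, of D]])
    fix x assume "x \<in> dual L"
    then have xV: "x \<in> V" by (rule dual_V)
    have "- (pi * Im \<tau> * (Qp x + Qm x)) \<le> - (pi * Im \<tau> * (\<kappa> * (norm x)\<^sup>2))"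
      using \<kappa>(2)[OF xV] y by (simp add: mult_left_mono)
    moreover have "- Im (pr x \<zeta>) \<le> C2 * norm x * norm \<zeta>"
      using C2(2)[of x \<zeta>] abs_Im_le_cmod[of "pr x \<zeta>"] by linarith
    then have "2 * pi * - Im (pr x \<zeta>) \<le> 2 * pi * (C2 * norm x * norm \<zeta>)" by (intro mult_left_mono) auto
    ultimately have "Re (tl x (\<tau>, \<zeta>)) + k / C * (C * ((norm x)\<^sup>2 + norm x)) \<le> - k * (norm x)\<^sup>2 + D * norm x"
    proof -
      assume h: "- (pi * Im \<tau> * (Qp x + Qm x)) \<le> - (pi * Im \<tau> * (\<kappa> * (norm x)\<^sup>2))"
        "2 * pi * - Im (pr x \<zeta>) \<le> 2 * pi * (C2 * norm x * norm \<zeta>)"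
      have "pi * Im \<tau> * (\<kappa> * (norm x)\<^sup>2) = 2 * (k * (norm x)\<^sup>2)" by (simp add: k_def)
      moreover have "k / C * (C * ((norm x)\<^sup>2 + norm x)) = k * (norm x)\<^sup>2 + k * norm x" using C by (simp add: distrib_left)
      moreover have "D * norm x = 2 * pi * (C2 * norm x * norm \<zeta>) + k * norm x" by (simp add: D_def distrib_right)
      moreover have "Re (tl x (\<tau>, \<zeta>)) = - (pi * Im \<tau> * (Qp x + Qm x)) + 2 * pi * - Im (pr x \<zeta>)" by (simp add: Re_tl)
      ultimately show ?thesis using h by linarith
    qed
    then show "norm (exp (Re (tl x (\<tau>, \<zeta>)) + k / C * (C * ((norm x)\<^sup>2 + norm x)))) \<le> exp (- k * (norm x)\<^sup>2 + D * norm x)" by simp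
  qed
  then show ?thesis using k C by (intro exI[of _ "k / C"]) simp
qed

lemma theta_smooth:
  assumes \<gamma>: "\<gamma> \<in> disc L"
  shows "smooth_on (\<lambda>p. th (fst p) (snd p) \<gamma>) (uhp \<times> cspan L)"
proof -
  obtain C where C: "C > 0" "\<And>x p. cmod (tl x p) \<le> C * ((norm x)\<^sup>2 + norm x) * norm p" using tl_bound by blast
  have "smooth_on (expsum \<gamma> (\<lambda>_. 1) tl) (uhp \<times> cspan L)"
  proof (rule smooth_on_openI)
    \<comment> \<open>The series converges for every \<open>\<zeta>\<close> of the ambient
      complexification, so it is itself the extension to an open set.\<close>
    show "open (uhp \<times> (UNIV :: 'a cplx set))" by (intro open_Times open_uhp open_UNIV)
    show "Ck_on n (expsum \<gamma> (\<lambda>_. 1) tl) (uhp \<times> UNIV)" for n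
    proof (rule expsum_Ck_on[where N = "\<lambda>x. C * ((norm x)\<^sup>2 + norm x)"])
      show "open (uhp \<times> (UNIV :: 'a cplx set))" by (intro open_Times open_uhp open_UNIV)
      fix p :: "complex \<times> 'a cplx" assume "p \<in> uhp \<times> UNIV"
      then have t: "fst p \<in> uhp" by auto
      obtain \<eta> where \<eta>: "\<eta> > 0" "(\<lambda>x. exp (Re (tl x (fst p, snd p)) + \<eta> * (C * ((norm x)\<^sup>2 + norm x)))) summable_on dual L"
        using tl_summable[OF t C(1)] by blast
      have "(\<lambda>x. exp (Re (tl x (fst p, snd p)) + \<eta> * (C * ((norm x)\<^sup>2 + norm x)))) summable_on \<gamma>"
        by (rule summable_on_subset_banach[OF \<eta>(2)]) (use disc_mem(1)[OF \<gamma>] in blast)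
      then show "\<exists>\<eta>>0. (\<lambda>x. cmod 1 * exp (Re (tl x p) + \<eta> * (C * ((norm x)\<^sup>2 + norm x)))) summable_on \<gamma>"
        using \<eta>(1) by (intro exI[of _ \<eta>]) simp
    qed (use linear_tl C in auto)
  qed auto
  then show ?thesis
    by (rule smooth_on_cong[rotated]) (simp add: siegel_theta_def \<gamma> expsum_def ee_tl)
qed

lemma jacobi_expansion:
  assumes \<tau>: "\<tau> \<in> uhp"
  shows "((\<lambda>x. G \<tau> (coset L x) * ee (qexpt L v \<tau> x + cform L (cvec x) \<zeta>)) has_sum jacobi_of L v G \<tau> \<zeta>) (dual L)"
proof -
  define M where "M = (\<Sum>\<delta>\<in>disc L. cmod (G \<tau> \<delta>))"
  have sm: "(\<lambda>x. G \<tau> (coset L x) * ee (qexpt L v \<tau> x + cform L (cvec x) \<zeta>)) summable_on dual L"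
  proof (rule summable_on_dominated[OF summable_on_cmult_right[OF dth_summable[OF sv_pos[OF \<tau>], of \<zeta>], of M]])
    fix x assume x: "x \<in> dual L"
    have "cmod (G \<tau> (coset L x)) \<le> M" unfolding M_def
      by (rule member_le_sum[OF coset_disc[OF x]]) (auto simp: finite_disc)
    then show "cmod (G \<tau> (coset L x) * ee (qexpt L v \<tau> x + cform L (cvec x) \<zeta>)) \<le> M * cmod (gq (sv \<tau>) x * ch x \<zeta>)"
      unfolding theta_term norm_mult[of "G \<tau> (coset L x)"] by (rule mult_right_mono) simp
  qed
  have "infsum (\<lambda>x. G \<tau> (coset L x) * ee (qexpt L v \<tau> x + cform L (cvec x) \<zeta>)) (dual L) =
    (\<Sum>\<gamma>\<in>disc L. th \<tau> \<zeta> \<gamma> * G \<tau> \<gamma>)"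
    unfolding infsum_dual_disc[OF sm]
  proof (rule sum.cong[OF refl])
    fix \<gamma> assume d: "\<gamma> \<in> disc L"
    have "(\<Sum>\<^sub>\<infinity>x\<in>\<gamma>. G \<tau> (coset L x) * ee (qexpt L v \<tau> x + cform L (cvec x) \<zeta>)) = (\<Sum>\<^sub>\<infinity>x\<in>\<gamma>. ee (qexpt L v \<tau> x + cform L (cvec x) \<zeta>) * G \<tau> \<gamma>)"
      by (rule infsum_cong) (simp add: disc_mem(2)[OF d])
    then show "(\<Sum>\<^sub>\<infinity>x\<in>\<gamma>. G \<tau> (coset L x) * ee (qexpt L v \<tau> x + cform L (cvec x) \<zeta>)) = th \<tau> \<zeta> \<gamma> * G \<tau> \<gamma>"
      by (simp add: siegel_theta_def d infsum_cmult_left')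
  qed
  then show ?thesis using has_sum_infsum[OF sm] by (simp add: jacobi_of_def gpair_def)
qed

text \<open>For fixed \<open>\<tau>\<close> the exponents are complex linear in
  \<open>\<zeta>\<close>, and the termwise derivative inherits this.\<close>

lemma jacobi_holomorphic:
  assumes \<tau>: "\<tau> \<in> uhp"
  shows "\<exists>D. (jacobi_of L v G \<tau> has_derivative D) (at \<zeta>) \<and> (\<forall>c \<xi>. D (cscale c \<xi>) = c * D \<xi>)"
proof -
  obtain C where C: "C > 0" "\<And>x p. cmod (tl x p) \<le> C * ((norm x)\<^sup>2 + norm x) * norm p" using tl_bound by blast
  define w where "w x = G \<tau> (coset L x) * ee (qexpt L v \<tau> x)" for x
  define l where "l x = (\<lambda>\<xi>. 2 * cpi * \<i> * pr x \<xi>)" for x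
  have lt: "l x \<xi> = tl x (0, \<xi>)" for x \<xi> by (simp add: l_def tl_def)
  have lb: "cmod (l x \<xi>) \<le> C * ((norm x)\<^sup>2 + norm x) * norm \<xi>" for x \<xi>
    using C(2)[of x "(0, \<xi>)"] unfolding lt by (simp add: norm_Pair)
  have ll: "linear (l x)" for x by (rule linearI) (simp_all add: l_def pr_simps scaleR_conv_of_real algebra_simps)
  have eq: "jacobi_of L v G \<tau> = expsum (dual L) w l"
  proof
    fix \<xi>
    have "jacobi_of L v G \<tau> \<xi> = (\<Sum>\<^sub>\<infinity>x\<in>dual L. G \<tau> (coset L x) * ee (qexpt L v \<tau> x + cform L (cvec x) \<xi>))"
      using infsumI[OF jacobi_expansion[OF \<tau>]] by simp
    also have "\<dots> = expsum (dual L) w l \<xi>" unfolding expsum_def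
      by (rule infsum_cong) (unfold w_def l_def pr_def ee_add, simp add: ee_def mult.assoc)
    finally show "jacobi_of L v G \<tau> \<xi> = expsum (dual L) w l \<xi>" .
  qed
  define M where "M = (\<Sum>\<delta>\<in>disc L. cmod (G \<tau> \<delta>))"
  obtain \<eta> where \<eta>: "\<eta> > 0" "(\<lambda>x. exp (Re (tl x (\<tau>, \<zeta>)) + \<eta> * (C * ((norm x)\<^sup>2 + norm x)))) summable_on dual L"
    using tl_summable[OF \<tau> C(1)] by blast
  have sm: "(\<lambda>x. cmod (w x) * exp (Re (l x \<zeta>) + \<eta> * (C * ((norm x)\<^sup>2 + norm x)))) summable_on dual L"
  proof (rule summable_on_dominated[OF summable_on_cmult_right[OF \<eta>(2), of M]])
    fix x assume x: "x \<in> dual L"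
    have M: "cmod (G \<tau> (coset L x)) \<le> M" unfolding M_def
      by (rule member_le_sum[OF coset_disc[OF x]]) (auto simp: finite_disc)
    have "tl x (\<tau>, \<zeta>) = 2 * cpi * \<i> * qexpt L v \<tau> x + l x \<zeta>" by (simp add: tl_def l_def qexpt_eq algebra_simps)
    then have "exp (Re (tl x (\<tau>, \<zeta>))) = cmod (ee (qexpt L v \<tau> x)) * exp (Re (l x \<zeta>))"
      by (simp add: ee_def exp_diff exp_minus divide_inverse mult.commute)
    then have "cmod (w x) * exp (Re (l x \<zeta>) + \<eta> * (C * ((norm x)\<^sup>2 + norm x))) =
       cmod (G \<tau> (coset L x)) * exp (Re (tl x (\<tau>, \<zeta>)) + \<eta> * (C * ((norm x)\<^sup>2 + norm x)))"
      by (simp only: w_def norm_mult exp_add mult.assoc)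
    also have "\<dots> \<le> M * exp (Re (tl x (\<tau>, \<zeta>)) + \<eta> * (C * ((norm x)\<^sup>2 + norm x)))" by (rule mult_right_mono[OF M]) simp
    finally show "norm (cmod (w x) * exp (Re (l x \<zeta>) + \<eta> * (C * ((norm x)\<^sup>2 + norm x)))) \<le> M * exp (Re (tl x (\<tau>, \<zeta>)) + \<eta> * (C * ((norm x)\<^sup>2 + norm x)))"
      by simp
  qed
  have "(expsum (dual L) w l has_derivative (\<lambda>d. expsum (dual L) (\<lambda>x. w x * l x d) l \<zeta>)) (at \<zeta>)"
    by (rule expsum_has_derivative[OF ll lb _ \<eta>(1) sm]) (use C(1) in auto)
  moreover have "expsum (dual L) (\<lambda>x. w x * l x (cscale c \<xi>)) l \<zeta> = c * expsum (dual L) (\<lambda>x. w x * l x \<xi>) l \<zeta>" for c \<xi>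
    unfolding expsum_def infsum_cmult_right'[symmetric] by (rule infsum_cong) (simp add: l_def pr_cscale)
  ultimately show ?thesis unfolding eq by blast
qed

text \<open>Completing the square turns the translation of \<open>\<zeta>\<close> by
  \<open>\<sigma>\<close> into the translation \<open>x + \<sigma>\<close> of the summation index,
  which preserves the coset; the translation by \<open>\<nu>\<close> disappears by
  integrality.\<close>

lemma theta_quasi_periodic:
  assumes \<sigma>: "\<sigma> \<in> pts L" and \<nu>: "\<nu> \<in> pts L" and \<gamma>: "\<gamma> \<in> disc L"
  shows "th \<tau> (\<zeta> + cscale \<tau> (cvec (oproj L (fst v) \<sigma>)) + cscale (cnj \<tau>) (cvec (oproj L (snd v) \<sigma>)) + cvec \<nu>) \<gamma> =
    ee (- qexpt L v \<tau> \<sigma> - cform L (cvec \<sigma>) \<zeta>) * th \<tau> \<zeta> \<gamma>"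
proof -
  define \<xi> where "\<xi> = \<zeta> + cscale \<tau> (cvec (oproj L (fst v) \<sigma>)) + cscale (cnj \<tau>) (cvec (oproj L (snd v) \<sigma>)) + cvec \<nu>"
  define t where "t x = qexpt L v \<tau> x + cform L (cvec x) \<zeta>" for x
  define c where "c = ee (- qexpt L v \<tau> \<sigma> - cform L (cvec \<sigma>) \<zeta>)"
  have tm: "ee (qexpt L v \<tau> x + cform L (cvec x) \<xi>) = c * ee (t (x + \<sigma>))" if x: "x \<in> dual L" for x
  proof -
    define bp where "bp = (\<Sum>f\<in>Fp. B x f * B \<sigma> f)"
    define bm where "bm = (\<Sum>f\<in>Fm. B x f * B \<sigma> f)"
    have op: "B x (oproj L (fst v) \<sigma>) = bp" "B x (oproj L (snd v) \<sigma>) = - bm"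
      by (simp_all add: oproj_plus oproj_minus B_sum_right B_simps bp_def bm_def mult.commute sum_negf)
    have Q: "Qp (x + \<sigma>) = Qp x + Qp \<sigma> + 2 * bp" "Qm (x + \<sigma>) = Qm x + Qm \<sigma> + 2 * bm"
      by (simp_all add: Qp_def Qm_def bp_def bm_def B_simps power2_sum sum.distrib sum_distrib_left mult.assoc)
    have "pr x \<xi> = pr x \<zeta> + \<tau> * cor bp - cnj \<tau> * cor bm + cor (B x \<nu>)"
      unfolding \<xi>_def by (simp add: pr_simps(1) pr_cscale pr_simps(4) op)
    then have "qexpt L v \<tau> x + pr x \<xi> = (- qexpt L v \<tau> \<sigma> - pr \<sigma> \<zeta>) + (qexpt L v \<tau> (x + \<sigma>) + pr (x + \<sigma>) \<zeta>) + cor (B x \<nu>)"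
      unfolding qexpt_eq Q pr_simps(5) by (simp add: algebra_simps add_divide_distrib)
    moreover have "ee (cor (B x \<nu>)) = 1" using dual_pair(1)[OF x \<nu>] ee_of_real_eq_1 by blast
    ultimately show ?thesis unfolding c_def t_def pr_def[symmetric] by (simp only: ee_add mult_1_right)
  qed
  have bij: "bij_betw (\<lambda>x. x + \<sigma>) \<gamma> \<gamma>"
  proof (rule bij_betwI[where g = "\<lambda>x. x - \<sigma>"])
    have "x + \<sigma> \<in> \<gamma>" "x - \<sigma> \<in> \<gamma>" if "x \<in> \<gamma>" for x
    proof -
      have "coset L (x + \<sigma>) = \<gamma>" "coset L (x - \<sigma>) = \<gamma>"
        using coset_eq_iff[of "x + \<sigma>" x] coset_eq_iff[of "x - \<sigma>" x] disc_mem(2)[OF \<gamma> that] \<sigma> pts_intros(4)[OF \<sigma>] by simp_all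
      then show "x + \<sigma> \<in> \<gamma>" "x - \<sigma> \<in> \<gamma>" using mem_coset[of "x + \<sigma>" "x + \<sigma>"] mem_coset[of "x - \<sigma>" "x - \<sigma>"] pts_intros(1) by auto
    qed
    then show "(\<lambda>x. x + \<sigma>) \<in> \<gamma> \<rightarrow> \<gamma>" "(\<lambda>x. x - \<sigma>) \<in> \<gamma> \<rightarrow> \<gamma>" by auto
  qed auto
  have "th \<tau> \<xi> \<gamma> = (\<Sum>\<^sub>\<infinity>x\<in>\<gamma>. c * ee (t (x + \<sigma>)))"
    unfolding siegel_theta_def using \<gamma> disc_mem(1)[OF \<gamma>] by (auto intro!: infsum_cong simp: tm)
  also have "\<dots> = c * (\<Sum>\<^sub>\<infinity>x\<in>\<gamma>. ee (t (x + \<sigma>)))" by (rule infsum_cmult_right')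
  also have "(\<Sum>\<^sub>\<infinity>x\<in>\<gamma>. ee (t (x + \<sigma>))) = (\<Sum>\<^sub>\<infinity>x\<in>\<gamma>. ee (t x))" by (rule infsum_reindex_bij_betw[OF bij])
  finally show ?thesis using \<gamma> by (simp add: \<xi>_def c_def t_def siegel_theta_def)
qed

definition zfac :: "real^2^2 \<Rightarrow> complex \<Rightarrow> 'a cplx \<Rightarrow> complex" where
  "zfac A \<tau> \<zeta> = ee (cor (A $ 2 $ 1) * zp \<zeta> / (2 * jfac A \<tau>) + cor (A $ 2 $ 1) * zm \<zeta> / (2 * cnj (jfac A \<tau>)))"

lemma modular_formD:
  assumes "modular_form L \<Gamma> p q G"
  shows "half_int p" "half_int q" "\<tau> \<in> uhp \<Longrightarrow> G \<tau> \<in> gring L" "\<gamma> \<in> disc L \<Longrightarrow> smooth_on (\<lambda>\<tau>. G \<tau> \<gamma>) uhp"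
    "\<gamma> \<in> disc L \<Longrightarrow> lin_exp_growth (\<lambda>\<tau>. G \<tau> \<gamma>)"
    "\<tau> \<in> uhp \<Longrightarrow> g \<in> \<Gamma> \<Longrightarrow> G (moeb (fst g) \<tau>) = (\<lambda>\<gamma>. autf (snd g) p q \<tau> * dual_weil_rep L g (G \<tau>) \<gamma>)"
  using assms unfolding modular_form_def by (auto simp: split_def)

lemma thfac_autf:
  assumes g: "g \<in> carrier Mp2Z" and \<tau>: "\<tau> \<in> uhp"
  shows "autf (snd g) (k - real (b_plus L) / 2) (l - real (b_minus L) / 2) \<tau> * thfac g \<tau> \<zeta> = autf (snd g) k l \<tau> * zfac (fst g) \<tau> \<zeta>"
proof -
  have "(snd g \<tau>)\<^sup>2 \<noteq> 0" using g \<tau> jfac_nonzero[OF SL2Z_SL2R] by (auto simp: Mp2Z_iff)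
  then have "snd g \<tau> \<noteq> 0" by auto
  from autf_shift[of "snd g", OF this, of k "b_plus L" l "b_minus L"] show ?thesis
    by (simp add: thfac_def zfac_def signature mult_ac)
qed

text \<open>Theta functions transform by \<open>wr\<close>, the modular form by the dual
  representation, and the pairing is invariant; only the scalar factors remain and their weights add
  up.\<close>

lemma jacobi_transform:
  assumes G: "modular_form L \<Gamma> (k - real (b_plus L) / 2) (l - real (b_minus L) / 2) G"
    and g: "g \<in> \<Gamma>" "g \<in> carrier Mp2Z" and \<tau>: "\<tau> \<in> uhp" and \<zeta>: "\<zeta> \<in> cspan L"
  shows "jacobi_of L v G (moeb (fst g) \<tau>) (gact (fst g) \<tau> \<zeta>) = autf (snd g) k l \<tau> * zfac (fst g) \<tau> \<zeta> * jacobi_of L v G \<tau> \<zeta>"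
proof -
  have "jacobi_of L v G (moeb (fst g) \<tau>) (gact (fst g) \<tau> \<zeta>) =
     autf (snd g) (k - real (b_plus L) / 2) (l - real (b_minus L) / 2) \<tau> * thfac g \<tau> \<zeta> * gpair L (wr g (th \<tau> \<zeta>)) (dual_weil_rep L g (G \<tau>))"
    unfolding jacobi_of_def theta_transform[OF g(2) \<tau> \<zeta>] modular_formD(6)[OF G \<tau> g(1)] by (simp add: gpair_def sum_distrib_left mult_ac)
  also have "gpair L (wr g (th \<tau> \<zeta>)) (dual_weil_rep L g (G \<tau>)) = jacobi_of L v G \<tau> \<zeta>"
    using dual_pairing[OF g(2)] siegel_gring modular_formD(3)[OF G \<tau>] by (simp add: jacobi_of_def)
  finally show ?thesis unfolding thfac_autf[OF g(2) \<tau>] .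
qed

text \<open>\<open>\<Phi>\<close> is kept apart from \<open>jacobi_of L v G\<close> so that the
  lemma applies directly to the product of two Jacobi forms once the product formula is
  known.\<close>

lemma modular_imp_jacobi_form:
  assumes G: "modular_form L \<Gamma> (k - real (b_plus L) / 2) (l - real (b_minus L) / 2) G"
    and \<Gamma>: "\<Gamma> \<subseteq> carrier Mp2Z" and eq: "\<And>\<tau> \<zeta>. \<tau> \<in> uhp \<Longrightarrow> \<zeta> \<in> cspan L \<Longrightarrow> \<Phi> \<tau> \<zeta> = jacobi_of L v G \<tau> \<zeta>"
  shows "jacobi_form L v \<Gamma> k l \<Phi>"
  unfolding jacobi_form_def Let_def
proof (intro conjI ballI)
  show "half_int k" "half_int l" using modular_formD(1,2)[OF G] by (simp_all add: half_int_shift)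
  have "smooth_on (\<lambda>p. \<Sum>\<gamma>\<in>disc L. th (fst p) (snd p) \<gamma> * G (fst p) \<gamma>) (uhp \<times> cspan L)"
    using modular_formD(4)[OF G]
    by (intro smooth_on_sum finite_disc smooth_on_mult theta_smooth smooth_on_compose_fst) auto
  then show "smooth_on (\<lambda>(\<tau>, \<zeta>). \<Phi> \<tau> \<zeta>) (uhp \<times> cspan L)"
    by (rule smooth_on_cong[rotated]) (auto simp: eq jacobi_of_def gpair_def)
next
  fix \<tau> \<zeta> \<sigma> \<nu> assume \<tau>: "\<tau> \<in> uhp" and \<zeta>: "\<zeta> \<in> cspan L" and \<sigma>: "\<sigma> \<in> pts L" and \<nu>: "\<nu> \<in> pts L"
  have "\<zeta> + cscale \<tau> (cvec (oproj L (fst v) \<sigma>)) + cscale (cnj \<tau>) (cvec (oproj L (snd v) \<sigma>)) + cvec \<nu> \<in> cspan L"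
    by (intro cspan_intros \<zeta> cscale_cspan proj_V pts_V \<nu>)
  then show "\<Phi> \<tau> (\<zeta> + cscale \<tau> (cvec (oproj L (fst v) \<sigma>)) + cscale (cnj \<tau>) (cvec (oproj L (snd v) \<sigma>)) + cvec \<nu>) =
        ee (- qexpt L v \<tau> \<sigma> - cform L (cvec \<sigma>) \<zeta>) * \<Phi> \<tau> \<zeta>"
    by (simp add: eq[OF \<tau>] \<zeta> jacobi_of_def gpair_def theta_quasi_periodic[OF \<sigma> \<nu>] sum_distrib_left mult.assoc cong: sum.cong)
next
  fix \<tau> \<zeta> g assume \<tau>: "\<tau> \<in> uhp" and \<zeta>: "\<zeta> \<in> cspan L" and g: "g \<in> \<Gamma>"
  have gc: "g \<in> carrier Mp2Z" using g \<Gamma> by blast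
  have mu: "moeb (fst g) \<tau> \<in> uhp" using gc \<tau> SL2Z_SL2R moeb_uhp by (auto simp: Mp2Z_iff)
  show "case g of (A, \<phi>) \<Rightarrow> \<Phi> (moeb A \<tau>) (cscale (1 / jfac A \<tau>) (cmap (oproj L (fst v)) \<zeta>) + cscale (1 / cnj (jfac A \<tau>)) (cmap (oproj L (snd v)) \<zeta>)) =
     autf \<phi> k l \<tau> * ee (of_real (A $ 2 $ 1) * cform L (cmap (oproj L (fst v)) \<zeta>) (cmap (oproj L (fst v)) \<zeta>) / (2 * jfac A \<tau>) +
       of_real (A $ 2 $ 1) * cform L (cmap (oproj L (snd v)) \<zeta>) (cmap (oproj L (snd v)) \<zeta>) / (2 * cnj (jfac A \<tau>))) * \<Phi> \<tau> \<zeta>"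
    unfolding split_def gact_def[symmetric] cform_proj[OF \<zeta>] zfac_def[symmetric] eq[OF mu gact_cspan] eq[OF \<tau> \<zeta>]
    by (rule jacobi_transform[OF G g gc \<tau> \<zeta>])
next
  fix \<tau> assume \<tau>: "\<tau> \<in> uhp"
  show "cholomorphic_on (\<Phi> \<tau>) (cspan L)"
    unfolding cholomorphic_on_def
  proof
    fix \<zeta> assume \<zeta>: "\<zeta> \<in> cspan L"
    obtain D where D: "(jacobi_of L v G \<tau> has_derivative D) (at \<zeta>)" "\<And>c \<xi>. D (cscale c \<xi>) = c * D \<xi>"
      using jacobi_holomorphic[OF \<tau>] by blast
    have "(\<Phi> \<tau> has_derivative D) (at \<zeta> within cspan L)"
      by (rule has_derivative_transform[OF \<zeta> eq[OF \<tau>] has_derivative_at_withinI[OF D(1)]])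
    then show "\<exists>D. (\<Phi> \<tau> has_derivative D) (at \<zeta> within cspan L) \<and> (\<forall>c. \<forall>\<xi>\<in>cspan L. D (cscale c \<xi>) = c * D \<xi>)"
      using D(2) by blast
  qed
next
  show "\<exists>f. (\<forall>x\<in>dual L. lin_exp_growth (f x)) \<and> (\<forall>\<tau>\<in>uhp. \<forall>\<zeta>\<in>cspan L.
     ((\<lambda>x. f x \<tau> * ee (qexpt L v \<tau> x + cform L (cvec x) \<zeta>)) has_sum \<Phi> \<tau> \<zeta>) (dual L))"
    using jacobi_expansion[where G = G] modular_formD(5)[OF G coset_disc]
    by (intro exI[of _ "\<lambda>x \<tau>. G \<tau> (coset L x)"]) (simp add: eq)
qed

end

section \<open>The diagonal lattice and its complement\<close>

lemma product_summable:
  fixes f :: "'a \<Rightarrow> real" and h :: "'b \<Rightarrow> real"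
  assumes "f summable_on A" "h summable_on C" "\<And>x. f x \<ge> 0" "\<And>y. h y \<ge> 0"
  shows "(\<lambda>p. f (fst p) * h (snd p)) summable_on A \<times> C"
proof (rule summable_on_SigmaI[where g = "\<lambda>x. f x * infsum h C"])
  show "((\<lambda>y. f (fst (x, y)) * h (snd (x, y))) has_sum f x * infsum h C) C" for x
    using has_sum_cmult_right[OF has_sum_infsum[OF assms(2)], of "f x"] by simp
qed (use assms summable_on_cmult_left in auto)

lemma infsum_product_eq:
  fixes f :: "'a \<Rightarrow> 'c::{banach,real_normed_field}" and h :: "'b \<Rightarrow> 'c"
  assumes "(\<lambda>p. f (fst p) * h (snd p)) summable_on A \<times> C"
  shows "infsum (\<lambda>p. f (fst p) * h (snd p)) (A \<times> C) = infsum f A * infsum h C"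
  using infsum_Sigma_banach[OF assms] by (simp add: infsum_cmult_right' infsum_cmult_left')

text \<open>With integral entries the automorphy factor has absolute value at least 1 for
  \<open>y \<ge> 1\<close>, and the second lower bound on \<open>y\<close> keeps its real part below
  \<open>y\<close>. So the imaginary part of the image lies between a multiple of
  \<open>1 / y\<close> and \<open>y\<close>.\<close>

lemma Im_moeb_bounds:
  fixes A :: "real^2^2" and x y R :: real
  assumes A: "A \<in> SL2Z" and x: "\<bar>x\<bar> \<le> R" and y: "y \<ge> 1" "y \<ge> \<bar>A $ 2 $ 1\<bar> * R + \<bar>A $ 2 $ 2\<bar>"
  shows "Im (moeb A (Complex x y)) > 0" "Im (moeb A (Complex x y)) \<le> y" "1 / Im (moeb A (Complex x y)) \<le> (1 + (A $ 2 $ 1)\<^sup>2) * y"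
proof -
  define c d j where "c = A $ 2 $ 1" and "d = A $ 2 $ 2" and "j = (cmod (jfac A (Complex x y)))\<^sup>2"
  have u: "Complex x y \<in> uhp" using y by (simp add: uhp_iff)
  note I = Im_moeb[OF SL2Z_SL2R[OF A] u]
  have j: "j = (c * x + d)\<^sup>2 + (c * y)\<^sup>2" by (simp add: j_def cmod_power2 Re_jfac Im_jfac c_def d_def)
  obtain m n :: int where mn: "c = of_int m" "d = of_int n"
  proof -
    have "c \<in> \<int>" "d \<in> \<int>" using A by (auto simp: SL2Z_def c_def d_def)
    then show ?thesis using that by (auto elim!: Ints_cases)
  qed
  have j1: "j \<ge> 1"
  proof (cases "m = 0")
    case True
    then have "d \<noteq> 0" using SL2R_det[OF SL2Z_SL2R[OF A]] mn by (auto simp: c_def d_def)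
    then have "\<bar>n\<bar> \<ge> 1" using mn by linarith
    then have "n\<^sup>2 \<ge> 1" by (simp add: abs_le_square_iff[of 1 n, simplified])
    then have "d\<^sup>2 \<ge> 1" unfolding mn by (metis of_int_1_le_iff of_int_power)
    then show ?thesis using True mn by (simp add: j)
  next
    case False
    then have "\<bar>m\<bar> \<ge> 1" by linarith
    then have "\<bar>c\<bar> \<ge> 1" unfolding mn by linarith
    then have "\<bar>c * y\<bar> \<ge> 1" using y(1) mult_mono[of 1 "\<bar>c\<bar>" 1 y] by (simp add: abs_mult)
    from power_mono[OF this, of 2] have "(c * y)\<^sup>2 \<ge> 1" by simp
    then show ?thesis by (simp add: j add_increasing)
  qed
  have j2: "j \<le> (1 + c\<^sup>2) * y\<^sup>2"
  proof -
    have "\<bar>c * x + d\<bar> \<le> \<bar>c\<bar> * \<bar>x\<bar> + \<bar>d\<bar>" by (metis abs_mult abs_triangle_ineq)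
    also have "\<dots> \<le> \<bar>c\<bar> * R + \<bar>d\<bar>" using x by (simp add: mult_left_mono)
    also have "\<dots> \<le> y" using y(2) by (simp add: c_def d_def)
    finally have "(c * x + d)\<^sup>2 \<le> y\<^sup>2" using y(1) by (simp add: abs_le_square_iff[symmetric])
    then show ?thesis by (simp add: j distrib_right power_mult_distrib)
  qed
  have e: "Im (moeb A (Complex x y)) = y / j" using I by (simp add: j_def)
  show "Im (moeb A (Complex x y)) > 0" unfolding e using j1 y(1) by simp
  show "Im (moeb A (Complex x y)) \<le> y" unfolding e using j1 y(1) by (simp add: divide_le_eq mult_le_cancel_left1)
  have "1 / (y / j) \<le> (1 + c\<^sup>2) * y" using j2 j1 y(1) by (simp add: divide_le_eq power2_eq_square mult.assoc)
  then show "1 / Im (moeb A (Complex x y)) \<le> (1 + (A $ 2 $ 1)\<^sup>2) * y" unfolding e by (simp add: c_def)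
qed

text \<open>A bound valid on the whole half-plane controls every cusp: under any \<open>A\<close>
  both \<open>Im \<tau>\<close> and \<open>1 / Im \<tau>\<close> become at most linear in
  \<open>y\<close>.\<close>

lemma lin_exp_growth_bound:
  assumes b: "\<And>\<tau>. \<tau> \<in> uhp \<Longrightarrow> cmod (f \<tau>) \<le> c * exp (C1 * Im \<tau> + C2 / Im \<tau>)" and C: "C1 \<ge> 0" "C2 \<ge> 0" "c \<ge> 0"
  shows "lin_exp_growth f"
  unfolding lin_exp_growth_def
proof
  fix A assume A: "A \<in> SL2Z"
  show "\<exists>C. \<forall>R. \<exists>c y0. \<forall>x y. \<bar>x\<bar> \<le> R \<and> y > 0 \<and> y \<ge> y0 \<longrightarrow> cmod (f (moeb A (Complex x y))) \<le> c * exp (C * y)"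
  proof (rule exI, rule allI)
    fix R :: real
    show "\<exists>c y0. \<forall>x y. \<bar>x\<bar> \<le> R \<and> y > 0 \<and> y \<ge> y0 \<longrightarrow> cmod (f (moeb A (Complex x y))) \<le> c * exp ((C1 + C2 * (1 + (A $ 2 $ 1)\<^sup>2)) * y)"
    proof (intro exI allI impI)
      fix x y :: real assume xy: "\<bar>x\<bar> \<le> R \<and> y > 0 \<and> y \<ge> max 1 (\<bar>A $ 2 $ 1\<bar> * R + \<bar>A $ 2 $ 2\<bar>)"
      define t where "t = moeb A (Complex x y)"
      have t: "Im t > 0" "Im t \<le> y" "1 / Im t \<le> (1 + (A $ 2 $ 1)\<^sup>2) * y"
        unfolding t_def using Im_moeb_bounds[OF A, of x R y] xy by auto
      have "C2 / Im t = C2 * (1 / Im t)" by simp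
      then have "C1 * Im t + C2 / Im t \<le> C1 * y + C2 * ((1 + (A $ 2 $ 1)\<^sup>2) * y)"
        using mult_left_mono[OF t(2) C(1)] mult_left_mono[OF t(3) C(2)] by linarith
      then have "C1 * Im t + C2 / Im t \<le> (C1 + C2 * (1 + (A $ 2 $ 1)\<^sup>2)) * y" by (simp only: distrib_right mult.assoc)
      then have "c * exp (C1 * Im t + C2 / Im t) \<le> c * exp ((C1 + C2 * (1 + (A $ 2 $ 1)\<^sup>2)) * y)" using C(3) by (simp add: mult_left_mono)
      then show "cmod (f (moeb A (Complex x y))) \<le> c * exp ((C1 + C2 * (1 + (A $ 2 $ 1)\<^sup>2)) * y)"
        using b[of t] t(1) by (simp add: t_def[symmetric] uhp_iff)
    qed
  qed
qed

lemma plus_lat_simps [simp]: "pts (plus_lat g L K) = pts L" "form (plus_lat g L K) = (\<lambda>x y. form L x y + form K (g x) (g y))"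
  "rspan (plus_lat g L K) = rspan L" "coset (plus_lat g L K) = coset L" "cspan (plus_lat g L K) = cspan L"
  by (auto simp: plus_lat_def rspan_def coset_def cspan_def fun_eq_iff)

context theta_lattice
begin

lemma proj_mem: "oproj L (fst v) x \<in> fst v" "oproj L (snd v) x \<in> snd v"
  unfolding oproj_plus oproj_minus using v_sub Fp_v Fm_v by (auto intro!: subspace_sum subspace_mul subspace_neg)

lemma proj_orth:
  shows "y \<in> fst v \<Longrightarrow> B (x - oproj L (fst v) x) y = 0" and "y \<in> snd v \<Longrightarrow> B (x - oproj L (snd v) x) y = 0"
proof -
  have "B (x - oproj L (fst v) x) f = 0" if f: "f \<in> Fp" for f
    using f onFp finFp by (simp add: oproj_plus B_simps B_sum_left if_distrib[of "\<lambda>x. _ * x"] cong: sum.cong if_cong)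
  then show "y \<in> fst v \<Longrightarrow> B (x - oproj L (fst v) x) y = 0"
    using linear_eq_0_on_span[OF lin_right, of Fp] unfolding spanFp by blast
  have "B (x - oproj L (snd v) x) f = 0" if f: "f \<in> Fm" for f
  proof -
    have "B (oproj L (snd v) x) f = (\<Sum>h\<in>Fm. if h = f then B x h else 0)"
      unfolding oproj_minus B_sum_left B_simps(3) by (rule sum.cong[OF refl]) (use onFm f in simp)
    also have "\<dots> = B x f" using f finFm by simp
    finally show ?thesis by (simp add: bilinear_lsub[OF bil])
  qed
  then show "y \<in> snd v \<Longrightarrow> B (x - oproj L (snd v) x) y = 0"
    using linear_eq_0_on_span[OF lin_right, of Fm] unfolding spanFm by blast
qed

text \<open>Completing the square compares the Gaussian with \<open>exp (- norm x)\<close> at the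
  cost of a factor \<open>exp (1 / (4 * k * \<epsilon>))\<close>; this is the source of the term
  \<open>C2 / Im \<tau>\<close> in the growth estimate.\<close>

lemma gauss_sum_bound:
  obtains c C where "c \<ge> 0" "C \<ge> 0" "\<And>\<epsilon>. \<epsilon> > 0 \<Longrightarrow> (\<lambda>x. exp (- (pi * \<epsilon>) * (Qp x + Qm x))) summable_on dual L"
    "\<And>\<epsilon>. \<epsilon> > 0 \<Longrightarrow> infsum (\<lambda>x. exp (- (pi * \<epsilon>) * (Qp x + Qm x))) (dual L) \<le> c * exp (C / \<epsilon>)"
proof -
  obtain \<kappa> where \<kappa>: "\<kappa> > 0" "\<And>x. x \<in> V \<Longrightarrow> \<kappa> * (norm x)\<^sup>2 \<le> Qp x + Qm x" using Q_lower by blast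
  define k where "k = pi * \<kappa>"
  have k: "k > 0" using \<kappa>(1) by (simp add: k_def)
  have s: "(\<lambda>x. exp (- 1 * norm x)) summable_on dual L" by (rule summable_dual_exp) simp
  define c where "c = infsum (\<lambda>x. exp (- 1 * norm x)) (dual L)"
  have bd: "norm (exp (- (pi * \<epsilon>) * (Qp x + Qm x))) \<le> exp (1 / (4 * k) / \<epsilon>) * exp (- 1 * norm x)" if e: "\<epsilon> > 0" and x: "x \<in> dual L" for \<epsilon> x
  proof -
    define r where "r = norm x"
    have ke: "k * \<epsilon> > 0" using k e by simp
    have sq: "0 \<le> (2 * t * r - 1)\<^sup>2 / (4 * t)" "(2 * t * r - 1)\<^sup>2 / (4 * t) = t * r\<^sup>2 - r + 1 / (4 * t)" if "t > 0" for t :: real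
      by (use that in simp) (use that in \<open>simp add: power2_eq_square field_simps\<close>)
    have 1: "- ((k * \<epsilon>) * r\<^sup>2) \<le> 1 / (4 * (k * \<epsilon>)) - r" using sq[OF ke] by linarith
    have "(pi * \<epsilon>) * (\<kappa> * r\<^sup>2) \<le> (pi * \<epsilon>) * (Qp x + Qm x)"
      unfolding r_def by (rule mult_left_mono[OF \<kappa>(2)[OF dual_V[OF x]]]) (use e in simp)
    moreover have "(pi * \<epsilon>) * (\<kappa> * r\<^sup>2) = (k * \<epsilon>) * r\<^sup>2" by (simp add: k_def)
    ultimately have "- (pi * \<epsilon>) * (Qp x + Qm x) \<le> 1 / (4 * k) / \<epsilon> + - 1 * norm x" using 1
      unfolding r_def divide_divide_eq_left by (simp only: mult_minus_left mult_1_left mult.assoc)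
    then have "exp (- (pi * \<epsilon>) * (Qp x + Qm x)) \<le> exp (1 / (4 * k) / \<epsilon> + - 1 * norm x)" by simp
    then show ?thesis unfolding exp_add by simp
  qed
  show ?thesis
  proof (rule that[of c "1 / (4 * k)"])
    show "c \<ge> 0" unfolding c_def by (rule infsum_nonneg) simp
    show "1 / (4 * k) \<ge> 0" using k by simp
    fix \<epsilon> :: real assume e: "\<epsilon> > 0"
    show "(\<lambda>x. exp (- (pi * \<epsilon>) * (Qp x + Qm x))) summable_on dual L"
      by (rule summable_on_dominated[OF summable_on_cmult_right[OF s] bd[OF e]])
    have "norm (infsum (\<lambda>x. exp (- (pi * \<epsilon>) * (Qp x + Qm x))) (dual L)) \<le> infsum (\<lambda>x. exp (1 / (4 * k) / \<epsilon>) * exp (- 1 * norm x)) (dual L)"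
      by (rule norm_infsum_dominated[OF summable_on_cmult_right[OF s] bd[OF e]])
    also have "\<dots> = c * exp (1 / (4 * k) / \<epsilon>)" unfolding c_def by (subst infsum_cmult_right') (rule mult.commute)
    finally show "infsum (\<lambda>x. exp (- (pi * \<epsilon>) * (Qp x + Qm x))) (dual L) \<le> c * exp (1 / (4 * k) / \<epsilon>)" by simp
  qed
qed

end

text \<open>A sum of two non-degenerate forms may degenerate. Here both are positive on
  \<open>fst v\<close>, negative on \<open>snd v\<close> and orthogonal between them, so the sum has
  the same decomposition.\<close>

lemma plus_lat_even_Gr:
  assumes L: "theta_lattice L v E Fp Fm" and K: "theta_lattice K w E' Gp Gm" and lin: "linear g"
    and img: "g ` pts L \<subseteq> pts K" "g ` fst v \<subseteq> fst w" "g ` snd v \<subseteq> snd w"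
  shows "even_lattice (plus_lat g L K)" "v \<in> Gr (form (plus_lat g L K)) (rspan (plus_lat g L K))"
proof -
  interpret L: theta_lattice L v E Fp Fm by (rule L)
  interpret K: theta_lattice K w E' Gp Gm by (rule K)
  define f where "f x y = form L x y + form K (g x) (g y)" for x y
  have bil: "bilinear f" unfolding f_def bilinear_def
    using L.lin_left L.lin_right linear_compose[OF lin K.lin_left] linear_compose[OF lin K.lin_right]
    by (auto simp: o_def intro!: linear_compose_add)
  have pos: "f x x > 0" if "x \<in> fst v" "x \<noteq> 0" for x
  proof -
    have "form K (g x) (g x) \<ge> 0" using K.v_pos[of "g x"] img(2) that K.B_simps(3)[of 0] by (cases "g x = 0") (auto simp: less_imp_le bilinear_lzero[OF K.bil])
    then show ?thesis using L.v_pos[OF that] by (simp add: f_def)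
  qed
  have neg: "f x x < 0" if "x \<in> snd v" "x \<noteq> 0" for x
  proof -
    have "form K (g x) (g x) \<le> 0" using K.v_neg[of "g x"] img(3) that by (cases "g x = 0") (auto simp: less_imp_le bilinear_lzero[OF K.bil])
    then show ?thesis using L.v_neg[OF that] by (simp add: f_def)
  qed
  have orth: "f x y = 0" if "x \<in> fst v" "y \<in> snd v" for x y
    using L.v_orth[OF that] K.v_orth[of "g x" "g y"] that img by (simp add: f_def image_subset_iff)
  have gV: "g x \<in> rspan K" if "x \<in> pts L" for x using that img(1) K.pts_V by blast
  show gr: "v \<in> Gr (form (plus_lat g L K)) (rspan (plus_lat g L K))"
    using L.v_sub pos neg orth L.v_sum by (cases v) (auto simp: Gr_def f_def)
  have nd: "x = 0" if x: "x \<in> pts L" and z: "\<forall>y\<in>pts L. f x y = 0" for x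
  proof -
    have fz: "f x y = 0" if "y \<in> rspan L" for y
      using linear_eq_0_on_span[of "f x" "pts L" y] bil z that by (auto simp: bilinear_def rspan_def)
    obtain p q where pq: "x = p + q" "p \<in> fst v" "q \<in> snd v" using L.pts_V[OF x] L.v_sum by auto
    have V: "p \<in> rspan L" "q \<in> rspan L" using pq L.v_V by auto
    have s: "f q p = f p q"
    proof -
      have "form K (g q) (g p) = form K (g p) (g q)" using K.B_sym[of "g q" "g p"] pq img K.v_V by blast
      then show ?thesis using L.B_sym[OF V] by (simp add: f_def)
    qed
    have "f p p = 0" using fz[OF V(1)] orth[OF pq(2,3)] s by (simp add: pq(1) bilinear_ladd[OF bil])
    moreover have "f q q = 0" using fz[OF V(2)] orth[OF pq(2,3)] by (simp add: pq(1) bilinear_ladd[OF bil])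
    ultimately show "x = 0" using pos[OF pq(2)] neg[OF pq(3)] pq(1) by force
  qed
  show "even_lattice (plus_lat g L K)"
    unfolding even_lattice_def plus_lat_simps f_def[symmetric]
  proof (intro conjI ballI impI)
    show "\<exists>E. finite E \<and> independent E \<and> pts L = {x. \<exists>c::'a \<Rightarrow> int. x = (\<Sum>e\<in>E. of_int (c e) *\<^sub>R e)}"
      using L.finE L.indE L.ptsE by blast
    show "bilinear (\<lambda>x. f x)" using bil by simp
    show "f x y = f y x" "f x y \<in> \<int>" if "x \<in> pts L" "y \<in> pts L" for x y
      unfolding f_def using L.B_sym[OF L.pts_V L.pts_V, of x y] K.B_sym[OF gV gV, of x y] that
        L.pts_pair[of x y] K.pts_pair[of "g x" "g y"] img(1) by (auto intro!: Ints_add)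
    show "\<exists>n::int. f x x = 2 * of_int n" if x: "x \<in> pts L" for x
    proof -
      obtain m n :: int where "form L x x = 2 * of_int m" "form K (g x) (g x) = 2 * of_int n"
        using L.pts_even[OF x] K.pts_even[of "g x"] img(1) x by blast
      then show ?thesis by (intro exI[of _ "m + n"]) (simp add: f_def)
    qed
    show "x = 0" if "x \<in> pts L" "\<forall>y\<in>pts L. f x y = 0" for x using nd that by blast
  qed
qed

text \<open>Three separate choices of bases: vectors orthonormal for \<open>L\<close> are in general
  not orthonormal for the sum of the forms.\<close>

locale theta_pair =
  L: theta_lattice L v E Fp Fm + K: theta_lattice K w E' Gp Gm + P: theta_lattice "plus_lat g L K" v E'' Hp Hm
  for L :: "'a::euclidean_space qlat" and v E Fp Fm and K :: "'b::euclidean_space qlat" and w E' Gp Gm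
    and E'' Hp Hm and g :: "'a \<Rightarrow> 'b" +
  assumes lin: "linear g" and img: "g ` pts L = pts K" "g ` fst v = fst w" "g ` snd v = snd w"
begin

abbreviation PL :: "'a qlat" where "PL \<equiv> plus_lat g L K"
abbreviation N :: "('a \<times> 'b) qlat" where "N \<equiv> sum_lat L K"
abbreviation M :: "('a \<times> 'b) qlat" where "M \<equiv> graph_lat g L K"
abbreviation gm :: "'a \<Rightarrow> 'a \<times> 'b" where "gm \<equiv> graph_map g"
abbreviation u :: "('a \<times> 'b) gr" where "u \<equiv> perp_gr N (gm ` fst v, gm ` snd v) (sum_gr v w)"

lemmas g_simps = linear_add[OF lin] linear_diff[OF lin] linear_0[OF lin] linear_cmul[OF lin] linear_neg[OF lin]

lemma g_pts: "x \<in> pts L \<Longrightarrow> g x \<in> pts K" and g_v: "x \<in> fst v \<Longrightarrow> g x \<in> fst w" "x \<in> snd v \<Longrightarrow> g x \<in> snd w"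
  using img by auto

lemma g_V: "g ` rspan L = rspan K"
  unfolding rspan_def img(1)[symmetric] by (rule linear_span_image[OF lin, symmetric])

lemma g_V': "x \<in> rspan L \<Longrightarrow> g x \<in> rspan K" using g_V by blast

lemma form_N: "form N p q = form L (fst p) (fst q) + form K (snd p) (snd q)"
  by (simp add: sum_lat_def)

lemma form_M: "form M = form N" by (simp add: graph_lat_def)

lemma gm_simps: "fst (gm x) = x" "snd (gm x) = g x" "gm x + gm y = gm (x + y)" "gm x - gm y = gm (x - y)"
  by (simp_all add: graph_map_def g_simps)

lemma inj_gm: "inj gm" by (rule injI) (simp add: graph_map_def)

text \<open>The pairing in \<open>N\<close> of \<open>p\<close> with the diagonal vector
  \<open>gm y\<close>, as a functional of \<open>y\<close>.\<close>

definition hp :: "'a \<times> 'b \<Rightarrow> 'a \<Rightarrow> real" where "hp p y = form L (fst p) y + form K (snd p) (g y)"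

lemma linear_hp: "linear (hp p)"
  unfolding hp_def[abs_def] by (rule linearI) (simp_all add: L.B_simps K.B_simps g_simps algebra_simps)

lemma hp_simps: "hp (p + q) y = hp p y + hp q y" "hp (p - q) y = hp p y - hp q y" "hp (gm x) y = form PL x y"
  by (simp_all add: hp_def L.B_simps K.B_simps gm_simps)

text \<open>Orthogonal projection to the diagonal, read back on \<open>L\<close>: the vector that
  represents \<open>hp p\<close> under the sum of the forms. The explicit formula gives additivity
  and integrality without unfolding \<open>oproj\<close>.\<close>

definition pj :: "'a \<times> 'b \<Rightarrow> 'a" where "pj p = (\<Sum>f\<in>P.F. (P.eps f * hp p f) *\<^sub>R f)"

lemma pj_V: "pj p \<in> rspan L"
  using P.V_intros P.F_V unfolding pj_def by (simp add: subspace_sum[OF L.subspace_V] subspace_mul[OF L.subspace_V])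

lemma pj_pair: assumes "y \<in> rspan L" shows "form PL (pj p) y = hp p y"
proof -
  have y: "y \<in> rspan PL" using assms by simp
  have "hp p y = hp p (\<Sum>f\<in>P.F. (P.eps f * form PL y f) *\<^sub>R f)" using P.V_expand[OF y] by metis
  also have "\<dots> = (\<Sum>f\<in>P.F. (P.eps f * form PL y f) * hp p f)"
    unfolding linear_sum[OF linear_hp] linear_cmul[OF linear_hp] real_scaleR_def ..
  also have "\<dots> = (\<Sum>f\<in>P.F. (P.eps f * hp p f) * form PL f y)"
    by (rule sum.cong[OF refl]) (simp only: P.B_sym_F[OF _ y] mult_ac)
  also have "\<dots> = form PL (pj p) y" unfolding pj_def P.B_sum_left P.B_simps(3) real_scaleR_def ..
  finally show ?thesis by simp
qed

lemma pj_unique: assumes "x \<in> rspan L" "\<And>y. y \<in> rspan L \<Longrightarrow> form PL x y = hp p y" shows "pj p = x"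
proof (rule P.B_eqI)
  show "pj p \<in> rspan PL" "x \<in> rspan PL" using pj_V assms(1) by simp_all
  show "form PL (pj p) e = form PL x e" if "e \<in> E''" for e
    using P.E_V[OF that] pj_pair[of e p] assms(2)[of e] by simp
qed

lemma pj_gm: "x \<in> rspan L \<Longrightarrow> pj (gm x) = x"
  by (rule pj_unique) (simp_all only: hp_simps)

lemma pj_add: "pj (p + q) = pj p + pj q"
  by (rule pj_unique) (simp_all only: hp_simps pj_pair P.B_simps(1) L.V_intros pj_V)

lemma pj_dual: assumes "fst p \<in> dual L" "snd p \<in> dual K" shows "pj p \<in> dual PL"
proof -
  have "form PL (pj p) y \<in> \<int>" if y: "y \<in> pts L" for y
    unfolding pj_pair[OF L.pts_V[OF y]] hp_def
    by (rule Ints_add[OF L.dual_pair(1)[OF assms(1) y] K.dual_pair(1)[OF assms(2) g_pts[OF y]]])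
  then show ?thesis using pj_V by (simp add: dual_def)
qed

lemma dual_N: "p \<in> dual N \<longleftrightarrow> fst p \<in> dual L \<and> snd p \<in> dual K"
proof -
  have sp: "rspan N = rspan L \<times> rspan K"
  proof
    show "rspan N \<subseteq> rspan L \<times> rspan K" unfolding rspan_def
      by (rule span_minimal) (auto simp: sum_lat_def span_base intro!: subspace_Times)
    show "rspan L \<times> rspan K \<subseteq> rspan N"
    proof
      fix p assume "p \<in> rspan L \<times> rspan K"
      then have p: "fst p \<in> span (pts L)" "snd p \<in> span (pts K)" by (auto simp: rspan_def)
      have l: "linear (\<lambda>x. (x, 0 :: 'b))" "linear (\<lambda>y. (0 :: 'a, y))" by (auto intro!: linearI)
      have s: "(\<lambda>x. (x, 0)) ` pts L \<subseteq> pts N" "(\<lambda>y. (0, y)) ` pts K \<subseteq> pts N"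
        using L.pts_intros(1) K.pts_intros(1) by (auto simp: sum_lat_def)
      have "(fst p, 0) \<in> (\<lambda>x. (x, 0 :: 'b)) ` span (pts L)" "(0, snd p) \<in> (\<lambda>y. (0 :: 'a, y)) ` span (pts K)" using p by auto
      then have "(fst p, 0) \<in> span (pts N)" "(0, snd p) \<in> span (pts N)"
        unfolding linear_span_image[OF l(1), symmetric] linear_span_image[OF l(2), symmetric]
        using span_mono[OF s(1)] span_mono[OF s(2)] by blast+
      from span_add[OF this] show "p \<in> rspan N" by (simp add: rspan_def)
    qed
  qed
  show ?thesis
  proof
    assume p: "p \<in> dual N"
    have "form L (fst p) y \<in> \<int>" if "y \<in> pts L" for y
      using p that K.pts_intros(1) bilinear_rzero[OF K.bil] unfolding dual_def by (fastforce simp: sum_lat_def)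
    moreover have "form K (snd p) y \<in> \<int>" if "y \<in> pts K" for y
      using p that L.pts_intros(1) bilinear_rzero[OF L.bil] unfolding dual_def by (fastforce simp: sum_lat_def)
    ultimately show "fst p \<in> dual L \<and> snd p \<in> dual K" using p by (auto simp: dual_def sp)
  next
    assume "fst p \<in> dual L \<and> snd p \<in> dual K"
    then have "p \<in> rspan N" "form N p y \<in> \<int>" if "y \<in> pts N" for y
      using that unfolding sp by (auto simp: dual_def form_N sum_lat_def mem_Times_iff intro!: Ints_add)
    moreover have "0 \<in> pts N" using L.pts_intros(1) K.pts_intros(1) by (simp add: sum_lat_def zero_prod_def)
    ultimately show "p \<in> dual N" by (auto simp: dual_def)
  qed
qed

lemma coset_N: "coset N p = coset L (fst p) \<times> coset K (snd p)"
  by (auto simp: coset_def sum_lat_def image_iff prod_eq_iff)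

lemma disc_N: "disc N = (\<lambda>(\<gamma>, \<delta>). \<gamma> \<times> \<delta>) ` (disc L \<times> disc K)"
proof -
  have "dual N = dual L \<times> dual K" using dual_N by (auto simp: mem_Times_iff)
  then have "disc N = (\<lambda>p. coset L (fst p) \<times> coset K (snd p)) ` (dual L \<times> dual K)" by (simp add: disc_def coset_N[abs_def])
  also have "\<dots> = (\<lambda>(\<gamma>, \<delta>). \<gamma> \<times> \<delta>) ` (disc L \<times> disc K)"
    unfolding disc_def map_prod_surj_on[OF refl refl, symmetric] image_image by (rule image_cong) (auto simp: map_prod_def)
  finally show ?thesis .
qed

lemma coset_M: "q \<in> coset M p \<longleftrightarrow> (\<exists>m\<in>pts L. q = p + gm m)"
  by (auto simp: coset_def graph_lat_def)

lemma coset_M_gm: "coset M (gm x) = gm ` coset L x"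
proof -
  have "coset M (gm x) = (\<lambda>m. gm x + gm m) ` pts L" by (auto simp: coset_def graph_lat_def)
  then show ?thesis by (simp add: gm_simps coset_def image_image)
qed

lemma rspan_M: "rspan M = gm ` rspan L"
proof -
  have "linear gm" by (rule linearI) (simp_all add: graph_map_def g_simps)
  then show ?thesis by (simp add: rspan_def graph_lat_def linear_span_image)
qed

lemma disc_M: "disc M = (`) gm ` disc PL"
proof -
  have "dual M = gm ` dual PL"
  proof -
    have "gm x \<in> dual M \<longleftrightarrow> x \<in> dual PL" for x
    proof -
      have "gm x \<in> gm ` rspan L \<longleftrightarrow> x \<in> rspan L" by (rule inj_image_mem_iff[OF inj_gm])
      moreover have "pts M = gm ` pts L" by (simp add: graph_lat_def)
      ultimately show ?thesis unfolding dual_def mem_Collect_eq rspan_M form_M by (simp add: form_N gm_simps)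
    qed
    moreover have "dual M \<subseteq> gm ` rspan L" unfolding dual_def rspan_M by blast
    ultimately show ?thesis by blast
  qed
  then show ?thesis by (simp add: disc_def image_image coset_M_gm)
qed

lemma oproj_M: "oproj N (rspan M) p = gm (pj p)"
  unfolding oproj_def
proof (rule the_equality)
  have *: "form N (p - gm x) (gm y) = hp p y - form PL x y" for x y
    by (simp add: form_N gm_simps hp_def L.B_simps K.B_simps)
  show "gm (pj p) \<in> rspan M \<and> (\<forall>y\<in>rspan M. form N (p - gm (pj p)) y = 0)"
    unfolding rspan_M ball_simps(9)
  proof (intro conjI ballI imageI)
    show "pj p \<in> rspan L" by (rule pj_V)
    show "form N (p - gm (pj p)) (gm y) = 0" if "y \<in> rspan L" for y unfolding * using pj_pair[OF that, of p] by linarith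
  qed
  show "a = gm (pj p)" if a: "a \<in> rspan M \<and> (\<forall>y\<in>rspan M. form N (p - a) y = 0)" for a
  proof -
    obtain x where x: "a = gm x" "x \<in> rspan L" using a unfolding rspan_M by blast
    have "pj p = x"
    proof (rule pj_unique[OF x(2)])
      fix y assume "y \<in> rspan L"
      then have "form N (p - gm x) (gm y) = 0" using a unfolding rspan_M x(1) by blast
      then show "form PL x y = hp p y" unfolding * by simp
    qed
    then show ?thesis by (simp add: x(1))
  qed
qed

lemma disc_proj_eq: "disc_proj N M p = gm ` coset L (pj p)"
  by (simp add: disc_proj_def oproj_M coset_M_gm)

text \<open>The sign \<open>s\<close> treats the positive and negative spaces together. Projecting
  to the complement of the diagonal in \<open>A \<times> C\<close> means projecting to
  \<open>A \<times> C\<close>, which gives \<open>(a1, b1)\<close>, and subtracting the diagonal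
  part \<open>gm p1\<close>; by Pythagoras the squares subtract.\<close>

lemma perp_proj:
  assumes A: "subspace A" "A \<subseteq> rspan L" and C: "subspace C" "C \<subseteq> rspan K" and gA: "g ` A \<subseteq> C"
    and def: "\<And>x. x \<in> A \<Longrightarrow> x \<noteq> 0 \<Longrightarrow> s * form L x x > 0" "\<And>x. x \<in> C \<Longrightarrow> x \<noteq> 0 \<Longrightarrow> s * form K x x > 0"
    and a1: "a1 \<in> A" "\<And>y. y \<in> A \<Longrightarrow> form L (fst p - a1) y = 0"
    and b1: "b1 \<in> C" "\<And>y. y \<in> C \<Longrightarrow> form K (snd p - b1) y = 0"
    and p1: "p1 \<in> A" "\<And>y. y \<in> A \<Longrightarrow> form PL p1 y = hp p y"
  shows "form N (oproj N (ocompl_in N (gm ` A) (A \<times> C)) p) (oproj N (ocompl_in N (gm ` A) (A \<times> C)) p) =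
    form L a1 a1 + form K b1 b1 - form PL p1 p1"
proof -
  define U where "U = ocompl_in N (gm ` A) (A \<times> C)"
  define z where "z = (a1 - p1, b1 - g p1)"
  have Udef: "x \<in> U \<longleftrightarrow> fst x \<in> A \<and> snd x \<in> C \<and> (\<forall>y\<in>A. form L (fst x) y + form K (snd x) (g y) = 0)" for x
    by (auto simp: U_def ocompl_in_def form_N gm_simps mem_Times_iff)
  have la: "form L (fst p) y = form L a1 y" if "y \<in> A" for y using a1(2)[OF that] by (simp add: L.B_simps)
  have lb: "form K (snd p) y = form K b1 y" if "y \<in> C" for y using b1(2)[OF that] by (simp add: K.B_simps)
  have gC: "g y \<in> C" if "y \<in> A" for y using gA that by blast
  have pp: "form L p1 y + form K (g p1) (g y) = form L a1 y + form K b1 (g y)" if "y \<in> A" for y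
    using p1(2)[OF that] la[OF that] lb[OF gC[OF that]] by (simp add: hp_def)
  have zU: "z \<in> U" unfolding Udef z_def using subspace_diff[OF A(1) a1(1) p1(1)] subspace_diff[OF C(1) b1(1) gC[OF p1(1)]] pp
    unfolding fst_conv snd_conv bilinear_lsub[OF L.bil] bilinear_lsub[OF K.bil] by force
  have zo: "form N (p - z) x = 0" if x: "x \<in> U" for x
  proof -
    have x': "fst x \<in> A" "snd x \<in> C" "form L (fst x) p1 + form K (snd x) (g p1) = 0" using x p1(1) by (auto simp: Udef)
    have "form L p1 (fst x) = form L (fst x) p1" using A(2) p1(1) x'(1) by (intro L.B_sym) auto
    moreover have "form K (g p1) (snd x) = form K (snd x) (g p1)" using C(2) gC[OF p1(1)] x'(2) by (intro K.B_sym) auto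
    ultimately show ?thesis using la[OF x'(1)] lb[OF x'(2)] x'(3) by (simp add: form_N z_def L.B_simps K.B_simps)
  qed
  have "oproj N U p = z" unfolding oproj_def
  proof (rule the_equality)
    show "z \<in> U \<and> (\<forall>x\<in>U. form N (p - z) x = 0)" using zU zo by blast
    fix t assume t: "t \<in> U \<and> (\<forall>x\<in>U. form N (p - t) x = 0)"
    define d where "d = t - z"
    have dU: "d \<in> U" using t zU subspace_diff[OF A(1)] subspace_diff[OF C(1)] unfolding Udef d_def
      by (auto simp: L.B_simps K.B_simps algebra_simps)
    have "form N d d = form N (p - z) d - form N (p - t) d" by (simp add: d_def form_N L.B_simps K.B_simps)
    also have "\<dots> = 0" using t zo dU by simp
    finally have "s * form L (fst d) (fst d) + s * form K (snd d) (snd d) = 0" by (simp add: form_N distrib_left[symmetric])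
    moreover have "s * form L (fst d) (fst d) \<ge> 0" "s * form K (snd d) (snd d) \<ge> 0"
      using def(1)[of "fst d"] def(2)[of "snd d"] dU unfolding Udef
      by (cases "fst d = 0"; cases "snd d = 0"; simp add: less_imp_le bilinear_lzero[OF L.bil] bilinear_lzero[OF K.bil])+
    ultimately have "s * form L (fst d) (fst d) = 0" "s * form K (snd d) (snd d) = 0" by linarith+
    then have "fst d = 0" "snd d = 0" using def(1)[of "fst d"] def(2)[of "snd d"] dU unfolding Udef by force+
    then show "t = z" by (simp add: d_def prod_eq_iff)
  qed
  moreover have "form N z z = form L a1 a1 + form K b1 b1 - form PL p1 p1"
  proof -
    have "form L a1 p1 = form L p1 a1" using A(2) p1(1) a1(1) by (intro L.B_sym) auto
    moreover have "form K b1 (g p1) = form K (g p1) b1" using C(2) gC[OF p1(1)] b1(1) by (intro K.B_sym) auto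
    ultimately show ?thesis using pp[OF p1(1)] by (simp add: form_N z_def L.B_simps K.B_simps)
  qed
  ultimately show ?thesis by (simp add: U_def)
qed

lemma perp_forms:
  "form N (oproj N (fst u) p) (oproj N (fst u) p) = L.Qp (fst p) + K.Qp (snd p) - P.Qp (pj p)"
  "form N (oproj N (snd u) p) (oproj N (snd u) p) = - (L.Qm (fst p) + K.Qm (snd p) - P.Qm (pj p))"
proof -
  have Q: "form L (oproj L (fst v) a) (oproj L (fst v) a) = L.Qp a" "form L (oproj L (snd v) a) (oproj L (snd v) a) = - L.Qm a" for a
    by (simp_all add: L.form_proj_plus L.form_proj_minus L.Qp_def L.Qm_def power2_eq_square)
  have R: "form K (oproj K (fst w) a) (oproj K (fst w) a) = K.Qp a" "form K (oproj K (snd w) a) (oproj K (snd w) a) = - K.Qm a" for a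
    by (simp_all add: K.form_proj_plus K.form_proj_minus K.Qp_def K.Qm_def power2_eq_square)
  have S: "form PL (oproj PL (fst v) a) (oproj PL (fst v) a) = P.Qp a" "form PL (oproj PL (snd v) a) (oproj PL (snd v) a) = - P.Qm a" for a
    unfolding P.form_proj_plus P.form_proj_minus P.Qp_def P.Qm_def power2_eq_square by (rule refl)+
  have T: "form PL (oproj PL (fst v) (pj p)) y = hp p y" if "y \<in> fst v" for y
    using P.proj_orth(1)[OF that, of "pj p"] pj_pair[OF L.v_V(1)[OF that], of p] unfolding bilinear_lsub[OF P.bil] by linarith
  have T': "form PL (oproj PL (snd v) (pj p)) y = hp p y" if "y \<in> snd v" for y
    using P.proj_orth(2)[OF that, of "pj p"] pj_pair[OF L.v_V(2)[OF that], of p] unfolding bilinear_lsub[OF P.bil] by linarith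
  have "form N (oproj N (ocompl_in N (gm ` fst v) (fst v \<times> fst w)) p) (oproj N (ocompl_in N (gm ` fst v) (fst v \<times> fst w)) p) =
    form L (oproj L (fst v) (fst p)) (oproj L (fst v) (fst p)) + form K (oproj K (fst w) (snd p)) (oproj K (fst w) (snd p)) - form PL (oproj PL (fst v) (pj p)) (oproj PL (fst v) (pj p))"
    by (rule perp_proj[where s = 1])
      (use L.v_sub K.v_sub L.v_V K.v_V L.v_pos K.v_pos img in \<open>auto intro: L.proj_mem K.proj_mem P.proj_mem L.proj_orth K.proj_orth T simp del: plus_lat_simps\<close>)
  then show "form N (oproj N (fst u) p) (oproj N (fst u) p) = L.Qp (fst p) + K.Qp (snd p) - P.Qp (pj p)"
    unfolding Q R S by (simp add: perp_gr_def sum_gr_def)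
  have "form N (oproj N (ocompl_in N (gm ` snd v) (snd v \<times> snd w)) p) (oproj N (ocompl_in N (gm ` snd v) (snd v \<times> snd w)) p) =
    form L (oproj L (snd v) (fst p)) (oproj L (snd v) (fst p)) + form K (oproj K (snd w) (snd p)) (oproj K (snd w) (snd p)) - form PL (oproj PL (snd v) (pj p)) (oproj PL (snd v) (pj p))"
    by (rule perp_proj[where s = "-1"])
      (use L.v_sub K.v_sub L.v_V K.v_V L.v_neg K.v_neg img in \<open>auto intro: L.proj_mem K.proj_mem P.proj_mem L.proj_orth K.proj_orth T' simp del: plus_lat_simps\<close>)
  then show "form N (oproj N (snd u) p) (oproj N (snd u) p) = - (L.Qm (fst p) + K.Qm (snd p) - P.Qm (pj p))"
    unfolding Q R S by (simp add: perp_gr_def sum_gr_def)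
qed

text \<open>Both spaces of \<open>u\<close> are orthogonal to the whole diagonal: to the part of
  \<open>m\<close> in the space of the same sign by construction, to the other part because
  \<open>v\<close> and \<open>w\<close> are orthogonal decompositions. So the kernel terms live on
  classes modulo \<open>M\<close>.\<close>

lemma perp_invariant: assumes m: "m \<in> rspan L" shows "qexpt N u \<tau> (p + gm m) = qexpt N u \<tau> p"
proof -
  obtain a b where ab: "m = a + b" "a \<in> fst v" "b \<in> snd v" using m L.v_sum by auto
  have z: "form N (gm m) x = 0" if x: "x \<in> fst u \<or> x \<in> snd u" for x
  proof -
    have V: "fst x \<in> rspan L" "snd x \<in> rspan K"
      using x L.v_V K.v_V by (auto simp: perp_gr_def sum_gr_def ocompl_in_def)
    have ga: "g a \<in> rspan K" "g b \<in> rspan K" using ab g_v K.v_V by auto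
    have s: "form L a (fst x) = form L (fst x) a" "form L b (fst x) = form L (fst x) b"
      "form K (g a) (snd x) = form K (snd x) (g a)" "form K (g b) (snd x) = form K (snd x) (g b)"
      using V ga L.v_V ab by (auto intro!: L.B_sym K.B_sym)
    have e: "form N (gm m) x = (form L (fst x) a + form K (snd x) (g a)) + (form L (fst x) b + form K (snd x) (g b))"
      unfolding form_N gm_simps ab(1) L.B_simps K.B_simps g_simps s by simp
    show ?thesis
    proof (cases "x \<in> fst u")
      case True
      then have t: "fst x \<in> fst v" "snd x \<in> fst w" "form L (fst x) a + form K (snd x) (g a) = 0"
        using ab by (auto simp: perp_gr_def sum_gr_def ocompl_in_def form_N gm_simps)
      show ?thesis unfolding e using t L.v_orth[OF t(1) ab(3)] K.v_orth[OF t(2) g_v(2)[OF ab(3)]] by simp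
    next
      case False
      then have t: "fst x \<in> snd v" "snd x \<in> snd w" "form L (fst x) b + form K (snd x) (g b) = 0"
        using x ab by (auto simp: perp_gr_def sum_gr_def ocompl_in_def form_N gm_simps)
      show ?thesis unfolding e s[symmetric] using t(3) L.v_orth[OF ab(2) t(1)] K.v_orth[OF g_v(1)[OF ab(2)] t(2)] s by simp
    qed
  qed
  have "form N (p + gm m - a) x = form N (p - a) x" if "x \<in> fst u \<or> x \<in> snd u" for x a
  proof -
    have "form N (p + gm m - a) x = form N (p - a) x + form N (gm m) x" by (simp add: form_N L.B_simps K.B_simps)
    then show ?thesis using z[OF that] by simp
  qed
  then have "oproj N (fst u) (p + gm m) = oproj N (fst u) p" "oproj N (snd u) (p + gm m) = oproj N (snd u) p"
    unfolding oproj_def by (auto intro!: arg_cong[where f = The])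
  then show ?thesis unfolding qexpt_def by (simp only:)
qed

text \<open>The splitting behind the product formula: rearranged, it says that the exponents for
  \<open>L\<close> and \<open>K\<close> add up to a kernel exponent plus a theta exponent of the
  sum.\<close>

lemma qexpt_perp: "qexpt N u \<tau> p = qexpt L v \<tau> (fst p) + qexpt K w \<tau> (snd p) - qexpt PL v \<tau> (pj p)"
  unfolding qexpt_def[of N] perp_forms L.qexpt_eq K.qexpt_eq P.qexpt_eq
  by (simp add: algebra_simps add_divide_distrib diff_divide_distrib)

end

text \<open>Half-integrality of the weights is what makes the floors in \<open>autf\<close>
  additive.\<close>

lemma autf_add:
  assumes "half_int k" "half_int k'" "half_int l" "half_int l'" "\<phi> \<tau> \<noteq> 0"
  shows "autf \<phi> k l \<tau> * autf \<phi> k' l' \<tau> = autf \<phi> (k + k') (l + l') \<tau>"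
proof -
  have f: "\<lfloor>2 * (a + b)\<rfloor> = \<lfloor>2 * a\<rfloor> + \<lfloor>2 * b\<rfloor>" if "half_int a" "half_int b" for a b :: real
    using that unfolding half_int_def by (auto elim!: Ints_cases simp: distrib_left)
  have c: "cnj (\<phi> \<tau>) \<noteq> 0" using assms(5) by simp
  show ?thesis unfolding autf_def f[OF assms(1,2)] f[OF assms(3,4)]
    power_int_add[OF disjI1[OF assms(5)]] power_int_add[OF disjI1[OF c]] by (simp only: mult_ac)
qed

lemma half_int_add: "half_int a \<Longrightarrow> half_int b \<Longrightarrow> half_int (a + b)"
  by (simp add: half_int_def distrib_left)

context theta_lattice
begin

lemma proj_unique:
  assumes "a \<in> fst v" "b \<in> snd v" shows "oproj L (fst v) (a + b) = a" "oproj L (snd v) (a + b) = b"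
proof -
  define d where "d = oproj L (fst v) (a + b) - a"
  have d: "d \<in> fst v" unfolding d_def by (rule subspace_diff[OF v_sub(1) proj_mem(1) assms(1)])
  have "B (oproj L (fst v) (a + b)) d = B (a + b) d" using proj_orth(1)[OF d, of "a + b"] by (simp add: bilinear_lsub[OF bil])
  moreover have "B b d = 0" using B_sym[OF v_V(2)[OF assms(2)] v_V(1)[OF d]] v_orth[OF d assms(2)] by simp
  ultimately have "B d d = 0" by (simp add: d_def bilinear_lsub[OF bil] bilinear_ladd[OF bil])
  then show "oproj L (fst v) (a + b) = a" using v_pos[OF d] by (auto simp: d_def)
  define e where "e = oproj L (snd v) (a + b) - b"
  have e: "e \<in> snd v" unfolding e_def by (rule subspace_diff[OF v_sub(2) proj_mem(2) assms(2)])
  have "B (oproj L (snd v) (a + b)) e = B (a + b) e" using proj_orth(2)[OF e, of "a + b"] by (simp add: bilinear_lsub[OF bil])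
  then have "B e e = 0" using v_orth[OF assms(1) e] by (simp add: e_def bilinear_lsub[OF bil] bilinear_ladd[OF bil])
  then show "oproj L (snd v) (a + b) = b" using v_neg[OF e] by (auto simp: e_def)
qed

text \<open>The inverse substitution multiplies by the automorphy factors. It lets uniqueness be
  tested at the transformed \<open>\<tau>\<close> using only points of the form
  \<open>gact A \<tau> \<zeta>\<close>.\<close>

lemma gact_surj:
  assumes "A \<in> SL2R" "\<tau> \<in> uhp" "\<xi> \<in> cspan L" obtains \<zeta> where "\<zeta> \<in> cspan L" "gact A \<tau> \<zeta> = \<xi>"
proof
  define j where "j = jfac A \<tau>"
  have j: "j \<noteq> 0" unfolding j_def by (rule jfac_nonzero[OF assms(1,2)])
  define \<zeta> where "\<zeta> = cscale j (cmap (oproj L (fst v)) \<xi>) + cscale (cnj j) (cmap (oproj L (snd v)) \<xi>)"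
  show z: "\<zeta> \<in> cspan L" unfolding \<zeta>_def by (intro cspan_intros cscale_cspan cmap_cspan)
  show "gact A \<tau> \<zeta> = \<xi>"
  proof (rule cspan_eqI[OF gact_cspan assms(3)])
    fix f assume f: "f \<in> F"
    have p: "pr f \<zeta> = j * (if f \<in> Fp then pr f \<xi> else 0) + cnj j * (if f \<in> Fm then pr f \<xi> else 0)"
      unfolding \<zeta>_def pr_simps(1) pr_cscale pr_proj_plus[OF assms(3) f] pr_proj_minus[OF assms(3) f] ..
    show "pr f (gact A \<tau> \<zeta>) = pr f \<xi>"
    proof (cases "f \<in> Fp")
      case True
      then have "f \<notin> Fm" using F_disjoint by blast
      then show ?thesis using True p j by (simp add: pr_gact(1)[OF z] j_def[symmetric])
    next
      case False
      then have "f \<in> Fm" using f by (simp add: F_def)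
      then show ?thesis using False p j by (simp add: pr_gact(2)[OF z] j_def[symmetric])
    qed
  qed
qed

text \<open>Injectivity of the passage to Jacobi forms, separately at each
  \<open>\<tau>\<close>.\<close>

lemma modular_unique:
  assumes \<tau>: "\<tau> \<in> uhp" and G: "G \<in> gring L" "G' \<in> gring L"
    and eq: "\<And>\<zeta>. \<zeta> \<in> cspan L \<Longrightarrow> gpair L (th \<tau> \<zeta>) G = gpair L (th \<tau> \<zeta>) G'"
  shows "G = G'"
proof (rule gring_eqI[OF G])
  fix \<gamma> assume \<gamma>: "\<gamma> \<in> disc L"
  have "G \<gamma> - G' \<gamma> = 0"
  proof (rule theta_independent[OF \<tau> _ \<gamma>])
    fix \<zeta> assume "\<zeta> \<in> cspan L"
    then show "(\<Sum>\<delta>\<in>disc L. (G \<delta> - G' \<delta>) * th \<tau> \<zeta> \<delta>) = 0"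
      using eq[of \<zeta>] by (simp add: gpair_def left_diff_distrib sum_subtractf mult.commute)
  qed
  then show "G \<gamma> = G' \<gamma>" by simp
qed

end

section \<open>The contraction kernel and the product formula\<close>

context theta_pair
begin

abbreviation kern :: "complex \<Rightarrow> 'a set \<Rightarrow> 'b set \<Rightarrow> 'a set \<Rightarrow> complex" where
  "kern \<tau> \<gamma> \<gamma>' \<delta> \<equiv> contraction_kernel N M u \<tau> (\<gamma> \<times> \<gamma>') (gm ` \<delta>)"

text \<open>A transversal: each class modulo \<open>M\<close> in the index set of the kernel
  contains exactly one point whose projection is \<open>rep \<delta>\<close> itself. It replaces the
  sum over classes by a sum over points.\<close>

definition RR :: "('a \<times> 'b) set \<Rightarrow> 'a set \<Rightarrow> ('a \<times> 'b) set" where "RR \<Gamma> \<delta> = {p \<in> \<Gamma>. pj p = rep \<delta>}"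

lemma coset_add: "m \<in> pts L \<Longrightarrow> coset L (x + m) = coset L x" "n \<in> pts K \<Longrightarrow> coset K (y + n) = coset K y"
  by (simp_all add: L.coset_eq_iff K.coset_eq_iff)

lemma coset_N_add: "m \<in> pts L \<Longrightarrow> coset N (p + gm m) = coset N p"
  by (simp add: coset_N gm_simps coset_add g_pts)

lemma coset_N_mem: assumes "\<gamma> \<in> disc L" "\<gamma>' \<in> disc K" "p \<in> \<gamma> \<times> \<gamma>'" shows "coset N p = \<gamma> \<times> \<gamma>'"
  using assms L.disc_mem(2) K.disc_mem(2) by (auto simp: coset_N mem_Times_iff)

lemma self_mem_N: "p \<in> coset N p"
  by (simp add: coset_N mem_Times_iff L.mem_coset K.mem_coset L.pts_intros(1) K.pts_intros(1))

lemma gm_0: "gm 0 = 0" by (simp add: graph_map_def g_simps zero_prod_def)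

lemma coset_M_add: assumes m: "m \<in> pts L" shows "coset M (p + gm m) = coset M p"
proof (intro equalityI subsetI)
  fix x assume "x \<in> coset M (p + gm m)"
  then obtain n where n: "n \<in> pts L" "x = p + gm m + gm n" unfolding coset_M by blast
  then show "x \<in> coset M p" unfolding coset_M
    by (intro bexI[of _ "m + n"]) (simp_all add: add.assoc gm_simps L.pts_intros(2) m)
next
  fix x assume "x \<in> coset M p"
  then obtain n where n: "n \<in> pts L" "x = p + gm n" unfolding coset_M by blast
  have "x = p + gm m + gm (n - m)" unfolding n(2) add.assoc gm_simps(3) by simp
  then show "x \<in> coset M (p + gm m)" unfolding coset_M using L.pts_intros(3)[OF n(1) m] by blast
qed

lemma rep_M: obtains m where "m \<in> pts L" "rep (coset M p) = p + gm m"
proof -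
  have "p \<in> coset M p" unfolding coset_M using L.pts_intros(1) gm_0 by (intro bexI[of _ 0]) simp_all
  then have "rep (coset M p) \<in> coset M p" unfolding rep_def by (rule someI)
  then show ?thesis using that unfolding coset_M by blast
qed

lemma disc_P:
  assumes "\<delta> \<in> disc PL"
  shows "rep \<delta> \<in> rspan L" "coset L (rep \<delta>) = \<delta>" "x \<in> \<delta> \<longleftrightarrow> x - rep \<delta> \<in> pts L"
proof -
  show "rep \<delta> \<in> rspan L" using P.dual_V[OF P.rep_dual[OF assms]] by simp
  show c: "coset L (rep \<delta>) = \<delta>" using P.coset_rep[OF assms] by simp
  show "x \<in> \<delta> \<longleftrightarrow> x - rep \<delta> \<in> pts L" using L.mem_coset[of x "rep \<delta>"] unfolding c .
qed

lemma pj_shift: "m \<in> pts L \<Longrightarrow> pj (p + gm m) = pj p + m"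
  by (simp add: pj_add pj_gm L.pts_V)

lemma kernel_eq:
  assumes d: "\<gamma> \<in> disc L" "\<gamma>' \<in> disc K" "\<delta> \<in> disc PL"
  shows "kern \<tau> \<gamma> \<gamma>' \<delta> = (\<Sum>\<^sub>\<infinity>p\<in>RR (\<gamma> \<times> \<gamma>') \<delta>. ee (qexpt N u \<tau> p))"
proof -
  define X where "X = {X \<in> coset M ` dual N. disc_proj N M (rep X) = gm ` \<delta> \<and> coset N (rep X) = \<gamma> \<times> \<gamma>'}"
  have "bij_betw (coset M) (RR (\<gamma> \<times> \<gamma>') \<delta>) X"
  proof (rule bij_betw_imageI)
    show "inj_on (coset M) (RR (\<gamma> \<times> \<gamma>') \<delta>)"
    proof (rule inj_onI)
      fix p q assume p: "p \<in> RR (\<gamma> \<times> \<gamma>') \<delta>" and q: "q \<in> RR (\<gamma> \<times> \<gamma>') \<delta>" and eq: "coset M p = coset M q"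
      have "p + gm 0 \<in> coset M p" unfolding coset_M using L.pts_intros(1) by blast
      then have "p \<in> coset M q" using eq gm_0 by simp
      then obtain m where m: "m \<in> pts L" "p = q + gm m" unfolding coset_M by blast
      then have "m = 0" using p q pj_shift[OF m(1), of q] by (simp add: RR_def)
      then show "p = q" using m gm_0 by simp
    qed
    show "coset M ` RR (\<gamma> \<times> \<gamma>') \<delta> = X"
    proof (intro equalityI subsetI)
      fix Z assume "Z \<in> coset M ` RR (\<gamma> \<times> \<gamma>') \<delta>"
      then obtain p where p: "Z = coset M p" "p \<in> \<gamma> \<times> \<gamma>'" "pj p = rep \<delta>" by (auto simp: RR_def)
      obtain m where m: "m \<in> pts L" "rep Z = p + gm m" using rep_M unfolding p(1) by blast
      have "p \<in> dual N" using p(2) L.disc_mem(1)[OF d(1)] K.disc_mem(1)[OF d(2)] by (auto simp: dual_N)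
      moreover have "disc_proj N M (rep Z) = gm ` \<delta>"
        unfolding disc_proj_eq m(2) pj_shift[OF m(1)] p(3) coset_add(1)[OF m(1)] disc_P(2)[OF d(3)] ..
      moreover have "coset N (rep Z) = \<gamma> \<times> \<gamma>'" unfolding m(2) coset_N_add[OF m(1)] by (rule coset_N_mem[OF d(1,2) p(2)])
      ultimately show "Z \<in> X" using p(1) by (simp add: X_def)
    next
      fix Z assume Z: "Z \<in> X"
      then obtain q where q: "Z = coset M q" by (auto simp: X_def)
      obtain m where m: "m \<in> pts L" "rep Z = q + gm m" using rep_M unfolding q by blast
      have ZR: "Z = coset M (rep Z)" unfolding m(2) coset_M_add[OF m(1)] by (rule q)
      have c: "coset L (pj (rep Z)) = coset L (rep \<delta>)"
        using Z unfolding X_def disc_proj_eq disc_P(2)[OF d(3)] by (simp add: inj_image_eq_iff[OF inj_gm])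
      \<comment> \<open>A translation by \<open>gm n\<close> stays in the class and moves the
        projection to \<open>rep \<delta>\<close>.\<close>
      define n where "n = rep \<delta> - pj (rep Z)"
      have n: "n \<in> pts L" using c[symmetric] unfolding L.coset_eq_iff n_def .
      define p where "p = rep Z + gm n"
      have "pj p = rep \<delta>" unfolding p_def pj_shift[OF n] by (simp add: n_def)
      moreover have "coset N p = \<gamma> \<times> \<gamma>'" using Z unfolding p_def coset_N_add[OF n] by (simp add: X_def)
      then have "p \<in> \<gamma> \<times> \<gamma>'" using self_mem_N[of p] by simp
      moreover have "Z = coset M p" unfolding p_def coset_M_add[OF n] by (rule ZR)
      ultimately show "Z \<in> coset M ` RR (\<gamma> \<times> \<gamma>') \<delta>" by (auto simp: RR_def)
    qed
  qed
  from infsum_reindex_bij_betw[OF this, of "\<lambda>X. ee (qexpt N u \<tau> (rep X))"]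
  have "kern \<tau> \<gamma> \<gamma>' \<delta> = (\<Sum>\<^sub>\<infinity>p\<in>RR (\<gamma> \<times> \<gamma>') \<delta>. ee (qexpt N u \<tau> (rep (coset M p))))"
    by (simp add: contraction_kernel_def X_def)
  also have "\<dots> = (\<Sum>\<^sub>\<infinity>p\<in>RR (\<gamma> \<times> \<gamma>') \<delta>. ee (qexpt N u \<tau> p))"
  proof (rule infsum_cong)
    fix p
    obtain m where m: "m \<in> pts L" "rep (coset M p) = p + gm m" using rep_M by blast
    show "ee (qexpt N u \<tau> (rep (coset M p))) = ee (qexpt N u \<tau> p)"
      unfolding m(2) perp_invariant[OF L.pts_V[OF m(1)]] ..
  qed
  finally show ?thesis .
qed

text \<open>The pair of elliptic variables \<open>\<zeta>\<close> and \<open>cmap g \<zeta>\<close>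
  lies on the complexified diagonal, so a dual vector meets it through its projection only.\<close>

lemma pr_pj: assumes "\<zeta> \<in> cspan L"
  shows "cform L (cvec (fst p)) \<zeta> + cform K (cvec (snd p)) (cmap g \<zeta>) = cform PL (cvec (pj p)) \<zeta>"
proof -
  have "fst \<zeta> \<in> rspan L" "snd \<zeta> \<in> rspan L" using assms by (simp_all add: L.cspan_iff)
  then show ?thesis unfolding L.pr_def[symmetric] K.pr_def[symmetric] P.pr_def[symmetric] L.pr_eq K.pr_eq P.pr_eq
    using pj_pair[of "fst \<zeta>" p] pj_pair[of "snd \<zeta>" p] by (simp add: complex_eq_iff hp_def cmap_def)
qed

lemma theta_product:
  assumes d: "\<gamma> \<in> disc L" "\<gamma>' \<in> disc K" and \<tau>: "\<tau> \<in> uhp" and \<zeta>: "\<zeta> \<in> cspan L"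
  shows "L.th \<tau> \<zeta> \<gamma> * K.th \<tau> (cmap g \<zeta>) \<gamma>' =
    (\<Sum>\<delta>\<in>disc PL. kern \<tau> \<gamma> \<gamma>' \<delta> * P.th \<tau> \<zeta> \<delta>)"
proof -
  define tL where "tL a = ee (qexpt L v \<tau> a + cform L (cvec a) \<zeta>)" for a
  define tK where "tK b = ee (qexpt K w \<tau> b + cform K (cvec b) (cmap g \<zeta>))" for b
  define tP where "tP x = ee (qexpt PL v \<tau> x + cform PL (cvec x) \<zeta>)" for x
  define t where "t p = tL (fst p) * tK (snd p)" for p
  have tq: "t p = ee (qexpt N u \<tau> p) * tP (pj p)" for p
    unfolding t_def tL_def tK_def tP_def ee_add[symmetric] qexpt_perp pr_pj[OF \<zeta>, symmetric] by (simp add: algebra_simps)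
  have "(\<lambda>x. cmod (tL x)) summable_on \<gamma>"
    by (rule summable_on_subset_banach[of _ "dual L"])
      (use L.dth_summable[OF L.sv_pos[OF \<tau>], of \<zeta>] L.disc_mem(1)[OF d(1)] in \<open>auto simp: tL_def L.theta_term\<close>)
  moreover have "(\<lambda>x. cmod (tK x)) summable_on \<gamma>'"
    by (rule summable_on_subset_banach[of _ "dual K"])
      (use K.dth_summable[OF K.sv_pos[OF \<tau>], of "cmap g \<zeta>"] K.disc_mem(1)[OF d(2)] in \<open>auto simp: tK_def K.theta_term\<close>)
  ultimately have "(\<lambda>p. cmod (tL (fst p)) * cmod (tK (snd p))) summable_on \<gamma> \<times> \<gamma>'"
    by (rule product_summable) simp_all
  then have sm: "t summable_on \<gamma> \<times> \<gamma>'" by (rule summable_on_dominated) (simp add: t_def norm_mult)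
  define S where "S \<delta> = {p \<in> \<gamma> \<times> \<gamma>'. pj p \<in> \<delta>}" for \<delta>
  have smS: "t summable_on S \<delta>" for \<delta> by (rule summable_on_subset_banach[OF sm]) (auto simp: S_def)
  have pd: "pj p \<in> dual PL" if "p \<in> \<gamma> \<times> \<gamma>'" for p
    using that by (intro pj_dual L.disc_mem(1)[OF d(1)] K.disc_mem(1)[OF d(2)]) auto
  have U: "(\<Union>\<delta>\<in>disc PL. S \<delta>) = \<gamma> \<times> \<gamma>'"
  proof (intro equalityI subsetI)
    fix p assume p: "p \<in> \<gamma> \<times> \<gamma>'"
    have "pj p \<in> coset PL (pj p)" by (simp add: L.mem_coset L.pts_intros(1))
    then show "p \<in> (\<Union>\<delta>\<in>disc PL. S \<delta>)" using P.coset_disc[OF pd[OF p]] p unfolding S_def by blast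
  qed (auto simp: S_def)
  have "L.th \<tau> \<zeta> \<gamma> * K.th \<tau> (cmap g \<zeta>) \<gamma>' = infsum t (\<gamma> \<times> \<gamma>')"
    using infsum_product_eq[OF sm[unfolded t_def[abs_def]]] d
    by (simp add: siegel_theta_def tL_def tK_def t_def[abs_def])
  also have "\<dots> = (\<Sum>\<delta>\<in>disc PL. infsum t (S \<delta>))"
  proof -
    have "(\<Sum>\<delta>\<in>disc PL. infsum t (S \<delta>)) = infsum t (\<Union>\<delta>\<in>disc PL. S \<delta>)"
    proof (rule sum_infsum[OF P.finite_disc smS])
      show "S \<delta> \<inter> S \<delta>' = {}" if "\<delta> \<in> disc PL" "\<delta>' \<in> disc PL" "\<delta> \<noteq> \<delta>'" for \<delta> \<delta>'
        using that P.disc_mem(2) unfolding S_def by blast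
    qed
    then show ?thesis unfolding U by simp
  qed
  also have "\<dots> = (\<Sum>\<delta>\<in>disc PL. kern \<tau> \<gamma> \<gamma>' \<delta> * P.th \<tau> \<zeta> \<delta>)"
  proof (rule sum.cong[OF refl])
    fix \<delta> assume \<delta>: "\<delta> \<in> disc PL"
    \<comment> \<open>A point projecting into \<open>\<delta>\<close> is uniquely a transversal
      point plus a diagonal lattice vector. Recording the projection as second coordinate makes the
      double sum a product of a kernel series and a theta series.\<close>
    define \<psi> where "\<psi> z = fst z + gm (snd z - rep \<delta>)" for z :: "('a \<times> 'b) \<times> 'a"
    have in_pts: "x - rep \<delta> \<in> pts L" if "x \<in> \<delta>" for x using disc_P(3)[OF \<delta>] that by blast
    have pj\<psi>: "pj (\<psi> z) = snd z" if "z \<in> RR (\<gamma> \<times> \<gamma>') \<delta> \<times> \<delta>" for z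
      using that pj_shift[OF in_pts, of "snd z" "fst z"] by (auto simp: \<psi>_def RR_def)
    have shift: "p + gm n \<in> \<gamma> \<times> \<gamma>'" if "p \<in> \<gamma> \<times> \<gamma>'" "n \<in> pts L" for p n
      using self_mem_N[of "p + gm n"] unfolding coset_N_add[OF that(2)] coset_N_mem[OF d that(1)] .
    have bij: "bij_betw \<psi> (RR (\<gamma> \<times> \<gamma>') \<delta> \<times> \<delta>) (S \<delta>)"
    proof (rule bij_betwI[where g = "\<lambda>q. (q + gm (rep \<delta> - pj q), pj q)"])
      show "\<psi> \<in> RR (\<gamma> \<times> \<gamma>') \<delta> \<times> \<delta> \<rightarrow> S \<delta>"
      proof
        fix z assume z: "z \<in> RR (\<gamma> \<times> \<gamma>') \<delta> \<times> \<delta>"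
        then have "\<psi> z \<in> \<gamma> \<times> \<gamma>'" unfolding \<psi>_def by (intro shift in_pts) (auto simp: RR_def)
        moreover have "snd z \<in> \<delta>" using z by auto
        ultimately show "\<psi> z \<in> S \<delta>" unfolding S_def using pj\<psi>[OF z] by simp
      qed
      show "(\<lambda>q. (q + gm (rep \<delta> - pj q), pj q)) \<in> S \<delta> \<rightarrow> RR (\<gamma> \<times> \<gamma>') \<delta> \<times> \<delta>"
      proof
        fix q assume "q \<in> S \<delta>"
        then have q: "q \<in> \<gamma> \<times> \<gamma>'" "pj q \<in> \<delta>" by (simp_all add: S_def)
        have n: "rep \<delta> - pj q \<in> pts L" using L.pts_intros(4)[OF in_pts[OF q(2)]] by simp
        show "(q + gm (rep \<delta> - pj q), pj q) \<in> RR (\<gamma> \<times> \<gamma>') \<delta> \<times> \<delta>"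
          using shift[OF q(1) n] pj_shift[OF n, of q] q(2) by (simp add: RR_def)
      qed
      show "(\<psi> z + gm (rep \<delta> - pj (\<psi> z)), pj (\<psi> z)) = z" if "z \<in> RR (\<gamma> \<times> \<gamma>') \<delta> \<times> \<delta>" for z
      proof -
        have "\<psi> z + gm (rep \<delta> - snd z) = fst z" unfolding \<psi>_def add.assoc gm_simps(3) by (simp add: gm_0)
        then show ?thesis by (simp add: pj\<psi>[OF that])
      qed
      show "\<psi> (q + gm (rep \<delta> - pj q), pj q) = q" if "q \<in> S \<delta>" for q
        unfolding \<psi>_def fst_conv snd_conv add.assoc gm_simps(3) by (simp add: gm_0)
    qed
    have t\<psi>: "t (\<psi> z) = ee (qexpt N u \<tau> (fst z)) * tP (snd z)" if z: "z \<in> RR (\<gamma> \<times> \<gamma>') \<delta> \<times> \<delta>" for z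
    proof -
      have "snd z - rep \<delta> \<in> rspan L" using z in_pts L.pts_V by auto
      then have "qexpt N u \<tau> (\<psi> z) = qexpt N u \<tau> (fst z)" unfolding \<psi>_def by (rule perp_invariant)
      then show ?thesis unfolding tq pj\<psi>[OF z] by simp
    qed
    have "(\<lambda>z. t (\<psi> z)) summable_on RR (\<gamma> \<times> \<gamma>') \<delta> \<times> \<delta>"
      using summable_on_reindex_bij_betw[OF bij, of t] smS by simp
    then have sm': "(\<lambda>z. ee (qexpt N u \<tau> (fst z)) * tP (snd z)) summable_on RR (\<gamma> \<times> \<gamma>') \<delta> \<times> \<delta>"
      by (rule summable_on_cong[THEN iffD1, rotated]) (simp add: t\<psi>)
    have "infsum t (S \<delta>) = (\<Sum>\<^sub>\<infinity>z\<in>RR (\<gamma> \<times> \<gamma>') \<delta> \<times> \<delta>. t (\<psi> z))"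
      by (rule infsum_reindex_bij_betw[OF bij, symmetric])
    also have "\<dots> = (\<Sum>\<^sub>\<infinity>z\<in>RR (\<gamma> \<times> \<gamma>') \<delta> \<times> \<delta>. ee (qexpt N u \<tau> (fst z)) * tP (snd z))"
      by (rule infsum_cong) (rule t\<psi>)
    also have "\<dots> = (\<Sum>\<^sub>\<infinity>p\<in>RR (\<gamma> \<times> \<gamma>') \<delta>. ee (qexpt N u \<tau> p)) * infsum tP \<delta>" by (rule infsum_product_eq[OF sm'])
    also have "infsum tP \<delta> = P.th \<tau> \<zeta> \<delta>" using \<delta> by (simp add: siegel_theta_def tP_def[abs_def])
    finally show "infsum t (S \<delta>) = kern \<tau> \<gamma> \<gamma>' \<delta> * P.th \<tau> \<zeta> \<delta>"
      unfolding kernel_eq[OF d \<delta>] .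
  qed
  finally show ?thesis .
qed

text \<open>The positive definite majorant on the direct sum.\<close>

definition Sq :: "'a \<times> 'b \<Rightarrow> real" where "Sq p = (L.Qp (fst p) + L.Qm (fst p)) + (K.Qp (snd p) + K.Qm (snd p))"

lemma perp_gauss:
  obtains c C where "c \<ge> 0" "C \<ge> 0" "\<And>\<epsilon>. \<epsilon> > 0 \<Longrightarrow> (\<lambda>p. exp (- (pi * \<epsilon>) * Sq p)) summable_on dual L \<times> dual K"
    "\<And>\<epsilon>. \<epsilon> > 0 \<Longrightarrow> infsum (\<lambda>p. exp (- (pi * \<epsilon>) * Sq p)) (dual L \<times> dual K) \<le> c * exp (C / \<epsilon>)"
proof -
  obtain c C where 1: "c \<ge> 0" "C \<ge> 0" "\<And>\<epsilon>. \<epsilon> > 0 \<Longrightarrow> (\<lambda>x. exp (- (pi * \<epsilon>) * (L.Qp x + L.Qm x))) summable_on dual L"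
    "\<And>\<epsilon>. \<epsilon> > 0 \<Longrightarrow> infsum (\<lambda>x. exp (- (pi * \<epsilon>) * (L.Qp x + L.Qm x))) (dual L) \<le> c * exp (C / \<epsilon>)"
    using L.gauss_sum_bound by blast
  obtain c' C' where 2: "c' \<ge> 0" "C' \<ge> 0" "\<And>\<epsilon>. \<epsilon> > 0 \<Longrightarrow> (\<lambda>x. exp (- (pi * \<epsilon>) * (K.Qp x + K.Qm x))) summable_on dual K"
    "\<And>\<epsilon>. \<epsilon> > 0 \<Longrightarrow> infsum (\<lambda>x. exp (- (pi * \<epsilon>) * (K.Qp x + K.Qm x))) (dual K) \<le> c' * exp (C' / \<epsilon>)"
    using K.gauss_sum_bound by blast
  have e: "exp (- (pi * \<epsilon>) * Sq p) = exp (- (pi * \<epsilon>) * (L.Qp (fst p) + L.Qm (fst p))) * exp (- (pi * \<epsilon>) * (K.Qp (snd p) + K.Qm (snd p)))" for \<epsilon> p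
    unfolding Sq_def distrib_left[of "- (pi * \<epsilon>)" "L.Qp (fst p) + L.Qm (fst p)"] by (rule exp_add)
  have sm: "(\<lambda>p. exp (- (pi * \<epsilon>) * (L.Qp (fst p) + L.Qm (fst p))) * exp (- (pi * \<epsilon>) * (K.Qp (snd p) + K.Qm (snd p)))) summable_on dual L \<times> dual K"
    if "\<epsilon> > 0" for \<epsilon> by (rule product_summable[OF 1(3)[OF that] 2(3)[OF that]]) simp_all
  show ?thesis
  proof (rule that[of "c * c'" "C + C'"])
    fix \<epsilon> :: real assume \<epsilon>: "\<epsilon> > 0"
    show "(\<lambda>p. exp (- (pi * \<epsilon>) * Sq p)) summable_on dual L \<times> dual K" unfolding e by (rule sm[OF \<epsilon>])
    have "infsum (\<lambda>p. exp (- (pi * \<epsilon>) * Sq p)) (dual L \<times> dual K) =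
      infsum (\<lambda>x. exp (- (pi * \<epsilon>) * (L.Qp x + L.Qm x))) (dual L) * infsum (\<lambda>x. exp (- (pi * \<epsilon>) * (K.Qp x + K.Qm x))) (dual K)"
      unfolding e by (rule infsum_product_eq[OF sm[OF \<epsilon>]])
    also have "\<dots> \<le> (c * exp (C / \<epsilon>)) * (c' * exp (C' / \<epsilon>))"
      by (rule mult_mono[OF 1(4)[OF \<epsilon>] 2(4)[OF \<epsilon>]]) (use 1(1) in \<open>auto intro: infsum_nonneg\<close>)
    also have "\<dots> = c * c' * exp ((C + C') / \<epsilon>)" unfolding add_divide_distrib exp_add by (simp only: mult_ac)
    finally show "infsum (\<lambda>p. exp (- (pi * \<epsilon>) * Sq p)) (dual L \<times> dual K) \<le> c * c' * exp ((C + C') / \<epsilon>)" .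
  qed (use 1 2 in auto)
qed

text \<open>The exponent of a kernel term as a real linear function of \<open>\<tau>\<close>. Its
  real part is governed by the majorant minus that of the projection, and the latter is constant on
  a transversal.\<close>

definition kp :: "'a \<times> 'b \<Rightarrow> complex \<Rightarrow> complex" where
  "kp p \<tau> = 2 * cpi * \<i> * (\<tau> * cor ((L.Qp (fst p) + K.Qp (snd p) - P.Qp (pj p)) / 2) -
     cnj \<tau> * cor ((L.Qm (fst p) + K.Qm (snd p) - P.Qm (pj p)) / 2))"

lemma ee_kp: "ee (qexpt N u \<tau> p) = exp (kp p \<tau>)"
proof -
  have "\<tau> * cor (a / 2) + cnj \<tau> * cor (- b / 2) = \<tau> * cor (a / 2) - cnj \<tau> * cor (b / 2)" for a b
    by simp
  then show ?thesis unfolding ee_def kp_def qexpt_def perp_forms by (simp only:)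
qed

lemma Re_kp: "Re (kp p \<tau>) = - (pi * Im \<tau>) * (Sq p - (P.Qp (pj p) + P.Qm (pj p)))"
  by (simp add: kp_def Sq_def algebra_simps add_divide_distrib diff_divide_distrib)

lemma linear_kp: "linear (kp p)"
proof -
  define a b where "a = cor ((L.Qp (fst p) + K.Qp (snd p) - P.Qp (pj p)) / 2)"
    and "b = cor ((L.Qm (fst p) + K.Qm (snd p) - P.Qm (pj p)) / 2)"
  have k: "kp p = (\<lambda>\<tau>. 2 * cpi * \<i> * (\<tau> * a - cnj \<tau> * b))" unfolding kp_def[abs_def] a_def b_def ..
  show ?thesis unfolding k by (rule linearI) (simp_all add: scaleR_conv_of_real algebra_simps)
qed

lemma kp_bound: "cmod (kp p \<tau>) \<le> pi * (Sq p + (P.Qp (pj p) + P.Qm (pj p))) * norm \<tau>"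
proof -
  define a b where "a = L.Qp (fst p) + K.Qp (snd p) - P.Qp (pj p)" and "b = L.Qm (fst p) + K.Qm (snd p) - P.Qm (pj p)"
  have ab: "\<bar>a\<bar> + \<bar>b\<bar> \<le> Sq p + (P.Qp (pj p) + P.Qm (pj p))"
    using L.Qp_nonneg[of "fst p"] L.Qm_nonneg[of "fst p"] K.Qp_nonneg[of "snd p"] K.Qm_nonneg[of "snd p"] P.Qp_nonneg[of "pj p"] P.Qm_nonneg[of "pj p"]
    unfolding a_def b_def Sq_def by linarith
  have n: "cmod (cor (a / 2)) = \<bar>a\<bar> / 2" "cmod (cor (b / 2)) = \<bar>b\<bar> / 2" unfolding norm_of_real by simp_all
  have "cmod (\<tau> * cor (a / 2) - cnj \<tau> * cor (b / 2)) \<le> cmod \<tau> * (\<bar>a\<bar> / 2) + cmod \<tau> * (\<bar>b\<bar> / 2)"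
    using norm_triangle_ineq4[of "\<tau> * cor (a / 2)" "cnj \<tau> * cor (b / 2)"] unfolding norm_mult n complex_mod_cnj .
  then have "2 * pi * cmod (\<tau> * cor (a / 2) - cnj \<tau> * cor (b / 2)) \<le> 2 * pi * (cmod \<tau> * (\<bar>a\<bar> / 2) + cmod \<tau> * (\<bar>b\<bar> / 2))"
    by (intro mult_left_mono) simp_all
  also have "\<dots> = pi * (\<bar>a\<bar> + \<bar>b\<bar>) * cmod \<tau>" by (simp add: field_simps)
  also have "\<dots> \<le> pi * (Sq p + (P.Qp (pj p) + P.Qm (pj p))) * cmod \<tau>" using ab by (intro mult_right_mono mult_left_mono) simp_all
  finally show ?thesis unfolding kp_def a_def[symmetric] b_def[symmetric] norm_mult[of "2 * cpi * \<i>"] by (simp add: norm_mult)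
qed

lemma RR_sub: assumes "\<gamma> \<in> disc L" "\<gamma>' \<in> disc K" shows "RR (\<gamma> \<times> \<gamma>') \<delta> \<subseteq> dual L \<times> dual K"
  using L.disc_mem(1)[OF assms(1)] K.disc_mem(1)[OF assms(2)] by (auto simp: RR_def)

lemma kernel_smooth:
  assumes d: "\<gamma> \<in> disc L" "\<gamma>' \<in> disc K" "\<delta> \<in> disc PL"
  shows "smooth_on (\<lambda>\<tau>. kern \<tau> \<gamma> \<gamma>' \<delta>) uhp"
proof -
  define R where "R = RR (\<gamma> \<times> \<gamma>') \<delta>"
  define s where "s = P.Qp (rep \<delta>) + P.Qm (rep \<delta>)"
  have s0: "s \<ge> 0" using P.Qp_nonneg[of "rep \<delta>"] P.Qm_nonneg[of "rep \<delta>"] by (simp add: s_def)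
  have pR: "P.Qp (pj p) + P.Qm (pj p) = s" if "p \<in> R" for p using that by (simp add: R_def RR_def s_def)
  have Sq0: "Sq p \<ge> 0" for p using L.Qp_nonneg[of "fst p"] L.Qm_nonneg[of "fst p"] K.Qp_nonneg[of "snd p"] K.Qm_nonneg[of "snd p"] by (simp add: Sq_def)
  obtain c C where cC: "\<And>\<epsilon>. \<epsilon> > 0 \<Longrightarrow> (\<lambda>p. exp (- (pi * \<epsilon>) * Sq p)) summable_on dual L \<times> dual K" using perp_gauss by blast
  have "smooth_on (expsum R (\<lambda>_. 1) kp) uhp"
  proof (rule smooth_on_openI[OF open_uhp order_refl])
    show "Ck_on n (expsum R (\<lambda>_. 1) kp) uhp" for n
    proof (rule expsum_Ck_on[OF open_uhp, where N = "\<lambda>p. pi * (Sq p + s)"])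
      show "linear (kp p)" for p by (rule linear_kp)
      show "cmod (kp p d) \<le> pi * (Sq p + s) * norm d" if "p \<in> R" for p d using kp_bound[of p d] unfolding pR[OF that] .
      show "0 \<le> pi * (Sq p + s)" for p using Sq0[of p] s0 by simp
      fix \<tau> assume \<tau>: "\<tau> \<in> uhp"
      \<comment> \<open>With \<open>Im \<tau> = 2 * y\<close> the decay is
        \<open>2 * pi * y * (Sq p - s)\<close>. The slack \<open>y * pi * (Sq p + s)\<close> uses up
        half of it and leaves the constant \<open>3 * pi * y * s\<close>.\<close>
      define y where "y = Im \<tau> / 2"
      have y: "y > 0" using \<tau> by (simp add: y_def uhp_iff)
      have "(\<lambda>p. exp (3 * pi * y * s) * exp (- (pi * y) * Sq p)) summable_on R"
        by (rule summable_on_cmult_right, rule summable_on_subset_banach[OF cC[OF y]]) (use RR_sub[OF d(1,2)] in \<open>simp add: R_def\<close>)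
      then have "(\<lambda>p. cmod 1 * exp (Re (kp p \<tau>) + y * (pi * (Sq p + s)))) summable_on R"
      proof (rule summable_on_cong[THEN iffD1, rotated])
        fix p assume p: "p \<in> R"
        have "Re (kp p \<tau>) + y * (pi * (Sq p + s)) = 3 * pi * y * s + - (pi * y) * Sq p"
          unfolding Re_kp pR[OF p] y_def by (simp add: field_simps)
        then show "exp (3 * pi * y * s) * exp (- (pi * y) * Sq p) = cmod 1 * exp (Re (kp p \<tau>) + y * (pi * (Sq p + s)))"
          by (simp only: exp_add norm_one mult_1_left)
      qed
      then show "\<exists>\<eta>>0. (\<lambda>p. cmod 1 * exp (Re (kp p \<tau>) + \<eta> * (pi * (Sq p + s)))) summable_on R" using y by blast
    qed
  qed
  then show ?thesis by (rule smooth_on_cong[rotated]) (simp add: kernel_eq[OF d] expsum_def ee_kp R_def)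
qed

text \<open>On the transversal the projection contributes at most
  \<open>exp (pi * s * Im \<tau>)\<close>; the rest is dominated by the Gaussian sum over both dual
  lattices, whose size is exponential in \<open>1 / Im \<tau>\<close>.\<close>

lemma kernel_growth:
  assumes d: "\<gamma> \<in> disc L" "\<gamma>' \<in> disc K" "\<delta> \<in> disc PL"
  shows "lin_exp_growth (\<lambda>\<tau>. kern \<tau> \<gamma> \<gamma>' \<delta>)"
proof -
  define R where "R = RR (\<gamma> \<times> \<gamma>') \<delta>"
  define s where "s = P.Qp (rep \<delta>) + P.Qm (rep \<delta>)"
  have s0: "s \<ge> 0" using P.Qp_nonneg[of "rep \<delta>"] P.Qm_nonneg[of "rep \<delta>"] by (simp add: s_def)
  obtain c C where cC: "c \<ge> 0" "C \<ge> 0" "\<And>\<epsilon>. \<epsilon> > 0 \<Longrightarrow> (\<lambda>p. exp (- (pi * \<epsilon>) * Sq p)) summable_on dual L \<times> dual K"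
    "\<And>\<epsilon>. \<epsilon> > 0 \<Longrightarrow> infsum (\<lambda>p. exp (- (pi * \<epsilon>) * Sq p)) (dual L \<times> dual K) \<le> c * exp (C / \<epsilon>)" using perp_gauss by blast
  show ?thesis
  proof (rule lin_exp_growth_bound[of _ c "pi * s" C])
    fix \<tau> assume "\<tau> \<in> uhp"
    then have y: "Im \<tau> > 0" by (simp add: uhp_iff)
    have sm: "(\<lambda>p. exp (- (pi * Im \<tau>) * Sq p)) summable_on R"
      by (rule summable_on_subset_banach[OF cC(3)[OF y]]) (use RR_sub[OF d(1,2)] in \<open>simp add: R_def\<close>)
    have "cmod (infsum (\<lambda>p. ee (qexpt N u \<tau> p)) R) \<le> infsum (\<lambda>p. exp (pi * s * Im \<tau>) * exp (- (pi * Im \<tau>) * Sq p)) R"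
    proof (rule norm_infsum_dominated[OF summable_on_cmult_right[OF sm]])
      fix p assume "p \<in> R"
      then have "P.Qp (pj p) + P.Qm (pj p) = s" by (simp add: R_def RR_def s_def)
      then have "Re (kp p \<tau>) = pi * s * Im \<tau> + - (pi * Im \<tau>) * Sq p" unfolding Re_kp by (simp add: algebra_simps)
      then show "cmod (ee (qexpt N u \<tau> p)) \<le> exp (pi * s * Im \<tau>) * exp (- (pi * Im \<tau>) * Sq p)"
        unfolding ee_kp norm_exp_eq_Re by (simp only: exp_add order_refl)
    qed
    also have "\<dots> = exp (pi * s * Im \<tau>) * infsum (\<lambda>p. exp (- (pi * Im \<tau>) * Sq p)) R" by (rule infsum_cmult_right')
    also have "\<dots> \<le> exp (pi * s * Im \<tau>) * infsum (\<lambda>p. exp (- (pi * Im \<tau>) * Sq p)) (dual L \<times> dual K)"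
      by (intro mult_left_mono infsum_mono_neutral sm cC(3)[OF y]) (use RR_sub[OF d(1,2)] in \<open>auto simp: R_def\<close>)
    also have "\<dots> \<le> exp (pi * s * Im \<tau>) * (c * exp (C / Im \<tau>))" by (intro mult_left_mono cC(4)[OF y]) simp
    also have "\<dots> = c * exp (pi * s * Im \<tau> + C / Im \<tau>)" unfolding exp_add by (simp only: mult_ac)
    finally show "cmod (kern \<tau> \<gamma> \<gamma>' \<delta>) \<le> c * exp (pi * s * Im \<tau> + C / Im \<tau>)"
      unfolding kernel_eq[OF d] R_def .
  qed (use s0 cC in auto)
qed

section \<open>Modularity of the contraction\<close>

abbreviation GG :: "(complex \<Rightarrow> 'a gring) \<Rightarrow> (complex \<Rightarrow> 'b gring) \<Rightarrow> complex \<Rightarrow> 'a gring" where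
  "GG F H \<equiv> diag_contraction g L K v w (tensor_form L K F H)"

lemma GG_eq:
  assumes \<delta>: "\<delta> \<in> disc PL"
  shows "GG F H \<tau> \<delta> = (\<Sum>\<gamma>\<in>disc L. \<Sum>\<gamma>'\<in>disc K. kern \<tau> \<gamma> \<gamma>' \<delta> * (F \<tau> \<gamma> * H \<tau> \<gamma>'))"
proof -
  have ne: "\<gamma> \<noteq> {}" "\<gamma>' \<noteq> {}" if "\<gamma> \<in> disc L" "\<gamma>' \<in> disc K" for \<gamma> \<gamma>'
    using L.rep_mem[OF that(1)] K.rep_mem[OF that(2)] by auto
  \<comment> \<open>Cosets are non-empty, so a product of two cosets determines its factors.\<close>
  have inj: "inj_on (\<lambda>(\<gamma>, \<gamma>'). \<gamma> \<times> \<gamma>') (disc L \<times> disc K)"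
    by (rule inj_onI) (use ne in \<open>auto simp: times_eq_iff\<close>)
  have "GG F H \<tau> \<delta> = (\<Sum>\<Gamma>\<in>disc N. contraction_kernel N M u \<tau> \<Gamma> (gm ` \<delta>) * tensor_form L K F H \<tau> \<Gamma>)"
    using \<delta> by (simp add: diag_contraction_def pull_gring_def theta_contraction_def disc_M gpair_def)
  also have "\<dots> = (\<Sum>z\<in>disc L \<times> disc K. contraction_kernel N M u \<tau> (fst z \<times> snd z) (gm ` \<delta>) * tensor_form L K F H \<tau> (fst z \<times> snd z))"
    unfolding disc_N sum.reindex[OF inj] by (rule sum.cong[OF refl]) (simp add: split_def)
  also have "\<dots> = (\<Sum>\<gamma>\<in>disc L. \<Sum>\<gamma>'\<in>disc K. kern \<tau> \<gamma> \<gamma>' \<delta> * tensor_form L K F H \<tau> (\<gamma> \<times> \<gamma>'))"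
    unfolding sum.cartesian_product by (rule sum.cong[OF refl]) (simp add: split_def)
  also have "\<dots> = (\<Sum>\<gamma>\<in>disc L. \<Sum>\<gamma>'\<in>disc K. kern \<tau> \<gamma> \<gamma>' \<delta> * (F \<tau> \<gamma> * H \<tau> \<gamma>'))"
  proof (intro sum.cong refl)
    fix \<gamma> \<gamma>' assume d: "\<gamma> \<in> disc L" "\<gamma>' \<in> disc K"
    have "\<gamma> \<times> \<gamma>' \<in> disc N" unfolding disc_N using d by blast
    then show "kern \<tau> \<gamma> \<gamma>' \<delta> * tensor_form L K F H \<tau> (\<gamma> \<times> \<gamma>') = kern \<tau> \<gamma> \<gamma>' \<delta> * (F \<tau> \<gamma> * H \<tau> \<gamma>')"
      using ne[OF d] by (simp add: tensor_form_def)
  qed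
  finally show ?thesis .
qed

lemma GG_gring: "GG F H \<tau> \<in> gring PL"
  by (auto simp: gring_def diag_contraction_def pull_gring_def theta_contraction_def disc_M inj_image_eq_iff[OF inj_gm])

lemma product_identity:
  assumes \<tau>: "\<tau> \<in> uhp" and \<zeta>: "\<zeta> \<in> cspan L"
  shows "jacobi_of L v F \<tau> \<zeta> * jacobi_of K w H \<tau> (cmap g \<zeta>) = jacobi_of PL v (GG F H) \<tau> \<zeta>"
proof -
  define k where "k \<gamma> \<gamma>' \<delta> = kern \<tau> \<gamma> \<gamma>' \<delta>" for \<gamma> \<gamma>' \<delta>
  define t where "t \<delta> = P.th \<tau> \<zeta> \<delta>" for \<delta>
  have "jacobi_of L v F \<tau> \<zeta> * jacobi_of K w H \<tau> (cmap g \<zeta>) =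
    (\<Sum>\<gamma>\<in>disc L. \<Sum>\<gamma>'\<in>disc K. (L.th \<tau> \<zeta> \<gamma> * K.th \<tau> (cmap g \<zeta>) \<gamma>') * (F \<tau> \<gamma> * H \<tau> \<gamma>'))"
    unfolding jacobi_of_def gpair_def sum_product by (simp only: mult_ac)
  also have "\<dots> = (\<Sum>\<gamma>\<in>disc L. \<Sum>\<gamma>'\<in>disc K. (\<Sum>\<delta>\<in>disc PL. k \<gamma> \<gamma>' \<delta> * t \<delta>) * (F \<tau> \<gamma> * H \<tau> \<gamma>'))"
    unfolding k_def t_def by (intro sum.cong refl) (simp only: theta_product[OF _ _ \<tau> \<zeta>])
  also have "\<dots> = (\<Sum>\<gamma>\<in>disc L. \<Sum>\<delta>\<in>disc PL. \<Sum>\<gamma>'\<in>disc K. t \<delta> * (k \<gamma> \<gamma>' \<delta> * (F \<tau> \<gamma> * H \<tau> \<gamma>')))"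
    unfolding sum_distrib_right by (subst sum.swap[of _ "disc PL" "disc K"]) (simp only: mult_ac)
  also have "\<dots> = (\<Sum>\<delta>\<in>disc PL. \<Sum>\<gamma>\<in>disc L. \<Sum>\<gamma>'\<in>disc K. t \<delta> * (k \<gamma> \<gamma>' \<delta> * (F \<tau> \<gamma> * H \<tau> \<gamma>')))" by (rule sum.swap)
  also have "\<dots> = jacobi_of PL v (GG F H) \<tau> \<zeta>"
    unfolding jacobi_of_def gpair_def t_def k_def by (rule sum.cong[OF refl]) (simp only: GG_eq sum_distrib_left)
  finally show ?thesis .
qed

text \<open>The projections depend only on the decomposition, and the forms on \<open>L\<close>, on
  \<open>K\<close> and their sum share it through \<open>g\<close>.\<close>

lemma proj_compat: assumes "x \<in> rspan L"
  shows "oproj PL (fst v) x = oproj L (fst v) x" "oproj PL (snd v) x = oproj L (snd v) x"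
    "g (oproj L (fst v) x) = oproj K (fst w) (g x)" "g (oproj L (snd v) x) = oproj K (snd w) (g x)"
proof -
  obtain a b where ab: "x = a + b" "a \<in> fst v" "b \<in> snd v" using assms L.v_sum by auto
  show "oproj PL (fst v) x = oproj L (fst v) x" "oproj PL (snd v) x = oproj L (snd v) x"
    unfolding ab(1) L.proj_unique[OF ab(2,3)] P.proj_unique[OF ab(2,3)] by (rule refl)+
  show "g (oproj L (fst v) x) = oproj K (fst w) (g x)" "g (oproj L (snd v) x) = oproj K (snd w) (g x)"
    unfolding ab(1) L.proj_unique[OF ab(2,3)] g_simps K.proj_unique[OF g_v(1)[OF ab(2)] g_v(2)[OF ab(3)]] by (rule refl)+
qed

lemma g_cspan: "\<zeta> \<in> cspan L \<Longrightarrow> cmap g \<zeta> \<in> cspan K"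
  by (simp add: L.cspan_iff K.cspan_iff cmap_def g_V')

lemma cmap_compat: assumes "\<zeta> \<in> cspan L"
  shows "cmap (oproj PL (fst v)) \<zeta> = cmap (oproj L (fst v)) \<zeta>" "cmap (oproj PL (snd v)) \<zeta> = cmap (oproj L (snd v)) \<zeta>"
    "cmap g (cmap (oproj L (fst v)) \<zeta>) = cmap (oproj K (fst w)) (cmap g \<zeta>)" "cmap g (cmap (oproj L (snd v)) \<zeta>) = cmap (oproj K (snd w)) (cmap g \<zeta>)"
  using assms unfolding cmap_def by (simp_all only: fst_conv snd_conv L.cspan_iff proj_compat)

lemma gact_compat: assumes \<zeta>: "\<zeta> \<in> cspan L"
  shows "P.gact A \<tau> \<zeta> = L.gact A \<tau> \<zeta>" "cmap g (L.gact A \<tau> \<zeta>) = K.gact A \<tau> (cmap g \<zeta>)"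
proof -
  show "P.gact A \<tau> \<zeta> = L.gact A \<tau> \<zeta>" unfolding P.gact_def L.gact_def cmap_compat(1,2)[OF \<zeta>] ..
  have "cmap g (x + y) = cmap g x + cmap g y" "cmap g (cscale c x) = cscale c (cmap g x)" for x y c
    by (simp_all add: cmap_def cscale_def g_simps)
  then show "cmap g (L.gact A \<tau> \<zeta>) = K.gact A \<tau> (cmap g \<zeta>)" unfolding K.gact_def L.gact_def cmap_compat(3,4)[OF \<zeta>, symmetric] by simp
qed

lemma zfac_compat: assumes \<zeta>: "\<zeta> \<in> cspan L"
  shows "L.zfac A \<tau> \<zeta> * K.zfac A \<tau> (cmap g \<zeta>) = P.zfac A \<tau> \<zeta>"
proof -
  have \<zeta>': "\<zeta> \<in> cspan PL" using \<zeta> by simp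
  have c: "cform PL x x = cform L x x + cform K (cmap g x) (cmap g x)" for x
    by (simp add: cform_def cmap_def complex_eq_iff)
  have z: "P.zp \<zeta> = L.zp \<zeta> + K.zp (cmap g \<zeta>)" "P.zm \<zeta> = L.zm \<zeta> + K.zm (cmap g \<zeta>)"
    unfolding P.cform_proj[OF \<zeta>', symmetric] L.cform_proj[OF \<zeta>, symmetric] K.cform_proj[OF g_cspan[OF \<zeta>], symmetric]
      cmap_compat(1,2)[OF \<zeta>] cmap_compat(3,4)[OF \<zeta>, symmetric] by (rule c)+
  show ?thesis unfolding P.zfac_def L.zfac_def K.zfac_def z ee_add[symmetric]
    by (simp only: distrib_left add_divide_distrib add_ac)
qed

lemma GG_modular:
  assumes \<Gamma>: "\<Gamma> \<subseteq> carrier Mp2Z"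
    and F: "modular_form L \<Gamma> (k - real (b_plus L) / 2) (l - real (b_minus L) / 2) F"
    and H: "modular_form K \<Gamma> (\<kappa> - real (b_plus K) / 2) (\<mu> - real (b_minus K) / 2) H"
  shows "modular_form PL \<Gamma> (k + \<kappa> - real (b_plus PL) / 2) (l + \<mu> - real (b_minus PL) / 2) (GG F H)"
proof -
  note Fd = L.modular_formD[OF F] and Hd = K.modular_formD[OF H]
  have hi: "half_int k" "half_int l" "half_int \<kappa>" "half_int \<mu>" using Fd(1,2) Hd(1,2) by (simp_all add: half_int_shift)
  define p q where "p = k + \<kappa> - real (b_plus PL) / 2" and "q = l + \<mu> - real (b_minus PL) / 2"
  have tr: "GG F H (moeb (fst h) \<tau>) = (\<lambda>\<gamma>. autf (snd h) p q \<tau> * dual_weil_rep PL h (GG F H \<tau>) \<gamma>)"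
    if \<tau>: "\<tau> \<in> uhp" and h: "h \<in> \<Gamma>" for \<tau> h
  proof -
    have hc: "h \<in> carrier Mp2Z" using h \<Gamma> by blast
    have A: "fst h \<in> SL2R" using hc SL2Z_SL2R by (auto simp: Mp2Z_iff)
    have "(snd h \<tau>)\<^sup>2 \<noteq> 0" using hc \<tau> jfac_nonzero[OF A] by (auto simp: Mp2Z_iff)
    then have \<phi>: "snd h \<tau> \<noteq> 0" by auto
    have mu: "moeb (fst h) \<tau> \<in> uhp" by (rule moeb_uhp[OF A \<tau>])
    show ?thesis
    proof (rule P.modular_unique[OF mu GG_gring P.gring_intros(1)[OF P.dual_weil_gring[OF hc GG_gring]]])
      \<comment> \<open>The test point is written as the image of some \<open>\<zeta>\<close>, since
        the Jacobi law relates the transformed point to the pair \<open>\<tau>\<close>,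
        \<open>\<zeta>\<close>.\<close>
      fix \<xi> assume "\<xi> \<in> cspan PL"
      then obtain \<zeta> where \<zeta>: "\<zeta> \<in> cspan PL" "P.gact (fst h) \<tau> \<zeta> = \<xi>" using P.gact_surj[OF A \<tau>] by blast
      have \<zeta>L: "\<zeta> \<in> cspan L" using \<zeta>(1) by simp
      have \<xi>1: "\<xi> = L.gact (fst h) \<tau> \<zeta>" using \<zeta>(2) gact_compat(1)[OF \<zeta>L] by simp
      have \<xi>2: "\<xi> \<in> cspan L" unfolding \<xi>1 by (rule L.gact_cspan)
      note \<xi> = \<xi>1 \<xi>2
      have "gpair PL (P.th (moeb (fst h) \<tau>) \<xi>) (GG F H (moeb (fst h) \<tau>)) =
         jacobi_of L v F (moeb (fst h) \<tau>) (L.gact (fst h) \<tau> \<zeta>) * jacobi_of K w H (moeb (fst h) \<tau>) (K.gact (fst h) \<tau> (cmap g \<zeta>))"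
        using product_identity[OF mu \<xi>(2), of F H] unfolding \<xi>(1) gact_compat(2)[OF \<zeta>L] by (simp only: jacobi_of_def)
      also have "\<dots> = (autf (snd h) k l \<tau> * autf (snd h) \<kappa> \<mu> \<tau>) * (L.zfac (fst h) \<tau> \<zeta> * K.zfac (fst h) \<tau> (cmap g \<zeta>)) *
          (jacobi_of L v F \<tau> \<zeta> * jacobi_of K w H \<tau> (cmap g \<zeta>))"
        unfolding L.jacobi_transform[OF F h hc \<tau> \<zeta>L] K.jacobi_transform[OF H h hc \<tau> g_cspan[OF \<zeta>L]] by (simp only: mult_ac)
      also have "\<dots> = autf (snd h) (k + \<kappa>) (l + \<mu>) \<tau> * P.zfac (fst h) \<tau> \<zeta> * jacobi_of PL v (GG F H) \<tau> \<zeta>"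
        unfolding autf_add[of k \<kappa> l \<mu> "snd h", OF hi(1,3,2,4) \<phi>] zfac_compat[OF \<zeta>L] product_identity[OF \<tau> \<zeta>L] ..
      \<comment> \<open>Back from the Jacobi weight to the modular one, with the signature of the
        sum lattice; the index factor is absorbed in \<open>P.thfac\<close>.\<close>
      also have "\<dots> = autf (snd h) p q \<tau> * P.thfac h \<tau> \<zeta> * jacobi_of PL v (GG F H) \<tau> \<zeta>"
        unfolding p_def q_def P.thfac_autf[OF hc \<tau>] ..
      also have "jacobi_of PL v (GG F H) \<tau> \<zeta> = gpair PL (P.wr h (P.th \<tau> \<zeta>)) (dual_weil_rep PL h (GG F H \<tau>))"
        using P.dual_pairing[OF hc] P.siegel_gring GG_gring unfolding jacobi_of_def by metis
      also have "autf (snd h) p q \<tau> * P.thfac h \<tau> \<zeta> * gpair PL (P.wr h (P.th \<tau> \<zeta>)) (dual_weil_rep PL h (GG F H \<tau>)) =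
        gpair PL (P.th (moeb (fst h) \<tau>) \<xi>) (\<lambda>\<gamma>. autf (snd h) p q \<tau> * dual_weil_rep PL h (GG F H \<tau>) \<gamma>)"
        unfolding \<zeta>(2)[symmetric] P.theta_transform[OF hc \<tau> \<zeta>(1)] gpair_def sum_distrib_left by (simp only: mult_ac)
      finally show "gpair PL (P.th (moeb (fst h) \<tau>) \<xi>) (GG F H (moeb (fst h) \<tau>)) =
        gpair PL (P.th (moeb (fst h) \<tau>) \<xi>) (\<lambda>\<gamma>. autf (snd h) p q \<tau> * dual_weil_rep PL h (GG F H \<tau>) \<gamma>)" .
    qed
  qed
  show ?thesis
    unfolding modular_form_def p_def[symmetric] q_def[symmetric]
  proof (intro conjI ballI)
    show "half_int p" "half_int q" unfolding p_def q_def half_int_shift using hi by (simp_all add: half_int_add)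
    show "GG F H \<tau> \<in> gring (neg_lat PL)" for \<tau> using GG_gring by simp
    show "smooth_on (\<lambda>\<tau>. GG F H \<tau> \<gamma>) uhp" if "\<gamma> \<in> disc PL" for \<gamma>
      unfolding GG_eq[OF that] by (intro smooth_on_sum smooth_on_mult L.finite_disc K.finite_disc kernel_smooth that Fd(4) Hd(4))
    show "lin_exp_growth (\<lambda>\<tau>. GG F H \<tau> \<gamma>)" if "\<gamma> \<in> disc PL" for \<gamma>
      unfolding GG_eq[OF that] by (intro lin_exp_growth_sum lin_exp_growth_mult L.finite_disc K.finite_disc kernel_growth that Fd(5) Hd(5))
    show "case h of (A, \<phi>) \<Rightarrow> GG F H (moeb A \<tau>) = (\<lambda>\<gamma>. autf \<phi> p q \<tau> * dual_weil_rep PL (A, \<phi>) (GG F H \<tau>) \<gamma>)" if "\<tau> \<in> uhp" "h \<in> \<Gamma>" for \<tau> h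
      using tr[OF that] by (simp only: split_def prod.collapse)
  qed
qed

section \<open>The diagonal as a primitive sublattice\<close>

lemma even_M: "even_lattice M"
proof -
  have lg: "linear gm" by (rule linearI) (simp_all add: graph_map_def g_simps)
  have ptsM: "pts M = gm ` pts L" by (simp add: graph_lat_def)
  have fM: "form M (gm x) (gm y) = form PL x y" for x y by (simp add: form_M form_N gm_simps)
  have sums: "gm (\<Sum>e\<in>E. of_int (c e) *\<^sub>R e) = (\<Sum>e\<in>E. of_int (c e) *\<^sub>R gm e)" for c :: "'a \<Rightarrow> int"
    by (simp add: linear_sum[OF lg] linear_cmul[OF lg])
  have re: "(\<Sum>e\<in>gm ` E. of_int (c e) *\<^sub>R e) = (\<Sum>e\<in>E. of_int (c (gm e)) *\<^sub>R gm e)" for c :: "'a \<times> 'b \<Rightarrow> int"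
    by (simp add: sum.reindex inj_on_subset[OF inj_gm subset_UNIV])
  have "pts M = {x. \<exists>c::'a \<times> 'b \<Rightarrow> int. x = (\<Sum>e\<in>gm ` E. of_int (c e) *\<^sub>R e)}"
  proof (intro equalityI subsetI)
    fix x assume "x \<in> pts M"
    then obtain c :: "'a \<Rightarrow> int" where "x = gm (\<Sum>e\<in>E. of_int (c e) *\<^sub>R e)" unfolding ptsM L.ptsE by blast
    then have "x = (\<Sum>e\<in>gm ` E. of_int ((c \<circ> fst) e) *\<^sub>R e)" unfolding re sums by (simp add: gm_simps)
    then show "x \<in> {x. \<exists>c::'a \<times> 'b \<Rightarrow> int. x = (\<Sum>e\<in>gm ` E. of_int (c e) *\<^sub>R e)}" by blast
  next
    fix x assume "x \<in> {x. \<exists>c::'a \<times> 'b \<Rightarrow> int. x = (\<Sum>e\<in>gm ` E. of_int (c e) *\<^sub>R e)}"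
    then obtain c :: "'a \<times> 'b \<Rightarrow> int" where "x = gm (\<Sum>e\<in>E. of_int ((c \<circ> gm) e) *\<^sub>R e)" unfolding re sums by auto
    then show "x \<in> pts M" unfolding ptsM L.ptsE by blast
  qed
  moreover have "finite (gm ` E)" "independent (gm ` E)"
    using L.finE L.indE linear_independent_injective_image[OF lg L.indE inj_on_subset[OF inj_gm subset_UNIV]] by simp_all
  moreover have "bilinear (form M)"
    unfolding form_M bilinear_def sum_lat_def by (auto intro!: linearI simp: L.B_simps K.B_simps algebra_simps)
  moreover have "gm x = 0" if "x = 0" for x using that gm_0 by simp
  ultimately show ?thesis
    using P.even unfolding even_lattice_def ptsM ball_simps(9) fM plus_lat_simps(1) by blast
qed

text \<open>The diagonal lattice is cut out of \<open>N\<close> by the graph of \<open>g\<close>,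
  which is a linear subspace and hence closed under division by integers.\<close>

lemma primitive_M: "primitive_sublattice M N"
  unfolding primitive_sublattice_def
proof (intro conjI ballI allI impI)
  show "even_lattice M" by (rule even_M)
  show "pts M \<subseteq> pts N" using g_pts by (auto simp: graph_lat_def sum_lat_def graph_map_def)
  show "form M x y = form N x y" for x y by (simp add: form_M)
  fix x and n :: int assume x: "x \<in> pts N" and n: "n \<noteq> 0 \<and> of_int n *\<^sub>R x \<in> pts M"
  then obtain m where m: "m \<in> pts L" "of_int n *\<^sub>R x = gm m" by (auto simp: graph_lat_def)
  have "of_int n *\<^sub>R fst x = m" using arg_cong[OF m(2), of fst] by (simp add: gm_simps)
  moreover have "of_int n *\<^sub>R snd x = g m" using arg_cong[OF m(2), of snd] by (simp add: gm_simps)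
  ultimately have "of_int n *\<^sub>R snd x = of_int n *\<^sub>R g (fst x)" by (simp add: g_simps[symmetric])
  then have "snd x = g (fst x)" using n by simp
  then have "x = gm (fst x)" by (simp add: graph_map_def prod_eq_iff)
  moreover have "fst x \<in> pts L" using x by (auto simp: sum_lat_def)
  ultimately show "x \<in> pts M" by (simp add: graph_lat_def)
qed

lemma graph_Gr: "gm ` fst v = fst (sum_gr v w) \<inter> rspan M" "gm ` snd v = snd (sum_gr v w) \<inter> rspan M"
  unfolding rspan_M sum_gr_def using g_v L.v_V by (auto simp: graph_map_def)

end

theorem theorem3p10:
  fixes L :: "'a::euclidean_space qlat" and K :: "'b::euclidean_space qlat"
    and \<iota> \<iota>\<^sub>R :: "'a \<Rightarrow> 'b" and v :: "'a gr" and w :: "'b gr" and bp bm :: nat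
  assumes "even_lattice L" and "even_lattice K"
    and "b_plus L = bp" and "b_minus L = bm" and "b_plus K = bp" and "b_minus K = bm"
    and "group_iso \<iota> L K"
    and "linear \<iota>\<^sub>R" and "\<forall>x\<in>pts L. \<iota>\<^sub>R x = \<iota> x"
    and "v \<in> Gr (form L) (rspan L)" and "w \<in> Gr (form K) (rspan K)"
    and "\<iota>\<^sub>R ` fst v = fst w" and "\<iota>\<^sub>R ` snd v = snd w"
  shows "even_lattice (plus_lat \<iota>\<^sub>R L K) \<and>
    v \<in> Gr (form (plus_lat \<iota>\<^sub>R L K)) (rspan (plus_lat \<iota>\<^sub>R L K)) \<and>
    lattice_iso (graph_map \<iota>) (plus_lat \<iota>\<^sub>R L K) (graph_lat \<iota> L K) \<and>
    primitive_sublattice (graph_lat \<iota> L K) (sum_lat L K) \<and>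
    graph_map \<iota>\<^sub>R ` fst v = fst (sum_gr v w) \<inter> rspan (graph_lat \<iota> L K) \<and>
    graph_map \<iota>\<^sub>R ` snd v = snd (sum_gr v w) \<inter> rspan (graph_lat \<iota> L K) \<and>
    (\<forall>\<Gamma> (k::real) (l::real) (\<kappa>::real) (\<mu>::real) F H.
       finite_index_subgroup \<Gamma> \<longrightarrow>
       modular_form L \<Gamma> (k - real bp / 2) (l - real bm / 2) F \<longrightarrow>
       modular_form K \<Gamma> (\<kappa> - real bp / 2) (\<mu> - real bm / 2) H \<longrightarrow>
       (let \<Phi> = (\<lambda>\<tau> \<zeta>. jacobi_of L v F \<tau> \<zeta> * jacobi_of K w H \<tau> (cmap \<iota>\<^sub>R \<zeta>));
            G = diag_contraction \<iota>\<^sub>R L K v w (tensor_form L K F H)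
        in jacobi_form (plus_lat \<iota>\<^sub>R L K) v \<Gamma> (k + \<kappa>) (l + \<mu>) \<Phi> \<and>
           assoc_modular_form (plus_lat \<iota>\<^sub>R L K) v \<Gamma> (k + \<kappa>) (l + \<mu>) \<Phi> G \<and>
           (\<forall>G'. assoc_modular_form (plus_lat \<iota>\<^sub>R L K) v \<Gamma> (k + \<kappa>) (l + \<mu>) \<Phi> G' \<longrightarrow>
              (\<forall>\<tau>\<in>uhp. G' \<tau> = G \<tau>))))"
proof -
  obtain E Fp Fm where TL: "theta_lattice L v E Fp Fm" using theta_lattice_exists[OF assms(1,10)] by blast
  obtain E' Gp Gm where TK: "theta_lattice K w E' Gp Gm" using theta_lattice_exists[OF assms(2,11)] by blast
  have iso: "bij_betw \<iota> (pts L) (pts K)" "\<And>x y. x \<in> pts L \<Longrightarrow> y \<in> pts L \<Longrightarrow> \<iota> (x + y) = \<iota> x + \<iota> y"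
    using assms(7) by (auto simp: group_iso_def)
  have "\<iota>\<^sub>R ` pts L = \<iota> ` pts L" using assms(9) by (intro image_cong) auto
  then have ip: "\<iota>\<^sub>R ` pts L = pts K" using iso(1) by (simp add: bij_betw_def)
  \<comment> \<open>The sum must be known to be an even lattice with \<open>v\<close> in its
    Grassmannian before bases for it can be chosen.\<close>
  note PG = plus_lat_even_Gr[OF TL TK assms(8) equalityD1[OF ip] equalityD1[OF assms(12)] equalityD1[OF assms(13)]]
  obtain E'' Hp Hm where TP: "theta_lattice (plus_lat \<iota>\<^sub>R L K) v E'' Hp Hm" using theta_lattice_exists[OF PG] by blast
  interpret T: theta_pair L v E Fp Fm K w E' Gp Gm E'' Hp Hm "\<iota>\<^sub>R"
    by (intro theta_pair.intro theta_pair_axioms.intro TL TK TP assms(8) ip assms(12,13))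
  have gi: "graph_map \<iota> x = graph_map \<iota>\<^sub>R x" if "x \<in> pts L" for x using assms(9) that by (simp add: graph_map_def)
  \<comment> \<open>The statement embeds by \<open>\<iota>\<close>, whose values off
    \<open>pts L\<close> are arbitrary. On \<open>pts L\<close> it agrees with the linear extension,
    so both graphs carry the same lattice.\<close>
  have gl: "graph_lat \<iota> L K = graph_lat \<iota>\<^sub>R L K" using gi by (simp add: graph_lat_def)
  have li: "lattice_iso (graph_map \<iota>) (plus_lat \<iota>\<^sub>R L K) (graph_lat \<iota> L K)"
    unfolding lattice_iso_def group_iso_def
  proof (intro conjI ballI)
    show "bij_betw (graph_map \<iota>) (pts (plus_lat \<iota>\<^sub>R L K)) (pts (graph_lat \<iota> L K))"
      by (auto simp: bij_betw_def graph_lat_def inj_on_def graph_map_def)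
    fix x y assume "x \<in> pts (plus_lat \<iota>\<^sub>R L K)" "y \<in> pts (plus_lat \<iota>\<^sub>R L K)"
    then have xy: "x \<in> pts L" "y \<in> pts L" by simp_all
    show "graph_map \<iota> (x + y) = graph_map \<iota> x + graph_map \<iota> y" using iso(2)[OF xy] by (simp add: graph_map_def)
    show "form (graph_lat \<iota> L K) (graph_map \<iota> x) (graph_map \<iota> y) = form (plus_lat \<iota>\<^sub>R L K) x y"
      unfolding gl gi[OF xy(1)] gi[OF xy(2)] T.form_M T.form_N T.gm_simps by simp
  qed
  have main: "jacobi_form (plus_lat \<iota>\<^sub>R L K) v \<Gamma> (k + \<kappa>) (l + \<mu>) \<Phi> \<and>
           assoc_modular_form (plus_lat \<iota>\<^sub>R L K) v \<Gamma> (k + \<kappa>) (l + \<mu>) \<Phi> G \<and>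
           (\<forall>G'. assoc_modular_form (plus_lat \<iota>\<^sub>R L K) v \<Gamma> (k + \<kappa>) (l + \<mu>) \<Phi> G' \<longrightarrow> (\<forall>\<tau>\<in>uhp. G' \<tau> = G \<tau>))"
    if \<Gamma>: "finite_index_subgroup \<Gamma>" and F: "modular_form L \<Gamma> (k - real bp / 2) (l - real bm / 2) F"
      and H: "modular_form K \<Gamma> (\<kappa> - real bp / 2) (\<mu> - real bm / 2) H"
      and \<Phi>: "\<Phi> = (\<lambda>\<tau> \<zeta>. jacobi_of L v F \<tau> \<zeta> * jacobi_of K w H \<tau> (cmap \<iota>\<^sub>R \<zeta>))"
      and G: "G = diag_contraction \<iota>\<^sub>R L K v w (tensor_form L K F H)" for \<Gamma> k l \<kappa> \<mu> F H \<Phi> G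
  proof (intro conjI allI impI ballI)
    have \<Gamma>': "\<Gamma> \<subseteq> carrier Mp2Z" using \<Gamma> unfolding finite_index_subgroup_def by (blast dest: subgroup.subset)
    have mG: "modular_form (plus_lat \<iota>\<^sub>R L K) \<Gamma> (k + \<kappa> - real (b_plus (plus_lat \<iota>\<^sub>R L K)) / 2) (l + \<mu> - real (b_minus (plus_lat \<iota>\<^sub>R L K)) / 2) G"
      unfolding G by (rule T.GG_modular[OF \<Gamma>']) (use F H assms(3-6) in simp_all)
    have eq: "\<Phi> \<tau> \<zeta> = jacobi_of (plus_lat \<iota>\<^sub>R L K) v G \<tau> \<zeta>" if "\<tau> \<in> uhp" "\<zeta> \<in> cspan (plus_lat \<iota>\<^sub>R L K)" for \<tau> \<zeta>
      unfolding \<Phi> G using T.product_identity[OF that(1), of \<zeta>] that(2) by simp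
    show "jacobi_form (plus_lat \<iota>\<^sub>R L K) v \<Gamma> (k + \<kappa>) (l + \<mu>) \<Phi>" by (rule T.P.modular_imp_jacobi_form[OF mG \<Gamma>' eq])
    show "assoc_modular_form (plus_lat \<iota>\<^sub>R L K) v \<Gamma> (k + \<kappa>) (l + \<mu>) \<Phi> G"
      unfolding assoc_modular_form_def using mG eq by blast
    fix G' \<tau> assume G': "assoc_modular_form (plus_lat \<iota>\<^sub>R L K) v \<Gamma> (k + \<kappa>) (l + \<mu>) \<Phi> G'" and \<tau>: "\<tau> \<in> uhp"
    note G'd = G'[unfolded assoc_modular_form_def]
    show "G' \<tau> = G \<tau>"
    proof (rule T.P.modular_unique[OF \<tau> T.P.modular_formD(3)[OF conjunct1[OF G'd] \<tau>] T.P.modular_formD(3)[OF mG \<tau>]])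
      fix \<zeta> assume \<zeta>: "\<zeta> \<in> cspan (plus_lat \<iota>\<^sub>R L K)"
      have "\<Phi> \<tau> \<zeta> = jacobi_of (plus_lat \<iota>\<^sub>R L K) v G' \<tau> \<zeta>" using G'd \<tau> \<zeta> by blast
      then show "gpair (plus_lat \<iota>\<^sub>R L K) (siegel_theta (plus_lat \<iota>\<^sub>R L K) v \<tau> \<zeta>) (G' \<tau>) = gpair (plus_lat \<iota>\<^sub>R L K) (siegel_theta (plus_lat \<iota>\<^sub>R L K) v \<tau> \<zeta>) (G \<tau>)"
        using eq[OF \<tau> \<zeta>] unfolding jacobi_of_def by simp
    qed
  qed
  show ?thesis
    unfolding Let_def gl
    by (intro conjI PG li[unfolded gl] T.primitive_M T.graph_Gr) (intro allI impI, rule main[OF _ _ _ refl refl])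
qed

end
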